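(* Fix $r\ge3$, let $b=b(n)\ge0$ satisfy $b=o(n)$, and suppose $n^{-2/r}(\log n)^{1/\binom r2}\ll p\ll n^{-2/(r+1)}$. There are a common decreasing event $\mathcal U$ with $\mathbb P(\mathcal U)\ge c_r>0$ and constants $c,C>0$, with $c_r,c,C$ depending only on $r$, with the following property. For every $W\subseteq[n]$ with $|[n]\setminus W|\le b$ and $r\mid|W|$, there is an event $\mathcal M_W$ of probability at most $\exp(-c|W|\mu_r/n)$ such that $$\{G_p[W]\text{ has no }K_r\text{-factor}\}\cap\mathcal U\subseteq\mathcal M_W\cup\bigcup_{\alpha\in\mathfrak C_W}\mathcal E_{W,\alpha},$$ where $|\mathfrak C_W|\le n^C$ and every $(\mathcal E_{W,\alpha},x_{W,\alpha})$, $\alpha\in\mathfrak C_W$, is a single-root witness with parameter $c$, local to $W$.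
   Context: All asymptotics are as $n\to\infty$, $p=p(n)$, $f\ll g$ means $f/g\to0$, and the assertion is for all sufficiently large $n$. $\mu_r=\mu_r(n,p):=\binom nr p^{\binom r2}$. Common birth-time space: to each $f\in\binom{[n]}2$ assign independent $\tau_f\sim\mathrm{Unif}[0,1]$; for $q\in[0,1]$, $G_q$ is the graph on $[n]$ with edges $\{f:\tau_f\le q\}$, so $G_q\sim G(n,q)$. $G_p[W]$ is the subgraph induced on $W$. All events are events in this space. An event is decreasing if it is preserved when birth times are increased (i.e. when edges are removed from the coupled graphs $G_q$). For a vertex $x$, $\mathscr F(x)$ is the sigma-field generated by all $\tau_f$ with $x\notin f$. For $W\subseteq[n]$, $\mathscr G_W:=\sigma(\tau_f:f\in\binom W2)$. A pair $(\mathcal E,x)$ is a single-root witness with parameter $c>0$, local to $W$, if $x\in W$, $\mathcal E\in\mathscr G_W$, and $$\mathbb P(\mathcal E\mid\mathscr F(x))\le\exp(-c\mu_r/n)\quad\text{almost surely}.$$ A $K_r$-factor of a graph is a collection of vertex-disjoint copies of $K_r$ covering all its vertices. *)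

theory Defs
  imports "HOL-Probability.Probability" "HOL-Library.Landau_Symbols"
begin

text \<open>Graphs on natural numbers, given by a vertex set and a set of two-element edges.\<close>

type_synonym graph = "nat set \<times> nat set set"

definition pairs :: "nat set \<Rightarrow> nat set set" where
  "pairs V = {f. f \<subseteq> V \<and> card f = 2}"

definition induced :: "graph \<Rightarrow> nat set \<Rightarrow> graph" where
  "induced G W = (fst G \<inter> W, {f \<in> snd G. f \<subseteq> W})"

text \<open>A copy of \<open>K\<^sub>r\<close> is determined by its vertex set, so a collection of vertex-disjoint
  copies is represented by the collection of these vertex sets.\<close>

definition clique_copy :: "nat \<Rightarrow> graph \<Rightarrow> nat set \<Rightarrow> bool" where
  "clique_copy r G T \<longleftrightarrow> T \<subseteq> fst G \<and> card T = r \<and> pairs T \<subseteq> snd G"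

definition has_clique_factor :: "nat \<Rightarrow> graph \<Rightarrow> bool" where
  "has_clique_factor r G \<longleftrightarrow>
     (\<exists>P. (\<forall>T\<in>P. clique_copy r G T) \<and> pairwise disjnt P \<and> \<Union>P = fst G)"

text \<open>The canonical space of birth times: a point \<open>\<omega>\<close> assigns to each pair \<open>f\<close> of \<open>{1..n}\<close>
  its birth time \<open>\<omega> f\<close>, and the measure is the product of copies of Lebesgue measure
  on \<open>[0,1]\<close>, that is, the birth times are independent and uniform.\<close>

definition birth_space :: "nat \<Rightarrow> (nat set \<Rightarrow> real) measure" where
  "birth_space n = (\<Pi>\<^sub>M f\<in>pairs {1..n}. restrict_space lborel {0..1})"

definition birth_graph :: "nat \<Rightarrow> real \<Rightarrow> (nat set \<Rightarrow> real) \<Rightarrow> graph" where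
  "birth_graph n q \<omega> = ({1..n}, {f \<in> pairs {1..n}. \<omega> f \<le> q})"

definition decreasing_event :: "nat \<Rightarrow> (nat set \<Rightarrow> real) set \<Rightarrow> bool" where
  "decreasing_event n U \<longleftrightarrow> U \<in> sets (birth_space n) \<and>
     (\<forall>\<omega>\<in>U. \<forall>\<omega>'\<in>space (birth_space n).
        (\<forall>f\<in>pairs {1..n}. \<omega> f \<le> \<omega>' f) \<longrightarrow> \<omega>' \<in> U)"

text \<open>The sigma-field generated by the birth times of the pairs in \<open>S\<close>.\<close>

definition birth_sigma :: "nat \<Rightarrow> nat set set \<Rightarrow> (nat set \<Rightarrow> real) measure" where
  "birth_sigma n S = sigma (space (birth_space n))
     {(\<lambda>\<omega>. \<omega> f) -` B \<inter> space (birth_space n) | f B. f \<in> S \<and> B \<in> sets borel}"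

definition sigma_avoiding :: "nat \<Rightarrow> nat \<Rightarrow> (nat set \<Rightarrow> real) measure" where
  "sigma_avoiding n x = birth_sigma n {f \<in> pairs {1..n}. x \<notin> f}"

definition sigma_inside :: "nat \<Rightarrow> nat set \<Rightarrow> (nat set \<Rightarrow> real) measure" where
  "sigma_inside n W = birth_sigma n (pairs W)"

text \<open>The expected number of copies of \<open>K\<^sub>r\<close> in \<open>G(n,p)\<close>.\<close>

definition mu :: "nat \<Rightarrow> nat \<Rightarrow> real \<Rightarrow> real" where
  "mu r n p = real (n choose r) * p ^ (r choose 2)"

text \<open>The conditional probability of \<open>E\<close> is the conditional expectation of its indicator.\<close>

definition single_root_witness ::
  "nat \<Rightarrow> nat \<Rightarrow> real \<Rightarrow> real \<Rightarrow> nat set \<Rightarrow> (nat set \<Rightarrow> real) set \<Rightarrow> nat \<Rightarrow> bool" where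
  "single_root_witness r n p c W E x \<longleftrightarrow>
     0 < c \<and> x \<in> W \<and> E \<in> sets (sigma_inside n W) \<and>
     (AE \<omega> in birth_space n.
        real_cond_exp (birth_space n) (sigma_avoiding n x) (indicator E) \<omega>
          \<le> exp (- c * mu r n p / real n))"

lemma prob_space_birth_space: "prob_space (birth_space n)"
  unfolding birth_space_def
  by (intro prob_space_PiM prob_space_restrict_space) auto

lemma subalgebra_birth_sigma:
  assumes "S \<subseteq> pairs {1..n}"
  shows "subalgebra (birth_space n) (birth_sigma n S)"
proof -
  have "(\<lambda>\<omega>. \<omega> f) -` B \<inter> space (birth_space n) \<in> sets (birth_space n)"
    if "f \<in> S" "B \<in> sets borel" for f B
  proof -
    have "(\<lambda>\<omega>. \<omega> f) \<in> measurable (birth_space n) (restrict_space lborel {0..1})"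
      unfolding birth_space_def using that(1) assms by (intro measurable_component_singleton) auto
    then have "(\<lambda>\<omega>. \<omega> f) \<in> borel_measurable (birth_space n)"
      by (simp add: measurable_restrict_space2_iff)
    then show ?thesis using that(2) by (rule measurable_sets)
  qed
  then show ?thesis
    unfolding subalgebra_def birth_sigma_def
    by (subst sets_measure_of)
      (auto intro!: sets.sigma_sets_subset simp: space_measure_of_conv)
qed

end

theory Submission
  imports Defs "HOL-Combinatorics.Multiset_Permutations" "HOL-Real_Asymp.Real_Asymp"
begin

text \<open>
  The proof counts the \<open>K\<^sub>r\<close>-factors of \<open>W\<close> while the pairs of \<open>W\<close> are removed from the complete
  graph by decreasing birth time, in the way of Johansson, Kahn and Vu. If \<open>e\<close> is the pair removed
  from a graph \<open>S\<close>, the loss of this step is the logarithm of the quotient of the numbers of factors of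
  \<open>S\<close> and \<open>S - {e}\<close>. A random pair of a graph with \<open>j\<close> edges destroys on average at most the fraction
  \<open>\<Gamma> / j\<close> of the factors, where \<open>\<Gamma> = (r - 1) * card W / 2\<close>. If the losses add up to
  their means plus \<open>O(n)\<close>, the number of factors stays positive until time \<open>p\<close>. Write
  \<open>D = n ^ (r - 1) * p ^ (r choose 2)\<close> for the scale of the number of \<open>r\<close>-cliques at a vertex; it is at least
  \<open>mu r n p / n\<close>, and by hypothesis it is much larger than \<open>ln n\<close>.

  Light losses. All orders of birth are equally likely, so the losses below a threshold of order
  \<open>1 / D\<close> have exponential moments with parameter of order \<open>D\<close>. They exceed their mean by \<open>n\<close> with
  probability at most \<open>exp (- c * n * D)\<close>; this is the event \<open>M\<close> (\<open>light_tail\<close>, \<open>bad_order_event\<close>).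

  Heavy losses. These are bounded deterministically. In a graph without a witness, the loss of an edge
  is at most a constant times the number of \<open>r\<close>-cliques through it divided by \<open>D\<close> (\<open>edge_loss\<close>). Hence
  heavy losses are dominated by their squares, and thereby by the number of pairs of
  cliques that share an edge (\<open>heavy_total\<close>). The event \<open>U\<close> says that such pair counts are of the
  expected order at all times; a maximal inequality gives it probability at least \<open>1 / 2\<close>
  (\<open>subgraph_count_maximal\<close>, \<open>regular_event\<close>).

  Witnesses. While the number of factors is within \<open>exp (O(n))\<close> of its typical order, the entropy bound
  forces the clique that covers a typical vertex \<open>y\<close> in a random factor to be spread over of the order
  of \<open>D\<close> cliques, among which many are disjoint (\<open>link_structure\<close>). Either the neighbourhood
  of \<open>y\<close> is crowded, that is, it contains many disjoint tuples from a family of cliques which is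
  thin in the graph without \<open>y\<close>; or the family has positive density. In the second case either the
  neighbourhood of another vertex \<open>x\<close> is sparse, that is, it contains far less than its share of the family; or
  \<open>x\<close> and \<open>y\<close> can be exchanged in a removed set of \<open>r\<close> vertices with the loss of only a constant factor
  (\<open>swap\<close>). Repeated exchanges show that after the deletion of an edge enough factors remain (\<open>spread\<close>). A crowded or a
  sparse neighbourhood is an event about the star of a single vertex, since the family does not depend
  on this star. Given all other birth times, the star is a random set, and the event has probability at
  most \<open>exp (- c * D)\<close>, by a moment bound for disjoint tuples and by Janson's inequality
  (\<open>crowded_nbhd_prob\<close>, \<open>sparse_nbhd_prob\<close>). The upper bound on \<open>p\<close> ensures that \<open>D \<le> n * p\<close>, so that
  \<open>D\<close> is the smallest exponent that occurs. Only the graphs at time \<open>p\<close> and at the births of pairs are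
  inspected, which keeps the number of witnesses polynomial.
\<close>

section \<open>Clique factors and the number of them\<close>

definition cliques :: "nat \<Rightarrow> nat set set \<Rightarrow> nat set \<Rightarrow> nat set set" where
  "cliques k S V = {T. T \<subseteq> V \<and> card T = k \<and> pairs T \<subseteq> S}"

definition factors :: "nat \<Rightarrow> nat set set \<Rightarrow> nat set \<Rightarrow> nat set set set" where
  "factors r S V = {P. P \<subseteq> cliques r S V \<and> pairwise disjnt P \<and> \<Union>P = V}"

definition num_factors :: "nat \<Rightarrow> nat set set \<Rightarrow> nat set \<Rightarrow> nat" where
  "num_factors r S V = card (factors r S V)"

definition nbr :: "nat set set \<Rightarrow> nat \<Rightarrow> nat set" where
  "nbr S t = {v. {t, v} \<in> S}"

lemma finite_pairs [simp]: "finite V \<Longrightarrow> finite (pairs V)"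
  unfolding pairs_def by auto

lemma card_pairs: "finite V \<Longrightarrow> card (pairs V) = card V choose 2"
  unfolding pairs_def using n_subsets[of V 2] by simp

lemma pairs_mono: "A \<subseteq> B \<Longrightarrow> pairs A \<subseteq> pairs B"
  unfolding pairs_def by auto

lemma finite_cliques [simp]: "finite V \<Longrightarrow> finite (cliques k S V)"
  unfolding cliques_def by auto

lemma finite_factors [simp]: "finite V \<Longrightarrow> finite (factors r S V)"
proof -
  assume "finite V"
  moreover have "factors r S V \<subseteq> Pow (cliques r S V)" unfolding factors_def by auto
  ultimately show ?thesis by (meson finite_Pow_iff finite_cliques finite_subset)
qed

lemma cliques_mono: "S \<subseteq> S' \<Longrightarrow> V \<subseteq> V' \<Longrightarrow> cliques k S V \<subseteq> cliques k S' V'"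
  unfolding cliques_def by auto

lemma cliques_cong: "S \<inter> pairs V = S' \<inter> pairs V \<Longrightarrow> cliques k S V = cliques k S' V"
  unfolding cliques_def using pairs_mono[of _ V] by blast

lemma factors_cong: "S \<inter> pairs V = S' \<inter> pairs V \<Longrightarrow> factors r S V = factors r S' V"
  unfolding factors_def using cliques_cong[of S V S' r] by simp

lemma num_factors_cong: "S \<inter> pairs V = S' \<inter> pairs V \<Longrightarrow> num_factors r S V = num_factors r S' V"
  unfolding num_factors_def using factors_cong[of S V S' r] by simp

lemma num_factors_mono: "finite V \<Longrightarrow> S \<subseteq> S' \<Longrightarrow> num_factors r S V \<le> num_factors r S' V"
  unfolding num_factors_def
  by (rule card_mono) (use cliques_mono[of S S' V V r] in \<open>auto simp: factors_def\<close>)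

text \<open>Because of this bijection, the probability that a uniformly random factor contains
\<open>Z\<close> is a ratio of factor counts; all later statements about random factors are statements
about such ratios.\<close>
lemma card_factors_containing:
  assumes "finite V" "Z \<in> cliques r S V" "r > 0"
  shows "card {P \<in> factors r S V. Z \<in> P} = num_factors r S (V - Z)"
  unfolding num_factors_def
proof (rule bij_betw_same_card)
  have Z0: "Z \<noteq> {}" "Z \<subseteq> V" using assms by (auto simp: cliques_def)
  show "bij_betw (\<lambda>P. P - {Z}) {P \<in> factors r S V. Z \<in> P} (factors r S (V - Z))"
  proof (rule bij_betwI[where g = "\<lambda>P. insert Z P"])
    show "(\<lambda>P. P - {Z}) \<in> {P \<in> factors r S V. Z \<in> P} \<rightarrow> factors r S (V - Z)"
    proof (rule funcsetI)
      fix P assume "P \<in> {P \<in> factors r S V. Z \<in> P}"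
      hence P: "P \<subseteq> cliques r S V" "pairwise disjnt P" "\<Union>P = V" "Z \<in> P"
        by (auto simp: factors_def)
      have dj: "X \<inter> Z = {}" if "X \<in> P" "X \<noteq> Z" for X
        using P(2,4) that by (auto simp: pairwise_def disjnt_def)
      have "\<Union>(P - {Z}) = V - Z" using P(3) dj P(4) by blast
      moreover have "P - {Z} \<subseteq> cliques r S (V - Z)"
      proof
        fix X assume X: "X \<in> P - {Z}"
        with dj have "X \<inter> Z = {}" by blast
        moreover have "X \<in> cliques r S V" using X P(1) by blast
        ultimately show "X \<in> cliques r S (V - Z)" by (auto simp: cliques_def)
      qed
      ultimately show "P - {Z} \<in> factors r S (V - Z)"
        using P(2) by (auto simp: factors_def pairwise_def)
    qed
    show "insert Z \<in> factors r S (V - Z) \<rightarrow> {P \<in> factors r S V. Z \<in> P}"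
    proof (rule funcsetI)
      fix P assume "P \<in> factors r S (V - Z)"
      hence P: "P \<subseteq> cliques r S (V - Z)" "pairwise disjnt P" "\<Union>P = V - Z"
        by (auto simp: factors_def)
      have "X \<inter> Z = {}" if "X \<in> P" for X using P(1) that by (auto simp: cliques_def)
      hence "pairwise disjnt (insert Z P)" using P(2)
        by (auto simp: pairwise_insert disjnt_def)
      moreover have "insert Z P \<subseteq> cliques r S V" using P(1) assms(2) cliques_mono[of S S "V - Z" V r] by auto
      ultimately show "insert Z P \<in> {P \<in> factors r S V. Z \<in> P}"
        using P(3) Z0 by (auto simp: factors_def)
    qed
    show "insert Z (P - {Z}) = P" if "P \<in> {P \<in> factors r S V. Z \<in> P}" for P
      using that by auto
    show "insert Z P - {Z} = P" if "P \<in> factors r S (V - Z)" for P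
      using that Z0 by (auto simp: factors_def cliques_def)
  qed
qed

text \<open>Exactly one clique of a factor covers \<open>y\<close>.\<close>
lemma num_factors_root:
  assumes "finite V" "y \<in> V" "r > 0"
  shows "num_factors r S V = (\<Sum>Z | Z \<in> cliques r S V \<and> y \<in> Z. num_factors r S (V - Z))"
proof -
  have "factors r S V = (\<Union>Z\<in>{Z \<in> cliques r S V. y \<in> Z}. {P \<in> factors r S V. Z \<in> P})"
    using assms(2) by (auto simp: factors_def)
  hence "num_factors r S V = card (\<Union>Z\<in>{Z \<in> cliques r S V. y \<in> Z}. {P \<in> factors r S V. Z \<in> P})"
    unfolding num_factors_def by simp
  also have "\<dots> = (\<Sum>Z\<in>{Z \<in> cliques r S V. y \<in> Z}. card {P \<in> factors r S V. Z \<in> P})"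
  proof (rule card_UN_disjoint)
    show "\<forall>Z\<in>{Z \<in> cliques r S V. y \<in> Z}. \<forall>Z'\<in>{Z \<in> cliques r S V. y \<in> Z}. Z \<noteq> Z' \<longrightarrow>
      {P \<in> factors r S V. Z \<in> P} \<inter> {P \<in> factors r S V. Z' \<in> P} = {}"
    proof (intro ballI impI)
      fix Z Z' assume Z: "Z \<in> {Z \<in> cliques r S V. y \<in> Z}" "Z' \<in> {Z \<in> cliques r S V. y \<in> Z}" "Z \<noteq> Z'"
      have False if "P \<in> factors r S V" "Z \<in> P" "Z' \<in> P" for P
        using that Z pairwiseD[of disjnt P Z Z'] by (auto simp: factors_def disjnt_def)
      thus "{P \<in> factors r S V. Z \<in> P} \<inter> {P \<in> factors r S V. Z' \<in> P} = {}" by auto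
    qed
  qed (use assms in auto)
  also have "\<dots> = (\<Sum>Z | Z \<in> cliques r S V \<and> y \<in> Z. num_factors r S (V - Z))"
    by (rule sum.cong) (auto intro: card_factors_containing assms)
  finally show ?thesis .
qed

lemma pairs_insert: "y \<notin> T \<Longrightarrow> pairs (insert y T) = pairs T \<union> (\<lambda>v. {y, v}) ` T"
proof
  assume y: "y \<notin> T"
  show "pairs (insert y T) \<subseteq> pairs T \<union> (\<lambda>v. {y, v}) ` T"
  proof
    fix f assume "f \<in> pairs (insert y T)"
    hence f: "f \<subseteq> insert y T" "card f = 2" by (auto simp: pairs_def)
    show "f \<in> pairs T \<union> (\<lambda>v. {y, v}) ` T"
    proof (cases "y \<in> f")
      case True
      then obtain v where "f = {y, v}" "v \<noteq> y" using f(2) by (auto simp: card_2_iff)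
      thus ?thesis using f(1) by auto
    next
      case False thus ?thesis using f by (auto simp: pairs_def)
    qed
  qed
  show "pairs T \<union> (\<lambda>v. {y, v}) ` T \<subseteq> pairs (insert y T)"
    using y by (auto simp: pairs_def card_2_iff)
qed

lemma insert_clique_iff:
  assumes "finite V" "y \<in> V" "T \<subseteq> V - {y}"
  shows "insert y T \<in> cliques (Suc k) S V \<longleftrightarrow> T \<in> cliques k S (V - {y}) \<and> T \<subseteq> nbr S y"
proof -
  have "finite T" "y \<notin> T" using assms finite_subset by blast+
  thus ?thesis using assms pairs_insert[of y T] by (auto simp: cliques_def nbr_def)
qed

text \<open>Cliques through \<open>y\<close> are described by the pairs at \<open>y\<close> and by a smaller clique that
does not involve those pairs. This separation is what makes a single vertex the only source of
randomness later on.\<close>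
lemma cliques_root_reindex:
  assumes "finite V" "y \<in> V"
  shows "bij_betw (insert y) {T \<in> cliques k S (V - {y}). T \<subseteq> nbr S y} {Z \<in> cliques (Suc k) S V. y \<in> Z}"
proof (rule bij_betwI[where g = "\<lambda>Z. Z - {y}"])
  show "insert y \<in> {T \<in> cliques k S (V - {y}). T \<subseteq> nbr S y} \<rightarrow> {Z \<in> cliques (Suc k) S V. y \<in> Z}"
  proof (rule funcsetI)
    fix T assume T: "T \<in> {T \<in> cliques k S (V - {y}). T \<subseteq> nbr S y}"
    hence "T \<subseteq> V - {y}" by (auto simp: cliques_def)
    from insert_clique_iff[OF assms this] T
    show "insert y T \<in> {Z \<in> cliques (Suc k) S V. y \<in> Z}" by auto
  qed
  show "(\<lambda>Z. Z - {y}) \<in> {Z \<in> cliques (Suc k) S V. y \<in> Z} \<rightarrow> {T \<in> cliques k S (V - {y}). T \<subseteq> nbr S y}"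
  proof (rule funcsetI)
    fix Z assume Z: "Z \<in> {Z \<in> cliques (Suc k) S V. y \<in> Z}"
    hence "Z - {y} \<subseteq> V - {y}" "insert y (Z - {y}) = Z" by (auto simp: cliques_def)
    with insert_clique_iff[OF assms this(1), of k S] Z
    show "Z - {y} \<in> {T \<in> cliques k S (V - {y}). T \<subseteq> nbr S y}" by auto
  qed
qed (auto simp: cliques_def)

lemma num_factors_root_link:
  assumes "finite V" "y \<in> V"
  shows "num_factors (Suc k) S V =
    (\<Sum>T | T \<in> cliques k S (V - {y}) \<and> T \<subseteq> nbr S y. num_factors (Suc k) S (V - insert y T))"
  using num_factors_root[OF assms, of "Suc k" S]
    sum.reindex_bij_betw[OF cliques_root_reindex[OF assms, of k S], of "\<lambda>Z. num_factors (Suc k) S (V - Z)"]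
  by simp

text \<open>Double counting: every factor has \<open>card V / r\<close> cliques.\<close>
lemma sum_num_factors_cliques:
  assumes "finite V" "r > 0"
  shows "r * (\<Sum>Z\<in>cliques r S V. num_factors r S (V - Z)) = card V * num_factors r S V"
proof -
  have "card V * num_factors r S V = (\<Sum>y\<in>V. num_factors r S V)" by simp
  also have "\<dots> = (\<Sum>y\<in>V. \<Sum>Z\<in>cliques r S V. if y \<in> Z then num_factors r S (V - Z) else 0)"
    by (rule sum.cong[OF refl], subst num_factors_root[OF assms(1) _ assms(2)])
      (auto simp: sum.If_cases assms Int_def)
  also have "\<dots> = (\<Sum>Z\<in>cliques r S V. \<Sum>y\<in>V. if y \<in> Z then num_factors r S (V - Z) else 0)"
    by (rule sum.swap)
  also have "\<dots> = (\<Sum>Z\<in>cliques r S V. r * num_factors r S (V - Z))"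
  proof (rule sum.cong[OF refl])
    fix Z assume "Z \<in> cliques r S V"
    hence "V \<inter> Z = Z" "card Z = r" by (auto simp: cliques_def)
    thus "(\<Sum>y\<in>V. if y \<in> Z then num_factors r S (V - Z) else 0) = r * num_factors r S (V - Z)"
      using assms by (simp add: sum.If_cases)
  qed
  finally show ?thesis by (simp add: sum_distrib_left)
qed

text \<open>A factor that is lost uses \<open>e\<close> in one of its cliques; the union bound over this clique
suffices.\<close>
lemma num_factors_delete_edge:
  assumes "finite V" "r > 0"
  shows "num_factors r S V \<le> num_factors r (S - {e}) V + (\<Sum>Z | Z \<in> cliques r S V \<and> e \<in> pairs Z. num_factors r S (V - Z))"
proof -
  have "factors r S V \<subseteq> factors r (S - {e}) V \<union>
     (\<Union>Z\<in>{Z \<in> cliques r S V. e \<in> pairs Z}. {P \<in> factors r S V. Z \<in> P})"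
  proof
    fix P assume P: "P \<in> factors r S V"
    show "P \<in> factors r (S - {e}) V \<union>
     (\<Union>Z\<in>{Z \<in> cliques r S V. e \<in> pairs Z}. {P \<in> factors r S V. Z \<in> P})"
    proof (cases "\<exists>Z\<in>P. e \<in> pairs Z")
      case True thus ?thesis using P by (auto simp: factors_def)
    next
      case False
      hence "P \<subseteq> cliques r (S - {e}) V" using P unfolding factors_def cliques_def by fast
      thus ?thesis using P by (auto simp: factors_def)
    qed
  qed
  hence "num_factors r S V \<le> card (factors r (S - {e}) V \<union>
     (\<Union>Z\<in>{Z \<in> cliques r S V. e \<in> pairs Z}. {P \<in> factors r S V. Z \<in> P}))"
    unfolding num_factors_def by (intro card_mono) (use assms in auto)
  also have "\<dots> \<le> num_factors r (S - {e}) V + card (\<Union>Z\<in>{Z \<in> cliques r S V. e \<in> pairs Z}. {P \<in> factors r S V. Z \<in> P})"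
    unfolding num_factors_def by (rule card_Un_le)
  also have "card (\<Union>Z\<in>{Z \<in> cliques r S V. e \<in> pairs Z}. {P \<in> factors r S V. Z \<in> P})
     \<le> (\<Sum>Z\<in>{Z \<in> cliques r S V. e \<in> pairs Z}. card {P \<in> factors r S V. Z \<in> P})"
    by (rule card_UN_le) (use assms in auto)
  also have "\<dots> = (\<Sum>Z | Z \<in> cliques r S V \<and> e \<in> pairs Z. num_factors r S (V - Z))"
    by (rule sum.cong) (auto intro: card_factors_containing assms)
  finally show ?thesis by simp
qed

text \<open>Together with the preceding double counting this gives the drift of the removal process: a uniformly
random edge of \<open>S\<close> destroys on average at most the fraction
\<open>(r - 1) * card V / (2 * card S)\<close> of the factors.\<close>
lemma sum_num_factors_destroyed:
  assumes "finite V" "r > 0" "finite S"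
  shows "(\<Sum>e\<in>S. num_factors r S V - num_factors r (S - {e}) V) \<le> (r choose 2) * (\<Sum>Z\<in>cliques r S V. num_factors r S (V - Z))"
proof -
  have "(\<Sum>e\<in>S. num_factors r S V - num_factors r (S - {e}) V) \<le> (\<Sum>e\<in>S. \<Sum>Z | Z \<in> cliques r S V \<and> e \<in> pairs Z. num_factors r S (V - Z))"
    by (rule sum_mono) (use num_factors_delete_edge[OF assms(1,2)] in \<open>simp add: le_diff_conv add.commute\<close>)
  also have "\<dots> = (\<Sum>e\<in>S. \<Sum>Z\<in>cliques r S V. if e \<in> pairs Z then num_factors r S (V - Z) else 0)"
    by (rule sum.cong[OF refl]) (auto simp: sum.If_cases assms Int_def)
  also have "\<dots> = (\<Sum>Z\<in>cliques r S V. \<Sum>e\<in>S. if e \<in> pairs Z then num_factors r S (V - Z) else 0)"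
    by (rule sum.swap)
  also have "\<dots> = (\<Sum>Z\<in>cliques r S V. (r choose 2) * num_factors r S (V - Z))"
  proof (rule sum.cong[OF refl])
    fix Z assume Z: "Z \<in> cliques r S V"
    hence "S \<inter> pairs Z = pairs Z" "card Z = r" by (auto simp: cliques_def)
    moreover have "finite Z" using Z assms by (auto simp: cliques_def intro: finite_subset)
    ultimately show "(\<Sum>e\<in>S. if e \<in> pairs Z then num_factors r S (V - Z) else 0) = (r choose 2) * num_factors r S (V - Z)"
      using assms by (simp add: sum.If_cases card_pairs)
  qed
  finally show ?thesis by (simp add: sum_distrib_left)
qed

lemma num_factors_empty [simp]: "num_factors r S {} = 1" if "r > 0"
proof -
  have "factors r S {} = {{}}" using that
    by (auto simp: factors_def cliques_def pairwise_def)
  thus ?thesis by (simp add: num_factors_def)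
qed

text \<open>Covering a fixed vertex of a complete graph on \<open>r * N\<close> vertices can be done in at least
\<open>N ^ (r - 1)\<close> ways. The bound is not sharp, but its logarithm is correct up to a
multiple of the number of vertices, which is all the precision that is used.\<close>
lemma fact_le_num_factors_complete:
  assumes "finite V" "card V = r * N" "r > 0"
  shows "fact N ^ (r - 1) \<le> num_factors r (pairs V) V"
  using assms
proof (induction N arbitrary: V)
  case 0
  then show ?case by simp
next
  case (Suc N)
  obtain y where y: "y \<in> V" using Suc.prems by fastforce
  obtain k where k: "r = Suc k" using Suc.prems by (cases r) auto
  have cV: "card (V - {y}) = r * N + k" using Suc.prems y k by simp
  have eq: "{T. T \<in> cliques k (pairs V) (V - {y}) \<and> T \<subseteq> nbr (pairs V) y} = {T. T \<subseteq> V - {y} \<and> card T = k}"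
  proof -
    have "{y, v} \<in> pairs V" if "v \<in> V - {y}" for v
      using that y by (auto simp: pairs_def)
    hence "V - {y} \<subseteq> nbr (pairs V) y" by (auto simp: nbr_def)
    moreover have "pairs T \<subseteq> pairs V" if "T \<subseteq> V - {y}" for T
      using that by (intro pairs_mono) auto
    ultimately show ?thesis by (auto simp: cliques_def)
  qed
  have "num_factors r (pairs V) V = (\<Sum>T | T \<subseteq> V - {y} \<and> card T = k. num_factors r (pairs V) (V - insert y T))"
    using num_factors_root_link[OF Suc.prems(1) y, of k "pairs V"] eq k by simp
  also have "\<dots> \<ge> (\<Sum>T | T \<subseteq> V - {y} \<and> card T = k. fact N ^ (r - 1))"
  proof (rule sum_mono)
    fix T assume T: "T \<in> {T. T \<subseteq> V - {y} \<and> card T = k}"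
    have fT: "finite T" using T Suc.prems(1) by (auto intro: finite_subset)
    have "y \<notin> T" using T by auto
    hence "card (insert y T) = r" using T fT k by auto
    hence "card (V - insert y T) = r * N"
      using T Suc.prems y by (subst card_Diff_subset) (auto simp: fT)
    with Suc.IH[of "V - insert y T"] Suc.prems
    have "fact N ^ (r - 1) \<le> num_factors r (pairs (V - insert y T)) (V - insert y T)" by simp
    also have "\<dots> = num_factors r (pairs V) (V - insert y T)"
      by (rule num_factors_cong) (use pairs_mono[of "V - insert y T" V] in auto)
    finally show "fact N ^ (r - 1) \<le> num_factors r (pairs V) (V - insert y T)" .
  qed
  finally have A: "(\<Sum>T | T \<subseteq> V - {y} \<and> card T = k. fact N ^ (r - 1)) \<le> num_factors r (pairs V) V" .
  have B: "(\<Sum>T | T \<subseteq> V - {y} \<and> card T = k. fact N ^ (r - 1)) = ((r * N + k) choose k) * fact N ^ (r - 1)"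
    using n_subsets[of "V - {y}" k] Suc.prems cV by simp
  have "((r * N + k) choose k) \<ge> Suc N ^ k"
  proof -
    have "real (Suc N) ^ k \<le> real ((r * N + k) choose k)"
    proof (cases "k = 0")
      case False
      have "real (Suc N) \<le> real (r * N + k) / real k"
        using False k by (simp add: field_simps)
      hence "real (Suc N) ^ k \<le> (real (r * N + k) / real k) ^ k" by (intro power_mono) auto
      also have "\<dots> \<le> real ((r * N + k) choose k)"
        using binomial_ge_n_over_k_pow_k[of k "r * N + k", where ?'a = real] by simp
      finally show ?thesis .
    qed simp
    thus ?thesis by (metis of_nat_le_iff of_nat_power)
  qed
  hence "Suc N ^ k * fact N ^ (r - 1) \<le> ((r * N + k) choose k) * fact N ^ (r - 1)" by simp
  moreover have "Suc N ^ k * fact N ^ (r - 1) = fact (Suc N) ^ (r - 1)"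
    using k by (simp only: fact_Suc power_mult_distrib of_nat_id diff_Suc_1)
  ultimately have "fact (Suc N) ^ (r - 1) \<le> ((r * N + k) choose k) * fact N ^ (r - 1)"
    by (metis mult_le_mono1)
  thus ?case using A B by (simp only: )
qed

text \<open>The entropy of a uniformly random factor is at most the sum of the entropies of its marginals, up
to one unit per clique. For a factor \<open>P\<close> let \<open>f P\<close> be the product of
\<open>\<pi> Z\<close> over \<open>Z \<in> P\<close>. The sum of this weight over all sets of cliques is the
product of the \<open>1 + \<pi> Z\<close>, hence at most the exponential of \<open>card V / r\<close>, the sum of the
\<open>\<pi> Z\<close>; so \<open>f\<close> is nearly a probability on the factors, and its mean logarithm is
compared with that of the uniform distribution.\<close>
lemma ln_num_factors_le_entropy:
  assumes "finite V" "r > 0" "num_factors r S V > 0"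
  defines "\<pi> \<equiv> \<lambda>Z. real (num_factors r S (V - Z)) / real (num_factors r S V)"
  shows "ln (real (num_factors r S V)) \<le> real (card V) / real r - (\<Sum>Z\<in>cliques r S V. \<pi> Z * ln (\<pi> Z))"
proof -
  let ?F = "factors r S V" and ?C = "cliques r S V"
  define N where "N = real (num_factors r S V)"
  have N0: "N > 0" using assms unfolding N_def by simp
  have fF: "finite ?F" "?F \<noteq> {}" "finite ?C"
    using assms by (auto simp: num_factors_def card_gt_0_iff)
  have \<pi>0: "\<pi> Z \<ge> 0" for Z by (simp add: \<pi>_def)
  have fP: "finite P" "P \<subseteq> ?C" if "P \<in> ?F" for P
    using that fF(3) by (auto simp: factors_def intro: finite_subset)
  have pos: "\<pi> Z > 0" if "P \<in> ?F" "Z \<in> P" for P Z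
  proof -
    have "Z \<in> ?C" using fP that by auto
    from card_factors_containing[OF assms(1) this assms(2)] that fF
    moreover have "card {P \<in> factors r S V. Z \<in> P} > 0"
      using that fF by (auto simp: card_gt_0_iff)
    ultimately have "num_factors r S (V - Z) > 0" by simp
    thus ?thesis using assms by (simp add: \<pi>_def)
  qed
  define f where "f P = (\<Prod>Z\<in>P. \<pi> Z)" for P
  have fpos: "f P > 0" if "P \<in> ?F" for P unfolding f_def using pos that by (intro prod_pos) auto
  have sum\<pi>: "(\<Sum>Z\<in>?C. \<pi> Z) = real (card V) / real r"
  proof -
    have "real r * (\<Sum>Z\<in>?C. real (num_factors r S (V - Z))) = real (card V) * N"
      unfolding N_def using sum_num_factors_cliques[OF assms(1,2), of S]
      by (metis of_nat_mult of_nat_sum)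
    thus ?thesis using N0 assms(2) unfolding \<pi>_def N_def[symmetric] sum_divide_distrib[symmetric]
      by (simp add: field_simps)
  qed
  have "(\<Sum>P\<in>?F. f P) \<le> (\<Sum>P\<in>Pow ?C. f P)"
    by (rule sum_mono2) (use fF fP \<pi>0 in \<open>auto simp: f_def intro!: prod_nonneg\<close>)
  also have "\<dots> = (\<Prod>Z\<in>?C. \<pi> Z + 1)"
    unfolding f_def by (subst prod_add) (use fF in auto)
  also have "\<dots> \<le> (\<Prod>Z\<in>?C. exp (\<pi> Z))"
    by (rule prod_mono) (use \<pi>0 exp_ge_add_one_self in \<open>auto simp: add.commute add_nonneg_nonneg\<close>)
  also have "\<dots> = exp (real (card V) / real r)"
    using sum\<pi> exp_sum[OF fF(3), of \<pi>] by simp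
  finally have sf: "(\<Sum>P\<in>?F. f P) \<le> exp (real (card V) / real r)" .
  have lnf: "ln (f P) = (\<Sum>Z\<in>P. ln (\<pi> Z))" if "P \<in> ?F" for P
    unfolding f_def using pos[OF that] fP[OF that] by (intro ln_prod) (auto simp: less_imp_neq[symmetric])
  define E where "E = exp (real (card V) / real r)"
  have E0: "E > 0" by (simp add: E_def)
  have "(\<Sum>P\<in>?F. ln (f P)) = (\<Sum>P\<in>?F. \<Sum>Z\<in>?C. if Z \<in> P then ln (\<pi> Z) else 0)"
  proof (rule sum.cong[OF refl])
    fix P assume P: "P \<in> ?F"
    hence "?C \<inter> P = P" using fP by auto
    thus "ln (f P) = (\<Sum>Z\<in>?C. if Z \<in> P then ln (\<pi> Z) else 0)"
      using lnf[OF P] fF by (simp add: sum.If_cases)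
  qed
  also have "\<dots> = (\<Sum>Z\<in>?C. \<Sum>P\<in>?F. if Z \<in> P then ln (\<pi> Z) else 0)" by (rule sum.swap)
  also have "\<dots> = (\<Sum>Z\<in>?C. N * (\<pi> Z * ln (\<pi> Z)))"
  proof (rule sum.cong[OF refl])
    fix Z assume Z: "Z \<in> ?C"
    have "?F \<inter> {P. Z \<in> P} = {P \<in> ?F. Z \<in> P}" by auto
    hence "(\<Sum>P\<in>?F. if Z \<in> P then ln (\<pi> Z) else 0) = real (card {P \<in> ?F. Z \<in> P}) * ln (\<pi> Z)"
      using fF by (simp add: sum.If_cases)
    also have "\<dots> = N * \<pi> Z * ln (\<pi> Z)"
      using card_factors_containing[OF assms(1) Z assms(2)] N0 by (simp add: \<pi>_def N_def)
    finally show "(\<Sum>P\<in>?F. if Z \<in> P then ln (\<pi> Z) else 0) = N * (\<pi> Z * ln (\<pi> Z))" by simp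
  qed
  finally have L1: "(\<Sum>P\<in>?F. ln (f P)) = N * (\<Sum>Z\<in>?C. \<pi> Z * ln (\<pi> Z))" by (simp add: sum_distrib_left)
  \<comment> \<open>Gibbs' inequality, through the tangent of \<open>ln\<close> at \<open>E / N\<close>\<close>
  have "(\<Sum>P\<in>?F. ln (f P)) \<le> (\<Sum>P\<in>?F. ln (E / N) + (f P * N / E - 1))"
  proof (rule sum_mono)
    fix P assume P: "P \<in> ?F"
    have "ln (f P * N / E) \<le> f P * N / E - 1"
      using fpos[OF P] N0 E0 by (intro ln_le_minus_one) auto
    moreover have "ln (f P * N / E) = ln (f P) - ln (E / N)"
      using fpos[OF P] N0 E0 by (simp add: ln_mult ln_div)
    ultimately show "ln (f P) \<le> ln (E / N) + (f P * N / E - 1)" by simp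
  qed
  also have "\<dots> = N * ln (E / N) + (\<Sum>P\<in>?F. f P) * N / E - N"
    by (simp add: sum.distrib sum_subtractf sum_distrib_right sum_divide_distrib num_factors_def N_def)
  also have "\<dots> \<le> N * ln (E / N)"
  proof -
    have "(\<Sum>P\<in>?F. f P) * N / E \<le> E * N / E" using sf N0 E0 unfolding E_def
      by (intro divide_right_mono mult_right_mono) auto
    thus ?thesis using E0 by simp
  qed
  finally have "N * (\<Sum>Z\<in>?C. \<pi> Z * ln (\<pi> Z)) \<le> N * ln (E / N)" using L1 by simp
  hence "(\<Sum>Z\<in>?C. \<pi> Z * ln (\<pi> Z)) \<le> ln (E / N)" using N0 by simp
  also have "\<dots> = real (card V) / real r - ln N" using N0 E0 by (simp add: ln_div E_def)
  finally show ?thesis by (simp add: N_def)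
qed

section \<open>Random subsets\<close>

text \<open>The expectation of \<open>g\<close> at the subset of \<open>V\<close> that contains each element independently
with probability \<open>q\<close>. It is kept as a finite sum: measures enter only where such sums appear as
slices of the space of birth times.\<close>
definition bexp :: "real \<Rightarrow> 'a set \<Rightarrow> ('a set \<Rightarrow> real) \<Rightarrow> real" where
  "bexp q V g = (\<Sum>N\<in>Pow V. q ^ card N * (1 - q) ^ card (V - N) * g N)"

lemma bexp_cong: "(\<And>N. N \<subseteq> V \<Longrightarrow> g N = g' N) \<Longrightarrow> bexp q V g = bexp q V g'"
  unfolding bexp_def by (rule sum.cong) auto

lemma bexp_mono: "0 \<le> q \<Longrightarrow> q \<le> 1 \<Longrightarrow> (\<And>N. N \<subseteq> V \<Longrightarrow> g N \<le> g' N) \<Longrightarrow> bexp q V g \<le> bexp q V g'"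
  unfolding bexp_def by (intro sum_mono mult_left_mono) auto

lemma bexp_cmult: "bexp q V (\<lambda>N. c * g N) = c * bexp q V g"
  unfolding bexp_def by (simp add: sum_distrib_left algebra_simps)

lemma bexp_diff: "bexp q V (\<lambda>N. f N - g N) = bexp q V f - bexp q V g"
  unfolding bexp_def by (simp add: sum_subtractf algebra_simps)

lemma bexp_sum: "bexp q V (\<lambda>N. \<Sum>i\<in>I. f i N) = (\<Sum>i\<in>I. bexp q V (f i))"
  unfolding bexp_def by (subst sum.swap) (simp add: sum_distrib_left)

lemma bexp_insert:
  assumes "finite V" "a \<notin> V"
  shows "bexp q (insert a V) g = q * bexp q V (\<lambda>N. g (insert a N)) + (1 - q) * bexp q V g"
proof -
  have "bexp q (insert a V) g = (\<Sum>N\<in>Pow V. q ^ card N * (1 - q) ^ card (insert a V - N) * g N)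
    + (\<Sum>N\<in>insert a ` Pow V. q ^ card N * (1 - q) ^ card (insert a V - N) * g N)"
    unfolding bexp_def Pow_insert by (rule sum.union_disjoint) (use assms in auto)
  also have "(\<Sum>N\<in>Pow V. q ^ card N * (1 - q) ^ card (insert a V - N) * g N) = (1 - q) * bexp q V g"
    unfolding bexp_def sum_distrib_left
  proof (rule sum.cong[OF refl])
    fix N assume N: "N \<in> Pow V"
    hence "insert a V - N = insert a (V - N)" using assms by auto
    hence "card (insert a V - N) = Suc (card (V - N))" using assms by simp
    thus "q ^ card N * (1 - q) ^ card (insert a V - N) * g N = (1 - q) * (q ^ card N * (1 - q) ^ card (V - N) * g N)"
      by simp
  qed
  also have "(\<Sum>N\<in>insert a ` Pow V. q ^ card N * (1 - q) ^ card (insert a V - N) * g N)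
     = (\<Sum>N\<in>Pow V. q ^ card (insert a N) * (1 - q) ^ card (insert a V - insert a N) * g (insert a N))"
    by (rule sum.reindex_cong[where l = "insert a"]) (use assms in \<open>auto simp: inj_on_def\<close>)
  also have "\<dots> = q * bexp q V (\<lambda>N. g (insert a N))"
    unfolding bexp_def sum_distrib_left
  proof (rule sum.cong[OF refl])
    fix N assume N: "N \<in> Pow V"
    hence "insert a V - insert a N = V - N" "card (insert a N) = Suc (card N)"
      using assms by (auto intro: card_insert_disjoint finite_subset)
    thus "q ^ card (insert a N) * (1 - q) ^ card (insert a V - insert a N) * g (insert a N)
      = q * (q ^ card N * (1 - q) ^ card (V - N) * g (insert a N))" by simp
  qed
  finally show ?thesis by simp
qed

lemma bexp_const [simp]: "finite V \<Longrightarrow> bexp q V (\<lambda>N. c) = c"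
proof (induction V rule: finite_induct)
  case empty thus ?case by (simp add: bexp_def)
next
  case (insert a V) thus ?case by (simp add: bexp_insert algebra_simps)
qed

lemma bexp_member:
  assumes "finite V" "a \<in> V"
  shows "bexp q V (\<lambda>N. if a \<in> N then g N else 0) = q * bexp q V (\<lambda>N. g (insert a N))"
proof -
  obtain V' where V: "V = insert a V'" "a \<notin> V'" using assms(2) by (meson Set.set_insert)
  have f: "finite V'" using V assms by simp
  have "bexp q V' (\<lambda>N. if a \<in> N then g N else 0) = bexp q V' (\<lambda>N. 0)"
    by (rule bexp_cong) (use V in auto)
  thus ?thesis using f V by (simp add: bexp_insert algebra_simps)
qed

text \<open>Given that \<open>A\<close> is contained in the random set, the rest of the set is still random with
density \<open>q\<close>.\<close>
lemma bexp_superset: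
  assumes "finite V" "A \<subseteq> V"
  shows "bexp q V (\<lambda>N. if A \<subseteq> N then g N else 0) = q ^ card A * bexp q V (\<lambda>N. g (N \<union> A))"
proof -
  have "finite A" using assms finite_subset by blast
  thus ?thesis using assms(2)
  proof (induction A arbitrary: g rule: finite_induct)
    case empty thus ?case by simp
  next
    case (insert a A)
    have "bexp q V (\<lambda>N. if insert a A \<subseteq> N then g N else 0)
      = bexp q V (\<lambda>N. if a \<in> N then (if A \<subseteq> N then g N else 0) else 0)"
      by (rule bexp_cong) auto
    also have "\<dots> = q * bexp q V (\<lambda>N. if A \<subseteq> insert a N then g (insert a N) else 0)"
      by (rule bexp_member) (use insert assms in auto)
    also have "bexp q V (\<lambda>N. if A \<subseteq> insert a N then g (insert a N) else 0)
       = bexp q V (\<lambda>N. if A \<subseteq> N then g (insert a N) else 0)"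
      by (rule bexp_cong) (use insert in auto)
    also have "\<dots> = q ^ card A * bexp q V (\<lambda>N. g (insert a (N \<union> A)))"
      using insert by simp
    finally show ?case using insert by simp
  qed
qed

lemma bexp_superset_const:
  assumes "finite V" "A \<subseteq> V"
  shows "bexp q V (\<lambda>N. if A \<subseteq> N then c else 0) = q ^ card A * c"
  using bexp_superset[OF assms, of q "\<lambda>_. c"] assms by simp

lemma bexp_markov:
  assumes "finite V" "0 \<le> q" "q \<le> 1" "B > 0" "\<And>N. N \<subseteq> V \<Longrightarrow> 0 \<le> f N"
  shows "bexp q V (\<lambda>N. if B \<le> f N then 1 else 0) \<le> bexp q V f / B"
proof -
  have "bexp q V (\<lambda>N. if B \<le> f N then 1 else 0) \<le> bexp q V (\<lambda>N. inverse B * f N)"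
    by (rule bexp_mono) (use assms in \<open>auto simp: field_simps\<close>)
  thus ?thesis unfolding bexp_cmult by (simp add: divide_inverse mult.commute)
qed

text \<open>Janson's inequality, for \<open>X\<close> the number of members of \<open>\<F>\<close> inside the random set. The
Laplace transform \<open>\<psi>\<close> of \<open>X\<close> satisfies \<open>- \<psi>' s \<ge> (E - s * D) * \<psi> s\<close>,
because given the presence of \<open>T\<close> the members disjoint from \<open>T\<close> are not affected, and the
members that meet \<open>T\<close> cost at most \<open>s\<close> times their expected number. Hence
\<open>\<psi> s * exp (s * E - s\<^sup>2 * D / 2)\<close> does not increase, and \<open>s = t / D\<close> is the best
exponent.\<close>
lemma janson_lower_tail:
  fixes \<F> :: "'a set set"
  assumes fin: "finite V" "finite \<F>" and sub: "\<And>T. T \<in> \<F> \<Longrightarrow> T \<subseteq> V" and q: "0 \<le> q" "q \<le> 1"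
  defines "E \<equiv> (\<Sum>T\<in>\<F>. q ^ card T)"
  assumes D: "(\<Sum>T\<in>\<F>. \<Sum>T' | T' \<in> \<F> \<and> T' \<inter> T \<noteq> {}. q ^ card (T \<union> T')) \<le> D" "D > 0" and t: "t \<ge> 0"
  shows "bexp q V (\<lambda>N. if real (card {T \<in> \<F>. T \<subseteq> N}) \<le> E - t then 1 else 0) \<le> exp (- (t\<^sup>2 / (2 * D)))"
proof -
  define X where "X N = (\<Sum>T\<in>\<F>. if T \<subseteq> N then 1 else 0 :: real)" for N
  have X: "real (card {T \<in> \<F>. T \<subseteq> N}) = X N" for N
    unfolding X_def using fin by (simp add: sum.If_cases Int_def)
  define \<psi> where "\<psi> s = bexp q V (\<lambda>N. exp (- s * X N))" for s
  have \<psi>0: "\<psi> s \<ge> 0" for s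
  proof -
    have "bexp q V (\<lambda>N. 0) \<le> \<psi> s" unfolding \<psi>_def by (rule bexp_mono) (use q in auto)
    thus ?thesis using fin by simp
  qed
  have key: "bexp q V (\<lambda>N. if T \<subseteq> N then exp (- s * X N) else 0)
     \<ge> \<psi> s * (q ^ card T - s * (\<Sum>T' | T' \<in> \<F> \<and> T' \<inter> T \<noteq> {}. q ^ card (T \<union> T')))"
    if T: "T \<in> \<F>" and s: "s \<ge> 0" for T s
  proof -
    \<comment> \<open>\<open>Y\<close> counts the members that meet \<open>T\<close>, including \<open>T\<close> itself; \<open>Z\<close> counts the others\<close>
    define Y where "Y N = (\<Sum>T' | T' \<in> \<F> \<and> T' \<inter> T \<noteq> {}. if T' \<subseteq> N then 1 else 0 :: real)" for N
    define Z where "Z N = (\<Sum>T' | T' \<in> \<F> \<and> T' \<inter> T = {}. if T' \<subseteq> N then 1 else 0 :: real)" for N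
    have XYZ: "X N = Y N + Z N" for N
    proof -
      have "\<F> = {T' \<in> \<F>. T' \<inter> T \<noteq> {}} \<union> {T' \<in> \<F>. T' \<inter> T = {}}" by auto
      thus ?thesis unfolding X_def Y_def Z_def
        by (metis (no_types, lifting) sum.union_disjoint fin(2) finite_Un disjoint_iff mem_Collect_eq)
    qed
    have Y0: "Y N \<ge> 0" for N unfolding Y_def by (intro sum_nonneg) auto
    have Zmono: "Z N \<le> Z N'" if "N \<subseteq> N'" for N N'
      unfolding Z_def by (rule sum_mono) (use that in auto)
    define Q where "Q = bexp q V (\<lambda>N. exp (- s * Z N))"
    have Q\<psi>: "\<psi> s \<le> Q" unfolding Q_def \<psi>_def
      by (rule bexp_mono) (use q s XYZ Y0 in \<open>auto simp: mult_left_mono\<close>)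
    have ZT: "Z (N \<union> T) = Z N" for N
      unfolding Z_def by (rule sum.cong) auto
    have QT: "bexp q V (\<lambda>N. if T \<subseteq> N then exp (- s * Z N) else 0) = q ^ card T * Q"
      unfolding Q_def by (subst bexp_superset) (use fin sub T ZT in auto)
    have QT': "bexp q V (\<lambda>N. if T \<union> T' \<subseteq> N then exp (- s * Z N) else 0) \<le> q ^ card (T \<union> T') * Q"
      if "T' \<in> \<F>" for T'
      unfolding Q_def
    proof (subst bexp_superset)
      show "q ^ card (T \<union> T') * bexp q V (\<lambda>N. exp (- s * Z (N \<union> (T \<union> T'))))
        \<le> q ^ card (T \<union> T') * bexp q V (\<lambda>N. exp (- s * Z N))"
        by (intro mult_left_mono bexp_mono) (use q s in \<open>auto intro!: mult_left_mono Zmono\<close>)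
    qed (use fin sub T that in auto)
    have "q ^ card T * Q - s * (\<Sum>T' | T' \<in> \<F> \<and> T' \<inter> T \<noteq> {}. q ^ card (T \<union> T') * Q)
      \<le> bexp q V (\<lambda>N. if T \<subseteq> N then exp (- s * Z N) else 0) - s * (\<Sum>T' | T' \<in> \<F> \<and> T' \<inter> T \<noteq> {}.
          bexp q V (\<lambda>N. if T \<union> T' \<subseteq> N then exp (- s * Z N) else 0))"
      unfolding QT by (intro diff_left_mono mult_left_mono sum_mono QT') (use s in auto)
    also have "\<dots> = bexp q V (\<lambda>N. (if T \<subseteq> N then exp (- s * Z N) else 0) - s * (\<Sum>T' | T' \<in> \<F> \<and> T' \<inter> T \<noteq> {}.
          if T \<union> T' \<subseteq> N then exp (- s * Z N) else 0))"
      by (simp only: bexp_diff bexp_cmult bexp_sum)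
    also have "\<dots> \<le> bexp q V (\<lambda>N. if T \<subseteq> N then exp (- s * X N) else 0)"
    proof (rule bexp_mono[OF q])
      fix N assume "N \<subseteq> V"
      have "(\<Sum>T' | T' \<in> \<F> \<and> T' \<inter> T \<noteq> {}. if T \<union> T' \<subseteq> N then exp (- s * Z N) else 0) = Y N * exp (- s * Z N)"
        if "T \<subseteq> N"
        unfolding Y_def sum_distrib_right by (rule sum.cong) (use that in auto)
      moreover have "(1 - s * Y N) * exp (- s * Z N) \<le> exp (- s * X N)"
      proof -
        have "1 - s * Y N \<le> exp (- (s * Y N))" using exp_ge_add_one_self[of "- (s * Y N)"] by simp
        hence "(1 - s * Y N) * exp (- s * Z N) \<le> exp (- (s * Y N)) * exp (- s * Z N)"
          by (intro mult_right_mono) auto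
        also have "\<dots> = exp (- s * X N)" unfolding XYZ exp_add[symmetric] by (simp add: algebra_simps)
        finally show ?thesis .
      qed
      ultimately show "(if T \<subseteq> N then exp (- s * Z N) else 0) - s * (\<Sum>T' | T' \<in> \<F> \<and> T' \<inter> T \<noteq> {}.
          if T \<union> T' \<subseteq> N then exp (- s * Z N) else 0) \<le> (if T \<subseteq> N then exp (- s * X N) else 0)"
        by (auto simp: algebra_simps)
    qed
    finally have lo: "Q * (q ^ card T - s * (\<Sum>T' | T' \<in> \<F> \<and> T' \<inter> T \<noteq> {}. q ^ card (T \<union> T')))
       \<le> bexp q V (\<lambda>N. if T \<subseteq> N then exp (- s * X N) else 0)"
      by (simp add: algebra_simps sum_distrib_left)
    let ?c = "q ^ card T - s * (\<Sum>T' | T' \<in> \<F> \<and> T' \<inter> T \<noteq> {}. q ^ card (T \<union> T'))"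
    show ?thesis
    proof (cases "?c \<ge> 0")
      case True
      thus ?thesis using lo mult_right_mono[OF Q\<psi> True] by linarith
    next
      case False
      hence "\<psi> s * ?c \<le> 0" using \<psi>0[of s] by (simp add: mult_nonneg_nonpos)
      moreover have "bexp q V (\<lambda>N. 0) \<le> bexp q V (\<lambda>N. if T \<subseteq> N then exp (- s * X N) else 0)"
        by (rule bexp_mono) (use q in auto)
      ultimately show ?thesis using fin by simp
    qed
  qed
  have drift: "bexp q V (\<lambda>N. X N * exp (- s * X N)) \<ge> \<psi> s * (E - s * D)" if s: "s \<ge> 0" for s
  proof -
    have "\<psi> s * (E - s * D) \<le> \<psi> s * (E - s * (\<Sum>T\<in>\<F>. \<Sum>T' | T' \<in> \<F> \<and> T' \<inter> T \<noteq> {}. q ^ card (T \<union> T')))"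
      by (intro mult_left_mono diff_left_mono D s \<psi>0)
    also have "\<dots> = (\<Sum>T\<in>\<F>. \<psi> s * (q ^ card T - s * (\<Sum>T' | T' \<in> \<F> \<and> T' \<inter> T \<noteq> {}. q ^ card (T \<union> T'))))"
      by (simp add: E_def sum_distrib_left sum_subtractf right_diff_distrib)
    also have "\<dots> \<le> (\<Sum>T\<in>\<F>. bexp q V (\<lambda>N. if T \<subseteq> N then exp (- s * X N) else 0))"
      by (rule sum_mono) (use key s in auto)
    also have "\<dots> = bexp q V (\<lambda>N. \<Sum>T\<in>\<F>. if T \<subseteq> N then exp (- s * X N) else 0)"
      by (rule bexp_sum[symmetric])
    also have "\<dots> = bexp q V (\<lambda>N. X N * exp (- s * X N))"
      by (rule bexp_cong) (auto simp: X_def sum_distrib_right intro!: sum.cong)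
    finally show ?thesis .
  qed
  define h where "h s = \<psi> s * exp (s * E - s\<^sup>2 * D / 2)" for s
  have d\<psi>: "(\<psi> has_real_derivative - bexp q V (\<lambda>N. X N * exp (- s * X N))) (at s)" for s
    unfolding \<psi>_def bexp_def sum_negf[symmetric]
    by (auto intro!: derivative_eq_intros sum.cong simp: algebra_simps)
  have dh: "(h has_real_derivative
     (- bexp q V (\<lambda>N. X N * exp (- s * X N)) + \<psi> s * (E - s * D)) * exp (s * E - s\<^sup>2 * D / 2)) (at s)" for s
    unfolding h_def by (auto intro!: derivative_eq_intros d\<psi> simp: algebra_simps)
  have "h s \<le> h 0" if s: "s \<ge> 0" for s
  proof (rule DERIV_nonpos_imp_nonincreasing[OF s])
    fix x assume "0 \<le> x" "x \<le> s"
    thus "\<exists>y. DERIV h x :> y \<and> y \<le> 0"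
      using dh[of x] drift[of x] by (intro exI conjI) (auto intro!: mult_nonpos_nonneg)
  qed
  moreover have "h 0 = 1" using fin by (simp add: h_def \<psi>_def)
  ultimately have h1: "h s \<le> 1" if "s \<ge> 0" for s using that by auto
  define s where "s = t / D"
  have s0: "s \<ge> 0" using t D by (simp add: s_def)
  have "bexp q V (\<lambda>N. if X N \<le> E - t then 1 else 0) \<le> bexp q V (\<lambda>N. exp (s * (E - t)) * exp (- s * X N))"
  proof (rule bexp_mono[OF q])
    fix N
    show "(if X N \<le> E - t then 1 else 0) \<le> exp (s * (E - t)) * exp (- s * X N)"
      using s0 mult_left_mono[of "X N" "E - t" s] by (auto simp: exp_add[symmetric])
  qed
  also have "\<dots> = exp (s * (E - t)) * \<psi> s" by (simp only: bexp_cmult \<psi>_def)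
  also have "\<dots> = h s * exp (s\<^sup>2 * D / 2 - s * t)"
    by (simp add: h_def mult_ac exp_add[symmetric] flip: mult.assoc) (simp add: algebra_simps)
  also have "\<dots> \<le> 1 * exp (s\<^sup>2 * D / 2 - s * t)" by (intro mult_right_mono h1 s0) auto
  also have "s\<^sup>2 * D / 2 - s * t = - (t\<^sup>2 / (2 * D))" using D by (simp add: s_def power2_eq_square field_simps)
  finally show ?thesis by (simp add: X)
qed

text \<open>Disjoint members of a family are present independently. Moments of tuples of disjoint members
therefore need no information on overlaps, unlike the moments of the number of members itself.\<close>
definition disjoint_tuples :: "nat \<Rightarrow> 'a set set \<Rightarrow> 'a set list set" where
  "disjoint_tuples k \<Q> = {xs. length xs = k \<and> set xs \<subseteq> \<Q> \<and> sorted_wrt (\<lambda>x y. x \<inter> y = {}) xs}"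

lemma finite_disjoint_tuples [simp]: "finite \<Q> \<Longrightarrow> finite (disjoint_tuples k \<Q>)"
  unfolding disjoint_tuples_def using finite_lists_length_eq[of \<Q> k]
  by (rule rev_finite_subset) auto

lemma disjoint_tuples_0 [simp]: "disjoint_tuples 0 \<Q> = {[]}" unfolding disjoint_tuples_def by auto

lemma disjoint_tuples_Suc: "disjoint_tuples (Suc k) \<Q> = (\<Union>xs\<in>disjoint_tuples k \<Q>. (\<lambda>x. x # xs) ` {x \<in> \<Q>. \<forall>y\<in>set xs. x \<inter> y = {}})"
proof (rule set_eqI)
  fix zs show "zs \<in> disjoint_tuples (Suc k) \<Q> \<longleftrightarrow> zs \<in> (\<Union>xs\<in>disjoint_tuples k \<Q>. (\<lambda>x. x # xs) ` {x \<in> \<Q>. \<forall>y\<in>set xs. x \<inter> y = {}})"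
    by (cases zs) (auto simp: disjoint_tuples_def)
qed

text \<open>Greedy choice: each of the fewer than \<open>k\<close> members that are already chosen excludes at most
\<open>b\<close> others.\<close>
lemma card_disjoint_tuples_ge:
  assumes fin: "finite \<Q>" and b: "\<And>T. T \<in> \<Q> \<Longrightarrow> real (card {T' \<in> \<Q>. T' \<inter> T \<noteq> {}}) \<le> b"
    and kb: "real k * b \<le> real (card \<Q>)" and b0: "b \<ge> 0"
  shows "(real (card \<Q>) - real k * b) ^ k \<le> real (card (disjoint_tuples k \<Q>))"
proof -
  have "j \<le> k \<Longrightarrow> (real (card \<Q>) - real k * b) ^ j \<le> real (card (disjoint_tuples j \<Q>))" for j
  proof (induction j)
    case 0 thus ?case by simp
  next
    case (Suc j)
    let ?a = "real (card \<Q>) - real k * b"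
    have ext: "?a \<le> real (card {x \<in> \<Q>. \<forall>y\<in>set xs. x \<inter> y = {}})" if "xs \<in> disjoint_tuples j \<Q>" for xs
    proof -
      have xs: "set xs \<subseteq> \<Q>" "length xs = j" using that by (auto simp: disjoint_tuples_def)
      have "\<Q> = {x \<in> \<Q>. \<forall>y\<in>set xs. x \<inter> y = {}} \<union> (\<Union>y\<in>set xs. {x \<in> \<Q>. x \<inter> y \<noteq> {}})" by auto
      hence "card \<Q> \<le> card {x \<in> \<Q>. \<forall>y\<in>set xs. x \<inter> y = {}} + card (\<Union>y\<in>set xs. {x \<in> \<Q>. x \<inter> y \<noteq> {}})"
        by (metis (no_types, lifting) card_Un_le)
      also have "card (\<Union>y\<in>set xs. {x \<in> \<Q>. x \<inter> y \<noteq> {}}) \<le> (\<Sum>y\<in>set xs. card {x \<in> \<Q>. x \<inter> y \<noteq> {}})"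
        by (rule card_UN_le) auto
      finally have "card \<Q> \<le> card {x \<in> \<Q>. \<forall>y\<in>set xs. x \<inter> y = {}} + (\<Sum>y\<in>set xs. card {x \<in> \<Q>. x \<inter> y \<noteq> {}})"
        by simp
      hence "real (card \<Q>) \<le> real (card {x \<in> \<Q>. \<forall>y\<in>set xs. x \<inter> y = {}} + (\<Sum>y\<in>set xs. card {x \<in> \<Q>. x \<inter> y \<noteq> {}}))"
        by (simp only: of_nat_le_iff)
      hence "real (card \<Q>) \<le> real (card {x \<in> \<Q>. \<forall>y\<in>set xs. x \<inter> y = {}}) + (\<Sum>y\<in>set xs. real (card {x \<in> \<Q>. x \<inter> y \<noteq> {}}))"
        by (simp only: of_nat_add of_nat_sum)
      also have "(\<Sum>y\<in>set xs. real (card {x \<in> \<Q>. x \<inter> y \<noteq> {}})) \<le> real (card (set xs)) * b"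
        by (rule sum_bounded_above) (use b xs in auto)
      also have "\<dots> \<le> real k * b"
        using card_length[of xs] xs Suc.prems b0 by (intro mult_right_mono) auto
      finally show ?thesis by simp
    qed
    have a0: "?a \<ge> 0" using kb by simp
    have fin': "finite {x \<in> \<Q>. \<forall>y\<in>set xs. x \<inter> y = {}}" for xs using fin by auto
    have "?a ^ Suc j \<le> (\<Sum>xs\<in>disjoint_tuples j \<Q>. ?a)"
    proof -
      have "?a * ?a ^ j \<le> ?a * real (card (disjoint_tuples j \<Q>))"
        using Suc.IH a0 Suc.prems by (intro mult_left_mono) auto
      thus ?thesis by (simp add: mult.commute)
    qed
    also have "\<dots> \<le> (\<Sum>xs\<in>disjoint_tuples j \<Q>. real (card {x \<in> \<Q>. \<forall>y\<in>set xs. x \<inter> y = {}}))"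
      by (rule sum_mono) (rule ext)
    also have "\<dots> = (\<Sum>xs\<in>disjoint_tuples j \<Q>. real (card ((\<lambda>x. x # xs) ` {x \<in> \<Q>. \<forall>y\<in>set xs. x \<inter> y = {}})))"
      by (simp add: card_image inj_on_def)
    also have "\<dots> = real (card (disjoint_tuples (Suc j) \<Q>))"
      unfolding disjoint_tuples_Suc
      using fin fin' by (subst card_UN_disjoint) (auto simp: image_iff)
    finally show ?case .
  qed
  thus ?thesis by simp
qed

lemma bexp_card_disjoint_tuples_le:
  assumes fin: "finite V" "finite \<A>" and sub: "\<And>T. T \<in> \<A> \<Longrightarrow> T \<subseteq> V \<and> card T = d" and q: "0 \<le> q" "q \<le> 1"
  shows "bexp q V (\<lambda>N. real (card (disjoint_tuples k {T \<in> \<A>. T \<subseteq> N}))) \<le> (real (card \<A>) * q ^ d) ^ k"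
proof -
  have card_Un: "card (\<Union>(set xs)) = d * k \<and> \<Union>(set xs) \<subseteq> V" if "xs \<in> disjoint_tuples k \<A>" for xs k
    using that
  proof (induction k arbitrary: xs)
    case (Suc k)
    then obtain x ys where xs: "xs = x # ys" "ys \<in> disjoint_tuples k \<A>" "x \<in> \<A>" "\<forall>y\<in>set ys. x \<inter> y = {}"
      by (auto simp: disjoint_tuples_Suc)
    have "finite x" "finite (\<Union>(set ys))" "x \<subseteq> V" "card x = d"
      using sub[OF xs(3)] Suc.IH[OF xs(2)] fin finite_subset by auto
    moreover have "x \<inter> \<Union>(set ys) = {}" using xs by auto
    ultimately have "card (x \<union> \<Union>(set ys)) = d + d * k" "x \<union> \<Union>(set ys) \<subseteq> V"
      using Suc.IH[OF xs(2)] by (auto simp: card_Un_disjoint)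
    thus ?case unfolding xs(1) by simp
  qed simp
  have eq: "real (card (disjoint_tuples k {T \<in> \<A>. T \<subseteq> N})) = (\<Sum>xs\<in>disjoint_tuples k \<A>. if \<Union>(set xs) \<subseteq> N then 1 else 0)" for N
  proof -
    have "disjoint_tuples k {T \<in> \<A>. T \<subseteq> N} = {xs \<in> disjoint_tuples k \<A>. \<Union>(set xs) \<subseteq> N}" by (auto simp: disjoint_tuples_def)
    thus ?thesis using fin by (simp add: sum.If_cases Int_def)
  qed
  have "bexp q V (\<lambda>N. real (card (disjoint_tuples k {T \<in> \<A>. T \<subseteq> N}))) = (\<Sum>xs\<in>disjoint_tuples k \<A>. bexp q V (\<lambda>N. if \<Union>(set xs) \<subseteq> N then 1 else 0))"
    unfolding eq by (rule bexp_sum)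
  also have "\<dots> = (\<Sum>xs\<in>disjoint_tuples k \<A>. q ^ (d * k))"
    by (rule sum.cong[OF refl]) (use card_Un fin in \<open>simp add: bexp_superset_const\<close>)
  also have "\<dots> = real (card (disjoint_tuples k \<A>)) * q ^ (d * k)" by simp
  also have "\<dots> \<le> real (card \<A> ^ k) * q ^ (d * k)"
  proof (intro mult_right_mono of_nat_mono)
    have "card (disjoint_tuples k \<A>) \<le> card {xs. set xs \<subseteq> \<A> \<and> length xs = k}"
      by (rule card_mono) (use finite_lists_length_eq[OF fin(2)] in \<open>auto simp: disjoint_tuples_def\<close>)
    thus "card (disjoint_tuples k \<A>) \<le> card \<A> ^ k" using card_lists_length_eq[OF fin(2)] by simp
  qed (use q in auto)
  finally show ?thesis by (simp add: power_mult_distrib power_mult)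
qed

section \<open>Conditioning on the birth times outside a star\<close>

abbreviation unif :: "real measure" where "unif \<equiv> restrict_space lborel {0..1}"

abbreviation unif_prod :: "nat set set \<Rightarrow> (nat set \<Rightarrow> real) measure" where
  "unif_prod K \<equiv> (\<Pi>\<^sub>M f\<in>K. unif)"

lemma prob_space_unif: "prob_space unif"
  by (rule prob_space_restrict_space) auto

interpretation unif: product_sigma_finite "\<lambda>_ :: nat set. unif"
  by (intro product_sigma_finite.intro prob_space_imp_sigma_finite prob_space_unif)

lemma space_unif [simp]: "space unif = {0..1}"
  by (simp add: space_restrict_space)

lemma prob_space_unif_prod: "prob_space (unif_prod K)"
  by (intro prob_space_PiM prob_space_unif)

lemma emeasure_unif_atMost: "0 \<le> q \<Longrightarrow> q \<le> 1 \<Longrightarrow> emeasure unif {0..q} = ennreal q"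
  by (subst emeasure_restrict_space) auto

lemma emeasure_unif_greater: "0 \<le> q \<Longrightarrow> q \<le> 1 \<Longrightarrow> emeasure unif {q<..1} = ennreal (1 - q)"
  by (subst emeasure_restrict_space) auto

lemma sets_unif_iff: "A \<in> sets unif \<longleftrightarrow> A \<in> sets borel \<and> A \<subseteq> {0..1}"
  by (subst sets_restrict_space_iff) auto

lemma component_measurable_prod: "f \<in> K \<Longrightarrow> (\<lambda>\<sigma>. \<sigma> f) \<in> borel_measurable (unif_prod K)"
  using measurable_component_singleton[of f K "\<lambda>_. unif"] by (simp add: measurable_restrict_space2_iff)

lemma component_measurable [measurable (raw)]:
  "f \<in> pairs {1..n} \<Longrightarrow> (\<lambda>\<omega>. \<omega> f) \<in> borel_measurable (birth_space n)"
  unfolding birth_space_def by (rule component_measurable_prod)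

lemma component_range: "\<omega> \<in> space (unif_prod K) \<Longrightarrow> f \<in> K \<Longrightarrow> \<omega> f \<in> {0..1}"
  by (auto simp: space_PiM PiE_iff)

text \<open>The coordinates with value at most \<open>q\<close> form a random subset of density \<open>q\<close>.\<close>
lemma emeasure_level_set:
  assumes "finite K" "B \<subseteq> K" "0 \<le> q" "q \<le> 1"
  shows "emeasure (unif_prod K) {\<sigma> \<in> space (unif_prod K). {g \<in> K. \<sigma> g \<le> q} = B}
     = ennreal (q ^ card B * (1 - q) ^ card (K - B))"
proof -
  let ?A = "\<lambda>g. if g \<in> B then {0..q} else {q<..1}"
  have "{\<sigma> \<in> space (unif_prod K). {g \<in> K. \<sigma> g \<le> q} = B} = Pi\<^sub>E K ?A"
  proof (rule set_eqI)
    fix \<sigma>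
    have "(\<sigma> \<in> extensional K \<and> (\<forall>g\<in>K. 0 \<le> \<sigma> g \<and> \<sigma> g \<le> 1) \<and> {g \<in> K. \<sigma> g \<le> q} = B)
       \<longleftrightarrow> (\<sigma> \<in> extensional K \<and> (\<forall>g\<in>K. \<sigma> g \<in> ?A g))" (is "?L = ?R")
    proof
      assume L: ?L
      show ?R
      proof (intro conjI ballI)
        fix g assume "g \<in> K"
        thus "\<sigma> g \<in> ?A g" using L by (cases "g \<in> B") (auto simp: not_le)
      qed (use L in simp)
    next
      assume R: ?R
      have *: "0 \<le> \<sigma> g \<and> \<sigma> g \<le> 1 \<and> (\<sigma> g \<le> q \<longleftrightarrow> g \<in> B)" if "g \<in> K" for g
        using R that assms by (cases "g \<in> B") fastforce+
      show ?L using R * assms(2) by auto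
    qed
    thus "\<sigma> \<in> {\<sigma> \<in> space (unif_prod K). {g \<in> K. \<sigma> g \<le> q} = B} \<longleftrightarrow> \<sigma> \<in> Pi\<^sub>E K ?A"
      by (simp only: mem_Collect_eq space_PiM PiE_iff space_unif atLeastAtMost_iff) blast
  qed
  also have "emeasure (unif_prod K) \<dots> = (\<Prod>g\<in>K. emeasure unif (?A g))"
    by (rule unif.emeasure_PiM) (use assms in \<open>auto simp: sets_unif_iff\<close>)
  also have "\<dots> = (\<Prod>g\<in>K. ennreal (if g \<in> B then q else 1 - q))"
    by (rule prod.cong) (use assms emeasure_unif_atMost emeasure_unif_greater in auto)
  also have "\<dots> = ennreal (\<Prod>g\<in>K. if g \<in> B then q else 1 - q)"
    by (rule prod_ennreal) (use assms in auto)
  also have "(\<Prod>g\<in>K. if g \<in> B then q else 1 - q) = q ^ card B * (1 - q) ^ card (K - B)"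
  proof -
    have "K \<inter> {g. g \<in> B} = B" "K \<inter> - {g. g \<in> B} = K - B" using assms(2) by auto
    thus ?thesis using assms(1) by (simp add: prod.If_cases)
  qed
  finally show ?thesis .
qed

text \<open>Fubini's theorem for the coordinates in \<open>K\<close> against all others.\<close>
lemma emeasure_split:
  assumes K: "K \<subseteq> pairs {1..n}" and A: "A \<in> sets (birth_space n)"
  shows "emeasure (birth_space n) A =
    (\<integral>\<^sup>+\<rho>. emeasure (unif_prod K) {\<sigma> \<in> space (unif_prod K). merge (pairs {1..n} - K) K (\<rho>, \<sigma>) \<in> A}
       \<partial>unif_prod (pairs {1..n} - K))"
proof -
  let ?I = "pairs {1..n}" let ?J = "?I - K"
  have fin: "finite ?I" "finite K" "finite ?J" using K by (auto simp: pairs_def intro: finite_subset)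
  have U: "?J \<union> K = ?I" using K by auto
  interpret K: prob_space "unif_prod K" by (rule prob_space_unif_prod)
  have A': "A \<in> sets (unif_prod (?J \<union> K))" using A unfolding U birth_space_def .
  have m: "merge ?J K \<in> measurable (unif_prod ?J \<Otimes>\<^sub>M unif_prod K) (unif_prod (?J \<union> K))"
    by (rule measurable_merge)
  have "emeasure (birth_space n) A = emeasure (distr (unif_prod ?J \<Otimes>\<^sub>M unif_prod K) (unif_prod (?J \<union> K)) (merge ?J K)) A"
    unfolding birth_space_def by (subst unif.distr_merge) (use fin U in auto)
  also have "\<dots> = emeasure (unif_prod ?J \<Otimes>\<^sub>M unif_prod K) (merge ?J K -` A \<inter> space (unif_prod ?J \<Otimes>\<^sub>M unif_prod K))"
    by (rule emeasure_distr[OF m A'])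
  also have "\<dots> = (\<integral>\<^sup>+\<rho>. emeasure (unif_prod K) (Pair \<rho> -` (merge ?J K -` A \<inter> space (unif_prod ?J \<Otimes>\<^sub>M unif_prod K))) \<partial>unif_prod ?J)"
    by (rule K.emeasure_pair_measure_alt) (rule measurable_sets[OF m A'])
  also have "\<dots> = (\<integral>\<^sup>+\<rho>. emeasure (unif_prod K) {\<sigma> \<in> space (unif_prod K). merge ?J K (\<rho>, \<sigma>) \<in> A} \<partial>unif_prod ?J)"
  proof (rule nn_integral_cong)
    fix \<rho> assume "\<rho> \<in> space (unif_prod ?J)"
    hence "Pair \<rho> -` (merge ?J K -` A \<inter> space (unif_prod ?J \<Otimes>\<^sub>M unif_prod K)) = {\<sigma> \<in> space (unif_prod K). merge ?J K (\<rho>, \<sigma>) \<in> A}"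
      unfolding space_pair_measure by blast
    thus "emeasure (unif_prod K) (Pair \<rho> -` (merge ?J K -` A \<inter> space (unif_prod ?J \<Otimes>\<^sub>M unif_prod K))) = emeasure (unif_prod K) {\<sigma> \<in> space (unif_prod K). merge ?J K (\<rho>, \<sigma>) \<in> A}"
      by simp
  qed
  finally show ?thesis .
qed

lemma slice_emeasure_measurable:
  assumes K: "K \<subseteq> pairs {1..n}" and A: "A \<in> sets (birth_space n)"
  shows "(\<lambda>\<rho>. emeasure (unif_prod K) {\<sigma> \<in> space (unif_prod K). merge (pairs {1..n} - K) K (\<rho>, \<sigma>) \<in> A})
    \<in> borel_measurable (unif_prod (pairs {1..n} - K))"
proof -
  interpret K: prob_space "unif_prod K" by (rule prob_space_unif_prod)
  let ?I = "pairs {1..n}"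
  have U: "(?I - K) \<union> K = ?I" using K by auto
  let ?J = "?I - K"
  have m: "merge ?J K \<in> measurable (unif_prod ?J \<Otimes>\<^sub>M unif_prod K) (unif_prod ?I)"
    using measurable_merge[of ?J K "\<lambda>_. unif"] unfolding U .
  have X: "merge ?J K -` A \<inter> space (unif_prod ?J \<Otimes>\<^sub>M unif_prod K) \<in> sets (unif_prod ?J \<Otimes>\<^sub>M unif_prod K)"
    by (rule measurable_sets[OF m]) (use A in \<open>simp add: birth_space_def\<close>)
  from K.measurable_emeasure_Pair[OF X]
  have "(\<lambda>\<rho>. emeasure (unif_prod K) (Pair \<rho> -` (merge ?J K -` A \<inter> space (unif_prod ?J \<Otimes>\<^sub>M unif_prod K)))) \<in> borel_measurable (unif_prod ?J)" .
  also have "?this \<longleftrightarrow> (\<lambda>\<rho>. emeasure (unif_prod K) {\<sigma> \<in> space (unif_prod K). merge ?J K (\<rho>, \<sigma>) \<in> A}) \<in> borel_measurable (unif_prod ?J)"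
  proof (rule measurable_cong)
    fix \<rho> assume "\<rho> \<in> space (unif_prod ?J)"
    hence "Pair \<rho> -` (merge ?J K -` A \<inter> space (unif_prod ?J \<Otimes>\<^sub>M unif_prod K)) = {\<sigma> \<in> space (unif_prod K). merge ?J K (\<rho>, \<sigma>) \<in> A}"
      unfolding space_pair_measure by blast
    thus "emeasure (unif_prod K) (Pair \<rho> -` (merge ?J K -` A \<inter> space (unif_prod ?J \<Otimes>\<^sub>M unif_prod K))) = emeasure (unif_prod K) {\<sigma> \<in> space (unif_prod K). merge ?J K (\<rho>, \<sigma>) \<in> A}"
      by simp
  qed
  finally show ?thesis .
qed

text \<open>An event of the generated sigma-field is a union of fibres of the generating coordinates; in this
form it can be used inside a slice.\<close>
lemma birth_sigma_determined:
  assumes "A \<in> sets (birth_sigma n S)" "\<omega> \<in> space (birth_space n)" "\<omega>' \<in> space (birth_space n)"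
    "\<And>g. g \<in> S \<Longrightarrow> \<omega> g = \<omega>' g"
  shows "\<omega> \<in> A \<longleftrightarrow> \<omega>' \<in> A"
proof -
  have "A \<in> sigma_sets (space (birth_space n))
     {(\<lambda>\<omega>. \<omega> f) -` B \<inter> space (birth_space n) | f B. f \<in> S \<and> B \<in> sets borel}"
    using assms(1) unfolding birth_sigma_def by (subst (asm) sets_measure_of) auto
  thus ?thesis
  proof induction
    case (Basic a) thus ?case using assms by auto
  qed (use assms in auto)
qed

text \<open>A conditional probability with respect to coordinates outside \<open>K\<close> is an average of slices
over \<open>K\<close>. To avoid regular conditional probabilities, the set where it exceeds \<open>e\<close> is
used as a test set: this set is constant on slices, so Fubini bounds the measure of its part in
\<open>E\<close> by \<open>e\<close> times its own measure.\<close>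
lemma real_cond_exp_le_slices:
  assumes K: "K \<subseteq> pairs {1..n}" and S: "S \<subseteq> pairs {1..n}" "S \<inter> K = {}"
    and E: "E \<in> sets (birth_space n)" and e: "e \<ge> 0"
    and slice: "\<And>\<rho>. \<rho> \<in> space (unif_prod (pairs {1..n} - K)) \<Longrightarrow>
      emeasure (unif_prod K) {\<sigma> \<in> space (unif_prod K). merge (pairs {1..n} - K) K (\<rho>, \<sigma>) \<in> E} \<le> ennreal e"
  shows "AE \<omega> in birth_space n. real_cond_exp (birth_space n) (birth_sigma n S) (indicator E) \<omega> \<le> e"
proof -
  let ?M = "birth_space n" and ?F = "birth_sigma n S" and ?I = "pairs {1..n}"
  interpret M: prob_space ?M by (rule prob_space_birth_space)
  interpret K: prob_space "unif_prod K" by (rule prob_space_unif_prod)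
  have sub: "subalgebra ?M ?F" by (rule subalgebra_birth_sigma[OF S(1)])
  interpret F: finite_measure_subalgebra ?M ?F
    by unfold_locales (rule sub)
  have U: "(?I - K) \<union> K = ?I" using K by auto
  have bound: "measure ?M (A \<inter> E) \<le> e * measure ?M A" if A: "A \<in> sets ?F" for A
  proof -
    have AM: "A \<in> sets ?M" using A sub by (auto simp: subalgebra_def)
    have sl: "emeasure (unif_prod K) {\<sigma> \<in> space (unif_prod K). merge (?I - K) K (\<rho>, \<sigma>) \<in> A \<inter> E}
      \<le> ennreal e * emeasure (unif_prod K) {\<sigma> \<in> space (unif_prod K). merge (?I - K) K (\<rho>, \<sigma>) \<in> A}"
      if \<rho>: "\<rho> \<in> space (unif_prod (?I - K))" for \<rho>
    proof (cases "\<exists>\<sigma>0\<in>space (unif_prod K). merge (?I - K) K (\<rho>, \<sigma>0) \<in> A")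
      case True
      then obtain \<sigma>0 where s0: "\<sigma>0 \<in> space (unif_prod K)" "merge (?I - K) K (\<rho>, \<sigma>0) \<in> A" by auto
      have sp: "merge (?I - K) K (\<rho>, \<sigma>) \<in> space ?M" if "\<sigma> \<in> space (unif_prod K)" for \<sigma>
        using \<rho> that U unfolding birth_space_def by (auto simp: space_PiM PiE_iff merge_def extensional_def)
      have "merge (?I - K) K (\<rho>, \<sigma>) \<in> A" if s: "\<sigma> \<in> space (unif_prod K)" for \<sigma>
      proof -
        have "merge (?I - K) K (\<rho>, \<sigma>0) g = merge (?I - K) K (\<rho>, \<sigma>) g" if "g \<in> S" for g
          using S that by (auto simp: merge_def)
        from birth_sigma_determined[OF A sp[OF s0(1)] sp[OF s] this] s0(2) show ?thesis by blast
      qed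
      hence "{\<sigma> \<in> space (unif_prod K). merge (?I - K) K (\<rho>, \<sigma>) \<in> A} = space (unif_prod K)"
        "{\<sigma> \<in> space (unif_prod K). merge (?I - K) K (\<rho>, \<sigma>) \<in> A \<inter> E} = {\<sigma> \<in> space (unif_prod K). merge (?I - K) K (\<rho>, \<sigma>) \<in> E}"
        by auto
      thus ?thesis using slice[OF \<rho>] by (simp add: K.emeasure_space_1)
    next
      case False
      hence "{\<sigma> \<in> space (unif_prod K). merge (?I - K) K (\<rho>, \<sigma>) \<in> A \<inter> E} = {}" by auto
      thus ?thesis by (simp only: emeasure_empty zero_le)
    qed
    have "emeasure ?M (A \<inter> E) = (\<integral>\<^sup>+\<rho>. emeasure (unif_prod K) {\<sigma> \<in> space (unif_prod K). merge (?I - K) K (\<rho>, \<sigma>) \<in> A \<inter> E}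
       \<partial>unif_prod (?I - K))"
      by (rule emeasure_split) (use K AM E in auto)
    also have "\<dots> \<le> (\<integral>\<^sup>+\<rho>. ennreal e * emeasure (unif_prod K) {\<sigma> \<in> space (unif_prod K). merge (?I - K) K (\<rho>, \<sigma>) \<in> A}
       \<partial>unif_prod (?I - K))"
      by (rule nn_integral_mono) (rule sl)
    also have "\<dots> = ennreal e * emeasure ?M A"
    proof (subst nn_integral_cmult)
      show "(\<lambda>\<rho>. emeasure (unif_prod K) {\<sigma> \<in> space (unif_prod K). merge (?I - K) K (\<rho>, \<sigma>) \<in> A}) \<in> borel_measurable (unif_prod (?I - K))"
        by (rule slice_emeasure_measurable[OF K AM])
    next
      show "ennreal e * (\<integral>\<^sup>+\<rho>. emeasure (unif_prod K) {\<sigma> \<in> space (unif_prod K). merge (?I - K) K (\<rho>, \<sigma>) \<in> A}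
         \<partial>unif_prod (?I - K)) = ennreal e * emeasure ?M A"
        by (subst emeasure_split[OF K AM]) simp
    qed
    finally show ?thesis
      using e by (simp add: M.emeasure_eq_measure ennreal_mult[symmetric])
  qed
  let ?f = "real_cond_exp ?M ?F (indicator E)"
  have int1: "integrable ?M (indicator E :: _ \<Rightarrow> real)"
    by (rule M.integrable_const_bound[where B = 1]) (use E in auto)
  have fm: "?f \<in> borel_measurable ?F" by simp
  have intf: "integrable ?M ?f" by (rule F.real_cond_exp_int(1)[OF int1])
  define B where "B = {\<omega> \<in> space ?F. ?f \<omega> > e}"
  have BF: "B \<in> sets ?F" unfolding B_def using fm by measurable
  have BM: "B \<in> sets ?M" using BF sub by (auto simp: subalgebra_def)
  have spF: "space ?F = space ?M" using sub by (simp add: subalgebra_def)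
  have "(\<integral>\<omega>\<in>B. ?f \<omega> \<partial>?M) = (\<integral>\<omega>\<in>B. indicator E \<omega> \<partial>?M)"
    using F.real_cond_exp_intA[OF int1 BF] by simp
  also have "\<dots> = measure ?M (B \<inter> E)"
  proof -
    have "(\<integral>\<omega>\<in>B. indicator E \<omega> \<partial>?M) = (\<integral>\<omega>. indicator (B \<inter> E) \<omega> \<partial>?M)"
      unfolding set_lebesgue_integral_def
      by (rule Bochner_Integration.integral_cong) (auto simp: indicator_def)
    also have "\<dots> = measure ?M (B \<inter> E)"
      using BM E by (simp add: Int_absorb2 sets.sets_into_space le_infI1)
    finally show ?thesis .
  qed
  also have "\<dots> \<le> e * measure ?M B" by (rule bound[OF BF])
  finally have le: "(\<integral>\<omega>\<in>B. ?f \<omega> \<partial>?M) \<le> e * measure ?M B" .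
  have i1: "integrable ?M (\<lambda>\<omega>. indicator B \<omega> * ?f \<omega>)"
    using integrable_mult_indicator[OF BM intf] by simp
  have i2: "integrable ?M (\<lambda>\<omega>. indicator B \<omega> * e)"
    by (rule M.integrable_const_bound[where B = e]) (use BM e in \<open>auto simp: indicator_def\<close>)
  have int0: "(\<integral>\<omega>. indicator B \<omega> * (?f \<omega> - e) \<partial>?M) \<le> 0"
    using le i1 i2 BM by (simp add: right_diff_distrib set_lebesgue_integral_def mult.commute)
  have nn: "0 \<le> indicator B \<omega> * (?f \<omega> - e)" for \<omega> by (auto simp: indicator_def B_def)
  have i3: "integrable ?M (\<lambda>\<omega>. indicator B \<omega> * (?f \<omega> - e))" using i1 i2 by (simp add: right_diff_distrib)
  have "(\<integral>\<omega>. indicator B \<omega> * (?f \<omega> - e) \<partial>?M) = 0"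
  proof (rule antisym[OF int0])
    show "0 \<le> (\<integral>\<omega>. indicator B \<omega> * (?f \<omega> - e) \<partial>?M)"
      by (rule Bochner_Integration.integral_nonneg) (rule nn)
  qed
  hence "AE \<omega> in ?M. indicator B \<omega> * (?f \<omega> - e) = 0"
    using integral_nonneg_eq_0_iff_AE[OF i3] nn by simp
  thus ?thesis
  proof (rule AE_mp, intro AE_I2 impI)
    fix \<omega> assume "\<omega> \<in> space ?M" "indicator B \<omega> * (?f \<omega> - e) = 0"
    thus "?f \<omega> \<le> e" using spF by (auto simp: B_def indicator_def not_less split: if_splits)
  qed
qed

text \<open>The graph is observed either at the deterministic time \<open>p\<close> or at the birth of a pair
\<open>f\<close>; the option tells the two apart.\<close>
definition stop_time :: "real \<Rightarrow> nat set option \<Rightarrow> (nat set \<Rightarrow> real) \<Rightarrow> real" where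
  "stop_time p t \<omega> = (case t of None \<Rightarrow> p | Some f \<Rightarrow> \<omega> f)"

definition level :: "nat set \<Rightarrow> real \<Rightarrow> (nat set \<Rightarrow> real) \<Rightarrow> nat set set" where
  "level W q \<omega> = {g \<in> pairs W. \<omega> g \<le> q}"

lemma space_birth_sigma [simp]: "space (birth_sigma n S) = space (birth_space n)"
  unfolding birth_sigma_def by (simp add: space_measure_of_conv)

lemma component_measurable_sigma:
  assumes "f \<in> S"
  shows "(\<lambda>\<omega>. \<omega> f) \<in> borel_measurable (birth_sigma n S)"
proof (rule measurableI)
  fix B :: "real set" assume "B \<in> sets borel"
  thus "(\<lambda>\<omega>. \<omega> f) -` B \<inter> space (birth_sigma n S) \<in> sets (birth_sigma n S)"
    unfolding space_birth_sigma using assms unfolding birth_sigma_def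
    by (subst sets_measure_of) (auto intro!: sigma_sets.Basic)
qed auto

text \<open>There are finitely many graphs on \<open>W\<close>, so the event is a finite union over their values.\<close>
lemma snapshot_event_sets:
  assumes W: "W \<subseteq> {1..n}" and t: "\<And>f. t = Some f \<Longrightarrow> f \<in> pairs W"
    and P: "\<And>S. S \<subseteq> pairs W \<Longrightarrow> {q. P q S} \<in> sets borel"
  shows "{\<omega> \<in> space (birth_space n). P (stop_time p t \<omega>) (level W (stop_time p t \<omega>) \<omega>)} \<in> sets (sigma_inside n W)"
proof -
  let ?N = "sigma_inside n W"
  have spN: "space ?N = space (birth_space n)" unfolding sigma_inside_def by simp
  have finW: "finite (pairs W)" using W finite_subset by (intro finite_pairs) blast
  have comp[measurable]: "(\<lambda>\<omega>. \<omega> g) \<in> borel_measurable ?N" if "g \<in> pairs W" for g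
    unfolding sigma_inside_def by (rule component_measurable_sigma[OF that])
  have tm[measurable]: "stop_time p t \<in> borel_measurable ?N"
    unfolding stop_time_def using comp t by (cases t) auto
  have "{\<omega> \<in> space (birth_space n). P (stop_time p t \<omega>) (level W (stop_time p t \<omega>) \<omega>)}
     = (\<Union>S\<in>Pow (pairs W). {\<omega> \<in> space ?N. stop_time p t \<omega> \<in> {q. P q S}}
          \<inter> {\<omega> \<in> space ?N. \<forall>g\<in>pairs W. (\<omega> g \<le> stop_time p t \<omega>) \<longleftrightarrow> g \<in> S})" (is "?L = ?R")
  proof (rule set_eqI)
    fix \<omega>
    have lev: "level W q \<omega> = S \<longleftrightarrow> (\<forall>g\<in>pairs W. (\<omega> g \<le> q) \<longleftrightarrow> g \<in> S)" if "S \<subseteq> pairs W" for q S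
      using that unfolding level_def by auto
    let ?q = "stop_time p t \<omega>"
    have sub: "level W ?q \<omega> \<subseteq> pairs W" unfolding level_def by auto
    have "(\<exists>S\<in>Pow (pairs W). P ?q S \<and> (\<forall>g\<in>pairs W. (\<omega> g \<le> ?q) \<longleftrightarrow> g \<in> S)) \<longleftrightarrow> P ?q (level W ?q \<omega>)"
    proof
      assume "\<exists>S\<in>Pow (pairs W). P ?q S \<and> (\<forall>g\<in>pairs W. (\<omega> g \<le> ?q) \<longleftrightarrow> g \<in> S)"
      then obtain S where "S \<subseteq> pairs W" "P ?q S" "\<forall>g\<in>pairs W. (\<omega> g \<le> ?q) \<longleftrightarrow> g \<in> S" by auto
      thus "P ?q (level W ?q \<omega>)" using lev[of S ?q] by simp
    next
      assume "P ?q (level W ?q \<omega>)"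
      thus "\<exists>S\<in>Pow (pairs W). P ?q S \<and> (\<forall>g\<in>pairs W. (\<omega> g \<le> ?q) \<longleftrightarrow> g \<in> S)"
        using sub lev[of "level W ?q \<omega>" ?q] by (intro bexI[of _ "level W ?q \<omega>"]) auto
    qed
    thus "\<omega> \<in> ?L \<longleftrightarrow> \<omega> \<in> ?R" using spN by auto
  qed
  also have "\<dots> \<in> sets ?N"
  proof (intro sets.finite_UN sets.Int)
    fix S assume S: "S \<in> Pow (pairs W)"
    show "{\<omega> \<in> space ?N. stop_time p t \<omega> \<in> {q. P q S}} \<in> sets ?N"
      using measurable_sets[OF tm P[of S]] S by (simp add: vimage_def Int_def conj_commute)
    have "{\<omega> \<in> space ?N. (\<omega> g \<le> stop_time p t \<omega>) \<longleftrightarrow> g \<in> S} \<in> sets ?N" if g: "g \<in> pairs W" for g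
    proof -
      have "{\<omega> \<in> space ?N. \<omega> g \<le> stop_time p t \<omega>} \<in> sets ?N" "{\<omega> \<in> space ?N. stop_time p t \<omega> < \<omega> g} \<in> sets ?N"
        using borel_measurable_le[OF comp[OF g] tm] borel_measurable_less[OF tm comp[OF g]] by auto
      thus ?thesis by (cases "g \<in> S") (simp_all add: not_le)
    qed
    thus "{\<omega> \<in> space ?N. \<forall>g\<in>pairs W. (\<omega> g \<le> stop_time p t \<omega>) \<longleftrightarrow> g \<in> S} \<in> sets ?N"
      by (intro sets.sets_Collect_finite_All finW)
  qed (use finW in auto)
  finally show ?thesis .
qed

lemma sets_sigma_inside: "W \<subseteq> {1..n} \<Longrightarrow> A \<in> sets (sigma_inside n W) \<Longrightarrow> A \<in> sets (birth_space n)"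
  using subalgebra_birth_sigma[of "pairs W" n] pairs_mono[of W "{1..n}"]
  by (auto simp: sigma_inside_def subalgebra_def)

lemma bexp_image:
  assumes "inj_on \<phi> V"
  shows "bexp q (\<phi> ` V) g = bexp q V (\<lambda>N. g (\<phi> ` N))"
proof -
  have "bij_betw (image \<phi>) (Pow V) (Pow (\<phi> ` V))"
    by (rule bij_betw_Pow) (use assms in \<open>simp add: bij_betw_def\<close>)
  hence "bexp q (\<phi> ` V) g = (\<Sum>N\<in>Pow V. q ^ card (\<phi> ` N) * (1 - q) ^ card (\<phi> ` V - \<phi> ` N) * g (\<phi> ` N))"
    unfolding bexp_def by (rule sum.reindex_bij_betw[symmetric])
  also have "\<dots> = bexp q V (\<lambda>N. g (\<phi> ` N))"
    unfolding bexp_def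
  proof (rule sum.cong[OF refl])
    fix N assume "N \<in> Pow V"
    hence N: "N \<subseteq> V" by simp
    have "\<phi> ` V - \<phi> ` N = \<phi> ` (V - N)" using assms N by (simp add: inj_on_image_set_diff)
    moreover have "card (\<phi> ` N) = card N" "card (\<phi> ` (V - N)) = card (V - N)"
      using assms N by (auto intro!: card_image intro: inj_on_subset)
    ultimately show "q ^ card (\<phi> ` N) * (1 - q) ^ card (\<phi> ` V - \<phi> ` N) * g (\<phi> ` N) =
      q ^ card N * (1 - q) ^ card (V - N) * g (\<phi> ` N)" by simp
  qed
  finally show ?thesis .
qed

lemma star_eq:
  assumes "x \<in> W"
  shows "{g \<in> pairs W. x \<in> g \<and> t \<noteq> Some g} = (\<lambda>v. {x, v}) ` {v \<in> W - {x}. t \<noteq> Some {x, v}}" (is "?L = ?R")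
proof
  show "?L \<subseteq> ?R"
  proof
    fix g assume g: "g \<in> ?L"
    then obtain v where "g = {x, v}" "v \<noteq> x" by (auto simp: pairs_def card_2_iff)
    thus "g \<in> ?R" using g by (auto simp: pairs_def)
  qed
  show "?R \<subseteq> ?L" using assms by (auto simp: pairs_def)
qed

text \<open>Given all birth times off the star of \<open>x\<close>, a snapshot shows a random star with density the time
of the snapshot. If the snapshot is taken at the birth of a pair \<open>f\<close> at \<open>x\<close>, this time
is not determined by the other pairs, and \<open>f\<close> is certainly present. Its birth time is then fixed as
well: a bound that holds for all its values is stronger than the bound on the average.\<close>
lemma snapshot_cond_prob:
  assumes W: "W \<subseteq> {1..n}" and t: "\<And>f. t = Some f \<Longrightarrow> f \<in> pairs W" and p: "0 \<le> p" "p \<le> 1"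
    and P: "\<And>S. S \<subseteq> pairs W \<Longrightarrow> {q. P q S} \<in> sets borel" and x: "x \<in> W" and e: "e \<ge> 0"
    and b: "\<And>q H. 0 \<le> q \<Longrightarrow> q \<le> 1 \<Longrightarrow> H \<subseteq> pairs W \<Longrightarrow> (\<And>g. g \<in> H \<Longrightarrow> x \<in> g \<Longrightarrow> t = Some g) \<Longrightarrow>
      (\<And>g. t = Some g \<Longrightarrow> g \<in> H) \<Longrightarrow>
      bexp q {v \<in> W - {x}. t \<noteq> Some {x, v}} (\<lambda>N. if P q (H \<union> (\<lambda>v. {x, v}) ` N) then 1 else 0) \<le> e"
  shows "AE \<omega> in birth_space n. real_cond_exp (birth_space n) (sigma_avoiding n x)
     (indicator {\<omega> \<in> space (birth_space n). P (stop_time p t \<omega>) (level W (stop_time p t \<omega>) \<omega>)}) \<omega> \<le> e"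
  unfolding sigma_avoiding_def
proof (rule real_cond_exp_le_slices)
  \<comment> \<open>the coordinates that are integrated; the pair that defines the snapshot is not among them\<close>
  define K where "K = {g \<in> pairs W. x \<in> g \<and> t \<noteq> Some g}"
  let ?E = "{\<omega> \<in> space (birth_space n). P (stop_time p t \<omega>) (level W (stop_time p t \<omega>) \<omega>)}"
  have WI: "pairs W \<subseteq> pairs {1..n}" using W by (rule pairs_mono)
  have finW: "finite (pairs W)" using W finite_subset by (intro finite_pairs) blast
  show K: "K \<subseteq> pairs {1..n}" using WI by (auto simp: K_def)
  have finK: "finite K" using finW by (simp add: K_def)
  show "{f \<in> pairs {1..n}. x \<notin> f} \<subseteq> pairs {1..n}" by auto
  show "{f \<in> pairs {1..n}. x \<notin> f} \<inter> K = {}" by (auto simp: K_def)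
  show "?E \<in> sets (birth_space n)"
    by (rule sets_sigma_inside[OF W]) (rule snapshot_event_sets[OF W t P])
  show "e \<ge> 0" by (rule e)
  fix \<rho> assume \<rho>: "\<rho> \<in> space (unif_prod (pairs {1..n} - K))"
  define q where "q = stop_time p t \<rho>"
  have tK: "f \<in> pairs {1..n} - K" if "t = Some f" for f using t[OF that] WI that by (auto simp: K_def)
  have q: "0 \<le> q" "q \<le> 1"
    using p component_range[OF \<rho> tK] by (cases t; auto simp: q_def stop_time_def)+
  define H where "H = {g \<in> pairs W - K. \<rho> g \<le> q}"
  have tm: "stop_time p t (merge (pairs {1..n} - K) K (\<rho>, \<sigma>)) = q" for \<sigma>
    using tK unfolding q_def stop_time_def by (cases t) (auto simp: merge_def)
  have lev: "level W q (merge (pairs {1..n} - K) K (\<rho>, \<sigma>)) = H \<union> {g \<in> K. \<sigma> g \<le> q}" for \<sigma>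
    using WI K unfolding level_def H_def by (auto simp: merge_def K_def)
  define \<B> where "\<B> = {B \<in> Pow K. P q (H \<union> B)}"
  have fin\<B>: "finite \<B>" using finK by (simp add: \<B>_def)
  have comp[measurable]: "(\<lambda>\<sigma>. \<sigma> g) \<in> borel_measurable (unif_prod K)" if "g \<in> K" for g
    by (rule component_measurable_prod[OF that])
  have meas: "{\<sigma> \<in> space (unif_prod K). {g \<in> K. \<sigma> g \<le> q} = B} \<in> sets (unif_prod K)" if "B \<subseteq> K" for B
  proof -
    have "{\<sigma> \<in> space (unif_prod K). {g \<in> K. \<sigma> g \<le> q} = B} = {\<sigma> \<in> space (unif_prod K). \<forall>g\<in>K. \<sigma> g \<le> q \<longleftrightarrow> g \<in> B}"
      using that by auto
    also have "\<dots> \<in> sets (unif_prod K)"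
    proof (intro sets.sets_Collect_finite_All finK)
      fix g assume "g \<in> K"
      from comp[OF this] have "{\<sigma> \<in> space (unif_prod K). \<sigma> g \<le> q} \<in> sets (unif_prod K)" "{\<sigma> \<in> space (unif_prod K). q < \<sigma> g} \<in> sets (unif_prod K)"
        by (simp_all add: borel_measurable_le borel_measurable_less)
      thus "{\<sigma> \<in> space (unif_prod K). (\<sigma> g \<le> q) = (g \<in> B)} \<in> sets (unif_prod K)"
        by (cases "g \<in> B") (simp_all add: not_le)
    qed
    finally show ?thesis .
  qed
  have "emeasure (unif_prod K) {\<sigma> \<in> space (unif_prod K). merge (pairs {1..n} - K) K (\<rho>, \<sigma>) \<in> ?E}
    \<le> emeasure (unif_prod K) (\<Union>B\<in>\<B>. {\<sigma> \<in> space (unif_prod K). {g \<in> K. \<sigma> g \<le> q} = B})"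
  proof (rule emeasure_mono)
    show "{\<sigma> \<in> space (unif_prod K). merge (pairs {1..n} - K) K (\<rho>, \<sigma>) \<in> ?E} \<subseteq>
       (\<Union>B\<in>\<B>. {\<sigma> \<in> space (unif_prod K). {g \<in> K. \<sigma> g \<le> q} = B})"
      using tm lev by (auto simp: \<B>_def)
    show "(\<Union>B\<in>\<B>. {\<sigma> \<in> space (unif_prod K). {g \<in> K. \<sigma> g \<le> q} = B}) \<in> sets (unif_prod K)"
      using fin\<B> meas by (intro sets.finite_UN) (auto simp: \<B>_def)
  qed
  also have "\<dots> \<le> (\<Sum>B\<in>\<B>. emeasure (unif_prod K) {\<sigma> \<in> space (unif_prod K). {g \<in> K. \<sigma> g \<le> q} = B})"
    by (rule emeasure_subadditive_finite) (use fin\<B> meas in \<open>auto simp: \<B>_def\<close>)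
  also have "\<dots> = (\<Sum>B\<in>\<B>. ennreal (q ^ card B * (1 - q) ^ card (K - B)))"
    by (rule sum.cong) (use emeasure_level_set[OF finK _ q] in \<open>auto simp: \<B>_def\<close>)
  also have "\<dots> = ennreal (\<Sum>B\<in>\<B>. q ^ card B * (1 - q) ^ card (K - B))"
    using q by (intro sum_ennreal) auto
  also have "(\<Sum>B\<in>\<B>. q ^ card B * (1 - q) ^ card (K - B)) = bexp q K (\<lambda>B. if P q (H \<union> B) then 1 else 0)"
    unfolding bexp_def \<B>_def using finK by (intro sum.mono_neutral_cong_left) auto
  also have "\<dots> = bexp q {v \<in> W - {x}. t \<noteq> Some {x, v}} (\<lambda>N. if P q (H \<union> (\<lambda>v. {x, v}) ` N) then 1 else 0)"
    unfolding K_def star_eq[OF x] by (rule bexp_image) (auto simp: inj_on_def doubleton_eq_iff)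
  also have "ennreal \<dots> \<le> ennreal e"
  proof (rule ennreal_leI, rule b[OF q])
    show "H \<subseteq> pairs W" by (auto simp: H_def)
    show "t = Some g" if "g \<in> H" "x \<in> g" for g using that by (auto simp: H_def K_def)
    show "g \<in> H" if "t = Some g" for g using that t[OF that] by (auto simp: H_def K_def q_def stop_time_def)
  qed
  finally show "emeasure (unif_prod K) {\<sigma> \<in> space (unif_prod K). merge (pairs {1..n} - K) K (\<rho>, \<sigma>) \<in> ?E} \<le> ennreal e" .
qed

section \<open>The order of birth\<close>

lemma tie_null:
  assumes "f \<in> pairs {1..n}" "g \<in> pairs {1..n}" "f \<noteq> g"
  shows "{\<omega> \<in> space (birth_space n). \<omega> f = \<omega> g} \<in> sets (birth_space n)"
    and "emeasure (birth_space n) {\<omega> \<in> space (birth_space n). \<omega> f = \<omega> g} = 0"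
proof -
  let ?A = "{\<omega> \<in> space (birth_space n). \<omega> f = \<omega> g}"
  note [measurable] = component_measurable[OF assms(1)] component_measurable[OF assms(2)]
  show A: "?A \<in> sets (birth_space n)" by measurable
  have K: "{g} \<subseteq> pairs {1..n}" using assms by simp
  have "emeasure (unif_prod {g}) {\<sigma> \<in> space (unif_prod {g}). merge (pairs {1..n} - {g}) {g} (\<rho>, \<sigma>) \<in> ?A} = 0"
    if \<rho>: "\<rho> \<in> space (unif_prod (pairs {1..n} - {g}))" for \<rho>
  proof -
    let ?c = "\<rho> f"
    have c: "?c \<in> {0..1}" using component_range[OF \<rho>, of f] assms by auto
    have P: "emeasure (unif_prod {g}) (Pi\<^sub>E {g} (\<lambda>_. {?c})) = (\<Prod>i\<in>{g}. emeasure unif {?c})"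
      by (rule unif.emeasure_PiM) (use c in \<open>auto simp: sets_unif_iff\<close>)
    have "emeasure unif {?c} = emeasure lborel {?c}"
      by (subst emeasure_restrict_space) (use c in auto)
    hence P0: "emeasure (unif_prod {g}) (Pi\<^sub>E {g} (\<lambda>_. {?c})) = 0" using P by simp
    have S: "Pi\<^sub>E {g} (\<lambda>_. {?c}) \<in> sets (unif_prod {g})"
      by (rule sets_PiM_I_finite) (use c in \<open>auto simp: sets_unif_iff\<close>)
    have "{\<sigma> \<in> space (unif_prod {g}). merge (pairs {1..n} - {g}) {g} (\<rho>, \<sigma>) \<in> ?A} \<subseteq> Pi\<^sub>E {g} (\<lambda>_. {?c})"
    proof
      fix \<sigma> assume \<sigma>: "\<sigma> \<in> {\<sigma> \<in> space (unif_prod {g}). merge (pairs {1..n} - {g}) {g} (\<rho>, \<sigma>) \<in> ?A}"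
      hence "\<sigma> \<in> extensional {g}" by (simp add: space_PiM PiE_iff)
      moreover have "\<sigma> g = ?c" using \<sigma> assms by (auto simp: merge_def)
      ultimately show "\<sigma> \<in> Pi\<^sub>E {g} (\<lambda>_. {?c})" unfolding PiE_iff by simp
    qed
    from emeasure_mono[OF this S] P0 show ?thesis by simp
  qed
  hence "emeasure (birth_space n) ?A = (\<integral>\<^sup>+\<rho>. 0 \<partial>unif_prod (pairs {1..n} - {g}))"
    unfolding emeasure_split[OF K A] by (intro nn_integral_cong) blast
  thus "emeasure (birth_space n) ?A = 0" by simp
qed

definition order_event :: "nat \<Rightarrow> nat set list \<Rightarrow> (nat set \<Rightarrow> real) set" where
  "order_event n l = {\<omega> \<in> space (birth_space n). sorted_wrt (\<lambda>a b. \<omega> b < \<omega> a) l}"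

lemma sorted_wrt_unique:
  assumes "\<And>a b. R a b \<Longrightarrow> \<not> R b a"
  shows "sorted_wrt R l \<Longrightarrow> sorted_wrt R l' \<Longrightarrow> set l = set l' \<Longrightarrow> distinct l \<Longrightarrow> distinct l' \<Longrightarrow> l = l'"
proof (induction l arbitrary: l')
  case Nil thus ?case by simp
next
  case (Cons a l)
  then obtain b m where l': "l' = b # m" by (cases l') auto
  have "a = b"
  proof (rule ccontr)
    assume "a \<noteq> b"
    hence "a \<in> set m" "b \<in> set l" using Cons.prems(3) l' by auto
    hence "R b a" "R a b" using Cons.prems l' by auto
    thus False using assms by blast
  qed
  moreover have "set l = set m" using Cons.prems l' \<open>a = b\<close> by auto
  hence "l = m" using Cons l' by auto
  ultimately show ?case using l' by simp
qed

lemma order_event_sets: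
  assumes "set l \<subseteq> pairs {1..n}"
  shows "order_event n l \<in> sets (birth_space n)"
proof -
  have "order_event n l = {\<omega> \<in> space (birth_space n). \<forall>j\<in>{..<length l}. \<forall>i\<in>{..<j}. \<omega> (l ! j) < \<omega> (l ! i)}"
    unfolding order_event_def sorted_wrt_iff_nth_less by auto
  also have "\<dots> \<in> sets (birth_space n)"
  proof (intro sets.sets_Collect_finite_All)
    fix i j assume "j \<in> {..<length l}" "i \<in> {..<j}"
    hence "l ! i \<in> pairs {1..n}" "l ! j \<in> pairs {1..n}" using assms by (auto intro!: subsetD[OF assms])
    note [measurable] = component_measurable[OF this(1)] component_measurable[OF this(2)]
    show "{\<omega> \<in> space (birth_space n). \<omega> (l ! j) < \<omega> (l ! i)} \<in> sets (birth_space n)" by measurable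
  qed auto
  finally show ?thesis .
qed

text \<open>A permutation of the coordinates preserves the product measure.\<close>
lemma order_event_same_measure:
  assumes A: "A \<subseteq> pairs {1..n}" "set l = A" "set l' = A" "distinct l" "distinct l'"
  shows "emeasure (birth_space n) (order_event n l) = emeasure (birth_space n) (order_event n l')"
proof -
  let ?I = "pairs {1..n}"
  have len: "length l = length l'" using A distinct_card by metis
  define \<pi> where "\<pi> g = (if g \<in> A then l' ! (inv_into {..<length l} (nth l) g) else g)" for g
  have b1: "bij_betw (nth l) {..<length l} A" using bij_betw_nth[OF A(4) refl] A by blast
  have b2: "bij_betw (nth l') {..<length l} A" using bij_betw_nth[OF A(5)] A len by blast
  have "bij_betw (nth l' \<circ> inv_into {..<length l} (nth l)) A A"
    by (rule bij_betw_trans[OF bij_betw_inv_into[OF b1] b2])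
  hence bA: "bij_betw \<pi> A A" by (rule bij_betw_cong[THEN iffD1, rotated]) (simp add: \<pi>_def)
  have "bij_betw \<pi> (A \<union> (?I - A)) (A \<union> (?I - A))"
    by (rule bij_betw_combine[OF bA]) (auto simp: \<pi>_def bij_betw_def inj_on_def)
  hence bI: "bij_betw \<pi> ?I ?I" using A(1) by (simp add: Un_absorb1)
  have map: "map \<pi> l = l'"
  proof (rule nth_equalityI)
    fix i assume i: "i < length (map \<pi> l)"
    hence "inv_into {..<length l} (nth l) (l ! i) = i"
      using b1 by (intro inv_into_f_f) (auto simp: bij_betw_def)
    thus "map \<pi> l ! i = l' ! i" using i A by (auto simp: \<pi>_def)
  qed (simp add: len)
  let ?T = "\<lambda>\<omega>. \<lambda>g\<in>?I. \<omega> (\<pi> g)"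
  have D: "distr (unif_prod ?I) (unif_prod ?I) ?T = unif_prod ?I"
    using distr_PiM_reindex[of ?I "\<lambda>_. unif" \<pi> ?I] bI prob_space_unif by (auto simp: bij_betw_def)
  have Tm: "?T \<in> measurable (unif_prod ?I) (unif_prod ?I)"
  proof (rule measurable_restrict)
    fix g assume "g \<in> ?I"
    hence "\<pi> g \<in> ?I" using bI by (auto simp: bij_betw_def)
    thus "(\<lambda>\<omega>. \<omega> (\<pi> g)) \<in> measurable (unif_prod ?I) unif" by (rule measurable_component_singleton)
  qed
  have ev: "order_event n l \<in> sets (unif_prod ?I)"
    using order_event_sets[of l n] A by (simp add: birth_space_def)
  have "emeasure (unif_prod ?I) (order_event n l) = emeasure (unif_prod ?I) (?T -` order_event n l \<inter> space (unif_prod ?I))"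
    using emeasure_distr[OF Tm ev] unfolding D .
  also have "?T -` order_event n l \<inter> space (unif_prod ?I) = order_event n l'"
  proof (rule set_eqI)
    fix \<omega> :: "nat set \<Rightarrow> real"
    have "sorted_wrt (\<lambda>a b. ?T \<omega> b < ?T \<omega> a) l \<longleftrightarrow> sorted_wrt (\<lambda>a b. \<omega> (\<pi> b) < \<omega> (\<pi> a)) l"
      using A(1,2) by (auto simp: sorted_wrt_iff_nth_less subset_iff)
    also have "\<dots> \<longleftrightarrow> sorted_wrt (\<lambda>a b. \<omega> b < \<omega> a) l'"
      unfolding map[symmetric] sorted_wrt_map ..
    finally show "\<omega> \<in> ?T -` order_event n l \<inter> space (unif_prod ?I) \<longleftrightarrow> \<omega> \<in> order_event n l'"
      using measurable_space[OF Tm, of \<omega>] by (auto simp: order_event_def birth_space_def)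
  qed
  finally show ?thesis by (simp add: birth_space_def)
qed

text \<open>All orders of birth are equally likely, so a set of orders can be bounded by counting
permutations.\<close>
lemma measure_orders_le:
  assumes A: "A \<subseteq> pairs {1..n}" and L: "L \<subseteq> permutations_of_set A"
  shows "(\<Union>l\<in>L. order_event n l) \<in> sets (birth_space n)"
    and "measure (birth_space n) (\<Union>l\<in>L. order_event n l) \<le> real (card L) / fact (card A)"
proof -
  let ?M = "birth_space n"
  interpret M: prob_space ?M by (rule prob_space_birth_space)
  have finA: "finite A" using A by (rule finite_subset) (simp add: finite_pairs)
  have finP: "finite (permutations_of_set A)" by simp
  have finL: "finite L" by (rule finite_subset[OF L finP])
  have P: "set l = A" "distinct l" if "l \<in> permutations_of_set A" for l
    using that by (auto simp: permutations_of_set_def)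
  have ev: "order_event n l \<in> sets ?M" if "l \<in> permutations_of_set A" for l
    using P[OF that] A by (intro order_event_sets) auto
  show "(\<Union>l\<in>L. order_event n l) \<in> sets ?M"
    using finL ev L by (intro sets.finite_UN) auto
  have dis: "disjoint_family_on (order_event n) (permutations_of_set A)"
    unfolding disjoint_family_on_def
  proof (intro ballI impI)
    fix l l' assume l: "l \<in> permutations_of_set A" "l' \<in> permutations_of_set A" "l \<noteq> l'"
    show "order_event n l \<inter> order_event n l' = {}"
    proof (rule ccontr)
      assume "order_event n l \<inter> order_event n l' \<noteq> {}"
      then obtain \<omega> :: "nat set \<Rightarrow> real" where "sorted_wrt (\<lambda>a b. \<omega> b < \<omega> a) l" "sorted_wrt (\<lambda>a b. \<omega> b < \<omega> a) l'"
        by (auto simp: order_event_def)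
      hence "l = l'" by (rule sorted_wrt_unique[rotated]) (use P l in auto)
      thus False using l by simp
    qed
  qed
  have one: "measure ?M (order_event n l) \<le> 1 / fact (card A)" if l: "l \<in> permutations_of_set A" for l
  proof -
    have "measure ?M (\<Union>l'\<in>permutations_of_set A. order_event n l') = (\<Sum>l'\<in>permutations_of_set A. measure ?M (order_event n l'))"
      by (rule M.finite_measure_finite_Union[OF finP _ dis]) (use ev in auto)
    also have "\<dots> = (\<Sum>l'\<in>permutations_of_set A. measure ?M (order_event n l))"
    proof (rule sum.cong[OF refl])
      fix l' assume "l' \<in> permutations_of_set A"
      thus "measure ?M (order_event n l') = measure ?M (order_event n l)"
        unfolding measure_def using order_event_same_measure[OF A] P l by metis
    qed
    also have "\<dots> = fact (card A) * measure ?M (order_event n l)" using finA by simp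
    finally have "fact (card A) * measure ?M (order_event n l) \<le> 1" using M.prob_le_1 by metis
    thus ?thesis by (simp add: field_simps)
  qed
  have "measure ?M (\<Union>l\<in>L. order_event n l) \<le> (\<Sum>l\<in>L. measure ?M (order_event n l))"
    by (rule M.finite_measure_subadditive_finite) (use finL ev L in auto)
  also have "\<dots> \<le> real (card L) * (1 / fact (card A))"
    by (rule sum_bounded_above) (use one L in auto)
  finally show "measure ?M (\<Union>l\<in>L. order_event n l) \<le> real (card L) / fact (card A)" by simp
qed

section \<open>Snapshots of the graph\<close>

text \<open>Cliques whose removal together with \<open>R\<close> leaves many factors. If \<open>x \<in> R\<close>, neither the cliques
nor the factors involve a pair at \<open>x\<close>, so that the family is independent of the star of
\<open>x\<close>. The additional vertex \<open>v\<close> is avoided because the other end of a deleted edge has to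
stay out of the cliques that replace it.\<close>
definition rich_cliques :: "nat \<Rightarrow> nat \<Rightarrow> nat set set \<Rightarrow> nat set \<Rightarrow> nat set \<Rightarrow> real \<Rightarrow> nat \<Rightarrow> nat set set" where
  "rich_cliques r k S W R \<theta> v = {T \<in> cliques k S (W - R - {v}). \<theta> \<le> real (num_factors r S (W - (R \<union> T)))}"

text \<open>The expected number of \<open>k\<close>-cliques of \<open>G(n,q)\<close> up to the factor \<open>k!\<close>.
Accordingly \<open>clique_scale n k q * q ^ k\<close> is the order of the number of \<open>k\<close>-cliques in the
neighbourhood of one vertex.\<close>
definition clique_scale :: "nat \<Rightarrow> nat \<Rightarrow> real \<Rightarrow> real" where
  "clique_scale n k q = real n ^ k * q ^ (k choose 2)"

text \<open>Rich cliques have density at least \<open>\<epsilon>\<close>, but the neighbourhood of \<open>t\<close> contains less than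
half of its share. Factor counts are natural numbers, so natural thresholds \<open>\<theta>\<close> suffice.\<close>
definition sparse_nbhd :: "nat \<Rightarrow> nat \<Rightarrow> nat set \<Rightarrow> nat set set \<Rightarrow> real \<Rightarrow> real \<Rightarrow> nat \<Rightarrow> nat set \<Rightarrow> nat \<Rightarrow> nat \<Rightarrow> bool" where
  "sparse_nbhd r n W S q \<epsilon> k R t v \<longleftrightarrow> (\<exists>\<theta>::nat.
     \<epsilon> * clique_scale n k q \<le> real (card (rich_cliques r k S W R (real \<theta>) v)) \<and>
     real (card {T \<in> rich_cliques r k S W R (real \<theta>) v. T \<subseteq> nbr S t}) < \<epsilon> / 2 * (clique_scale n k q * q ^ k))"

text \<open>Rich cliques have density below \<open>\<epsilon>\<close>, but the disjoint \<open>K\<close>-tuples of them in the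
neighbourhood of \<open>y\<close> are as numerous as for density \<open>\<eta>\<close>.\<close>
definition crowded_nbhd :: "nat \<Rightarrow> nat \<Rightarrow> nat set \<Rightarrow> nat set set \<Rightarrow> real \<Rightarrow> real \<Rightarrow> real \<Rightarrow> nat \<Rightarrow> nat set \<Rightarrow> nat \<Rightarrow> bool" where
  "crowded_nbhd r n W S q \<epsilon> \<eta> K R y \<longleftrightarrow> (\<exists>\<theta>::nat.
     real (card (rich_cliques r (r - 1) S W R (real \<theta>) y)) < \<epsilon> * clique_scale n (r - 1) q \<and>
     (\<eta> * clique_scale n (r - 1) q * q ^ (r - 1)) ^ K \<le> real (card (disjoint_tuples K {T \<in> rich_cliques r (r - 1) S W R (real \<theta>) y. T \<subseteq> nbr S y})))"

definition pair_count :: "nat \<Rightarrow> nat \<Rightarrow> nat set set \<Rightarrow> nat set \<Rightarrow> nat" where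
  "pair_count k i S V = card {(T, T'). T \<in> cliques k S V \<and> T' \<in> cliques k S V \<and> card (T \<inter> T') = i}"

text \<open>The exponents are the numbers of vertices and of edges of two \<open>k\<close>-cliques that share
\<open>i\<close> vertices, so the right-hand side is \<open>\<kappa>\<close> times the expected order. For
\<open>i = k\<close> the cliques themselves are counted.\<close>
definition pair_bound :: "nat \<Rightarrow> nat \<Rightarrow> real \<Rightarrow> nat set set \<Rightarrow> nat set \<Rightarrow> real \<Rightarrow> bool" where
  "pair_bound r n \<kappa> S V q \<longleftrightarrow> (\<forall>k\<le>r. \<forall>i\<le>k. real (pair_count k i S V)
     \<le> \<kappa> * (real n ^ (2 * k - i) * q ^ (2 * (k choose 2) - (i choose 2))))"

lemma finite_rich_cliques [simp]: "finite W \<Longrightarrow> finite (rich_cliques r k S W R \<theta> v)"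
  unfolding rich_cliques_def by auto

lemma rich_cliques_antimono: "\<theta> \<le> \<theta>' \<Longrightarrow> rich_cliques r k S W R \<theta>' v \<subseteq> rich_cliques r k S W R \<theta> v"
  unfolding rich_cliques_def by auto

lemma rich_cliques_ceiling: "rich_cliques r k S W R (real (nat \<lceil>\<theta>\<rceil>)) v = rich_cliques r k S W R \<theta> v"
  unfolding rich_cliques_def by (auto simp: nat_ceiling_le_eq)

lemma rich_cliques_absorb: "v \<in> R \<Longrightarrow> v' \<in> R \<Longrightarrow> rich_cliques r k S W R \<theta> v = rich_cliques r k S W R \<theta> v'"
proof -
  assume "v \<in> R" "v' \<in> R"
  hence "W - R - {v} = W - R - {v'}" by auto
  thus ?thesis unfolding rich_cliques_def by simp
qed

lemma rich_cliques_in_nbr_ge: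
  assumes "\<not> sparse_nbhd r n W S q \<epsilon> k R t v" "\<epsilon> * clique_scale n k q \<le> real (card (rich_cliques r k S W R \<theta> v))"
  shows "\<epsilon> / 2 * (clique_scale n k q * q ^ k) \<le> real (card {T \<in> rich_cliques r k S W R \<theta> v. T \<subseteq> nbr S t})"
proof (rule ccontr)
  assume "\<not> ?thesis"
  hence "sparse_nbhd r n W S q \<epsilon> k R t v"
    unfolding sparse_nbhd_def not_le using assms(2) rich_cliques_ceiling[of r k S W R \<theta> v]
    by (intro exI[of _ "nat \<lceil>\<theta>\<rceil>"]) simp
  thus False using assms(1) by simp
qed

lemma clique_finite: "finite V \<Longrightarrow> T \<in> cliques k S V \<Longrightarrow> finite T"
  unfolding cliques_def by (simp add: finite_subset[of T V])

lemma pair_count_diag: "pair_count k k S V = card (cliques k S V)" if "finite V"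
proof -
  have "{(T, T'). T \<in> cliques k S V \<and> T' \<in> cliques k S V \<and> card (T \<inter> T') = k} = (\<lambda>T. (T, T)) ` cliques k S V"
  proof -
    have 1: "T = T'" if T: "T \<in> cliques k S V" "T' \<in> cliques k S V" "card (T \<inter> T') = k" for T T'
    proof -
      have f: "finite T" "finite T'" using T clique_finite[OF \<open>finite V\<close>] by blast+
      have c: "card T = k" "card T' = k" using T by (simp_all add: cliques_def)
      have "T \<inter> T' = T" by (rule card_subset_eq[OF f(1) Int_lower1]) (simp only: c T)
      moreover have "T \<inter> T' = T'" by (rule card_subset_eq[OF f(2) Int_lower2]) (simp only: c T)
      ultimately show ?thesis by simp
    qed
    have 2: "card (T \<inter> T) = k" if "T \<in> cliques k S V" for T using that by (simp add: cliques_def)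
    show ?thesis using 1 2 by blast
  qed
  thus ?thesis unfolding pair_count_def by (simp add: card_image inj_on_def)
qed

lemma choose_Suc_2: "Suc k choose 2 = (k choose 2) + k"
  by (simp add: numeral_2_eq_2)

lemma real_choose_2: "real (r choose 2) = real r * (real r - 1) / 2"
  by (cases r) (auto simp: choose_two real_of_nat_div algebra_simps)

lemma clique_scale_Suc: "clique_scale n (Suc k) q = real n * (clique_scale n k q * q ^ k)"
  unfolding clique_scale_def choose_Suc_2 by (simp add: power_add)

text \<open>The quotient of consecutive scales \<open>clique_scale n s q * q ^ s\<close> is \<open>n * q ^ (s + 1)\<close>, which
for \<open>q \<le> 1\<close> decreases in \<open>s\<close>. So the scales first grow and then fall, and the smallest one
is at one of the two ends; for \<open>q > 1\<close> they only grow.\<close>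
lemma link_scale_ge_min:
  assumes q: "0 < q" and s: "1 \<le> s" "s \<le> t" and n: "n > 0"
    and m: "m \<le> real n * q" "m \<le> clique_scale n t q * q ^ t"
  shows "m \<le> clique_scale n s q * q ^ s"
proof -
  define a where "a i = clique_scale n i q * q ^ i" for i
  have a_Suc: "a (Suc i) = a i * (real n * q ^ Suc i)" for i
    unfolding a_def clique_scale_Suc by simp
  have a0: "a i > 0" for i unfolding a_def clique_scale_def using q n by simp
  have a1: "a 1 = real n * q" by (simp add: a_def clique_scale_def numeral_2_eq_2)
  show ?thesis
  proof (cases "real n * q ^ s \<ge> 1")
    case q1: True
    have "a 1 \<le> a s"
    proof (cases "q \<le> 1")
      case True
      have "j \<le> s \<Longrightarrow> 1 \<le> j \<Longrightarrow> a 1 \<le> a j" for j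
      proof (induction j)
        case (Suc j)
        show ?case
        proof (cases "j = 0")
          case False
          have "q ^ s \<le> q ^ Suc j" by (rule power_decreasing) (use Suc.prems True q in auto)
          hence "1 \<le> real n * q ^ Suc j" using q1 by (meson mult_left_mono of_nat_0_le_iff order_trans)
          hence "a j * 1 \<le> a (Suc j)" unfolding a_Suc using a0[of j] by (intro mult_left_mono) auto
          thus ?thesis using Suc False by simp
        qed simp
      qed simp
      thus ?thesis using s by simp
    next
      case False
      have "j \<ge> 1 \<Longrightarrow> a 1 \<le> a j" for j
      proof (induction j)
        case (Suc j)
        show ?case
        proof (cases "j = 0")
          case F: False
          have "1 \<le> real n * q ^ Suc j"
            using False n one_le_power[of q "Suc j"] mult_mono[of 1 "real n" 1 "q ^ Suc j"] by simp
          hence "a j * 1 \<le> a (Suc j)" unfolding a_Suc using a0[of j] by (intro mult_left_mono) auto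
          thus ?thesis using Suc F by simp
        qed simp
      qed simp
      thus ?thesis using s by simp
    qed
    hence "m \<le> a s" using m(1) a1 by linarith
    thus ?thesis unfolding a_def .
  next
    case q1: False
    have q_le: "q \<le> 1"
    proof (rule ccontr)
      assume "\<not> q \<le> 1"
      hence "1 \<le> real n * q ^ s" using n one_le_power[of q s] mult_mono[of 1 "real n" 1 "q ^ s"] by simp
      thus False using q1 by simp
    qed
    have "s \<le> j \<Longrightarrow> a j \<le> a s" for j
    proof (induction j)
      case (Suc j)
      show ?case
      proof (cases "Suc j = s")
        case False
        hence sj: "s \<le> j" using Suc by simp
        have "q ^ Suc j \<le> q ^ s" by (rule power_decreasing) (use sj q q_le in auto)
        hence "real n * q ^ Suc j \<le> real n * q ^ s" by (intro mult_left_mono) auto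
        hence "real n * q ^ Suc j \<le> 1" using q1 by linarith
        hence "a (Suc j) \<le> a j * 1" unfolding a_Suc using a0[of j] by (intro mult_left_mono) auto
        thus ?thesis using Suc sj by simp
      qed simp
    qed (use s in simp)
    from this[OF s(2)] m(2) show ?thesis unfolding a_def by linarith
  qed
qed

lemma card_filter_markov:
  assumes "finite A" "\<And>y. y \<in> A \<Longrightarrow> 0 \<le> f y" "(\<Sum>y\<in>A. f y) \<le> B" "c > 0"
  shows "real (card {y \<in> A. c < f y}) \<le> B / c"
proof -
  have "real (card {y \<in> A. c < f y}) * c = (\<Sum>y | y \<in> A \<and> c < f y. c)" by simp
  also have "\<dots> \<le> (\<Sum>y | y \<in> A \<and> c < f y. f y)" by (rule sum_mono) auto
  also have "\<dots> \<le> (\<Sum>y\<in>A. f y)" by (rule sum_mono2) (use assms in auto)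
  finally show ?thesis using assms by (simp add: field_simps)
qed

lemma sum_over_members:
  fixes g :: "'a set \<Rightarrow> real"
  assumes "finite V" "finite \<C>" "\<And>Z. Z \<in> \<C> \<Longrightarrow> Z \<subseteq> V"
  shows "(\<Sum>y\<in>V. \<Sum>Z | Z \<in> \<C> \<and> y \<in> Z. g Z) = (\<Sum>Z\<in>\<C>. real (card Z) * g Z)"
proof -
  have "(\<Sum>y\<in>V. \<Sum>Z | Z \<in> \<C> \<and> y \<in> Z. g Z) = (\<Sum>y\<in>V. \<Sum>Z\<in>\<C>. if y \<in> Z then g Z else 0)"
    by (rule sum.cong[OF refl]) (use assms in \<open>auto simp: sum.If_cases Int_def\<close>)
  also have "\<dots> = (\<Sum>Z\<in>\<C>. \<Sum>y\<in>V. if y \<in> Z then g Z else 0)" by (rule sum.swap)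
  also have "\<dots> = (\<Sum>Z\<in>\<C>. real (card Z) * g Z)"
  proof (rule sum.cong[OF refl])
    fix Z assume "Z \<in> \<C>"
    hence "V \<inter> Z = Z" using assms by auto
    thus "(\<Sum>y\<in>V. if y \<in> Z then g Z else 0) = real (card Z) * g Z" using assms by (simp add: sum.If_cases)
  qed
  finally show ?thesis .
qed

text \<open>The graph \<open>S\<close> on \<open>W\<close> at time \<open>q\<close>. The parameter \<open>m\<close> is a lower bound for the two
extreme link scales, hence for all of them; it is kept apart from the scale \<open>D\<close> of the
number of \<open>r\<close>-cliques at a vertex, since different uses need different values.\<close>
locale snapshot =
  fixes r n :: nat and W :: "nat set" and S :: "nat set set" and q \<kappa> m :: real
  assumes r3: "r \<ge> 3" and W: "W \<subseteq> {1..n}" "n \<le> 2 * card W" and S: "S \<subseteq> pairs W"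
    and q: "0 < q" "q \<le> 1" and \<kappa>: "\<kappa> \<ge> 1" and pb: "pair_bound r n \<kappa> S W q"
    and D1: "1 \<le> clique_scale n (r - 1) q * q ^ (r - 1)"
    and m: "1 \<le> m" "m \<le> real n * q" "m \<le> clique_scale n (r - 1) q * q ^ (r - 1)"
begin

definition "D = clique_scale n (r - 1) q * q ^ (r - 1)"

lemma D_ge: "1 \<le> D" "m \<le> D" "0 < D" using D1 m by (auto simp: D_def)

lemma finW: "finite W" using W finite_subset[OF W(1)] by simp

lemma n0: "n > 0" using m q by (cases n) auto

lemma cardW: "card W \<le> n" "real n / 2 \<le> real (card W)"
proof -
  show "card W \<le> n" using card_mono[OF _ W(1)] by simp
  show "real n / 2 \<le> real (card W)" using W(2) by linarith
qed

lemma clique_scale_r: "clique_scale n r q = real n * D"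
  using clique_scale_Suc[of n "r - 1" q] r3 by (simp add: D_def)

lemma card_cliques_r: "real (card (cliques r S W)) \<le> \<kappa> * real n * D"
proof -
  have "real (pair_count r r S W) \<le> \<kappa> * (real n ^ (2 * r - r) * q ^ (2 * (r choose 2) - (r choose 2)))"
    using pb unfolding pair_bound_def by blast
  thus ?thesis using clique_scale_r unfolding pair_count_diag[OF finW] by (simp add: clique_scale_def)
qed

text \<open>Sharing \<open>i \<ge> 2\<close> vertices costs the factor \<open>clique_scale n i q \<ge> n * m\<close> compared with all
pairs of cliques.\<close>
lemma pair_count_r:
  assumes "2 \<le> i" "i \<le> r"
  shows "real (pair_count r i S W) \<le> \<kappa> * real n * D\<^sup>2 / m"
proof -
  have c: "i choose 2 \<le> r choose 2" using assms by (simp add: binomial_right_mono)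
  have "real (pair_count r i S W) \<le> \<kappa> * (real n ^ (2 * r - i) * q ^ (2 * (r choose 2) - (i choose 2)))"
    using pb assms unfolding pair_bound_def by blast
  also have "real n ^ (2 * r - i) * q ^ (2 * (r choose 2) - (i choose 2)) = (clique_scale n r q)\<^sup>2 / clique_scale n i q"
    unfolding clique_scale_def using n0 q assms c
    by (simp add: power_diff power_mult_distrib flip: power_mult) (simp add: mult.commute)
  also have "clique_scale n i q = real n * (clique_scale n (i - 1) q * q ^ (i - 1))"
    using clique_scale_Suc[of n "i - 1" q] assms by simp
  also have "\<kappa> * ((clique_scale n r q)\<^sup>2 / (real n * (clique_scale n (i - 1) q * q ^ (i - 1)))) \<le> \<kappa> * ((clique_scale n r q)\<^sup>2 / (real n * m))"
  proof -
    have "m \<le> clique_scale n (i - 1) q * q ^ (i - 1)"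
      by (rule link_scale_ge_min[where t = "r - 1"]) (use q assms n0 m in auto)
    hence "real n * m \<le> real n * (clique_scale n (i - 1) q * q ^ (i - 1))" by (intro mult_left_mono) auto
    moreover have "0 < real n * m" using n0 m by simp
    ultimately have "(clique_scale n r q)\<^sup>2 / (real n * (clique_scale n (i - 1) q * q ^ (i - 1))) \<le> (clique_scale n r q)\<^sup>2 / (real n * m)"
      by (intro frac_le zero_le_power2 order_refl)
    thus ?thesis using \<kappa> by (intro mult_left_mono) simp_all
  qed
  also have "\<dots> = \<kappa> * real n * D\<^sup>2 / m"
    unfolding clique_scale_r using n0 by (simp add: power2_eq_square)
  finally show ?thesis by simp
qed

lemma card_edge_sharing:
  "real (card {(Z, Z'). Z \<in> cliques r S W \<and> Z' \<in> cliques r S W \<and> 2 \<le> card (Z \<inter> Z')}) \<le> real r * (\<kappa> * real n * D\<^sup>2 / m)"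
proof -
  let ?P = "\<lambda>i. {(Z, Z'). Z \<in> cliques r S W \<and> Z' \<in> cliques r S W \<and> card (Z \<inter> Z') = i}"
  have sub: "{(Z, Z'). Z \<in> cliques r S W \<and> Z' \<in> cliques r S W \<and> 2 \<le> card (Z \<inter> Z')} \<subseteq> (\<Union>i\<in>{2..r}. ?P i)"
  proof (clarify)
    fix Z Z' assume Z: "Z \<in> cliques r S W" "Z' \<in> cliques r S W" "2 \<le> card (Z \<inter> Z')"
    have "finite Z" using Z clique_finite[OF finW] by blast
    hence "card (Z \<inter> Z') \<le> r" using Z card_mono[of Z "Z \<inter> Z'"] by (auto simp: cliques_def)
    thus "(Z, Z') \<in> (\<Union>i\<in>{2..r}. ?P i)" using Z by auto
  qed
  have finP: "finite (?P i)" for i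
    by (rule finite_subset[of _ "cliques r S W \<times> cliques r S W"]) (use finW in auto)
  have "card {(Z, Z'). Z \<in> cliques r S W \<and> Z' \<in> cliques r S W \<and> 2 \<le> card (Z \<inter> Z')} \<le> card (\<Union>i\<in>{2..r}. ?P i)"
    by (rule card_mono[OF _ sub]) (use finP in auto)
  also have "\<dots> \<le> (\<Sum>i\<in>{2..r}. pair_count r i S W)"
    unfolding pair_count_def by (rule card_UN_le) auto
  finally have "real (card {(Z, Z'). Z \<in> cliques r S W \<and> Z' \<in> cliques r S W \<and> 2 \<le> card (Z \<inter> Z')})
     \<le> real (\<Sum>i\<in>{2..r}. pair_count r i S W)" by (simp only: of_nat_le_iff)
  also have "\<dots> = (\<Sum>i\<in>{2..r}. real (pair_count r i S W))" by (rule of_nat_sum)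
  also have "\<dots> \<le> (\<Sum>i\<in>{2..r}. \<kappa> * real n * D\<^sup>2 / m)"
    by (rule sum_mono) (use pair_count_r in auto)
  also have "\<dots> = real (r - 1) * (\<kappa> * real n * D\<^sup>2 / m)" by simp
  also have "\<dots> \<le> real r * (\<kappa> * real n * D\<^sup>2 / m)"
    by (rule mult_right_mono) (use \<kappa> m in auto)
  finally show ?thesis .
qed

end

section \<open>Exchanging a vertex of the removed set\<close>

lemma x_ln_x_ge: "0 < x \<Longrightarrow> x * ln x \<ge> -1" for x :: real
proof -
  assume x: "0 < x"
  have "ln (1 / x) \<le> 1 / x - 1" using x by (intro ln_le_minus_one) simp
  hence "1 - 1 / x \<le> ln x" using x by (simp add: ln_div)
  hence "x * (1 - 1 / x) \<le> x * ln x" using x by (intro mult_left_mono) auto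
  moreover have "x * (1 - 1 / x) = x - 1" using x by (simp add: field_simps)
  ultimately show ?thesis using x by linarith
qed

lemma sum_Un_le:
  fixes f :: "'a \<Rightarrow> real"
  assumes "finite A" "finite B" "\<And>x. f x \<ge> 0"
  shows "sum f (A \<union> B) \<le> sum f A + sum f B"
  using assms sum_Un[of A B f] sum_nonneg[of "A \<inter> B" f] by simp

text \<open>Constants for the analysis of the clique that covers a given vertex in a random factor, relative to
the flat law with weights \<open>1 / D\<close>. At most vertices the relative entropy is below
\<open>excess_bound\<close>. Weights above \<open>peak_bound / D\<close> and weights below \<open>link_share / D\<close>
each carry at most a quarter of the mass, and \<open>overlap_bound\<close> controls the intersecting pairs of
cliques at the vertex. The argument \<open>KS\<close> measures how far the logarithm of the number of
factors may lie below its typical value.\<close>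
definition excess_bound :: "nat \<Rightarrow> real \<Rightarrow> real \<Rightarrow> real" where
  "excess_bound r \<kappa> KS = 16 * real r * (1 + KS + \<kappa>)"

definition peak_bound :: "nat \<Rightarrow> real \<Rightarrow> real \<Rightarrow> real" where
  "peak_bound r \<kappa> KS = exp (4 * excess_bound r \<kappa> KS)"

definition link_share :: "nat \<Rightarrow> real \<Rightarrow> real" where
  "link_share r \<kappa> = 1 / (64 * real r * \<kappa>)"

definition overlap_bound :: "nat \<Rightarrow> real \<Rightarrow> real" where
  "overlap_bound r \<kappa> = 16 * (real r)\<^sup>2 * \<kappa>"

context snapshot
begin

abbreviation "K3 \<equiv> excess_bound r \<kappa>"
abbreviation "MM \<equiv> peak_bound r \<kappa>"
abbreviation "\<delta> \<equiv> link_share r \<kappa>"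
abbreviation "K5 \<equiv> overlap_bound r \<kappa>"

text \<open>If the number of factors is within a factor \<open>exp (O(n))\<close> of its typical order, the marginals
\<open>\<pi>\<close> are close to flat: by the entropy bound their total entropy relative to weights
\<open>1 / D\<close> is linear in \<open>n\<close>. Restricting to the positive part costs at most \<open>1 / D\<close>
per clique, since \<open>x * ln x \<ge> - 1\<close>.\<close>
lemma entropy_excess:
  assumes V: "V \<subseteq> W" and s: "num_factors r S V > 0" and lnS: "real (card W) / real r * ln D - KS * real n \<le> ln (real (num_factors r S V))"
  defines "\<pi> \<equiv> \<lambda>Z. real (num_factors r S (V - Z)) / real (num_factors r S V)"
  shows "(\<Sum>Z\<in>cliques r S V. \<pi> Z * max 0 (ln (\<pi> Z * D))) \<le> (1 + KS + \<kappa>) * real n"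
proof -
  let ?C = "cliques r S V"
  have finV: "finite V" using V finW by (rule finite_subset)
  have r0: "r > 0" using r3 by simp
  have lnD: "ln D \<ge> 0" using D_ge by simp
  have \<pi>0: "\<pi> Z \<ge> 0" for Z unfolding \<pi>_def by simp
  have ent: "ln (real (num_factors r S V)) \<le> real (card V) / real r - (\<Sum>Z\<in>?C. \<pi> Z * ln (\<pi> Z))"
    using ln_num_factors_le_entropy[OF finV r0 s] unfolding \<pi>_def .
  have sum\<pi>: "(\<Sum>Z\<in>?C. \<pi> Z) = real (card V) / real r"
  proof -
    have "real r * (\<Sum>Z\<in>?C. real (num_factors r S (V - Z))) = real (card V) * real (num_factors r S V)"
      using sum_num_factors_cliques[OF finV r0, of S] by (metis of_nat_mult of_nat_sum)
    thus ?thesis using s r0 unfolding \<pi>_def sum_divide_distrib[symmetric] by (simp add: field_simps)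
  qed
  have pt: "\<pi> Z * max 0 (ln (\<pi> Z * D)) \<le> \<pi> Z * ln (\<pi> Z) + \<pi> Z * ln D + 1 / D" for Z
  proof (cases "\<pi> Z = 0")
    case True thus ?thesis using D_ge by simp
  next
    case False
    hence p: "\<pi> Z > 0" using \<pi>0[of Z] by simp
    have l: "\<pi> Z * ln (\<pi> Z) + \<pi> Z * ln D = \<pi> Z * ln (\<pi> Z * D)"
      using p D_ge by (simp add: ln_mult algebra_simps)
    show ?thesis
    proof (cases "ln (\<pi> Z * D) \<ge> 0")
      case True thus ?thesis using l D_ge by simp
    next
      case False
      have "-1 \<le> \<pi> Z * D * ln (\<pi> Z * D)" using p D_ge by (intro x_ln_x_ge) simp
      hence "- 1 / D \<le> \<pi> Z * ln (\<pi> Z * D)" using D_ge by (simp add: field_simps)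
      thus ?thesis using False l by simp
    qed
  qed
  have "(\<Sum>Z\<in>?C. \<pi> Z * max 0 (ln (\<pi> Z * D))) \<le> (\<Sum>Z\<in>?C. \<pi> Z * ln (\<pi> Z) + \<pi> Z * ln D + 1 / D)"
    by (rule sum_mono) (rule pt)
  also have "\<dots> = (\<Sum>Z\<in>?C. \<pi> Z * ln (\<pi> Z)) + real (card V) / real r * ln D + real (card ?C) / D"
    by (simp add: sum.distrib sum_distrib_right[symmetric] sum\<pi>)
  also have "\<dots> \<le> (1 + KS + \<kappa>) * real n"
  proof -
    have cV: "card V \<le> card W" using V finW by (rule card_mono[rotated])
    have "real (card V) / real r * ln D \<le> real (card W) / real r * ln D"
      using cV lnD by (intro mult_right_mono divide_right_mono) auto
    moreover have "real (card V) / real r \<le> real n"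
    proof -
      have "real (card V) / real r \<le> real (card V) / 1" using r3 by (intro divide_left_mono) auto
      thus ?thesis using cV cardW(1) by linarith
    qed
    moreover have "real (card ?C) / D \<le> \<kappa> * real n"
    proof -
      have "card ?C \<le> card (cliques r S W)" by (rule card_mono) (use finW cliques_mono[OF order_refl V] in auto)
      hence "real (card ?C) \<le> \<kappa> * real n * D" using card_cliques_r by linarith
      thus ?thesis using D_ge by (simp add: field_simps)
    qed
    ultimately show ?thesis using ent lnS by (simp add: algebra_simps)
  qed
  finally show ?thesis .
qed

lemma consts_pos: "KS \<ge> 0 \<Longrightarrow> K3 KS > 0" "MM KS > 0" "\<delta> > 0" "K5 > 0"
  using r3 \<kappa> by (auto simp: excess_bound_def peak_bound_def link_share_def overlap_bound_def intro!: mult_pos_pos add_pos_nonneg)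

text \<open>Half of the law of the clique covering \<open>y\<close> sits on weights of order \<open>1 / D\<close>, hence on
at least \<open>D / (2 * MM KS)\<close> cliques that leave many factors. After discarding those that meet too many
others, at least half of these remain, and disjoint \<open>K\<close>-tuples are chosen from them
greedily.\<close>
lemma link_structure:
  assumes V: "V \<subseteq> W" and y: "y \<in> V" and s: "num_factors r S V > 0" and KS: "KS \<ge> 0"
  defines "\<pi> \<equiv> \<lambda>Z. real (num_factors r S (V - Z)) / real (num_factors r S V)"
  assumes phi: "(\<Sum>Z | Z \<in> cliques r S V \<and> y \<in> Z. \<pi> Z * max 0 (ln (\<pi> Z * D))) \<le> K3 KS"
    and deg: "real (card {Z \<in> cliques r S V. y \<in> Z}) \<le> 16 * real r * \<kappa> * D"
    and ovl: "real (card {(Z, Z'). Z \<in> cliques r S V \<and> Z' \<in> cliques r S V \<and> 2 \<le> card (Z \<inter> Z') \<and> y \<in> Z \<inter> Z'}) \<le> K5 * D\<^sup>2 / m"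
    and K: "real K * (32 * (MM KS)\<^sup>2 * K5) \<le> m"
  shows "(D / (8 * MM KS)) ^ K \<le> real (card (disjoint_tuples K {T \<in> cliques (r - 1) S (V - {y}). T \<subseteq> nbr S y \<and>
            \<delta> * real (num_factors r S V) / D \<le> real (num_factors r S (V - insert y T))}))"
proof -
  let ?L = "{T \<in> cliques (r - 1) S (V - {y}). T \<subseteq> nbr S y}"
  let ?M = "MM KS"
  define p where "p T = \<pi> (insert y T)" for T
  have finV: "finite V" using V finW by (rule finite_subset)
  have r1: "r = Suc (r - 1)" using r3 by simp
  have finL: "finite ?L" using finV by simp
  have s0: "real (num_factors r S V) > 0" using s by simp
  have p0: "p T \<ge> 0" for T by (simp add: p_def \<pi>_def)
  note bij = cliques_root_reindex[OF finV y, of "r - 1" S, folded r1]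
  have sum1: "(\<Sum>T\<in>?L. p T) = 1"
  proof -
    have "num_factors r S V = (\<Sum>T\<in>?L. num_factors r S (V - insert y T))"
      using num_factors_root_link[OF finV y, of "r - 1" S] r1 by simp
    hence "real (num_factors r S V) = (\<Sum>T\<in>?L. real (num_factors r S (V - insert y T)))" by (metis of_nat_sum)
    thus ?thesis using s0 unfolding p_def \<pi>_def sum_divide_distrib[symmetric] by simp
  qed
  have phi': "(\<Sum>T\<in>?L. p T * max 0 (ln (p T * D))) \<le> K3 KS"
    using phi sum.reindex_bij_betw[OF bij, of "\<lambda>Z. \<pi> Z * max 0 (ln (\<pi> Z * D))"] by (simp add: p_def)
  have deg': "real (card ?L) \<le> 16 * real r * \<kappa> * D"
    using deg bij_betw_same_card[OF bij] by simp
  define ov where "ov T = card {T' \<in> ?L. T' \<inter> T \<noteq> {}}" for T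
  have ov_sum: "(\<Sum>T\<in>?L. real (ov T)) \<le> K5 * D\<^sup>2 / m"
  proof -
    let ?P = "{(Z, Z'). Z \<in> cliques r S V \<and> Z' \<in> cliques r S V \<and> 2 \<le> card (Z \<inter> Z') \<and> y \<in> Z \<inter> Z'}"
    let ?S = "SIGMA T:?L. {T' \<in> ?L. T' \<inter> T \<noteq> {}}"
    have "(\<Sum>T\<in>?L. ov T) = card ?S"
      unfolding ov_def using finV by (subst card_SigmaI) auto
    also have "\<dots> \<le> card ?P"
    proof (rule card_inj_on_le[where f = "\<lambda>(T, T'). (insert y T, insert y T')"])
      have ny: "y \<notin> T" if "T \<in> ?L" for T using that by (auto simp: cliques_def)
      show "inj_on (\<lambda>(T, T'). (insert y T, insert y T')) ?S"
      proof (rule inj_onI, clarify)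
        fix A B A' B' assume "A \<in> cliques (r - 1) S (V - {y})" "B \<in> cliques (r - 1) S (V - {y})"
          "A' \<in> cliques (r - 1) S (V - {y})" "B' \<in> cliques (r - 1) S (V - {y})"
          and e: "insert y A = insert y A'" "insert y B = insert y B'"
        hence "y \<notin> A" "y \<notin> B" "y \<notin> A'" "y \<notin> B'" by (auto simp: cliques_def)
        thus "A = A' \<and> B = B'" using e by (simp add: insert_ident)
      qed
      show "(\<lambda>(T, T'). (insert y T, insert y T')) ` ?S \<subseteq> ?P"
      proof (rule image_subsetI)
        fix z assume z: "z \<in> ?S"
        obtain A B where zAB: "z = (A, B)" by (cases z)
        from z zAB obtain u where A: "A \<in> cliques (r - 1) S (V - {y})" "A \<subseteq> nbr S y"
          and B: "B \<in> cliques (r - 1) S (V - {y})" "B \<subseteq> nbr S y" and u: "u \<in> B" "u \<in> A" by auto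
        have AB: "insert y A \<in> cliques r S V" "insert y B \<in> cliques r S V"
          using bij A B unfolding bij_betw_def by blast+
        have "{y, u} \<subseteq> insert y A \<inter> insert y B" "u \<noteq> y" using u A by (auto simp: cliques_def)
        moreover have "finite (insert y A \<inter> insert y B)" using AB clique_finite[OF finV] by blast
        ultimately have "card {y, u} \<le> card (insert y A \<inter> insert y B)" by (intro card_mono)
        hence "2 \<le> card (insert y A \<inter> insert y B)" using \<open>u \<noteq> y\<close> by simp
        thus "(\<lambda>(T, T'). (insert y T, insert y T')) z \<in> ?P" using AB zAB by simp
      qed
      show "finite ?P"
        by (rule finite_subset[of _ "cliques r S V \<times> cliques r S V"]) (use finV in auto)
    qed
    finally have "real (\<Sum>T\<in>?L. ov T) \<le> real (card ?P)" by (simp only: of_nat_le_iff)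
    thus ?thesis using ovl by simp
  qed
  define Q where "Q = {T \<in> ?L. \<delta> \<le> p T * D \<and> p T * D \<le> ?M}"
  have M1: "ln ?M = 4 * K3 KS" by (simp add: peak_bound_def)
  have heavy: "(\<Sum>T | T \<in> ?L \<and> ?M < p T * D. p T) \<le> 1 / 4"
  proof -
    have "(\<Sum>T | T \<in> ?L \<and> ?M < p T * D. p T) * (4 * K3 KS) = (\<Sum>T | T \<in> ?L \<and> ?M < p T * D. p T * (4 * K3 KS))"
      by (rule sum_distrib_right)
    also have "\<dots> \<le> (\<Sum>T | T \<in> ?L \<and> ?M < p T * D. p T * max 0 (ln (p T * D)))"
    proof (rule sum_mono)
      fix T assume "T \<in> {T. T \<in> ?L \<and> ?M < p T * D}"
      hence "ln ?M \<le> ln (p T * D)" using consts_pos(2)[of KS] by (intro ln_mono) auto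
      thus "p T * (4 * K3 KS) \<le> p T * max 0 (ln (p T * D))" using p0[of T] M1 by (intro mult_left_mono) auto
    qed
    also have "\<dots> \<le> (\<Sum>T\<in>?L. p T * max 0 (ln (p T * D)))"
      by (rule sum_mono2) (use finL p0 in auto)
    also have "\<dots> \<le> K3 KS" by (rule phi')
    finally show ?thesis using consts_pos(1)[OF KS] by (simp add: field_simps)
  qed
  have light: "(\<Sum>T | T \<in> ?L \<and> p T * D < \<delta>. p T) \<le> 1 / 4"
  proof -
    have "(\<Sum>T | T \<in> ?L \<and> p T * D < \<delta>. p T) \<le> (\<Sum>T | T \<in> ?L \<and> p T * D < \<delta>. \<delta> / D)"
      by (rule sum_mono) (use D_ge in \<open>auto simp: field_simps\<close>)
    also have "\<dots> \<le> real (card ?L) * (\<delta> / D)"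
    proof -
      have "card {T. T \<in> ?L \<and> p T * D < \<delta>} \<le> card ?L" using finL by (intro card_mono) auto
      hence "real (card {T. T \<in> ?L \<and> p T * D < \<delta>}) * (\<delta> / D) \<le> real (card ?L) * (\<delta> / D)"
        using consts_pos(3) D_ge by (intro mult_right_mono of_nat_mono) auto
      thus ?thesis by simp
    qed
    also have "\<dots> \<le> 16 * real r * \<kappa> * D * (\<delta> / D)"
      using deg' consts_pos D_ge by (intro mult_right_mono) auto
    also have "\<dots> = 1 / 4" using D_ge r3 \<kappa> by (simp add: link_share_def field_simps)
    finally show ?thesis .
  qed
  have finQ: "finite Q" unfolding Q_def using finV by simp
  have massQ: "(\<Sum>T\<in>Q. p T) \<ge> 1 / 2"
  proof -
    have "?L = Q \<union> ({T \<in> ?L. ?M < p T * D} \<union> {T \<in> ?L. p T * D < \<delta>})" unfolding Q_def by auto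
    hence "(\<Sum>T\<in>?L. p T) = (\<Sum>T\<in>Q \<union> ({T \<in> ?L. ?M < p T * D} \<union> {T \<in> ?L. p T * D < \<delta>}). p T)"
      by (rule arg_cong)
    also have "\<dots> \<le> (\<Sum>T\<in>Q. p T) + (\<Sum>T\<in>{T \<in> ?L. ?M < p T * D} \<union> {T \<in> ?L. p T * D < \<delta>}. p T)"
      by (rule sum_Un_le) (use finQ finV p0 in auto)
    also have "(\<Sum>T\<in>{T \<in> ?L. ?M < p T * D} \<union> {T \<in> ?L. p T * D < \<delta>}. p T) \<le>
       (\<Sum>T\<in>{T \<in> ?L. ?M < p T * D}. p T) + (\<Sum>T\<in>{T \<in> ?L. p T * D < \<delta>}. p T)"
      by (rule sum_Un_le) (use finV p0 in auto)
    finally show ?thesis using sum1 heavy light by simp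
  qed
  have cardQ: "D / (2 * ?M) \<le> real (card Q)"
  proof -
    have "1 / 2 \<le> (\<Sum>T\<in>Q. ?M / D)"
      using massQ by (rule order_trans) (rule sum_mono, use D_ge in \<open>auto simp: Q_def field_simps\<close>)
    hence "1 / 2 \<le> real (card Q) * (?M / D)" by simp
    thus ?thesis using D_ge consts_pos(2)[of KS] by (simp add: field_simps)
  qed
  \<comment> \<open>by Markov, at most half of \<open>Q\<close> has more than \<open>b\<close> intersecting partners\<close>
  define b where "b = 4 * ?M * K5 * D / m"
  have b0: "b > 0" using consts_pos D_ge m by (simp add: b_def)
  define Q' where "Q' = {T \<in> Q. real (ov T) \<le> b}"
  have cardQ': "D / (4 * ?M) \<le> real (card Q')"
  proof -
    have "real (card {T \<in> Q. b < real (ov T)}) \<le> (K5 * D\<^sup>2 / m) / b"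
    proof (rule card_filter_markov[OF finQ])
      have "(\<Sum>T\<in>Q. real (ov T)) \<le> (\<Sum>T\<in>?L. real (ov T))" by (rule sum_mono2) (use finL in \<open>auto simp: Q_def\<close>)
      thus "(\<Sum>T\<in>Q. real (ov T)) \<le> K5 * D\<^sup>2 / m" using ov_sum by simp
    qed (use b0 in auto)
    also have "\<dots> = D / (4 * ?M)" using consts_pos(2)[of KS] consts_pos(4) D_ge m
      by (simp add: b_def field_simps power2_eq_square)
    finally have 1: "real (card {T \<in> Q. b < real (ov T)}) \<le> D / (4 * ?M)" .
    have "Q = Q' \<union> {T \<in> Q. b < real (ov T)}" by (auto simp: Q'_def)
    hence "card Q \<le> card Q' + card {T \<in> Q. b < real (ov T)}" by (metis card_Un_le)
    hence "real (card Q) \<le> real (card Q') + real (card {T \<in> Q. b < real (ov T)})" by linarith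
    moreover have "D / (2 * ?M) = D / (4 * ?M) + D / (4 * ?M)" by (simp add: field_simps)
    ultimately show ?thesis using 1 cardQ by linarith
  qed
  have Kb: "real K * b \<le> D / (8 * ?M)"
  proof -
    have "real K * b = (real K * (32 * ?M\<^sup>2 * K5)) * (D / (8 * ?M * m))"
      using consts_pos(2)[of KS] m by (simp add: b_def field_simps power2_eq_square)
    also have "\<dots> \<le> m * (D / (8 * ?M * m))" using K D_ge consts_pos(2)[of KS] m by (intro mult_right_mono) auto
    also have "\<dots> = D / (8 * ?M)" using m by simp
    finally show ?thesis .
  qed
  have split: "D / (4 * ?M) = D / (8 * ?M) + D / (8 * ?M)" by (simp add: field_simps)
  have D8: "0 \<le> D / (8 * ?M)" using D_ge consts_pos(2)[of KS] by simp
  have finQ': "finite Q'" using finQ by (simp add: Q'_def)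
  have "(D / (8 * ?M)) ^ K \<le> (real (card Q') - real K * b) ^ K"
    using cardQ' Kb split D8 by (intro power_mono) linarith+
  also have "\<dots> \<le> real (card (disjoint_tuples K Q'))"
  proof (rule card_disjoint_tuples_ge[OF finQ'])
    show "real K * b \<le> real (card Q')" using cardQ' Kb split D8 by linarith
    fix T assume "T \<in> Q'"
    hence "real (ov T) \<le> b" by (simp add: Q'_def)
    moreover have "card {T' \<in> Q'. T' \<inter> T \<noteq> {}} \<le> ov T"
      unfolding ov_def by (rule card_mono) (use finV in \<open>auto simp: Q'_def Q_def\<close>)
    ultimately show "real (card {T' \<in> Q'. T' \<inter> T \<noteq> {}}) \<le> b" by linarith
  qed (use b0 in simp)
  also have "\<dots> \<le> real (card (disjoint_tuples K {T \<in> cliques (r - 1) S (V - {y}). T \<subseteq> nbr S y \<and>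
            \<delta> * real (num_factors r S V) / D \<le> real (num_factors r S (V - insert y T))}))"
  proof (intro of_nat_mono card_mono)
    have "T \<in> {T \<in> cliques (r - 1) S (V - {y}). T \<subseteq> nbr S y \<and> \<delta> * real (num_factors r S V) / D \<le> real (num_factors r S (V - insert y T))}"
      if T: "T \<in> Q'" for T
    proof -
      have "\<delta> \<le> p T * D" using T by (auto simp: Q'_def Q_def)
      hence "\<delta> * real (num_factors r S V) / D \<le> real (num_factors r S (V - insert y T))"
        using s0 D_ge by (simp add: p_def \<pi>_def field_simps)
      thus ?thesis using T by (auto simp: Q'_def Q_def)
    qed
    thus "disjoint_tuples K Q' \<subseteq> disjoint_tuples K {T \<in> cliques (r - 1) S (V - {y}). T \<subseteq> nbr S y \<and> \<delta> * real (num_factors r S V) / D \<le> real (num_factors r S (V - insert y T))}"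
      unfolding disjoint_tuples_def by blast
  qed (use finV in simp)
  finally show ?thesis .
qed

text \<open>The sum over all vertices of each of the three quantities is at most \<open>n / 16\<close> times the bound that is
required of a typical vertex.\<close>
lemma typical_vertices:
  assumes V: "V \<subseteq> W" and s: "num_factors r S V > 0" and lnS: "real (card W) / real r * ln D - KS * real n \<le> ln (real (num_factors r S V))"
    and KS: "KS \<ge> 0"
  defines "\<pi> \<equiv> \<lambda>Z. real (num_factors r S (V - Z)) / real (num_factors r S V)"
  defines "good \<equiv> \<lambda>y. (\<Sum>Z | Z \<in> cliques r S V \<and> y \<in> Z. \<pi> Z * max 0 (ln (\<pi> Z * D))) \<le> K3 KS \<and>
      real (card {Z \<in> cliques r S V. y \<in> Z}) \<le> 16 * real r * \<kappa> * D \<and>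
      real (card {(Z, Z'). Z \<in> cliques r S V \<and> Z' \<in> cliques r S V \<and> 2 \<le> card (Z \<inter> Z') \<and> y \<in> Z \<inter> Z'}) \<le> K5 * D\<^sup>2 / m"
  shows "real (card {y \<in> V. \<not> good y}) \<le> 3 * real n / 16"
proof -
  let ?C = "cliques r S V"
  have finV: "finite V" using V finW by (rule finite_subset)
  have finC: "finite ?C" using finV by simp
  have subC: "Z \<subseteq> V" "card Z = r" if "Z \<in> ?C" for Z using that by (auto simp: cliques_def)
  define f1 where "f1 y = (\<Sum>Z | Z \<in> ?C \<and> y \<in> Z. \<pi> Z * max 0 (ln (\<pi> Z * D)))" for y
  define f2 where "f2 y = real (card {Z \<in> ?C. y \<in> Z})" for y
  define P where "P = {(Z, Z'). Z \<in> ?C \<and> Z' \<in> ?C \<and> 2 \<le> card (Z \<inter> Z')}"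
  define f3 where "f3 y = real (card {(Z, Z'). Z \<in> ?C \<and> Z' \<in> ?C \<and> 2 \<le> card (Z \<inter> Z') \<and> y \<in> Z \<inter> Z'})" for y
  have \<pi>0: "\<pi> Z \<ge> 0" for Z by (simp add: \<pi>_def)
  have CW: "?C \<subseteq> cliques r S W" by (rule cliques_mono[OF order_refl V])
  have s1: "(\<Sum>y\<in>V. f1 y) \<le> real r * ((1 + KS + \<kappa>) * real n)"
  proof -
    have "(\<Sum>y\<in>V. f1 y) = (\<Sum>Z\<in>?C. real (card Z) * (\<pi> Z * max 0 (ln (\<pi> Z * D))))"
      unfolding f1_def by (rule sum_over_members) (use finV finC subC in auto)
    also have "\<dots> = real r * (\<Sum>Z\<in>?C. \<pi> Z * max 0 (ln (\<pi> Z * D)))"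
      unfolding sum_distrib_left by (rule sum.cong) (use subC in auto)
    also have "\<dots> \<le> real r * ((1 + KS + \<kappa>) * real n)"
      using entropy_excess[OF V s lnS] unfolding \<pi>_def by (intro mult_left_mono) auto
    finally show ?thesis .
  qed
  have s2: "(\<Sum>y\<in>V. f2 y) \<le> real r * (\<kappa> * real n * D)"
  proof -
    have "(\<Sum>y\<in>V. f2 y) = (\<Sum>y\<in>V. \<Sum>Z | Z \<in> ?C \<and> y \<in> Z. 1)" by (simp add: f2_def)
    also have "\<dots> = (\<Sum>Z\<in>?C. real (card Z) * 1)"
      by (rule sum_over_members) (use finV finC subC in auto)
    also have "\<dots> = real r * real (card ?C)" using subC by simp
    also have "\<dots> \<le> real r * (\<kappa> * real n * D)"
    proof (rule mult_left_mono)
      have "card ?C \<le> card (cliques r S W)" using CW finW by (intro card_mono) auto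
      thus "real (card ?C) \<le> \<kappa> * real n * D" using card_cliques_r by linarith
    qed simp
    finally show ?thesis .
  qed
  have s3: "(\<Sum>y\<in>V. f3 y) \<le> real r * (real r * (\<kappa> * real n * D\<^sup>2 / m))"
  proof -
    have finP: "finite P"
      unfolding P_def by (rule finite_subset[of _ "?C \<times> ?C"]) (use finC in auto)
    have "f3 y = (\<Sum>z\<in>P. if y \<in> fst z \<inter> snd z then 1 else 0)" for y
    proof -
      have "{(Z, Z'). Z \<in> ?C \<and> Z' \<in> ?C \<and> 2 \<le> card (Z \<inter> Z') \<and> y \<in> Z \<inter> Z'} = {z \<in> P. y \<in> fst z \<inter> snd z}"
        unfolding P_def by auto
      thus ?thesis unfolding f3_def using finP by (simp add: sum.If_cases Int_def)
    qed
    hence "(\<Sum>y\<in>V. f3 y) = (\<Sum>y\<in>V. \<Sum>z\<in>P. if y \<in> fst z \<inter> snd z then 1 else 0)" by simp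
    also have "\<dots> = (\<Sum>z\<in>P. \<Sum>y\<in>V. if y \<in> fst z \<inter> snd z then 1 else 0)" by (rule sum.swap)
    also have "\<dots> \<le> (\<Sum>z\<in>P. real r)"
    proof (rule sum_mono)
      fix z assume "z \<in> P"
      hence z: "fst z \<in> ?C" by (auto simp: P_def)
      have "(\<Sum>y\<in>V. if y \<in> fst z \<inter> snd z then 1 else 0 :: real) = real (card (V \<inter> {y. y \<in> fst z \<inter> snd z}))"
        using finV by (simp add: sum.If_cases)
      also have "\<dots> \<le> real (card (fst z))"
        using clique_finite[OF finV z] by (intro of_nat_mono card_mono) auto
      finally show "(\<Sum>y\<in>V. if y \<in> fst z \<inter> snd z then 1 else 0) \<le> real r" using subC(2)[OF z] by simp
    qed
    also have "\<dots> = real r * real (card P)" by simp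
    also have "\<dots> \<le> real r * (real r * (\<kappa> * real n * D\<^sup>2 / m))"
    proof (rule mult_left_mono)
      have "card P \<le> card {(Z, Z'). Z \<in> cliques r S W \<and> Z' \<in> cliques r S W \<and> 2 \<le> card (Z \<inter> Z')}"
      proof (rule card_mono)
        show "finite {(Z, Z'). Z \<in> cliques r S W \<and> Z' \<in> cliques r S W \<and> 2 \<le> card (Z \<inter> Z')}"
          by (rule finite_subset[of _ "cliques r S W \<times> cliques r S W"]) (use finW in auto)
      qed (use CW in \<open>auto simp: P_def\<close>)
      thus "real (card P) \<le> real r * (\<kappa> * real n * D\<^sup>2 / m)" using card_edge_sharing by linarith
    qed simp
    finally show ?thesis .
  qed
  have m1: "real (card {y \<in> V. K3 KS < f1 y}) \<le> real n / 16"
  proof -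
    have "real (card {y \<in> V. K3 KS < f1 y}) \<le> (real r * ((1 + KS + \<kappa>) * real n)) / K3 KS"
      by (rule card_filter_markov[OF finV _ s1]) (use consts_pos(1)[OF KS] \<pi>0 in \<open>auto simp: f1_def intro!: sum_nonneg mult_nonneg_nonneg\<close>)
    also have "\<dots> = real n / 16"
    proof -
      have "real r * ((1 + KS + \<kappa>) * real n) = K3 KS * (real n / 16)" by (simp add: excess_bound_def)
      hence "real r * ((1 + KS + \<kappa>) * real n) / K3 KS = K3 KS * (real n / 16) / K3 KS" by (rule arg_cong)
      thus ?thesis using consts_pos(1)[OF KS] by (metis nonzero_mult_div_cancel_left less_irrefl)
    qed
    finally show ?thesis .
  qed
  have m2: "real (card {y \<in> V. 16 * real r * \<kappa> * D < f2 y}) \<le> real n / 16"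
  proof -
    have "real (card {y \<in> V. 16 * real r * \<kappa> * D < f2 y}) \<le> (real r * (\<kappa> * real n * D)) / (16 * real r * \<kappa> * D)"
      by (rule card_filter_markov[OF finV _ s2]) (use r3 \<kappa> D_ge in \<open>auto simp: f2_def\<close>)
    also have "\<dots> = real n / 16" using r3 \<kappa> D_ge by (simp add: field_simps)
    finally show ?thesis .
  qed
  have m3: "real (card {y \<in> V. K5 * D\<^sup>2 / m < f3 y}) \<le> real n / 16"
  proof -
    have "real (card {y \<in> V. K5 * D\<^sup>2 / m < f3 y}) \<le> (real r * (real r * (\<kappa> * real n * D\<^sup>2 / m))) / (K5 * D\<^sup>2 / m)"
      by (rule card_filter_markov[OF finV _ s3]) (use consts_pos(4) D_ge m in \<open>auto simp: f3_def\<close>)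
    also have "\<dots> = real n / 16" using r3 \<kappa> D_ge m by (simp add: overlap_bound_def field_simps power2_eq_square)
    finally show ?thesis .
  qed
  have "{y \<in> V. \<not> good y} \<subseteq> {y \<in> V. K3 KS < f1 y} \<union> ({y \<in> V. 16 * real r * \<kappa> * D < f2 y} \<union> {y \<in> V. K5 * D\<^sup>2 / m < f3 y})"
    unfolding good_def f1_def f2_def f3_def by (auto simp: not_le)
  hence "card {y \<in> V. \<not> good y} \<le> card ({y \<in> V. K3 KS < f1 y} \<union> ({y \<in> V. 16 * real r * \<kappa> * D < f2 y} \<union> {y \<in> V. K5 * D\<^sup>2 / m < f3 y}))"
    by (rule card_mono[rotated]) (use finV in auto)
  also have "\<dots> \<le> card {y \<in> V. K3 KS < f1 y} + (card {y \<in> V. 16 * real r * \<kappa> * D < f2 y} + card {y \<in> V. K5 * D\<^sup>2 / m < f3 y})"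
    using card_Un_le[of "{y \<in> V. K3 KS < f1 y}"] card_Un_le[of "{y \<in> V. 16 * real r * \<kappa> * D < f2 y}"]
    by (meson add_left_mono order_trans)
  finally have "real (card {y \<in> V. \<not> good y}) \<le> real (card {y \<in> V. K3 KS < f1 y}) + (real (card {y \<in> V. 16 * real r * \<kappa> * D < f2 y}) + real (card {y \<in> V. K5 * D\<^sup>2 / m < f3 y}))"
    by linarith
  thus ?thesis using m1 m2 m3 by linarith
qed

text \<open>In a removed set of \<open>r\<close> vertices, \<open>x\<close> can be exchanged for most vertices \<open>y\<close> at the
price of a constant factor. The covering cliques of a typical \<open>y\<close> supply many disjoint
\<open>K\<close>-tuples of rich cliques in its neighbourhood; as this neighbourhood is not crowded, rich cliques
have positive density; as the neighbourhood of \<open>x\<close> is not sparse, it contains of the order of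
\<open>D\<close> rich cliques. Each of them covers \<open>x\<close>, now returned to the graph, and leaves the factor
count \<open>\<theta>\<close>. The family is independent of the stars of both vertices because both belong to its
root set.\<close>
lemma swap:
  assumes S0: "S0 \<subseteq> W" "card S0 = r - 1" "x \<in> W" "x \<notin> S0"
    and s: "num_factors r S (W - insert x S0) > 0"
    and lnS: "real (card W) / real r * ln D - KS * real n \<le> ln (real (num_factors r S (W - insert x S0)))"
    and KS: "KS \<ge> 0" and \<epsilon>: "\<epsilon> > 0"
    and K: "real K * (32 * (MM KS)\<^sup>2 * K5) \<le> m"
    and F0: "finite F0" "card F0 \<le> 3" and n_large: "16 * (real r + 3) \<le> real n"
    and up: "\<And>y. y \<in> W \<Longrightarrow> y \<notin> insert x S0 \<Longrightarrow> y \<notin> F0 \<Longrightarrow>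
       \<not> crowded_nbhd r n W S q \<epsilon> (1 / (8 * MM KS)) K (insert y (insert x S0)) y"
    and low: "\<And>y. y \<in> W \<Longrightarrow> y \<notin> insert x S0 \<Longrightarrow> \<not> sparse_nbhd r n W S q \<epsilon> (r - 1) (insert y (insert x S0)) x x"
  shows "real n / 4 \<le> real (card {y \<in> W - insert x S0 - F0.
      \<epsilon> * \<delta> / 2 * real (num_factors r S (W - insert x S0)) \<le> real (num_factors r S (W - insert y S0))})"
proof -
  let ?V = "W - insert x S0"
  let ?s = "real (num_factors r S ?V)"
  define \<pi> where "\<pi> Z = real (num_factors r S (?V - Z)) / ?s" for Z
  define good where "good y \<longleftrightarrow> (\<Sum>Z | Z \<in> cliques r S ?V \<and> y \<in> Z. \<pi> Z * max 0 (ln (\<pi> Z * D))) \<le> K3 KS \<and>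
      real (card {Z \<in> cliques r S ?V. y \<in> Z}) \<le> 16 * real r * \<kappa> * D \<and>
      real (card {(Z, Z'). Z \<in> cliques r S ?V \<and> Z' \<in> cliques r S ?V \<and> 2 \<le> card (Z \<inter> Z') \<and> y \<in> Z \<inter> Z'}) \<le> K5 * D\<^sup>2 / m" for y
  have VW: "?V \<subseteq> W" by auto
  have finV: "finite ?V" using finW by simp
  have r1: "r = Suc (r - 1)" using r3 by simp
  have finS0: "finite S0" using S0(1) finW by (rule finite_subset)
  have bad: "real (card {y \<in> ?V. \<not> good y}) \<le> 3 * real n / 16"
    unfolding good_def \<pi>_def by (rule typical_vertices[OF VW s lnS KS])
  let ?Y = "{y \<in> ?V - F0. \<epsilon> * \<delta> / 2 * ?s \<le> real (num_factors r S (W - insert y S0))}"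
  have ok: "\<epsilon> * \<delta> / 2 * ?s \<le> real (num_factors r S (W - insert y S0))" if y: "y \<in> ?V" "y \<notin> F0" "good y" for y
  proof -
    let ?R = "insert y (insert x S0)"
    define \<theta> where "\<theta> = \<delta> * ?s / D"
    let ?F = "rich_cliques r (r - 1) S W ?R \<theta> y"
    have Vy: "?V - {y} = W - ?R - {y}" by auto
    have ni: "?V - insert y T = W - (?R \<union> T)" for T by auto
    have link: "{T \<in> cliques (r - 1) S (?V - {y}). T \<subseteq> nbr S y \<and> \<delta> * ?s / D \<le> real (num_factors r S (?V - insert y T))}
       = {T \<in> ?F. T \<subseteq> nbr S y}"
      unfolding rich_cliques_def \<theta>_def Vy ni by auto
    have tups: "(1 / (8 * MM KS) * clique_scale n (r - 1) q * q ^ (r - 1)) ^ K \<le> real (card (disjoint_tuples K {T \<in> ?F. T \<subseteq> nbr S y}))"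
    proof -
      have "1 / (8 * MM KS) * clique_scale n (r - 1) q * q ^ (r - 1) = D / (8 * MM KS)" by (simp add: D_def)
      thus ?thesis
        using link_structure[OF VW y(1) s KS _ _ _ K] y(3) unfolding good_def \<pi>_def link by metis
    qed
    have big: "\<epsilon> * clique_scale n (r - 1) q \<le> real (card ?F)"
    proof (rule ccontr)
      assume "\<not> ?thesis"
      hence "crowded_nbhd r n W S q \<epsilon> (1 / (8 * MM KS)) K ?R y"
        unfolding crowded_nbhd_def not_le using tups rich_cliques_ceiling[of r "r - 1" S W ?R \<theta> y]
        by (intro exI[of _ "nat \<lceil>\<theta>\<rceil>"]) simp
      thus False using up[of y] y by auto
    qed
    have Fx: "rich_cliques r (r - 1) S W ?R \<theta> x = ?F" by (rule rich_cliques_absorb) auto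
    have "\<epsilon> / 2 * (clique_scale n (r - 1) q * q ^ (r - 1)) \<le> real (card {T \<in> rich_cliques r (r - 1) S W ?R \<theta> x. T \<subseteq> nbr S x})"
      by (rule rich_cliques_in_nbr_ge) (use low[of y] y big Fx in auto)
    hence cnt: "\<epsilon> / 2 * D \<le> real (card {T \<in> ?F. T \<subseteq> nbr S x})" unfolding Fx D_def .
    have \<theta>0: "\<theta> \<ge> 0" using consts_pos(3) D_ge by (simp add: \<theta>_def)
    have "\<epsilon> * \<delta> / 2 * ?s = \<epsilon> / 2 * D * \<theta>" using D_ge by (simp add: \<theta>_def)
    also have "\<dots> \<le> real (card {T \<in> ?F. T \<subseteq> nbr S x}) * \<theta>" by (rule mult_right_mono[OF cnt \<theta>0])
    also have "\<dots> = (\<Sum>T\<in>{T \<in> ?F. T \<subseteq> nbr S x}. \<theta>)" by simp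
    also have "\<dots> \<le> (\<Sum>T\<in>{T \<in> ?F. T \<subseteq> nbr S x}. real (num_factors r S (W - insert y S0 - insert x T)))"
    proof (rule sum_mono)
      fix T assume "T \<in> {T \<in> ?F. T \<subseteq> nbr S x}"
      moreover have "W - insert y S0 - insert x T = W - (?R \<union> T)" by auto
      ultimately show "\<theta> \<le> real (num_factors r S (W - insert y S0 - insert x T))" by (simp add: rich_cliques_def)
    qed
    also have "\<dots> \<le> (\<Sum>T | T \<in> cliques (r - 1) S (W - insert y S0 - {x}) \<and> T \<subseteq> nbr S x. real (num_factors r S (W - insert y S0 - insert x T)))"
    proof (rule sum_mono2)
      show "finite {T. T \<in> cliques (r - 1) S (W - insert y S0 - {x}) \<and> T \<subseteq> nbr S x}" using finW by simp
      have "W - ?R - {y} = W - insert y S0 - {x}" by auto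
      thus "{T \<in> ?F. T \<subseteq> nbr S x} \<subseteq> {T. T \<in> cliques (r - 1) S (W - insert y S0 - {x}) \<and> T \<subseteq> nbr S x}"
        by (auto simp: rich_cliques_def)
    qed simp
    also have "\<dots> = real (num_factors r S (W - insert y S0))"
    proof -
      have "x \<in> W - insert y S0" using S0 y by auto
      from num_factors_root_link[OF _ this, of "r - 1" S] finW r1 show ?thesis by simp
    qed
    finally show ?thesis .
  qed
  have "card ?V = card W - r"
    using S0 finS0 r3 by (subst card_Diff_subset) auto
  hence cV: "real (card ?V) \<ge> real n / 2 - real r" using cardW(2) by linarith
  have "?V \<subseteq> ?Y \<union> ({y \<in> ?V. \<not> good y} \<union> F0)" using ok by auto
  hence "card ?V \<le> card (?Y \<union> ({y \<in> ?V. \<not> good y} \<union> F0))" by (rule card_mono[rotated]) (use finW F0 in auto)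
  also have "\<dots> \<le> card ?Y + (card {y \<in> ?V. \<not> good y} + card F0)"
    using card_Un_le[of ?Y] card_Un_le[of "{y \<in> ?V. \<not> good y}" F0] by (meson add_left_mono order_trans)
  finally have "real (card ?V) \<le> real (card ?Y) + (real (card {y \<in> ?V. \<not> good y}) + real (card F0))" by linarith
  moreover have "real (card F0) \<le> 3" using F0(2) by simp
  moreover have "N / 4 \<le> a" if "V \<le> a + (b + c)" "c \<le> 3" "b \<le> 3 * N / 16" "N / 2 - R \<le> V" "16 * (R + 3) \<le> N" for a b c V N R :: real
    using that by (simp add: field_simps)
  ultimately show ?thesis using bad cV n_large by blast
qed

end

section \<open>From one exchange to all cliques\<close>

text \<open>Every extension of the cliques by one vertex divides the density by \<open>8 * r\<close>.\<close>
definition eps :: "real \<Rightarrow> nat \<Rightarrow> nat \<Rightarrow> real" where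
  "eps e1 r k = e1 / (8 * real r) ^ k"

text \<open>The second clause, with the singletons as rich cliques, is a lower bound for the degrees. \<open>F0\<close>
consists of the ends of the pair whose birth defines the snapshot: at these vertices one neighbour is
not random, so crowdedness cannot be excluded with the required probability.\<close>
definition no_witness :: "nat \<Rightarrow> nat \<Rightarrow> nat set \<Rightarrow> nat set set \<Rightarrow> real \<Rightarrow> real \<Rightarrow> real \<Rightarrow> nat \<Rightarrow> nat set \<Rightarrow> bool" where
  "no_witness r n W S q e1 \<eta> K F0 \<longleftrightarrow>
     (\<forall>R t v k. R \<subseteq> W \<longrightarrow> card R \<le> r + 1 \<longrightarrow> t \<in> R \<longrightarrow> v \<in> W \<longrightarrow> 1 \<le> k \<longrightarrow> k \<le> r - 1 \<longrightarrow>
        \<not> sparse_nbhd r n W S q (eps e1 r k) k R t v) \<and>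
     (\<forall>t\<in>W. \<not> sparse_nbhd r n W S q (1 / 4) 1 {t} t t) \<and>
     (\<forall>R y. R \<subseteq> W \<longrightarrow> card R = r + 1 \<longrightarrow> y \<in> R \<longrightarrow> y \<notin> F0 \<longrightarrow> \<not> crowded_nbhd r n W S q (eps e1 r (r - 1)) \<eta> K R y)"

lemma no_witnessD:
  assumes "no_witness r n W S q e1 \<eta> K F0"
  shows "R \<subseteq> W \<Longrightarrow> card R \<le> r + 1 \<Longrightarrow> t \<in> R \<Longrightarrow> v \<in> W \<Longrightarrow> 1 \<le> k \<Longrightarrow> k \<le> r - 1 \<Longrightarrow>
      \<not> sparse_nbhd r n W S q (eps e1 r k) k R t v"
    and "t \<in> W \<Longrightarrow> \<not> sparse_nbhd r n W S q (1 / 4) 1 {t} t t"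
    and "R \<subseteq> W \<Longrightarrow> card R = r + 1 \<Longrightarrow> y \<in> R \<Longrightarrow> y \<notin> F0 \<Longrightarrow> \<not> crowded_nbhd r n W S q (eps e1 r (r - 1)) \<eta> K R y"
  using assms unfolding no_witness_def by (elim conjE; simp)+

definition local_ratio :: "nat \<Rightarrow> real \<Rightarrow> real \<Rightarrow> real" where
  "local_ratio r \<kappa> e1 = eps e1 r (r - 1) * link_share r \<kappa> / 2"

context snapshot
begin

abbreviation "c1 \<equiv> local_ratio r \<kappa>"

lemma degree_sum:
  assumes "no_witness r n W S q e1 \<eta> K F0" and n4: "n \<ge> 4"
  shows "(real n)\<^sup>2 * q / 32 \<le> real (card S)"
proof -
  have finS: "finite S" using S finite_subset[OF S] finW by simp
  have deg: "real n * q / 8 \<le> real (card {e \<in> S. t \<in> e})" if t: "t \<in> W" for t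
  proof -
    have F: "rich_cliques r 1 S W {t} 0 t = (\<lambda>v. {v}) ` (W - {t})"
    proof -
      have "pairs {v} = {}" for v :: nat
      proof -
        have "f \<notin> pairs {v}" for f
        proof
          assume "f \<in> pairs {v}"
          hence "f \<subseteq> {v}" "card f = 2" by (simp_all add: pairs_def)
          thus False using card_mono[of "{v}" f] by simp
        qed
        thus ?thesis by blast
      qed
      thus ?thesis by (auto simp: rich_cliques_def cliques_def card_1_singleton_iff)
    qed
    have "card (rich_cliques r 1 S W {t} 0 t) = card W - 1"
      unfolding F using t finW by (subst card_image) auto
    hence "real (card (rich_cliques r 1 S W {t} 0 t)) \<ge> 1 / 4 * real n" using W(2) n4 by linarith
    hence big: "1 / 4 * clique_scale n 1 q \<le> real (card (rich_cliques r 1 S W {t} 0 t))" by (simp add: clique_scale_def numeral_2_eq_2)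
    have "1 / 4 / 2 * (clique_scale n 1 q * q ^ 1) \<le> real (card {T \<in> rich_cliques r 1 S W {t} 0 t. T \<subseteq> nbr S t})"
      by (rule rich_cliques_in_nbr_ge[OF no_witnessD(2)[OF assms(1) t] big])
    also have "real (card {T \<in> rich_cliques r 1 S W {t} 0 t. T \<subseteq> nbr S t}) \<le> real (card {e \<in> S. t \<in> e})"
    proof (rule of_nat_mono, rule card_inj_on_le[where f = "\<lambda>T. insert t T"])
      show "inj_on (insert t) {T \<in> rich_cliques r 1 S W {t} 0 t. T \<subseteq> nbr S t}"
        unfolding F by (auto simp: inj_on_def doubleton_eq_iff)
      show "insert t ` {T \<in> rich_cliques r 1 S W {t} 0 t. T \<subseteq> nbr S t} \<subseteq> {e \<in> S. t \<in> e}"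
        unfolding F by (auto simp: nbr_def)
    qed (use finS in simp)
    finally show ?thesis by (simp add: clique_scale_def numeral_2_eq_2)
  qed
  have "(real n / 2) * (real n * q / 8) \<le> real (card W) * (real n * q / 8)"
    using cardW(2) q by (intro mult_right_mono) auto
  also have "\<dots> = (\<Sum>t\<in>W. real n * q / 8)" by simp
  also have "\<dots> \<le> (\<Sum>t\<in>W. real (card {e \<in> S. t \<in> e}))" by (rule sum_mono) (rule deg)
  also have "\<dots> = (\<Sum>t\<in>W. \<Sum>e | e \<in> S \<and> t \<in> e. 1)" by simp
  also have "\<dots> = (\<Sum>e\<in>S. real (card e) * 1)"
    by (rule sum_over_members) (use finW finS S in \<open>auto simp: pairs_def\<close>)
  also have "\<dots> = (\<Sum>e\<in>S. 2)" by (rule sum.cong) (use S in \<open>auto simp: pairs_def\<close>)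
  also have "\<dots> = 2 * real (card S)" by simp
  finally show ?thesis by (simp add: power2_eq_square field_simps)
qed

lemma ln_inv_c1:
  assumes e1: "0 < e1" "e1 \<le> 1"
  shows "ln (1 / c1 e1) \<ge> 0"
proof -
  have eps0: "eps e1 r j > 0" for j using e1 r3 by (simp add: eps_def)
  have "\<delta> \<le> 1" using r3 \<kappa> mult_mono[of 1 "64 * real r" 1 \<kappa>] by (simp add: link_share_def)
  moreover have "eps e1 r (r - 1) \<le> 1"
  proof -
    have "1 \<le> (8 * real r) ^ (r - 1)" using r3 by (intro one_le_power) simp
    thus ?thesis using e1 by (simp add: eps_def divide_le_eq)
  qed
  ultimately have "eps e1 r (r - 1) * \<delta> \<le> 1 * 1" using eps0[of "r - 1"] consts_pos(3) by (intro mult_mono) auto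
  hence "c1 e1 \<le> 1" by (simp add: local_ratio_def)
  moreover have "c1 e1 > 0" unfolding local_ratio_def using eps0 consts_pos(3) by simp
  ultimately show ?thesis by simp
qed

text \<open>Starting from one set \<open>R \<union> X\<close> whose removal leaves many factors, the vertices of \<open>X\<close> are
exchanged one after another. Each exchange leaves \<open>n / 4\<close> choices for the new vertex
\<open>y\<close> and costs a factor \<open>c1 e1\<close> in the number of factors; since the neighbourhood of \<open>y\<close>
is not sparse, it contains a share \<open>q ^ k\<close> of the cliques already constructed. So one rich
clique produces a positive density of them. For \<open>k = 0\<close> the only clique is the empty
one, which lies in every neighbourhood.\<close>
lemma spread:
  assumes nw: "no_witness r n W S q e1 (1 / (8 * MM KS)) K F0" and F0: "finite F0" "card F0 \<le> 2"
    and e1: "0 < e1" "e1 \<le> 1" and KS: "KS \<ge> 0"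
    and K: "real K * (32 * (MM KS)\<^sup>2 * K5) \<le> m" and n_large: "16 * (real r + 3) \<le> real n"
    and v: "v \<in> W"
  defines "L \<equiv> real (card W) / real r * ln D - KS * real n"
  shows "R \<subseteq> W \<Longrightarrow> X \<subseteq> W \<Longrightarrow> R \<inter> X = {} \<Longrightarrow> card R = r - k \<Longrightarrow> card X = k \<Longrightarrow> k \<le> r - 1 \<Longrightarrow>
    num_factors r S (W - (R \<union> X)) > 0 \<Longrightarrow> L + real k * ln (1 / c1 e1) \<le> ln (real (num_factors r S (W - (R \<union> X)))) \<Longrightarrow>
    eps e1 r k * clique_scale n k q \<le> real (card (rich_cliques r k S W R (c1 e1 ^ k * real (num_factors r S (W - (R \<union> X)))) v))"
proof (induction k arbitrary: R X)
  case 0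
  have "finite X" by (rule finite_subset[OF 0(2) finW])
  hence "X = {}" using 0 by simp
  have "{} \<in> rich_cliques r 0 S W R (c1 e1 ^ 0 * real (num_factors r S (W - (R \<union> X)))) v"
    using \<open>X = {}\<close> by (auto simp: rich_cliques_def cliques_def pairs_def)
  hence "card (rich_cliques r 0 S W R (c1 e1 ^ 0 * real (num_factors r S (W - (R \<union> X)))) v) \<ge> 1"
    using finite_rich_cliques[OF finW] by (metis One_nat_def Suc_leI card_gt_0_iff empty_iff)
  thus ?case using e1 by (simp add: eps_def clique_scale_def numeral_2_eq_2)
next
  case (Suc k)
  let ?s = "real (num_factors r S (W - (R \<union> X)))"
  define \<theta> where "\<theta> = c1 e1 ^ Suc k * ?s"
  have eps0: "eps e1 r j > 0" for j using e1 r3 by (simp add: eps_def)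
  have c10: "c1 e1 > 0" unfolding local_ratio_def using eps0 consts_pos(3) by simp
  have finR: "finite R" by (rule finite_subset[OF Suc.prems(1) finW])
  have finX: "finite X" by (rule finite_subset[OF Suc.prems(2) finW])
  obtain x where x: "x \<in> X" using Suc.prems(5) by fastforce
  define X' where "X' = X - {x}"
  have X': "card X' = k" "finite X'" "X' \<subseteq> W" using x Suc.prems finX by (auto simp: X'_def)
  define S0 where "S0 = R \<union> X'"
  have S0: "S0 \<subseteq> W" "x \<in> W" "x \<notin> S0" "insert x S0 = R \<union> X"
    using Suc.prems x X' by (auto simp: S0_def X'_def)
  have "R \<inter> X' = {}" using Suc.prems by (auto simp: X'_def)
  hence cS0: "card S0 = r - 1"
    unfolding S0_def using Suc.prems X' finR by (subst card_Un_disjoint) auto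
  have finS0: "finite S0" using finR X' by (simp add: S0_def)
  have cS0x: "card (insert x S0) = r"
    unfolding card_insert_disjoint[OF finS0 S0(3)] using cS0 r3 by simp
  have l0: "ln (1 / c1 e1) \<ge> 0" by (rule ln_inv_c1[OF e1])
  have s0: "num_factors r S (W - insert x S0) > 0" using Suc.prems S0 by simp
  let ?F1 = "insert v F0"
  define Y where "Y = {y \<in> W - insert x S0 - ?F1. c1 e1 * real (num_factors r S (W - insert x S0)) \<le> real (num_factors r S (W - insert y S0))}"
  have Yc: "real n / 4 \<le> real (card Y)"
    unfolding Y_def local_ratio_def
  proof (rule swap[OF S0(1) cS0 S0(2,3) s0 _ KS eps0 K _ _ n_large])
    show "real (card W) / real r * ln D - KS * real n \<le> ln (real (num_factors r S (W - insert x S0)))"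
    proof -
      have "0 \<le> real (Suc k) * ln (1 / c1 e1)" using l0 by simp
      thus ?thesis using Suc.prems(8) S0(4) unfolding L_def by (metis add_increasing2 order_trans order_refl)
    qed
    show "finite ?F1" using F0 by simp
    show "card ?F1 \<le> 3" using F0 card_insert_le_m1[of 3 F0 v] by simp
    show "\<not> crowded_nbhd r n W S q (eps e1 r (r - 1)) (1 / (8 * MM KS)) K (insert y (insert x S0)) y"
      if "y \<in> W" "y \<notin> insert x S0" "y \<notin> ?F1" for y
    proof -
      have "card (insert y (insert x S0)) = r + 1" using that cS0x finS0 by simp
      moreover have "insert y (insert x S0) \<subseteq> W" using that S0 by auto
      ultimately show ?thesis using that(3) by (intro no_witnessD(3)[OF nw]) auto
    qed
    show "\<not> sparse_nbhd r n W S q (eps e1 r (r - 1)) (r - 1) (insert y (insert x S0)) x x"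
      if "y \<in> W" "y \<notin> insert x S0" for y
    proof -
      have "card (insert y (insert x S0)) = r + 1" using that cS0x finS0 by simp
      moreover have "insert y (insert x S0) \<subseteq> W" "x \<in> insert y (insert x S0)" using that S0 by auto
      moreover have "1 \<le> r - 1" using r3 by simp
      ultimately show ?thesis using S0(2) by (intro no_witnessD(1)[OF nw]) auto
    qed
  qed
  have finY: "finite Y" unfolding Y_def using finW by simp
  define G where "G y = {T \<in> rich_cliques r k S W (insert y R) \<theta> v. T \<subseteq> nbr S y}" for y
  have Gc: "eps e1 r k / 2 * (clique_scale n k q * q ^ k) \<le> real (card (G y))" if y: "y \<in> Y" for y
  proof -
    have yp: "y \<in> W" "y \<notin> R" "y \<notin> X'" "y \<noteq> v"
      using y unfolding Y_def S0_def by auto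
    have WR: "W - (insert y R \<union> X') = W - insert y S0" by (auto simp: S0_def)
    have sy: "c1 e1 * ?s \<le> real (num_factors r S (W - insert y S0))" using y S0(4) by (auto simp: Y_def)
    have s_pos: "?s > 0" using Suc.prems by simp
    have sy0: "real (num_factors r S (W - insert y S0)) > 0" using sy c10 s_pos by (meson less_le_trans mult_pos_pos)
    have "eps e1 r k * clique_scale n k q \<le> real (card (rich_cliques r k S W (insert y R) (c1 e1 ^ k * real (num_factors r S (W - (insert y R \<union> X')))) v))"
    proof (rule Suc.IH)
      show "insert y R \<subseteq> W" using yp Suc.prems by auto
      show "X' \<subseteq> W" by (rule X')
      show "insert y R \<inter> X' = {}" using yp \<open>R \<inter> X' = {}\<close> by auto
      show "card (insert y R) = r - k" using yp finR Suc.prems by simp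
      show "card X' = k" by (rule X')
      show "k \<le> r - 1" using Suc.prems by simp
      show "0 < num_factors r S (W - (insert y R \<union> X'))" using sy0 unfolding WR by simp
      have "L + real k * ln (1 / c1 e1) = (L + real (Suc k) * ln (1 / c1 e1)) - ln (1 / c1 e1)"
        by (simp add: algebra_simps)
      also have "\<dots> \<le> ln ?s + ln (c1 e1)" using Suc.prems(8) c10 by (simp add: ln_div)
      also have "\<dots> = ln (c1 e1 * ?s)" using c10 s_pos by (simp add: ln_mult)
      also have "\<dots> \<le> ln (real (num_factors r S (W - insert y S0)))"
        by (rule ln_mono) (use sy c10 s_pos sy0 in auto)
      finally show "L + real k * ln (1 / c1 e1) \<le> ln (real (num_factors r S (W - (insert y R \<union> X'))))" unfolding WR .
    qed
    also have "\<dots> \<le> real (card (rich_cliques r k S W (insert y R) \<theta> v))"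
    proof (intro of_nat_mono card_mono rich_cliques_antimono)
      have "c1 e1 ^ k * (c1 e1 * ?s) \<le> c1 e1 ^ k * real (num_factors r S (W - insert y S0))"
        by (rule mult_left_mono[OF sy]) (use c10 in simp)
      thus "\<theta> \<le> c1 e1 ^ k * real (num_factors r S (W - (insert y R \<union> X')))" unfolding WR \<theta>_def by (simp add: mult_ac)
    qed (use finW in simp)
    finally have big: "eps e1 r k * clique_scale n k q \<le> real (card (rich_cliques r k S W (insert y R) \<theta> v))" .
    show ?thesis
    proof (cases "k = 0")
      case True
      have "G y = rich_cliques r k S W (insert y R) \<theta> v"
      proof -
        have "T = {}" if "T \<in> rich_cliques r k S W (insert y R) \<theta> v" for T
        proof -
          have T: "T \<in> cliques 0 S (W - insert y R - {v})" using that True by (simp add: rich_cliques_def)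
          have "finite T" by (rule clique_finite[OF _ T]) (use finW in simp)
          moreover have "card T = 0" using T by (simp add: cliques_def)
          ultimately show ?thesis by simp
        qed
        thus ?thesis unfolding G_def by blast
      qed
      moreover have "eps e1 r k / 2 * (clique_scale n k q * q ^ k) \<le> eps e1 r k * clique_scale n k q"
        using True eps0[of 0] by (simp add: clique_scale_def numeral_2_eq_2)
      ultimately show ?thesis using order_trans[OF _ big] by (simp only:)
    next
      case False
      show ?thesis unfolding G_def
      proof (rule rich_cliques_in_nbr_ge[OF _ big])
        have "card (insert y R) \<le> r + 1" using yp finR Suc.prems by simp
        thus "\<not> sparse_nbhd r n W S q (eps e1 r k) k (insert y R) y v"
          using yp Suc.prems False v by (intro no_witnessD(1)[OF nw]) auto
      qed
    qed
  qed
  have finG: "finite (G y)" for y unfolding G_def using finW by simp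
  let ?Fam = "rich_cliques r (Suc k) S W R \<theta> v"
  have ins: "insert y T \<in> ?Fam \<and> y \<in> insert y T \<and> y \<notin> T" if y: "y \<in> Y" and T: "T \<in> G y" for y T
  proof -
    have yp: "y \<in> W" "y \<notin> R" "y \<noteq> v" using y unfolding Y_def S0_def by auto
    have T': "T \<in> cliques k S (W - insert y R - {v})" "T \<subseteq> nbr S y" "\<theta> \<le> real (num_factors r S (W - (insert y R \<union> T)))"
      using T by (auto simp: G_def rich_cliques_def)
    have e: "W - insert y R - {v} = (W - R - {v}) - {y}" by auto
    have sub: "T \<subseteq> (W - R - {v}) - {y}" using T'(1) unfolding e by (auto simp: cliques_def)
    have "insert y T \<in> cliques (Suc k) S (W - R - {v})"
      using insert_clique_iff[OF _ _ sub, of k S] T' yp finW unfolding e by auto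
    moreover have "insert y R \<union> T = R \<union> insert y T" by auto
    ultimately show ?thesis using T' sub by (auto simp: rich_cliques_def)
  qed
  \<comment> \<open>each clique of size \<open>k + 1\<close> arises at most \<open>k + 1\<close> times, once for every choice of \<open>y\<close> in it\<close>
  have "(\<Sum>y\<in>Y. card (G y)) = card (SIGMA y:Y. G y)"
    using finY finG by (subst card_SigmaI) auto
  also have "\<dots> \<le> card (SIGMA Z:?Fam. Z)"
  proof (rule card_inj_on_le[where f = "\<lambda>(y, T). (insert y T, y)"])
    show "inj_on (\<lambda>(y, T). (insert y T, y)) (SIGMA y:Y. G y)"
    proof (rule inj_onI)
      fix a b assume ab: "a \<in> (SIGMA y:Y. G y)" "b \<in> (SIGMA y:Y. G y)" "(\<lambda>(y, T). (insert y T, y)) a = (\<lambda>(y, T). (insert y T, y)) b"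
      obtain y T y' T' where e: "a = (y, T)" "b = (y', T')" by (cases a, cases b)
      have "y = y'" "insert y T = insert y' T'" using ab e by auto
      moreover have "y \<notin> T" "y' \<notin> T'" using ins ab e by auto
      ultimately show "a = b" using e by (simp add: insert_ident)
    qed
    show "(\<lambda>(y, T). (insert y T, y)) ` (SIGMA y:Y. G y) \<subseteq> (SIGMA Z:?Fam. Z)" using ins by auto
    have "finite Z" if "Z \<in> ?Fam" for Z
      using that clique_finite[of "W - R - {v}" Z "Suc k" S] finW by (auto simp: rich_cliques_def)
    thus "finite (SIGMA Z:?Fam. Z)" using finW by (intro finite_SigmaI) auto
  qed
  also have "\<dots> = (\<Sum>Z\<in>?Fam. card Z)"
  proof (rule card_SigmaI)
    show "\<forall>Z\<in>?Fam. finite Z" using clique_finite[of "W - R - {v}" _ "Suc k" S] finW by (auto simp: rich_cliques_def)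
  qed (use finW in simp)
  also have "\<dots> = (\<Sum>Z\<in>?Fam. Suc k)" by (rule sum.cong) (auto simp: rich_cliques_def cliques_def)
  also have "\<dots> = card ?Fam * Suc k" by simp
  finally have "real (\<Sum>y\<in>Y. card (G y)) \<le> real (card ?Fam * Suc k)" by (simp only: of_nat_le_iff)
  hence up: "(\<Sum>y\<in>Y. real (card (G y))) \<le> real (card ?Fam) * real (Suc k)" by (simp only: of_nat_sum of_nat_mult)
  have e0: "0 \<le> eps e1 r k / 2 * (clique_scale n k q * q ^ k)" using eps0[of k] q by (simp add: clique_scale_def)
  have "real n / 4 * (eps e1 r k / 2 * (clique_scale n k q * q ^ k)) \<le> real (card Y) * (eps e1 r k / 2 * (clique_scale n k q * q ^ k))"
    by (rule mult_right_mono[OF Yc e0])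
  also have "\<dots> = (\<Sum>y\<in>Y. eps e1 r k / 2 * (clique_scale n k q * q ^ k))" by simp
  also have "\<dots> \<le> (\<Sum>y\<in>Y. real (card (G y)))" by (rule sum_mono) (rule Gc)
  also note up
  finally have fin: "eps e1 r k / 8 * clique_scale n (Suc k) q \<le> real (card ?Fam) * real (Suc k)"
    unfolding clique_scale_Suc by (simp add: mult_ac)
  have "eps e1 r (Suc k) * clique_scale n (Suc k) q * real (Suc k) \<le> eps e1 r k / 8 * clique_scale n (Suc k) q"
  proof -
    have "eps e1 r (Suc k) * real (Suc k) \<le> eps e1 r (Suc k) * real r"
      using Suc.prems r3 eps0[of "Suc k"] by (intro mult_left_mono) auto
    also have "\<dots> = eps e1 r k / 8" using r3 by (simp add: eps_def)
    finally have "eps e1 r (Suc k) * real (Suc k) * clique_scale n (Suc k) q \<le> eps e1 r k / 8 * clique_scale n (Suc k) q"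
      using q by (intro mult_right_mono) (auto simp: clique_scale_def)
    thus ?thesis by (simp add: mult_ac)
  qed
  with fin have "eps e1 r (Suc k) * clique_scale n (Suc k) q * real (Suc k) \<le> real (card ?Fam) * real (Suc k)" by linarith
  hence "eps e1 r (Suc k) * clique_scale n (Suc k) q \<le> real (card ?Fam)" by (rule mult_right_le_imp_le) simp
  thus ?case unfolding \<theta>_def .
qed

end

text \<open>The maximum with 2 serves the case in which all cliques through the edge are negligible.\<close>
definition loss_bound :: "nat \<Rightarrow> real \<Rightarrow> real \<Rightarrow> real" where
  "loss_bound r \<kappa> e1 = max 2 (2 / (eps e1 r (r - 1) * local_ratio r \<kappa> e1 ^ (r - 1)))"

context snapshot
begin

abbreviation "C1 \<equiv> loss_bound r \<kappa>"

text \<open>Let \<open>w Z\<close> be the number of factors through \<open>Z\<close>, largest among the cliques that contain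
\<open>e\<close>. Deleting \<open>e\<close> destroys at most \<open>w Z\<close> factors for each of these cliques. If
\<open>w Z\<close> is smaller than the total by a large power of \<open>n\<close>, this is negligible. Otherwise
\<open>Z\<close> spreads: of the order of \<open>D\<close> cliques at one end \<open>u\<close> of \<open>e\<close> avoid the
other end \<open>v\<close> and leave a constant proportion of \<open>w Z\<close> factors. None of these uses
\<open>e\<close>, so at least a constant times \<open>D * w Z\<close> factors survive.\<close>
lemma edge_loss:
  assumes nw: "no_witness r n W S q e1 (1 / (8 * MM KS)) K F0" and F0: "finite F0" "card F0 \<le> 2"
    and e1: "0 < e1" "e1 \<le> 1" and KS: "KS \<ge> 0"
    and K: "real K * (32 * (MM KS)\<^sup>2 * K5) \<le> m" and n_large: "16 * (real r + 3) \<le> real n"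
    and slack: "2 * real r * ln (real n) + real r * ln (1 / c1 e1) \<le> (KS - KA) * real n"
    and e: "e \<in> S" and pos: "num_factors r S W > 0"
    and lnA: "real (card W) / real r * ln D - KA * real n \<le> ln (real (num_factors r S W))"
  shows "num_factors r (S - {e}) W > 0"
    and "ln (real (num_factors r S W) / real (num_factors r (S - {e}) W)) \<le> C1 e1 * real (card {Z \<in> cliques r S W. e \<in> pairs Z}) / D"
proof -
  let ?E = "{Z \<in> cliques r S W. e \<in> pairs Z}"
  let ?\<Phi> = "real (num_factors r S W)" and ?\<Phi>' = "real (num_factors r (S - {e}) W)"
  have finE: "finite ?E" using finW by simp
  have r0: "r > 0" using r3 by simp
  have le: "?\<Phi> \<le> ?\<Phi>' + (\<Sum>Z\<in>?E. real (num_factors r S (W - Z)))"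
  proof -
    have "real (num_factors r S W) \<le> real (num_factors r (S - {e}) W + (\<Sum>Z\<in>?E. num_factors r S (W - Z)))"
      using num_factors_delete_edge[OF finW r0, of S e] by (simp only: of_nat_le_iff)
    thus ?thesis by (simp only: of_nat_add of_nat_sum)
  qed
  have \<Phi>'0: "?\<Phi>' \<ge> 0" by simp
  have \<Phi>0: "?\<Phi> > 0" using pos by simp
  have eps0: "eps e1 r j > 0" for j using e1 r3 by (simp add: eps_def)
  have c10: "c1 e1 > 0" unfolding local_ratio_def using eps0 consts_pos(3) by simp
  have C1: "C1 e1 \<ge> 2" "2 / (eps e1 r (r - 1) * c1 e1 ^ (r - 1)) \<le> C1 e1" by (simp_all add: loss_bound_def)
  have n1: "real n \<ge> 1" using n0 by linarith
  have claim: "num_factors r (S - {e}) W > 0 \<and> ln (?\<Phi> / ?\<Phi>') \<le> C1 e1 * real (card ?E) / D"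
  proof (cases "?E = {}")
    case True
    hence "(\<Sum>Z\<in>?E. real (num_factors r S (W - Z))) = 0" by (simp only: sum.empty)
    hence "?\<Phi> \<le> ?\<Phi>'" using le by linarith
    moreover have "?\<Phi> / ?\<Phi>' \<le> 1" using calculation \<Phi>0 by (simp add: divide_le_eq)
    moreover have "0 < ?\<Phi> / ?\<Phi>'" using \<Phi>0 calculation(1) by (intro divide_pos_pos) linarith+
    ultimately have l: "ln (?\<Phi> / ?\<Phi>') \<le> 0" by simp
    have "0 \<le> C1 e1 * real (card ?E) / D"
      using C1(1) D_ge(3) by (intro divide_nonneg_nonneg mult_nonneg_nonneg) linarith+
    hence "ln (?\<Phi> / ?\<Phi>') \<le> C1 e1 * real (card ?E) / D" using l by (rule order_trans[rotated])
    moreover have "num_factors r (S - {e}) W > 0" using \<open>?\<Phi> \<le> ?\<Phi>'\<close> \<Phi>0 by linarith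
    ultimately show ?thesis by blast
  next
    case False
    define w where "w Z = num_factors r S (W - Z)" for Z
    obtain Z where Z: "Z \<in> ?E" "\<And>Z'. Z' \<in> ?E \<Longrightarrow> w Z' \<le> w Z"
    proof -
      have "Max (w ` ?E) \<in> w ` ?E" using finE False by (intro Max_in) auto
      then obtain Z where Z: "Z \<in> ?E" "Max (w ` ?E) = w Z" by (rule imageE)
      have "w Z' \<le> w Z" if "Z' \<in> ?E" for Z' unfolding Z(2)[symmetric] using that finE by (intro Max_ge) auto
      thus ?thesis by (rule that[OF Z(1)])
    qed
    have sumE: "(\<Sum>Z'\<in>?E. real (num_factors r S (W - Z'))) \<le> real (card ?E) * real (w Z)"
      by (rule sum_bounded_above) (use Z(2) in \<open>auto simp: w_def\<close>)
    have cE: "real (card ?E) \<ge> 1"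
    proof -
      have "card ?E > 0" using card_gt_0_iff[of ?E] finE False by blast
      thus ?thesis by linarith
    qed
    have D_le: "D \<le> real n ^ (r - 1)"
    proof -
      have "q ^ ((r - 1) choose 2) * q ^ (r - 1) \<le> 1 * 1" using q by (intro mult_mono power_le_one) auto
      hence "real n ^ (r - 1) * (q ^ ((r - 1) choose 2) * q ^ (r - 1)) \<le> real n ^ (r - 1) * 1"
        by (intro mult_left_mono) auto
      thus ?thesis by (simp add: D_def clique_scale_def mult.assoc)
    qed
    have cE_le: "real (card ?E) \<le> real n ^ r"
    proof -
      have "card ?E \<le> card {Z. Z \<subseteq> W \<and> card Z = r}"
        using finW by (intro card_mono) (auto simp: cliques_def)
      also have "\<dots> = card W choose r" by (rule n_subsets[OF finW])
      also have "\<dots> \<le> n choose r" using cardW by (intro binomial_right_mono) auto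
      also have "\<dots> \<le> n ^ r" by (rule binomial_le_pow) (use n_large in simp)
      finally show ?thesis by (metis of_nat_le_iff of_nat_power)
    qed
    show ?thesis
    proof (cases "real (w Z) * real n ^ (2 * r) \<le> ?\<Phi>")
      case True
      let ?x = "real (card ?E) * real (w Z) / ?\<Phi>"
      have wn: "real (w Z) / ?\<Phi> \<le> 1 / real n ^ (2 * r)" using True \<Phi>0 n1 by (simp add: field_simps)
      have "?x \<le> real n ^ r * (1 / real n ^ (2 * r))"
        using mult_mono[OF cE_le wn] by simp
      also have "\<dots> = 1 / real n ^ r" using n1 by (simp only: mult_2 power_add) simp
      also have "\<dots> \<le> 1 / 2"
      proof -
        have "(2::real) ^ 1 \<le> real n ^ 1" using n_large by simp
        also have "\<dots> \<le> real n ^ r" using n1 r0 by (intro power_increasing) auto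
        finally show ?thesis by (intro frac_le) auto
      qed
      finally have x2: "?x \<le> 1 / 2" .
      have x0: "?x \<ge> 0" by simp
      have "?\<Phi> * (1 - ?x) \<le> ?\<Phi>'" using le sumE \<Phi>0 by (simp add: algebra_simps)
      moreover have "0 < ?\<Phi> * (1 - ?x)" using \<Phi>0 x2 by simp
      ultimately have p': "?\<Phi>' > 0" by linarith
      have "?\<Phi> / ?\<Phi>' \<le> 1 / (1 - ?x)"
      proof -
        define y where "y = 1 - ?x"
        have "?\<Phi> * y \<le> ?\<Phi>'" using \<open>?\<Phi> * (1 - ?x) \<le> ?\<Phi>'\<close> by (simp only: y_def)
        moreover have "y > 0" using x2 unfolding y_def by linarith
        ultimately have "?\<Phi> / ?\<Phi>' \<le> 1 / y" using p' by (simp add: field_simps)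
        thus ?thesis by (simp only: y_def)
      qed
      also have "\<dots> \<le> 1 + 2 * ?x"
      proof -
        have "1 / (1 - x) \<le> 1 + 2 * x" if "0 \<le> x" "x \<le> 1 / 2" for x :: real
          using mult_nonneg_nonneg[of x "1 - 2 * x"] that by (simp add: divide_le_eq algebra_simps)
        from this[OF x0 x2] show ?thesis .
      qed
      finally have "ln (?\<Phi> / ?\<Phi>') \<le> 2 * ?x"
        using ln_le_minus_one[of "?\<Phi> / ?\<Phi>'"] \<Phi>0 p' by simp
      also have "2 * ?x = 2 * real (card ?E) * (real (w Z) / ?\<Phi>)" by simp
      also have "\<dots> \<le> 2 * real (card ?E) * (1 / real n ^ (2 * r))" by (intro mult_left_mono wn) simp
      also have "\<dots> \<le> 2 * real (card ?E) * (1 / D)"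
      proof -
        have "real n ^ (r - 1) \<le> real n ^ (2 * r)" by (rule power_increasing) (use n1 in auto)
        hence "D \<le> real n ^ (2 * r)" using D_le by linarith
        thus ?thesis using D_ge by (intro mult_left_mono frac_le) auto
      qed
      also have "\<dots> \<le> C1 e1 * real (card ?E) / D" using C1 D_ge by (simp add: divide_right_mono mult_right_mono)
      finally show ?thesis using p' by simp
    next
      case False
      hence wbig: "?\<Phi> < real (w Z) * real n ^ (2 * r)" by simp
      hence w0: "real (w Z) > 0" using \<Phi>0 n1 by (metis less_trans mult_eq_0_iff not_gr_zero of_nat_0 of_nat_0_less_iff less_irrefl)
      have lnw: "ln ?\<Phi> - 2 * real r * ln (real n) \<le> ln (real (w Z))"
      proof -
        have "ln ?\<Phi> \<le> ln (real (w Z) * real n ^ (2 * r))" using wbig \<Phi>0 by (intro ln_mono) auto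
        also have "\<dots> = ln (real (w Z)) + 2 * real r * ln (real n)" using w0 n1 by (simp add: ln_mult ln_realpow)
        finally show ?thesis by simp
      qed
      obtain u v where uv: "e = {u, v}" "u \<noteq> v" using e S by (auto simp: pairs_def card_2_iff)
      have uvW: "u \<in> W" "v \<in> W" using e S uv by (auto simp: pairs_def)
      have ZC: "Z \<subseteq> W" "card Z = r" "u \<in> Z" using Z(1) uv by (auto simp: cliques_def pairs_def)
      have finZ: "finite Z" using ZC(1) finW by (rule finite_subset)
      let ?X = "Z - {u}"
      have RX: "{u} \<union> ?X = Z" using ZC by auto
      define \<theta> where "\<theta> = c1 e1 ^ (r - 1) * real (w Z)"
      have big: "eps e1 r (r - 1) * clique_scale n (r - 1) q \<le> real (card (rich_cliques r (r - 1) S W {u} \<theta> v))"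
      proof -
        have "eps e1 r (r - 1) * clique_scale n (r - 1) q \<le> real (card (rich_cliques r (r - 1) S W {u} (c1 e1 ^ (r - 1) * real (num_factors r S (W - ({u} \<union> ?X)))) v))"
        proof (rule spread[OF nw F0 e1 KS K n_large uvW(2)])
          show "card {u} = r - (r - 1)" using r3 by simp
          show "card ?X = r - 1" using ZC finZ by simp
          show "0 < num_factors r S (W - ({u} \<union> ?X))" using w0 unfolding RX w_def by simp
          show "real (card W) / real r * ln D - KS * real n + real (r - 1) * ln (1 / c1 e1) \<le> ln (real (num_factors r S (W - ({u} \<union> ?X))))"
          proof -
            have "real (r - 1) * ln (1 / c1 e1) \<le> real r * ln (1 / c1 e1)"
              by (intro mult_right_mono) (use ln_inv_c1[OF e1] in auto)
            hence "real (card W) / real r * ln D - KS * real n + real (r - 1) * ln (1 / c1 e1) \<le> ln ?\<Phi> - 2 * real r * ln (real n)"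
              using slack lnA by (simp add: algebra_simps)
            thus ?thesis using lnw unfolding RX w_def by linarith
          qed
        qed (use uvW ZC in auto)
        thus ?thesis unfolding RX \<theta>_def w_def .
      qed
      let ?G = "{T \<in> rich_cliques r (r - 1) S W {u} \<theta> v. T \<subseteq> nbr S u}"
      have cnt: "eps e1 r (r - 1) / 2 * D \<le> real (card ?G)"
        unfolding D_def
        by (rule rich_cliques_in_nbr_ge[OF _ big], rule no_witnessD(1)[OF nw]) (use uvW r3 in auto)
      have \<theta>0: "\<theta> > 0" unfolding \<theta>_def using c10 w0 by simp
      have "eps e1 r (r - 1) / 2 * D * \<theta> \<le> real (card ?G) * \<theta>" using \<theta>0 by (intro mult_right_mono cnt) auto
      also have "\<dots> = (\<Sum>T\<in>?G. \<theta>)" by simp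
      also have "\<dots> \<le> (\<Sum>T\<in>?G. real (num_factors r (S - {e}) (W - insert u T)))"
      proof (rule sum_mono)
        fix T assume T: "T \<in> ?G"
        have "num_factors r (S - {e}) (W - insert u T) = num_factors r S (W - insert u T)"
          by (rule num_factors_cong) (auto simp: uv pairs_def)
        thus "\<theta> \<le> real (num_factors r (S - {e}) (W - insert u T))" using T by (simp add: rich_cliques_def)
      qed
      also have "\<dots> \<le> (\<Sum>T | T \<in> cliques (r - 1) (S - {e}) (W - {u}) \<and> T \<subseteq> nbr (S - {e}) u. real (num_factors r (S - {e}) (W - insert u T)))"
      proof (rule sum_mono2)
        show "finite {T. T \<in> cliques (r - 1) (S - {e}) (W - {u}) \<and> T \<subseteq> nbr (S - {e}) u}" using finW by simp
        show "?G \<subseteq> {T. T \<in> cliques (r - 1) (S - {e}) (W - {u}) \<and> T \<subseteq> nbr (S - {e}) u}"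
        proof
          fix T assume T: "T \<in> ?G"
          hence T1: "T \<in> cliques (r - 1) S (W - {u} - {v})" "T \<subseteq> nbr S u" by (auto simp: rich_cliques_def)
          have uT: "u \<notin> T" "v \<notin> T" using T1 by (auto simp: cliques_def)
          have "e \<notin> pairs T" using uT by (auto simp: pairs_def uv)
          hence "T \<in> cliques (r - 1) (S - {e}) (W - {u})" using T1 by (auto simp: cliques_def)
          moreover have "T \<subseteq> nbr (S - {e}) u" using T1 uT uv by (auto simp: nbr_def doubleton_eq_iff)
          ultimately show "T \<in> {T. T \<in> cliques (r - 1) (S - {e}) (W - {u}) \<and> T \<subseteq> nbr (S - {e}) u}" by simp
        qed
      qed simp
      also have "\<dots> = ?\<Phi>'"
        using num_factors_root_link[OF finW uvW(1), of "r - 1" "S - {e}"] r3 by simp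
      finally have lower: "eps e1 r (r - 1) / 2 * D * \<theta> \<le> ?\<Phi>'" .
      have lw0: "0 < eps e1 r (r - 1) / 2 * D * \<theta>" using eps0[of "r - 1"] D_ge \<theta>0 by simp
      hence p': "?\<Phi>' > 0" using lower by linarith
      have "?\<Phi> / ?\<Phi>' \<le> (?\<Phi>' + real (card ?E) * real (w Z)) / ?\<Phi>'"
        using le sumE p' by (intro divide_right_mono) linarith+
      also have "\<dots> = 1 + real (card ?E) * real (w Z) / ?\<Phi>'" using p' by (simp add: add_divide_distrib)
      also have "\<dots> \<le> 1 + real (card ?E) * real (w Z) / (eps e1 r (r - 1) / 2 * D * \<theta>)"
        using lower lw0 p' by (intro add_left_mono divide_left_mono) (auto intro!: mult_pos_pos)
      also have "\<dots> = 1 + 2 / (eps e1 r (r - 1) * c1 e1 ^ (r - 1)) * real (card ?E) / D"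
        using w0 by (simp add: \<theta>_def mult_ac)
      also have "\<dots> \<le> 1 + C1 e1 * real (card ?E) / D"
        using C1 D_ge by (intro add_left_mono divide_right_mono mult_right_mono) auto
      finally have "ln (?\<Phi> / ?\<Phi>') \<le> C1 e1 * real (card ?E) / D"
        using ln_le_minus_one[of "?\<Phi> / ?\<Phi>'"] \<Phi>0 p' by simp
      thus ?thesis using p' by simp
    qed
  qed
  thus "num_factors r (S - {e}) W > 0" by simp
  from claim show "ln (real (num_factors r S W) / real (num_factors r (S - {e}) W)) \<le> C1 e1 * real (card {Z \<in> cliques r S W. e \<in> pairs Z}) / D"
    by simp
qed

end

section \<open>The probability of a witness at a fixed snapshot\<close>

definition star :: "nat \<Rightarrow> nat set \<Rightarrow> nat set set" where
  "star x N = (\<lambda>v. {x, v}) ` N"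

text \<open>A root set that contains \<open>x\<close> hides the pairs at \<open>x\<close>.\<close>
lemma rich_cliques_cong:
  assumes "\<And>g. x \<notin> g \<Longrightarrow> g \<in> S \<longleftrightarrow> g \<in> S'" "x \<in> R"
  shows "rich_cliques r k S W R \<theta> v = rich_cliques r k S' W R \<theta> v"
proof -
  have *: "S \<inter> pairs V = S' \<inter> pairs V" if "x \<notin> V" for V
  proof -
    have "g \<in> S \<longleftrightarrow> g \<in> S'" if "g \<in> pairs V" for g
      using assms(1)[of g] that \<open>x \<notin> V\<close> by (auto simp: pairs_def)
    thus ?thesis by blast
  qed
  have "cliques k S (W - R - {v}) = cliques k S' (W - R - {v})"
    by (rule cliques_cong, rule *) (use assms(2) in auto)
  moreover have "num_factors r S (W - (R \<union> T)) = num_factors r S' (W - (R \<union> T))" for T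
    by (rule num_factors_cong, rule *) (use assms(2) in auto)
  ultimately show ?thesis unfolding rich_cliques_def by simp
qed

text \<open>A decreasing family has a least and a greatest member with a given property. One tail bound for this
member covers all thresholds \<open>\<theta>\<close> at once.\<close>
lemma nested_least:
  fixes \<A> :: "nat \<Rightarrow> 'a set"
  assumes "\<And>\<theta>. finite (\<A> \<theta>)" "\<And>\<theta> \<theta>'. \<theta> \<le> \<theta>' \<Longrightarrow> \<A> \<theta>' \<subseteq> \<A> \<theta>" "P \<theta>1"
  obtains \<theta>0 where "P \<theta>0" "\<And>\<theta>. P \<theta> \<Longrightarrow> \<A> \<theta>0 \<subseteq> \<A> \<theta>"
proof -
  obtain \<theta>0 where \<theta>0: "P \<theta>0" "\<And>\<theta>. P \<theta> \<Longrightarrow> card (\<A> \<theta>0) \<le> card (\<A> \<theta>)"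
    using ex_has_least_nat[of P \<theta>1 "\<lambda>\<theta>. card (\<A> \<theta>)"] assms(3) by blast
  have "\<A> \<theta>0 \<subseteq> \<A> \<theta>" if "P \<theta>" for \<theta>
  proof (cases "\<theta> \<le> \<theta>0")
    case True thus ?thesis by (rule assms(2))
  next
    case False
    hence "\<A> \<theta> \<subseteq> \<A> \<theta>0" by (intro assms(2)) simp
    hence "\<A> \<theta> = \<A> \<theta>0" using card_subset_eq[OF assms(1)] \<theta>0(2)[OF that] card_mono[OF assms(1)] by (metis antisym)
    thus ?thesis by simp
  qed
  thus ?thesis using that \<theta>0(1) by blast
qed

lemma nested_greatest:
  fixes \<A> :: "nat \<Rightarrow> 'a set"
  assumes "\<And>\<theta>. finite (\<A> \<theta>)" "\<And>\<theta> \<theta>'. \<theta> \<le> \<theta>' \<Longrightarrow> \<A> \<theta>' \<subseteq> \<A> \<theta>" "P \<theta>1"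
  obtains \<theta>0 where "P \<theta>0" "\<And>\<theta>. P \<theta> \<Longrightarrow> \<A> \<theta> \<subseteq> \<A> \<theta>0"
proof -
  define \<theta>0 where "\<theta>0 = (LEAST \<theta>. P \<theta>)"
  have "P \<theta>0" unfolding \<theta>0_def by (rule LeastI[of P, OF assms(3)])
  moreover have "\<A> \<theta> \<subseteq> \<A> \<theta>0" if "P \<theta>" for \<theta>
    using assms(2) Least_le[of P, OF that] unfolding \<theta>0_def by blast
  ultimately show ?thesis using that by blast
qed

lemma bexp_antimono_insert:
  assumes "finite V" "u \<notin> V" "0 \<le> q" "q \<le> 1" "\<And>N. N \<subseteq> V \<Longrightarrow> g (insert u N) \<le> g N"
  shows "bexp q V (\<lambda>N. g (insert u N)) \<le> bexp q (insert u V) g"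
proof -
  have "bexp q V (\<lambda>N. g (insert u N)) \<le> bexp q V g" by (rule bexp_mono) (use assms in auto)
  hence "(1 - q) * bexp q V (\<lambda>N. g (insert u N)) \<le> (1 - q) * bexp q V g" using assms by (intro mult_left_mono) auto
  thus ?thesis using bexp_insert[OF assms(1,2), of q g] by (simp add: algebra_simps)
qed

text \<open>The variance term of Janson's inequality: pairs of cliques that share \<open>i\<close> vertices contribute the
square of the mean divided by the \<open>i\<close>-th link scale, and every link scale is at least
\<open>m\<close>.\<close>
lemma pair_sum_le:
  assumes finV: "finite V" and k: "1 \<le> k" "k \<le> r - 1" and q: "0 < q" "q \<le> 1" and \<kappa>: "\<kappa> \<ge> 0" and n: "n > 0"
    and pb: "pair_bound r n \<kappa> S V q"
    and m: "0 < m" "m \<le> real n * q" "m \<le> clique_scale n (r - 1) q * q ^ (r - 1)"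
    and sub: "\<A> \<subseteq> cliques k S V"
  shows "(\<Sum>T\<in>\<A>. \<Sum>T' | T' \<in> \<A> \<and> T' \<inter> T \<noteq> {}. q ^ card (T \<union> T')) \<le> real r * (\<kappa> * (clique_scale n k q * q ^ k)\<^sup>2 / m)"
proof -
  let ?C = "cliques k S V"
  have fC: "finite ?C" using finV by simp
  have fA: "finite \<A>" by (rule finite_subset[OF sub fC])
  let ?P = "\<lambda>i. {(T, T'). T \<in> ?C \<and> T' \<in> ?C \<and> card (T \<inter> T') = i}"
  have fP: "finite (?P i)" for i by (rule finite_subset[of _ "?C \<times> ?C"]) (use fC in auto)
  have "(\<Sum>T\<in>\<A>. \<Sum>T' | T' \<in> \<A> \<and> T' \<inter> T \<noteq> {}. q ^ card (T \<union> T')) = (\<Sum>(T, T')\<in>(SIGMA T:\<A>. {T'. T' \<in> \<A> \<and> T' \<inter> T \<noteq> {}}). q ^ card (T \<union> T'))"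
    by (rule sum.Sigma) (use fA in auto)
  also have "\<dots> \<le> (\<Sum>(T, T')\<in>(\<Union>i\<in>{1..k}. ?P i). q ^ card (T \<union> T'))"
  proof (rule sum_mono2)
    show "finite (\<Union>i\<in>{1..k}. ?P i)" using fP by auto
    show "(SIGMA T:\<A>. {T'. T' \<in> \<A> \<and> T' \<inter> T \<noteq> {}}) \<subseteq> (\<Union>i\<in>{1..k}. ?P i)"
    proof
      fix z assume z: "z \<in> (SIGMA T:\<A>. {T'. T' \<in> \<A> \<and> T' \<inter> T \<noteq> {}})"
      then obtain T T' where e: "z = (T, T')" "T \<in> ?C" "T' \<in> ?C" "T' \<inter> T \<noteq> {}" using sub by auto
      have f: "finite T" by (rule clique_finite[OF finV e(2)])
      have "card (T \<inter> T') \<ge> 1" using e(4) f by (metis Int_commute One_nat_def Suc_leI card_gt_0_iff finite_Int)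
      moreover have "card (T \<inter> T') \<le> k" using card_mono[OF f, of "T \<inter> T'"] e(2) by (simp add: cliques_def)
      ultimately show "z \<in> (\<Union>i\<in>{1..k}. ?P i)" using e by auto
    qed
  qed (use q in auto)
  also have "\<dots> = (\<Sum>i\<in>{1..k}. \<Sum>(T, T')\<in>?P i. q ^ card (T \<union> T'))"
    by (rule sum.UNION_disjoint) (use fP in auto)
  also have "\<dots> = (\<Sum>i\<in>{1..k}. real (pair_count k i S V) * q ^ (2 * k - i))"
  proof (rule sum.cong[OF refl])
    fix i assume i: "i \<in> {1..k}"
    have "(\<Sum>(T, T')\<in>?P i. q ^ card (T \<union> T')) = (\<Sum>z\<in>?P i. q ^ (2 * k - i))"
    proof (rule sum.cong[OF refl])
      fix z assume "z \<in> ?P i"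
      then obtain T T' where e: "z = (T, T')" "T \<in> ?C" "T' \<in> ?C" "card (T \<inter> T') = i" by auto
      have "card (T \<union> T') + card (T \<inter> T') = card T + card T'"
        using card_Un_Int[OF clique_finite[OF finV e(2)] clique_finite[OF finV e(3)]] by simp
      hence "card (T \<union> T') = 2 * k - i" using e by (simp add: cliques_def)
      thus "(case z of (T, T') \<Rightarrow> q ^ card (T \<union> T')) = q ^ (2 * k - i)" using e by simp
    qed
    thus "(\<Sum>(T, T')\<in>?P i. q ^ card (T \<union> T')) = real (pair_count k i S V) * q ^ (2 * k - i)"
      by (simp add: pair_count_def)
  qed
  also have "\<dots> \<le> (\<Sum>i\<in>{1..k}. \<kappa> * (clique_scale n k q * q ^ k)\<^sup>2 / m)"
  proof (rule sum_mono)
    fix i assume i: "i \<in> {1..k}"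
    have c: "i choose 2 \<le> k choose 2" using i by (simp add: binomial_right_mono)
    have "real (pair_count k i S V) * q ^ (2 * k - i) \<le> \<kappa> * (real n ^ (2 * k - i) * q ^ (2 * (k choose 2) - (i choose 2))) * q ^ (2 * k - i)"
      by (rule mult_right_mono) (use pb k i q in \<open>auto simp: pair_bound_def\<close>)
    also have "\<dots> = \<kappa> * ((clique_scale n k q * q ^ k)\<^sup>2 / (clique_scale n i q * q ^ i))"
    proof -
      have "2 * (k choose 2) - (i choose 2) + (i choose 2) = 2 * (k choose 2)" "2 * k - i + i = 2 * k" using c i by auto
      hence p: "real n ^ (2 * k - i) * real n ^ i = real n ^ (2 * k)" "q ^ (2 * (k choose 2) - (i choose 2)) * q ^ (i choose 2) = q ^ (2 * (k choose 2))"
        "q ^ (2 * k - i) * q ^ i = q ^ (2 * k)"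
        by (metis power_add)+
      let ?X = "real n ^ (2 * k - i) * q ^ (2 * (k choose 2) - (i choose 2)) * q ^ (2 * k - i)"
      have "?X * (clique_scale n i q * q ^ i) = (real n ^ (2 * k - i) * real n ^ i) *
          (q ^ (2 * (k choose 2) - (i choose 2)) * q ^ (i choose 2)) * (q ^ (2 * k - i) * q ^ i)"
        unfolding clique_scale_def by (simp only: mult_ac)
      also have "\<dots> = (clique_scale n k q * q ^ k)\<^sup>2"
        unfolding p clique_scale_def power_mult_distrib by (simp only: power_mult[symmetric] mult.commute[of 2])
      finally have "?X * (clique_scale n i q * q ^ i) = (clique_scale n k q * q ^ k)\<^sup>2" .
      moreover have "clique_scale n i q * q ^ i \<noteq> 0" using q n by (simp add: clique_scale_def)
      ultimately have "?X = (clique_scale n k q * q ^ k)\<^sup>2 / (clique_scale n i q * q ^ i)"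
        by (rule eq_divide_imp[rotated])
      hence "\<kappa> * ?X = \<kappa> * ((clique_scale n k q * q ^ k)\<^sup>2 / (clique_scale n i q * q ^ i))" by (rule arg_cong)
      thus ?thesis by (simp only: mult.assoc)
    qed
    also have "\<dots> \<le> \<kappa> * ((clique_scale n k q * q ^ k)\<^sup>2 / m)"
    proof -
      have "m \<le> clique_scale n i q * q ^ i" by (rule link_scale_ge_min[where t = "r - 1"]) (use q i k n m in auto)
      thus ?thesis using \<kappa> m by (intro mult_left_mono frac_le) auto
    qed
    finally show "real (pair_count k i S V) * q ^ (2 * k - i) \<le> \<kappa> * (clique_scale n k q * q ^ k)\<^sup>2 / m" by simp
  qed
  also have "\<dots> = real k * (\<kappa> * (clique_scale n k q * q ^ k)\<^sup>2 / m)" by simp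
  also have "\<dots> \<le> real r * (\<kappa> * (clique_scale n k q * q ^ k)\<^sup>2 / m)"
    by (rule mult_right_mono) (use k \<kappa> m in auto)
  finally show ?thesis .
qed

text \<open>Given the pairs \<open>H\<close> off the random part of the star of \<open>x\<close>, the rich cliques form a fixed
family whose pair counts are under control, and Janson's inequality applies to the least family of
density \<open>\<epsilon>\<close>. If the pair that defines the snapshot lies at \<open>x\<close>, one neighbour is
present with certainty; this only raises the count, so it may be replaced by a random one.\<close>
lemma sparse_nbhd_prob:
  assumes W: "finite W" and x: "x \<in> W" "x \<in> R" and k: "1 \<le> k" "k \<le> r - 1" and q: "0 < q" "q \<le> 1"
    and \<kappa>: "\<kappa> > 0" and n: "n > 0" and \<epsilon>: "\<epsilon> > 0"
    and m: "0 < m" "m \<le> real n * q" "m \<le> clique_scale n (r - 1) q * q ^ (r - 1)"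
    and H: "H \<subseteq> pairs W" "\<And>g. g \<in> H \<Longrightarrow> x \<in> g \<Longrightarrow> t = Some g" "\<And>g. t = Some g \<Longrightarrow> g \<in> H"
  shows "bexp q {v \<in> W - {x}. t \<noteq> Some {x, v}} (\<lambda>N. if sparse_nbhd r n W (H \<union> star x N) q \<epsilon> k R x v \<and>
      pair_bound r n \<kappa> {g \<in> H \<union> star x N. x \<notin> g} W q then 1 else 0) \<le> exp (- (\<epsilon>\<^sup>2 / (8 * real r * \<kappa>)) * m)"
    (is "bexp q ?V ?bad \<le> _")
proof -
  define H0 where "H0 = {g \<in> H. x \<notin> g}"
  define \<A> where "\<A> \<theta> = rich_cliques r k H0 W R (real \<theta>) v" for \<theta> :: nat
  let ?a = "clique_scale n k q * q ^ k"
  have a0: "?a > 0" "clique_scale n k q > 0" using q n by (auto simp: clique_scale_def)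
  have r0: "r > 0" using k by auto
  have H0N: "{g \<in> H \<union> star x N. x \<notin> g} = H0" for N by (auto simp: H0_def star_def)
  have famA: "rich_cliques r k (H \<union> star x N) W R (real \<theta>) v = \<A> \<theta>" for N \<theta>
    unfolding \<A>_def by (rule rich_cliques_cong[of x]) (use x in \<open>auto simp: H0_def star_def\<close>)
  define P where "P \<theta> \<longleftrightarrow> \<epsilon> * clique_scale n k q \<le> real (card (\<A> \<theta>))" for \<theta>
  have finV: "finite ?V" using W by simp
  have exp0: "0 \<le> exp (- (\<epsilon>\<^sup>2 / (8 * real r * \<kappa>)) * m)" by simp
  show ?thesis
  proof (cases "(\<exists>\<theta>. P \<theta>) \<and> pair_bound r n \<kappa> H0 W q")
    case False
    have "bexp q ?V ?bad = bexp q ?V (\<lambda>N. 0)"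
      unfolding H0N sparse_nbhd_def famA using False by (intro bexp_cong) (auto simp: P_def)
    thus ?thesis using finV exp0 by simp
  next
    case True
    then obtain \<theta>1 where "P \<theta>1" by blast
    then obtain \<theta>0 where \<theta>0: "P \<theta>0" "\<And>\<theta>. P \<theta> \<Longrightarrow> \<A> \<theta>0 \<subseteq> \<A> \<theta>"
      by (rule nested_least[where \<A> = \<A> and P = P, rotated 2]) (use W in \<open>auto simp: \<A>_def intro!: rich_cliques_antimono\<close>)
    define F where "F = \<A> \<theta>0"
    have finF: "finite F" using W by (simp add: F_def \<A>_def)
    have Fsub: "F \<subseteq> cliques k H0 W" "\<And>T. T \<in> F \<Longrightarrow> T \<subseteq> W - {x} \<and> card T = k"
      using x by (auto simp: F_def \<A>_def rich_cliques_def cliques_def)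
    define g where "g N = (if real (card {T \<in> F. T \<subseteq> N}) \<le> \<epsilon> / 2 * ?a then 1 else 0 :: real)" for N
    have gmono: "g N' \<le> g N" if "N \<subseteq> N'" for N N'
    proof -
      have "card {T \<in> F. T \<subseteq> N} \<le> card {T \<in> F. T \<subseteq> N'}" using finF that by (intro card_mono) auto
      thus ?thesis by (auto simp: g_def)
    qed
    define u where "u = {u. t = Some {x, u}}"
    have badg: "?bad N \<le> g (N \<union> u)" for N
    proof (cases "sparse_nbhd r n W (H \<union> star x N) q \<epsilon> k R x v")
      case True
      then obtain \<theta> where th: "P \<theta>" "real (card {T \<in> \<A> \<theta>. T \<subseteq> nbr (H \<union> star x N) x}) < \<epsilon> / 2 * ?a"
        unfolding sparse_nbhd_def famA P_def by blast
      have nb: "N \<union> u \<subseteq> nbr (H \<union> star x N) x" using H(3) by (auto simp: nbr_def star_def u_def)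
      have "card {T \<in> F. T \<subseteq> N \<union> u} \<le> card {T \<in> \<A> \<theta>. T \<subseteq> nbr (H \<union> star x N) x}"
        using \<theta>0(2)[OF th(1)] nb W by (intro card_mono) (auto simp: F_def \<A>_def)
      hence "real (card {T \<in> F. T \<subseteq> N \<union> u}) \<le> \<epsilon> / 2 * ?a" using th(2) by linarith
      thus ?thesis by (simp add: g_def)
    qed (simp add: g_def)
    have step1: "bexp q ?V ?bad \<le> bexp q ?V (\<lambda>N. g (N \<union> u))"
      by (rule bexp_mono) (use q badg in auto)
    have step2: "bexp q ?V (\<lambda>N. g (N \<union> u)) \<le> bexp q (W - {x}) g"
    proof (cases "\<exists>w. t = Some {x, w}")
      case False
      hence "u = {}" "?V = W - {x}" by (auto simp: u_def)
      thus ?thesis by simp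
    next
      case True
      then obtain w where w: "t = Some {x, w}" by blast
      hence "{x, w} \<in> pairs W" using H by blast
      hence w': "w \<in> W" "w \<noteq> x" by (auto simp: pairs_def card_insert_if)
      have u: "u = {w}" using w by (auto simp: u_def doubleton_eq_iff)
      have V: "?V = W - {x} - {w}" using w by (auto simp: doubleton_eq_iff)
      have ins: "insert w ?V = W - {x}" using w' unfolding V by auto
      have "bexp q ?V (\<lambda>N. g (insert w N)) \<le> bexp q (insert w ?V) g"
        by (rule bexp_antimono_insert[OF finV]) (use q w in \<open>auto intro!: gmono\<close>)
      thus ?thesis unfolding ins u by simp
    qed
    define E where "E = (\<Sum>T\<in>F. q ^ card T)"
    have E: "E = real (card F) * q ^ k" unfolding E_def using Fsub(2) by simp
    have Ege: "\<epsilon> * ?a \<le> E"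
    proof -
      have "\<epsilon> * clique_scale n k q * q ^ k \<le> real (card F) * q ^ k"
        using \<theta>0(1) q by (intro mult_right_mono) (auto simp: P_def F_def)
      thus ?thesis by (simp add: E mult.assoc)
    qed
    have E0: "E > 0" using Ege \<epsilon> a0 by (meson less_le_trans mult_pos_pos)
    define Dl where "Dl = real r * (\<kappa> * ?a\<^sup>2 / m)"
    have Dl0: "Dl > 0"
      unfolding Dl_def using r0 \<kappa> zero_less_power[OF a0(1), of 2] m(1) by (intro mult_pos_pos divide_pos_pos) auto
    have "bexp q (W - {x}) g \<le> bexp q (W - {x}) (\<lambda>N. if real (card {T \<in> F. T \<subseteq> N}) \<le> E - E / 2 then 1 else 0)"
      by (rule bexp_mono) (use q Ege in \<open>auto simp: g_def\<close>)
    also have "\<dots> \<le> exp (- ((E / 2)\<^sup>2 / (2 * Dl)))"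
      unfolding E_def
    proof (rule janson_lower_tail)
      show "(\<Sum>T\<in>F. \<Sum>T' | T' \<in> F \<and> T' \<inter> T \<noteq> {}. q ^ card (T \<union> T')) \<le> Dl"
        unfolding Dl_def by (rule pair_sum_le[OF W k q _ n _ m Fsub(1)]) (use \<kappa> True in auto)
    qed (use W finF Fsub(2) q Dl0 E0 in \<open>auto simp: E_def\<close>)
    also have "\<dots> \<le> exp (- (\<epsilon>\<^sup>2 / (8 * real r * \<kappa>)) * m)"
    proof -
      have "(\<epsilon> * ?a)\<^sup>2 \<le> E\<^sup>2" using Ege \<epsilon> a0 by (intro power_mono) auto
      hence "(\<epsilon> * ?a)\<^sup>2 / (8 * Dl) \<le> E\<^sup>2 / (8 * Dl)" using Dl0 by (intro divide_right_mono) auto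
      moreover have "(\<epsilon> * ?a)\<^sup>2 / (8 * Dl) = \<epsilon>\<^sup>2 / (8 * real r * \<kappa>) * m"
      proof -
        have "(\<epsilon> * a)\<^sup>2 / (8 * (real r * (\<kappa> * a\<^sup>2 / m))) = \<epsilon>\<^sup>2 / (8 * real r * \<kappa>) * m" if "a > 0" for a
          using that r0 \<kappa> m(1) by (simp add: field_simps power2_eq_square)
        from this[OF a0(1)] show ?thesis unfolding Dl_def .
      qed
      moreover have "E\<^sup>2 / (8 * Dl) = (E / 2)\<^sup>2 / (2 * Dl)" by (simp add: power2_eq_square)
      ultimately show ?thesis by simp
    qed
    finally show ?thesis using step1 step2 by linarith
  qed
qed

text \<open>Markov's inequality for the number of disjoint \<open>K\<close>-tuples in the neighbourhood, applied to the
greatest family of density below \<open>\<epsilon>\<close>. A forced neighbour would destroy the bound on the moment,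
hence the assumption that \<open>H\<close> has no pair at \<open>y\<close>.\<close>
lemma crowded_nbhd_prob:
  assumes W: "finite W" and y: "y \<in> W" "y \<in> R" and q: "0 < q" "q \<le> 1" and n: "n > 0" and \<epsilon>: "\<epsilon> > 0" and \<eta>: "\<eta> > 0"
    and H: "H \<subseteq> pairs W" "\<And>g. g \<in> H \<Longrightarrow> y \<notin> g"
  shows "bexp q (W - {y}) (\<lambda>N. if crowded_nbhd r n W (H \<union> star y N) q \<epsilon> \<eta> K R y then 1 else 0) \<le> (\<epsilon> / \<eta>) ^ K"
    (is "bexp q ?V ?bad \<le> _")
proof -
  define \<A> where "\<A> \<theta> = rich_cliques r (r - 1) H W R (real \<theta>) y" for \<theta> :: nat
  let ?a = "clique_scale n (r - 1) q * q ^ (r - 1)"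
  have a0: "?a > 0" using q n by (auto simp: clique_scale_def)
  have famA: "rich_cliques r (r - 1) (H \<union> star y N) W R (real \<theta>) y = \<A> \<theta>" for N \<theta>
    unfolding \<A>_def by (rule rich_cliques_cong[of y]) (use y in \<open>auto simp: star_def\<close>)
  define P where "P \<theta> \<longleftrightarrow> real (card (\<A> \<theta>)) < \<epsilon> * clique_scale n (r - 1) q" for \<theta>
  have finV: "finite ?V" using W by simp
  have nb: "nbr (H \<union> star y N) y = N" for N
  proof -
    have "{y, v} \<in> H \<union> star y N \<longleftrightarrow> v \<in> N" for v
    proof
      assume "{y, v} \<in> H \<union> star y N"
      hence "{y, v} \<in> star y N" using H(2)[of "{y, v}"] by blast
      thus "v \<in> N" unfolding star_def by (auto simp: doubleton_eq_iff)
    qed (simp add: star_def)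
    thus ?thesis unfolding nbr_def by simp
  qed
  show ?thesis
  proof (cases "\<exists>\<theta>. P \<theta>")
    case False
    have "bexp q ?V ?bad = bexp q ?V (\<lambda>N. 0)"
      unfolding crowded_nbhd_def famA using False by (intro bexp_cong) (auto simp: P_def)
    thus ?thesis using finV \<epsilon> \<eta> by simp
  next
    case True
    then obtain \<theta>1 where "P \<theta>1" by blast
    then obtain \<theta>0 where \<theta>0: "P \<theta>0" "\<And>\<theta>. P \<theta> \<Longrightarrow> \<A> \<theta> \<subseteq> \<A> \<theta>0"
      by (rule nested_greatest[where \<A> = \<A> and P = P, rotated 2]) (use W in \<open>auto simp: \<A>_def intro!: rich_cliques_antimono\<close>)
    define F where "F = \<A> \<theta>0"
    have finF: "finite F" using W by (simp add: F_def \<A>_def)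
    have Fsub: "\<And>T. T \<in> F \<Longrightarrow> T \<subseteq> W - {y} \<and> card T = r - 1"
      using y by (auto simp: F_def \<A>_def rich_cliques_def cliques_def)
    let ?B = "(\<eta> * ?a) ^ K"
    have B0: "?B > 0" using \<eta> a0 by simp
    have "bexp q ?V ?bad \<le> bexp q ?V (\<lambda>N. if ?B \<le> real (card (disjoint_tuples K {T \<in> F. T \<subseteq> N})) then 1 else 0)"
    proof (rule bexp_mono)
      fix N
      show "?bad N \<le> (if ?B \<le> real (card (disjoint_tuples K {T \<in> F. T \<subseteq> N})) then 1 else 0)"
      proof (cases "crowded_nbhd r n W (H \<union> star y N) q \<epsilon> \<eta> K R y")
        case True
        then obtain \<theta> where th: "P \<theta>" "?B \<le> real (card (disjoint_tuples K {T \<in> \<A> \<theta>. T \<subseteq> N}))"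
          unfolding crowded_nbhd_def famA P_def nb by (auto simp: mult.assoc)
        have "card (disjoint_tuples K {T \<in> \<A> \<theta>. T \<subseteq> N}) \<le> card (disjoint_tuples K {T \<in> F. T \<subseteq> N})"
        proof (rule card_mono)
          show "finite (disjoint_tuples K {T \<in> F. T \<subseteq> N})" using finF by simp
          show "disjoint_tuples K {T \<in> \<A> \<theta>. T \<subseteq> N} \<subseteq> disjoint_tuples K {T \<in> F. T \<subseteq> N}"
            using \<theta>0(2)[OF th(1)] unfolding disjoint_tuples_def F_def by blast
        qed
        thus ?thesis using th(2) by simp
      qed simp
    qed (use q in auto)
    also have "\<dots> \<le> bexp q ?V (\<lambda>N. real (card (disjoint_tuples K {T \<in> F. T \<subseteq> N}))) / ?B"
      by (rule bexp_markov[OF finV]) (use q B0 in auto)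
    also have "\<dots> \<le> (real (card F) * q ^ (r - 1)) ^ K / ?B"
      using B0 by (intro divide_right_mono bexp_card_disjoint_tuples_le[OF finV finF]) (use Fsub q in auto)
    also have "\<dots> \<le> (\<epsilon> * ?a) ^ K / ?B"
    proof (intro divide_right_mono power_mono)
      have "real (card F) * q ^ (r - 1) \<le> \<epsilon> * clique_scale n (r - 1) q * q ^ (r - 1)"
        using \<theta>0(1) q by (intro mult_right_mono) (auto simp: P_def F_def)
      thus "real (card F) * q ^ (r - 1) \<le> \<epsilon> * ?a" by (simp add: mult.assoc)
    qed (use B0 q in auto)
    also have "\<dots> = (\<epsilon> / \<eta>) ^ K"
      unfolding power_divide[symmetric] by (subst nonzero_mult_divide_mult_cancel_right[OF a0[THEN less_imp_neq, THEN not_sym]]) (rule refl)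
    finally show ?thesis .
  qed
qed

section \<open>Light losses along a random order\<close>

definition loss :: "nat \<Rightarrow> nat set \<Rightarrow> nat set set \<Rightarrow> nat set \<Rightarrow> real" where
  "loss r W S e = ln (real (num_factors r S W) / real (num_factors r (S - {e}) W))"

text \<open>Only losses up to the threshold \<open>b\<close> have useful exponential moments. The others are replaced by
zero here and are bounded deterministically elsewhere.\<close>
definition light :: "nat \<Rightarrow> nat set \<Rightarrow> (nat \<Rightarrow> real) \<Rightarrow> nat set set \<Rightarrow> nat set \<Rightarrow> real" where
  "light r W b S e = (if num_factors r (S - {e}) W > 0 \<and> loss r W S e \<le> b (card S) then loss r W S e else 0)"

text \<open>The entries are removed from the front of the list, so that the suffixes are the successive graphs;
the summation stops when \<open>m\<close> pairs are left.\<close>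
fun light_sum :: "nat \<Rightarrow> nat set \<Rightarrow> (nat \<Rightarrow> real) \<Rightarrow> nat \<Rightarrow> nat set list \<Rightarrow> real" where
  "light_sum r W b m [] = 0"
| "light_sum r W b m (e # l) = (if m < length (e # l) then light r W b (set (e # l)) e + light_sum r W b m l else 0)"

lemma loss_nonneg:
  assumes "finite W" "num_factors r (S - {e}) W > 0"
  shows "loss r W S e \<ge> 0"
proof -
  have "num_factors r (S - {e}) W \<le> num_factors r S W" by (rule num_factors_mono[OF assms(1)]) auto
  hence "1 \<le> real (num_factors r S W) / real (num_factors r (S - {e}) W)" using assms(2) by (simp add: le_divide_eq)
  thus ?thesis unfolding loss_def by (intro ln_ge_zero)
qed

lemma light_sum_short: "length l \<le> m \<Longrightarrow> light_sum r W b m l = 0"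
  by (cases l) auto

text \<open>If \<open>\<xi> e\<close> is the proportion of factors lost with \<open>e\<close>, a light loss \<open>l\<close> satisfies
\<open>exp (lam * l) \<le> 1 + lam * (1 + O(lam * b)) * \<xi> e\<close>, and the \<open>\<xi> e\<close> sum up to at most
\<open>\<Gamma>\<close>.\<close>
lemma exp_light_step:
  assumes W: "finite W" and S: "finite S" "S \<noteq> {}" and r: "r > 0"
    and b: "0 \<le> b (card S)" "b (card S) \<le> 1 / 2" and lam: "1 \<le> lam" "lam * b (card S) \<le> 1"
  defines "\<Gamma> \<equiv> real (r - 1) * real (card W) / 2"
  shows "(\<Sum>e\<in>S. exp (lam * light r W b S e)) \<le> real (card S) * exp (lam * (1 + 5 * (lam * b (card S))) * \<Gamma> / real (card S))"
proof -
  let ?b = "b (card S)" and ?\<Phi> = "real (num_factors r S W)"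
  have cS: "real (card S) > 0" using S by (simp add: card_gt_0_iff)
  define c where "c = lam * (1 + 5 * (lam * ?b))"
  have c0: "c \<ge> 0" using lam b by (simp add: c_def)
  have \<Gamma>0: "\<Gamma> \<ge> 0" by (simp add: \<Gamma>_def)
  define \<xi> where "\<xi> e = real (num_factors r S W - num_factors r (S - {e}) W) / ?\<Phi>" for e
  have pt: "exp (lam * light r W b S e) \<le> 1 + c * \<xi> e" for e
  proof (cases "num_factors r (S - {e}) W > 0 \<and> loss r W S e \<le> ?b")
    case False
    hence "light r W b S e = 0" by (auto simp: light_def)
    thus ?thesis using c0 by (simp add: \<xi>_def)
  next
    case True
    let ?\<Phi>' = "real (num_factors r (S - {e}) W)"
    define l where "l = loss r W S e"
    have le: "num_factors r (S - {e}) W \<le> num_factors r S W" by (rule num_factors_mono[OF W]) auto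
    have p: "?\<Phi>' > 0" "?\<Phi> > 0" using True le by auto
    have l: "0 \<le> l" "l \<le> ?b" using loss_nonneg[OF W] True by (auto simp: l_def)
    define x where "x = ?\<Phi>' / ?\<Phi>"
    have x0: "x > 0" using p by (simp add: x_def)
    have lx: "l = - ln x" unfolding l_def loss_def x_def using p by (simp add: ln_div)
    have \<xi>: "\<xi> e = 1 - x" unfolding \<xi>_def x_def using le p by (simp add: of_nat_diff diff_divide_distrib)
    have xb: "1 - ?b \<le> x"
    proof -
      have "1 - ?b \<le> exp (- ?b)" using exp_ge_add_one_self[of "- ?b"] by simp
      also have "\<dots> \<le> exp (- l)" using l by simp
      also have "\<dots> = x" using lx x0 by simp
      finally show ?thesis .
    qed
    have x1: "x \<le> 1" using le p by (simp add: x_def)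
    have \<xi>0: "\<xi> e \<ge> 0" using \<xi> x1 by simp
    have l\<xi>: "l \<le> (1 + 2 * ?b) * \<xi> e"
    proof -
      have "ln (1 / x) \<le> 1 / x - 1" using x0 by (intro ln_le_minus_one) simp
      hence "l \<le> \<xi> e * (1 / x)" using lx x0 \<xi> by (simp add: ln_div field_simps)
      also have "1 / x \<le> 1 + 2 * ?b"
      proof -
        have "1 \<le> (1 + 2 * ?b) * (1 - ?b)" using mult_nonneg_nonneg[of ?b "1 - 2 * ?b"] b by (simp add: algebra_simps)
        also have "\<dots> \<le> (1 + 2 * ?b) * x" using xb b by (intro mult_left_mono) auto
        finally show ?thesis using x0 by (simp add: divide_le_eq)
      qed
      hence "\<xi> e * (1 / x) \<le> \<xi> e * (1 + 2 * ?b)" using \<xi>0 by (intro mult_left_mono) auto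
      finally show ?thesis by (simp add: mult.commute)
    qed
    have laml: "0 \<le> lam * l" "lam * l \<le> 1"
    proof -
      show "0 \<le> lam * l" using lam l by simp
      have "lam * l \<le> lam * ?b" using lam l by (intro mult_left_mono) auto
      thus "lam * l \<le> 1" using lam by linarith
    qed
    have "exp (lam * l) \<le> 1 + lam * l + (lam * l)\<^sup>2" by (rule exp_bound[OF laml])
    also have "\<dots> \<le> 1 + lam * l * (1 + lam * ?b)"
    proof -
      have "(lam * l) * (lam * l) \<le> (lam * l) * (lam * ?b)" using laml lam l by (intro mult_left_mono) auto
      thus ?thesis by (simp add: power2_eq_square algebra_simps)
    qed
    also have "\<dots> \<le> 1 + lam * ((1 + 2 * ?b) * \<xi> e) * (1 + lam * ?b)"
      using lam l\<xi> b by (intro add_left_mono mult_right_mono mult_left_mono) auto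
    also have "\<dots> \<le> 1 + c * \<xi> e"
    proof -
      have "?b \<le> lam * ?b" using lam b mult_right_mono[of 1 lam ?b] by simp
      hence "(1 + 2 * ?b) * (1 + lam * ?b) \<le> (1 + 2 * (lam * ?b)) * (1 + lam * ?b)"
        using lam b by (intro mult_right_mono) auto
      also have "\<dots> \<le> 1 + 5 * (lam * ?b)"
      proof -
        have "(lam * ?b) * (lam * ?b) \<le> (lam * ?b) * 1" using lam b by (intro mult_left_mono) auto
        thus ?thesis by (simp add: algebra_simps)
      qed
      finally have "lam * \<xi> e * ((1 + 2 * ?b) * (1 + lam * ?b)) \<le> lam * \<xi> e * (1 + 5 * (lam * ?b))"
        using lam \<xi>0 by (intro mult_left_mono) auto
      thus ?thesis by (simp add: c_def mult_ac)
    qed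
    finally show ?thesis using True by (simp add: light_def l_def)
  qed
  have sum\<xi>: "(\<Sum>e\<in>S. \<xi> e) \<le> \<Gamma>"
  proof (cases "num_factors r S W = 0")
    case True thus ?thesis using \<Gamma>0 by (simp add: \<xi>_def)
  next
    case False
    hence \<Phi>0: "?\<Phi> > 0" by simp
    have "real r * real (\<Sum>e\<in>S. num_factors r S W - num_factors r (S - {e}) W) \<le> real r * real ((r choose 2) * (\<Sum>Z\<in>cliques r S W. num_factors r S (W - Z)))"
      by (intro mult_left_mono of_nat_mono sum_num_factors_destroyed[OF W r S(1)]) simp
    also have "\<dots> = real (r choose 2) * real (r * (\<Sum>Z\<in>cliques r S W. num_factors r S (W - Z)))" by simp
    also have "\<dots> = real (r choose 2) * (real (card W) * ?\<Phi>)"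
      unfolding sum_num_factors_cliques[OF W r] by simp
    also have "real (r choose 2) = real r * real (r - 1) / 2" using r by (simp add: real_choose_2 of_nat_diff)
    also have "real r * real (r - 1) / 2 * (real (card W) * ?\<Phi>) = real r * (\<Gamma> * ?\<Phi>)" by (simp add: \<Gamma>_def)
    finally have "real (\<Sum>e\<in>S. num_factors r S W - num_factors r (S - {e}) W) \<le> \<Gamma> * ?\<Phi>"
      by (rule mult_left_le_imp_le) (use r in simp)
    hence "real (\<Sum>e\<in>S. num_factors r S W - num_factors r (S - {e}) W) / ?\<Phi> \<le> \<Gamma>" using \<Phi>0 by (simp only: pos_divide_le_eq)
    thus ?thesis unfolding \<xi>_def sum_divide_distrib[symmetric] by (simp only: of_nat_sum)
  qed
  have "(\<Sum>e\<in>S. exp (lam * light r W b S e)) \<le> (\<Sum>e\<in>S. 1 + c * \<xi> e)" by (rule sum_mono) (rule pt)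
  also have "\<dots> = real (card S) + c * (\<Sum>e\<in>S. \<xi> e)" by (simp add: sum.distrib sum_distrib_left)
  also have "\<dots> \<le> real (card S) + c * \<Gamma>" using c0 sum\<xi> by (intro add_left_mono mult_left_mono) auto
  also have "\<dots> = real (card S) * (1 + c * \<Gamma> / real (card S))" using cS by (simp add: field_simps)
  also have "\<dots> \<le> real (card S) * exp (c * \<Gamma> / real (card S))"
    using cS exp_ge_add_one_self by (intro mult_left_mono) auto
  finally show ?thesis by (simp add: c_def)
qed

text \<open>The supermartingale argument, written as a recursion over the first entry of a uniformly random
order.\<close>
lemma exp_light_sum:
  assumes fin: "finite A"
    and step: "\<And>S. S \<subseteq> A \<Longrightarrow> S \<noteq> {} \<Longrightarrow> m < card S \<Longrightarrow> (\<Sum>e\<in>S. exp (lam * light r W b S e)) \<le> real (card S) * exp (g (card S))"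
  shows "(\<Sum>l\<in>permutations_of_set A. exp (lam * light_sum r W b m l)) \<le> fact (card A) * exp (\<Sum>j\<in>{m<..card A}. g j)"
  using fin step
proof (induction "card A" arbitrary: A)
  case 0
  hence "A = {}" by simp
  thus ?case by simp
next
  case (Suc k)
  show ?case
  proof (cases "card A \<le> m")
    case True
    have "(\<Sum>l\<in>permutations_of_set A. exp (lam * light_sum r W b m l)) = (\<Sum>l\<in>permutations_of_set A. 1)"
    proof (rule sum.cong[OF refl])
      fix l assume "l \<in> permutations_of_set A"
      hence "length l = card A" by (auto simp: permutations_of_set_def distinct_card)
      thus "exp (lam * light_sum r W b m l) = 1" using True by (simp add: light_sum_short)
    qed
    moreover have "{m<..card A} = {}" using True by auto
    ultimately show ?thesis using Suc.prems(1) by (simp del: permutations_of_set_nonempty)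
  next
    case False
    have A: "A \<noteq> {}" using Suc by auto
    have IH: "(\<Sum>l\<in>permutations_of_set (A - {e}). exp (lam * light_sum r W b m l)) \<le> fact k * exp (\<Sum>j\<in>{m<..k}. g j)"
      if e: "e \<in> A" for e
    proof -
      have c: "card (A - {e}) = k" using e Suc by simp
      show ?thesis using Suc.hyps(1)[of "A - {e}"] Suc.prems c by auto
    qed
    have "(\<Sum>l\<in>permutations_of_set A. exp (lam * light_sum r W b m l))
       = (\<Sum>l\<in>(\<Union>e\<in>A. (#) e ` permutations_of_set (A - {e})). exp (lam * light_sum r W b m l))"
      using permutations_of_set_nonempty[OF A] by simp
    also have "\<dots> = (\<Sum>e\<in>A. \<Sum>l\<in>(#) e ` permutations_of_set (A - {e}). exp (lam * light_sum r W b m l))"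
      by (rule sum.UNION_disjoint) (use Suc.prems in auto)
    also have "\<dots> = (\<Sum>e\<in>A. exp (lam * light r W b A e) * (\<Sum>l\<in>permutations_of_set (A - {e}). exp (lam * light_sum r W b m l)))"
    proof (rule sum.cong[OF refl])
      fix e assume e: "e \<in> A"
      have "(\<Sum>l\<in>(#) e ` permutations_of_set (A - {e}). exp (lam * light_sum r W b m l)) =
         (\<Sum>l\<in>permutations_of_set (A - {e}). exp (lam * light_sum r W b m (e # l)))"
        by (rule sum.reindex_cong[where l = "(#) e"]) (auto simp: inj_on_def)
      also have "\<dots> = (\<Sum>l\<in>permutations_of_set (A - {e}). exp (lam * light r W b A e) * exp (lam * light_sum r W b m l))"
      proof (rule sum.cong[OF refl])
        fix l assume l: "l \<in> permutations_of_set (A - {e})"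
        have s: "set (e # l) = A" using l e by (auto simp: permutations_of_set_def)
        have "length l = card (A - {e})" using l distinct_card by (fastforce simp: permutations_of_set_def)
        hence "length (e # l) = card A" using e Suc.prems(1) Suc.hyps(2) by simp
        hence "light_sum r W b m (e # l) = light r W b A e + light_sum r W b m l"
          using False s by (simp only: light_sum.simps) simp
        thus "exp (lam * light_sum r W b m (e # l)) = exp (lam * light r W b A e) * exp (lam * light_sum r W b m l)"
          by (simp only: distrib_left exp_add)
      qed
      also have "\<dots> = exp (lam * light r W b A e) * (\<Sum>l\<in>permutations_of_set (A - {e}). exp (lam * light_sum r W b m l))"
        by (simp only: sum_distrib_left)
      finally show "(\<Sum>l\<in>(#) e ` permutations_of_set (A - {e}). exp (lam * light_sum r W b m l)) = \<dots>" .
    qed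
    also have "\<dots> \<le> (\<Sum>e\<in>A. exp (lam * light r W b A e) * (fact k * exp (\<Sum>j\<in>{m<..k}. g j)))"
      by (intro sum_mono mult_left_mono IH) auto
    also have "\<dots> = (\<Sum>e\<in>A. exp (lam * light r W b A e)) * (fact k * exp (\<Sum>j\<in>{m<..k}. g j))"
      by (simp only: sum_distrib_right)
    also have "\<dots> \<le> real (card A) * exp (g (card A)) * (fact k * exp (\<Sum>j\<in>{m<..k}. g j))"
      using Suc.prems A False by (intro mult_right_mono) auto
    also have "\<dots> = fact (card A) * exp (\<Sum>j\<in>{m<..card A}. g j)"
    proof -
      have "{m<..card A} = insert (card A) {m<..k}" using False Suc.hyps(2) by auto
      moreover have "card A \<notin> {m<..k}" using Suc.hyps(2) by auto
      ultimately have "exp (\<Sum>j\<in>{m<..card A}. g j) = exp (g (card A)) * exp (\<Sum>j\<in>{m<..k}. g j)"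
        by (simp add: exp_add)
      moreover have "(fact (card A) :: real) = real (card A) * fact k" using Suc.hyps(2)[symmetric] by simp
      ultimately show ?thesis by (simp only: mult_ac)
    qed
    finally show ?thesis .
  qed
qed

text \<open>This is why the threshold for light losses decays like \<open>j powr (- 1 / 2)\<close>: the second-order terms
have a bounded sum.\<close>
lemma sum_inverse_three_halves:
  assumes "m0 \<ge> 1" "m0 \<le> m"
  shows "(\<Sum>j\<in>{m<..N}. sqrt (real m0 / real j) / real j) \<le> 2"
proof -
  have pt: "1 / (real j * sqrt (real j)) \<le> 2 * (1 / sqrt (real (j - 1)) - 1 / sqrt (real j))" if j: "j \<ge> 2" for j
  proof -
    define a b where "a = sqrt (real (j - 1))" and "b = sqrt (real j)"
    have ab: "0 < a" "a \<le> b" "a\<^sup>2 = real j - 1" "b\<^sup>2 = real j" using j by (auto simp: a_def b_def)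
    have "(b - a) * (b + a) = 1" using ab by (simp add: algebra_simps power2_eq_square)
    hence "1 \<le> (b - a) * (2 * b)" using ab mult_left_mono[of "b + a" "2 * b" "b - a"] by simp
    hence "a / (b * b) * 1 \<le> a / (b * b) * ((b - a) * (2 * b))" using ab by (intro mult_left_mono) auto
    moreover have "1 / (b\<^sup>2 * b) \<le> 2 * (1 / a - 1 / b)"
    proof -
      have "2 * (1 / a - 1 / b) = 2 * (b - a) / (a * b)" using ab by (simp add: field_simps)
      moreover have "1 / (b\<^sup>2 * b) \<le> 2 * (b - a) / (a * b)"
      proof -
        have "a * b \<le> b * b" using ab by (intro mult_right_mono) auto
        have "1 / (b\<^sup>2 * b) \<le> ((b - a) * (2 * b)) / (b\<^sup>2 * b)"
          using \<open>1 \<le> (b - a) * (2 * b)\<close> ab by (intro divide_right_mono) auto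
        also have "\<dots> = 2 * (b - a) / (b * b)"
        proof -
          have "b > 0" using ab(1,2) by linarith
          thus ?thesis by (simp add: power2_eq_square field_simps)
        qed
        also have "\<dots> \<le> 2 * (b - a) / (a * b)"
          using ab \<open>a * b \<le> b * b\<close> by (intro frac_le) auto
        finally show ?thesis .
      qed
      ultimately show ?thesis by simp
    qed
    ultimately show ?thesis unfolding a_def b_def by simp
  qed
  have tele: "(\<Sum>j\<in>{m<..N}. 1 / (real j * sqrt (real j))) \<le> 2 * (1 / sqrt (real m) - 1 / sqrt (real N))" if "m \<le> N" for N
    using that
  proof (induction N rule: dec_induct)
    case (step N)
    have "{m<..Suc N} = insert (Suc N) {m<..N}" using step by auto
    hence "(\<Sum>j\<in>{m<..Suc N}. 1 / (real j * sqrt (real j))) = 1 / (real (Suc N) * sqrt (real (Suc N))) + (\<Sum>j\<in>{m<..N}. 1 / (real j * sqrt (real j)))"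
      by simp
    also have "1 / (real (Suc N) * sqrt (real (Suc N))) \<le> 2 * (1 / sqrt (real N) - 1 / sqrt (real (Suc N)))"
      using pt[of "Suc N"] step assms by simp
    finally show ?case using step by simp
  qed simp
  show ?thesis
  proof (cases "m \<le> N")
    case False thus ?thesis by simp
  next
    case True
    have "(\<Sum>j\<in>{m<..N}. sqrt (real m0 / real j) / real j) = sqrt (real m0) * (\<Sum>j\<in>{m<..N}. 1 / (real j * sqrt (real j)))"
      unfolding sum_distrib_left by (rule sum.cong) (auto simp: real_sqrt_divide)
    also have "\<dots> \<le> sqrt (real m0) * (2 * (1 / sqrt (real m) - 1 / sqrt (real N)))"
      by (intro mult_left_mono tele True) simp
    also have "\<dots> \<le> sqrt (real m0) * (2 * (1 / sqrt (real m0)))"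
    proof (intro mult_left_mono)
      have "1 / sqrt (real m) \<le> 1 / sqrt (real m0)" using assms by (intro frac_le) auto
      moreover have "1 / sqrt (real N) \<ge> 0" by simp
      ultimately show "1 / sqrt (real m) - 1 / sqrt (real N) \<le> 1 / sqrt (real m0)" by linarith
    qed auto
    also have "\<dots> = 2" using assms by simp
    finally show ?thesis .
  qed
qed

text \<open>Exponential Markov inequality with \<open>lam = 1 / (10 * r * b0)\<close>, the largest order for which the
second-order terms stay below half of the deviation \<open>n\<close>.\<close>
lemma light_tail:
  assumes W: "finite W" "card W \<le> n" and r: "r > 0" and A: "finite A" and m0: "1 \<le> m0" "m0 \<le> m"
    and b0: "0 < b0" "10 * real r * b0 \<le> 1"
  defines "\<Gamma> \<equiv> real (r - 1) * real (card W) / 2" and "b \<equiv> \<lambda>j. b0 * sqrt (real m0 / real j)"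
  shows "real (card {l \<in> permutations_of_set A. (\<Sum>j\<in>{m<..card A}. \<Gamma> / real j) + real n \<le> light_sum r W b m l})
    \<le> fact (card A) * exp (- (real n / (20 * real r * b0)))"
proof -
  define lam where "lam = 1 / (10 * real r * b0)"
  have rb: "0 < 10 * real r * b0" using r b0 by simp
  have lam1: "1 \<le> lam" using b0(2) rb by (simp add: lam_def le_divide_eq)
  have lamb: "lam * b0 = 1 / (10 * real r)" using b0 by (simp add: lam_def)
  have lamb1: "lam * b0 \<le> 1" unfolding lamb using r by (simp add: divide_le_eq)
  have b2: "b0 \<le> 1 / 2"
  proof -
    have "10 * 1 * b0 \<le> 10 * real r * b0" using r b0 by (intro mult_right_mono mult_left_mono) auto
    thus ?thesis using b0 by linarith
  qed
  have \<Gamma>0: "\<Gamma> \<ge> 0" by (simp add: \<Gamma>_def)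
  have bj: "0 \<le> b j" "b j \<le> b0" if "m < j" for j
  proof -
    show "0 \<le> b j" using b0 by (simp add: b_def)
    have "sqrt (real m0 / real j) \<le> 1" using that m0 by simp
    thus "b j \<le> b0" using b0 mult_left_mono[of _ 1 b0] by (simp add: b_def)
  qed
  define g where "g j = lam * (1 + 5 * (lam * b j)) * \<Gamma> / real j" for j
  have main: "(\<Sum>l\<in>permutations_of_set A. exp (lam * light_sum r W b m l)) \<le> fact (card A) * exp (\<Sum>j\<in>{m<..card A}. g j)"
  proof (rule exp_light_sum[OF A])
    fix S assume S: "S \<subseteq> A" "S \<noteq> {}" "m < card S"
    have "lam * b (card S) \<le> lam * b0" using bj(2)[OF S(3)] lam1 by (intro mult_left_mono) auto
    hence "lam * b (card S) \<le> 1" using lamb1 by linarith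
    thus "(\<Sum>e\<in>S. exp (lam * light r W b S e)) \<le> real (card S) * exp (g (card S))"
      unfolding g_def \<Gamma>_def
      by (intro exp_light_step[OF W(1) _ S(2) r]) (use S A bj[OF S(3)] b2 lam1 lamb1 finite_subset[OF S(1) A] in auto)
  qed
  have sg: "(\<Sum>j\<in>{m<..card A}. g j) \<le> lam * (\<Sum>j\<in>{m<..card A}. \<Gamma> / real j) + lam * real n / 2"
  proof -
    have "(\<Sum>j\<in>{m<..card A}. g j) = (\<Sum>j\<in>{m<..card A}. lam * (\<Gamma> / real j) + 5 * lam * (lam * b0) * \<Gamma> * (sqrt (real m0 / real j) / real j))"
      by (rule sum.cong) (auto simp: g_def b_def field_simps)
    also have "\<dots> = lam * (\<Sum>j\<in>{m<..card A}. \<Gamma> / real j) + 5 * lam * (lam * b0) * \<Gamma> * (\<Sum>j\<in>{m<..card A}. sqrt (real m0 / real j) / real j)"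
      by (simp only: sum.distrib sum_distrib_left)
    also have "\<dots> \<le> lam * (\<Sum>j\<in>{m<..card A}. \<Gamma> / real j) + 5 * lam * (lam * b0) * \<Gamma> * 2"
      using lam1 b0 \<Gamma>0 by (intro add_left_mono mult_left_mono sum_inverse_three_halves m0) auto
    also have "5 * lam * (lam * b0) * \<Gamma> * 2 \<le> lam * real n / 2"
    proof -
      have "\<Gamma> \<le> real r * real n / 2"
        unfolding \<Gamma>_def using W(2) by (intro divide_right_mono mult_mono) auto
      hence "5 * lam * (lam * b0) * \<Gamma> * 2 \<le> 5 * lam * (lam * b0) * (real r * real n / 2) * 2"
        using lam1 b0 by (intro mult_right_mono mult_left_mono) auto
      also have "\<dots> = lam * real n / 2" unfolding lamb using r by simp
      finally show ?thesis .
    qed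
    finally show ?thesis by simp
  qed
  let ?T = "(\<Sum>j\<in>{m<..card A}. \<Gamma> / real j) + real n"
  let ?L = "{l \<in> permutations_of_set A. ?T \<le> light_sum r W b m l}"
  have "real (card ?L) * exp (lam * ?T) = (\<Sum>l\<in>?L. exp (lam * ?T))" by simp
  also have "\<dots> \<le> (\<Sum>l\<in>?L. exp (lam * light_sum r W b m l))"
    by (rule sum_mono) (use lam1 in \<open>auto intro!: mult_left_mono\<close>)
  also have "\<dots> \<le> (\<Sum>l\<in>permutations_of_set A. exp (lam * light_sum r W b m l))"
    by (rule sum_mono2) auto
  also note main
  also have "fact (card A) * exp (\<Sum>j\<in>{m<..card A}. g j) \<le> fact (card A) * exp (lam * ?T - lam * real n / 2)"
    using sg by (intro mult_left_mono) (auto simp: algebra_simps)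
  finally have "real (card ?L) * exp (lam * ?T) \<le> (fact (card A) * exp (- (lam * real n / 2))) * exp (lam * ?T)"
    by (simp add: mult.assoc exp_add[symmetric])
  hence "real (card ?L) \<le> fact (card A) * exp (- (lam * real n / 2))" by (rule mult_right_le_imp_le) simp
  also have "lam * real n / 2 = real n / (20 * real r * b0)" by (simp add: lam_def)
  finally show ?thesis .
qed

section \<open>Regularity of the clique counts at all times\<close>

lemma born_before_sets:
  "F \<subseteq> pairs {1..n} \<Longrightarrow> {\<omega> \<in> space (birth_space n). \<forall>g\<in>F. \<omega> g \<le> q} \<in> sets (birth_space n)"
proof (intro sets.sets_Collect_finite_All)
  fix g assume F: "F \<subseteq> pairs {1..n}" "g \<in> F"
  note [measurable] = component_measurable[OF subsetD[OF F]]
  show "{\<omega> \<in> space (birth_space n). \<omega> g \<le> q} \<in> sets (birth_space n)" by measurable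
qed (auto intro: finite_subset)

text \<open>Given that all pairs of \<open>F\<close> are born before \<open>q\<close>, their birth times are uniform on
\<open>{0..q}\<close>, also under an event that cannot tell these times apart.\<close>
lemma level_scaling:
  assumes F: "F \<subseteq> pairs {1..n}" and A: "A \<in> sets (birth_space n)" and q: "0 \<le> q'" "q' \<le> q" "0 < q" "q \<le> 1"
    and ins: "\<And>\<omega> \<omega>'. \<omega> \<in> space (birth_space n) \<Longrightarrow> \<omega>' \<in> space (birth_space n) \<Longrightarrow>
      (\<And>g. g \<in> pairs {1..n} - F \<Longrightarrow> \<omega> g = \<omega>' g) \<Longrightarrow> (\<And>g. g \<in> F \<Longrightarrow> \<omega> g \<le> q \<and> \<omega>' g \<le> q) \<Longrightarrow> \<omega> \<in> A \<Longrightarrow> \<omega>' \<in> A"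
  shows "measure (birth_space n) (A \<inter> {\<omega> \<in> space (birth_space n). \<forall>g\<in>F. \<omega> g \<le> q'})
    = (q' / q) ^ card F * measure (birth_space n) (A \<inter> {\<omega> \<in> space (birth_space n). \<forall>g\<in>F. \<omega> g \<le> q})"
proof -
  let ?M = "birth_space n" and ?I = "pairs {1..n}"
  let ?B = "\<lambda>q. {\<omega> \<in> space ?M. \<forall>g\<in>F. \<omega> g \<le> q}"
  interpret M: prob_space ?M by (rule prob_space_birth_space)
  have finF: "finite F" using finite_subset[OF F] by simp
  have U: "?I - F \<union> F = ?I" using F by auto
  have sp: "merge (?I - F) F (\<rho>, \<sigma>) \<in> space ?M" if "\<rho> \<in> space (unif_prod (?I - F))" "\<sigma> \<in> space (unif_prod F)" for \<rho> \<sigma>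
    using that U unfolding birth_space_def by (auto simp: space_PiM PiE_iff merge_def extensional_def)
  have full: "emeasure (unif_prod F) {\<sigma> \<in> space (unif_prod F). \<forall>g\<in>F. \<sigma> g \<le> x} = ennreal (x ^ card F)" if "0 \<le> x" "x \<le> 1" for x
  proof -
    have "{\<sigma> \<in> space (unif_prod F). \<forall>g\<in>F. \<sigma> g \<le> x} = {\<sigma> \<in> space (unif_prod F). {g \<in> F. \<sigma> g \<le> x} = F}" by auto
    thus ?thesis using emeasure_level_set[OF finF order_refl that] by simp
  qed
  have slice: "emeasure (unif_prod F) {\<sigma> \<in> space (unif_prod F). merge (?I - F) F (\<rho>, \<sigma>) \<in> A \<inter> ?B q'}
    = ennreal ((q' / q) ^ card F) * emeasure (unif_prod F) {\<sigma> \<in> space (unif_prod F). merge (?I - F) F (\<rho>, \<sigma>) \<in> A \<inter> ?B q}"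
    if \<rho>: "\<rho> \<in> space (unif_prod (?I - F))" for \<rho>
  proof -
    have mg: "merge (?I - F) F (\<rho>, \<sigma>) g = \<sigma> g" if "g \<in> F" for g \<sigma> using that by (auto simp: merge_def)
    have mg': "merge (?I - F) F (\<rho>, \<sigma>) g = \<rho> g" if "g \<in> ?I - F" for g \<sigma> using that by (auto simp: merge_def)
    show ?thesis
    proof (cases "\<exists>\<sigma>\<in>space (unif_prod F). merge (?I - F) F (\<rho>, \<sigma>) \<in> A \<and> (\<forall>g\<in>F. \<sigma> g \<le> q)")
      case True
      then obtain \<sigma>0 where s0: "\<sigma>0 \<in> space (unif_prod F)" "merge (?I - F) F (\<rho>, \<sigma>0) \<in> A" "\<forall>g\<in>F. \<sigma>0 g \<le> q" by auto
      have all: "merge (?I - F) F (\<rho>, \<sigma>) \<in> A" if "\<sigma> \<in> space (unif_prod F)" "\<forall>g\<in>F. \<sigma> g \<le> q" for \<sigma>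
        by (rule ins[OF sp[OF \<rho> s0(1)] sp[OF \<rho> that(1)] _ _ s0(2)]) (use mg mg' s0(3) that(2) in auto)
      have "{\<sigma> \<in> space (unif_prod F). merge (?I - F) F (\<rho>, \<sigma>) \<in> A \<inter> ?B x} = {\<sigma> \<in> space (unif_prod F). \<forall>g\<in>F. \<sigma> g \<le> x}"
        if "x \<le> q" for x
      proof (rule Collect_cong)
        fix \<sigma>
        have 1: "(\<forall>g\<in>F. merge (?I - F) F (\<rho>, \<sigma>) g \<le> x) = (\<forall>g\<in>F. \<sigma> g \<le> x)" using mg by simp
        have 2: "\<forall>g\<in>F. \<sigma> g \<le> q" if "\<forall>g\<in>F. \<sigma> g \<le> x" using that \<open>x \<le> q\<close> by (meson order_trans)
        show "(\<sigma> \<in> space (unif_prod F) \<and> merge (?I - F) F (\<rho>, \<sigma>) \<in> A \<inter> ?B x) = (\<sigma> \<in> space (unif_prod F) \<and> (\<forall>g\<in>F. \<sigma> g \<le> x))"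
          unfolding Int_iff mem_Collect_eq 1 using all[of \<sigma>] sp[OF \<rho>, of \<sigma>] 2 by blast
      qed
      hence "emeasure (unif_prod F) {\<sigma> \<in> space (unif_prod F). merge (?I - F) F (\<rho>, \<sigma>) \<in> A \<inter> ?B q'} = ennreal (q' ^ card F)"
        "emeasure (unif_prod F) {\<sigma> \<in> space (unif_prod F). merge (?I - F) F (\<rho>, \<sigma>) \<in> A \<inter> ?B q} = ennreal (q ^ card F)"
        using full q by simp_all
      thus ?thesis using q by (simp add: ennreal_mult[symmetric] power_divide)
    next
      case False
      hence "{\<sigma> \<in> space (unif_prod F). merge (?I - F) F (\<rho>, \<sigma>) \<in> A \<inter> ?B x} = {}" if "x \<le> q" for x
      proof -
        have 1: "(\<forall>g\<in>F. merge (?I - F) F (\<rho>, \<sigma>) g \<le> x) = (\<forall>g\<in>F. \<sigma> g \<le> x)" for \<sigma> using mg by simp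
        have 2: "\<forall>g\<in>F. \<sigma> g \<le> q" if "\<forall>g\<in>F. \<sigma> g \<le> x" for \<sigma> using that \<open>x \<le> q\<close> by (meson order_trans)
        show ?thesis unfolding Int_iff mem_Collect_eq 1 using False 2 by blast
      qed
      hence "{\<sigma> \<in> space (unif_prod F). merge (?I - F) F (\<rho>, \<sigma>) \<in> A \<inter> ?B q'} = {}"
        "{\<sigma> \<in> space (unif_prod F). merge (?I - F) F (\<rho>, \<sigma>) \<in> A \<inter> ?B q} = {}"
        using q by blast+
      thus ?thesis using q by (simp only: emeasure_empty mult_zero_right)
    qed
  qed
  have AB: "A \<inter> ?B x \<in> sets ?M" for x using A born_before_sets[OF F] by auto
  have "emeasure ?M (A \<inter> ?B q') = (\<integral>\<^sup>+\<rho>. ennreal ((q' / q) ^ card F) *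
      emeasure (unif_prod F) {\<sigma> \<in> space (unif_prod F). merge (?I - F) F (\<rho>, \<sigma>) \<in> A \<inter> ?B q} \<partial>unif_prod (?I - F))"
    unfolding emeasure_split[OF F AB] by (rule nn_integral_cong) (rule slice)
  also have "\<dots> = ennreal ((q' / q) ^ card F) * emeasure ?M (A \<inter> ?B q)"
    by (subst nn_integral_cmult[OF slice_emeasure_measurable[OF F AB]], subst emeasure_split[OF F AB]) (rule refl)
  finally show ?thesis using q
    by (simp add: M.emeasure_eq_measure ennreal_mult[symmetric])
qed

text \<open>Read backwards in time, the number of copies divided by its mean is a martingale, and this is the
maximal inequality for it. The event is decomposed according to the first index \<open>j\<close> (the latest
time) at which the count is too large. By the preceding lemma a copy present at this time survives until the last
index \<open>J\<close> with probability \<open>(Q J / Q j) ^ e\<close>, so each part contributes at least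
\<open>\<kappa> * card \<Lambda> * Q J ^ e\<close> times its probability to the mean number of copies at
\<open>J\<close>, and this mean is \<open>card \<Lambda> * Q J ^ e\<close>.\<close>
lemma subgraph_count_maximal:
  fixes h :: "'a \<Rightarrow> nat set set" and Q :: "nat \<Rightarrow> real"
  assumes fin: "finite \<Lambda>" and h: "\<And>a. a \<in> \<Lambda> \<Longrightarrow> h a \<subseteq> pairs {1..n} \<and> card (h a) = e"
    and Q: "\<And>i j. i \<le> j \<Longrightarrow> Q j \<le> Q i" "\<And>j. 0 < Q j" "\<And>j. Q j \<le> 1" and \<kappa>: "\<kappa> > 0"
  defines "X \<equiv> \<lambda>j \<omega>. real (card {a \<in> \<Lambda>. \<forall>g\<in>h a. \<omega> g \<le> Q j})"
  defines "bad \<equiv> \<lambda>j \<omega>. \<kappa> * real (card \<Lambda>) * Q j ^ e < X j \<omega>"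
  shows "{\<omega> \<in> space (birth_space n). \<exists>j\<le>J. bad j \<omega>} \<in> sets (birth_space n)"
    and "measure (birth_space n) {\<omega> \<in> space (birth_space n). \<exists>j\<le>J. bad j \<omega>} \<le> 1 / \<kappa>"
proof -
  let ?M = "birth_space n" and ?I = "pairs {1..n}"
  interpret M: prob_space ?M by (rule prob_space_birth_space)
  define B where "B a j = {\<omega> \<in> space ?M. \<forall>g\<in>h a. \<omega> g \<le> Q j}" for a j
  have Bs: "B a j \<in> sets ?M" if "a \<in> \<Lambda>" for a j
    unfolding B_def using h[OF that] by (intro born_before_sets) auto
  have Xi: "X j \<omega> = (\<Sum>a\<in>\<Lambda>. indicator (B a j) \<omega>)" if "\<omega> \<in> space ?M" for j \<omega>
    unfolding X_def using fin that by (simp add: indicator_def B_def sum.If_cases Int_def)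
  have Xm[measurable]: "X j \<in> borel_measurable ?M" for j
  proof -
    have "(\<lambda>\<omega>. \<Sum>a\<in>\<Lambda>. indicator (B a j) \<omega> :: real) \<in> borel_measurable ?M"
      by (intro borel_measurable_sum borel_measurable_indicator Bs)
    thus ?thesis by (rule measurable_cong[THEN iffD1, rotated]) (simp add: Xi)
  qed
  have bads: "{\<omega> \<in> space ?M. bad j \<omega>} \<in> sets ?M" for j unfolding bad_def by measurable
  show "{\<omega> \<in> space ?M. \<exists>j\<le>J. bad j \<omega>} \<in> sets ?M"
  proof -
    have "{\<omega> \<in> space ?M. \<exists>j\<le>J. bad j \<omega>} = (\<Union>j\<in>{..J}. {\<omega> \<in> space ?M. bad j \<omega>})" by auto
    also have "\<dots> \<in> sets ?M" using bads by (intro sets.finite_UN) auto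
    finally show ?thesis .
  qed
  define A where "A j = {\<omega> \<in> space ?M. bad j \<omega> \<and> (\<forall>i<j. \<not> bad i \<omega>)}" for j
  have As: "A j \<in> sets ?M" for j
  proof -
    have "A j = {\<omega> \<in> space ?M. bad j \<omega>} - (\<Union>i\<in>{..<j}. {\<omega> \<in> space ?M. bad i \<omega>})" by (auto simp: A_def)
    also have "\<dots> \<in> sets ?M" using bads by (intro sets.Diff sets.finite_UN) auto
    finally show ?thesis .
  qed
  have dis: "disjoint_family_on A {..J}"
  proof -
    have "A i \<inter> A j = {}" if "i \<noteq> j" for i j
      using that by (cases "i < j") (auto simp: A_def)
    thus ?thesis by (auto simp: disjoint_family_on_def)
  qed
  have un: "{\<omega> \<in> space ?M. \<exists>j\<le>J. bad j \<omega>} = (\<Union>j\<in>{..J}. A j)"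
  proof (rule set_eqI)
    fix \<omega>
    have "(\<exists>j\<le>J. bad j \<omega>) \<longleftrightarrow> (\<exists>j\<le>J. bad j \<omega> \<and> (\<forall>i<j. \<not> bad i \<omega>))"
    proof
      assume "\<exists>j\<le>J. bad j \<omega>"
      then obtain j where j: "j \<le> J" "bad j \<omega>" "\<forall>m<j. \<not> (m \<le> J \<and> bad m \<omega>)"
        using exists_least_iff[of "\<lambda>j. j \<le> J \<and> bad j \<omega>"] by blast
      hence "\<not> bad i \<omega>" if "i < j" for i using that by simp
      thus "\<exists>j\<le>J. bad j \<omega> \<and> (\<forall>i<j. \<not> bad i \<omega>)" using j by blast
    qed blast
    thus "\<omega> \<in> {\<omega> \<in> space ?M. \<exists>j\<le>J. bad j \<omega>} \<longleftrightarrow> \<omega> \<in> (\<Union>j\<in>{..J}. A j)"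
      unfolding A_def UN_iff mem_Collect_eq atMost_iff by blast
  qed
  let ?L = "real (card \<Lambda>)"
  have scal: "measure ?M (A j \<inter> B a J) = (Q J / Q j) ^ e * measure ?M (A j \<inter> B a j)" if j: "j \<le> J" and a: "a \<in> \<Lambda>" for a j
  proof -
    have "measure ?M (A j \<inter> B a J) = (Q J / Q j) ^ card (h a) * measure ?M (A j \<inter> B a j)"
      unfolding B_def
    proof (rule level_scaling)
      fix \<omega> \<omega>' assume w: "\<omega> \<in> space ?M" "\<omega>' \<in> space ?M" "\<And>g. g \<in> ?I - h a \<Longrightarrow> \<omega> g = \<omega>' g"
        "\<And>g. g \<in> h a \<Longrightarrow> \<omega> g \<le> Q j \<and> \<omega>' g \<le> Q j" "\<omega> \<in> A j"
      have lev: "\<omega> g \<le> Q i \<longleftrightarrow> \<omega>' g \<le> Q i" if "i \<le> j" "g \<in> ?I" for i g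
      proof (cases "g \<in> h a")
        case True
        have "\<omega> g \<le> Q j" "\<omega>' g \<le> Q j" using w(4)[OF True] by simp_all
        hence "\<omega> g \<le> Q i" "\<omega>' g \<le> Q i" using Q(1)[OF that(1)] by linarith+
        thus ?thesis by blast
      next
        case False
        thus ?thesis using w(3)[of g] that(2) by simp
      qed
      have "X i \<omega> = X i \<omega>'" if "i \<le> j" for i
      proof -
        have "{a \<in> \<Lambda>. \<forall>g\<in>h a. \<omega> g \<le> Q i} = {a \<in> \<Lambda>. \<forall>g\<in>h a. \<omega>' g \<le> Q i}"
          using lev[OF that] h by (intro Collect_cong) blast
        thus ?thesis by (simp add: X_def)
      qed
      hence "bad i \<omega> \<longleftrightarrow> bad i \<omega>'" if "i \<le> j" for i using that by (simp add: bad_def)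
      thus "\<omega>' \<in> A j" using w(2,5) by (auto simp: A_def)
    qed (use h[OF a] As Q(1)[OF j] Q(2)[of j] Q(2)[of J] Q(3)[of j] in auto)
    thus ?thesis using h[OF a] by simp
  qed
  have first: "\<kappa> * ?L * Q j ^ e * measure ?M (A j) \<le> (\<Sum>a\<in>\<Lambda>. measure ?M (A j \<inter> B a j))" for j
  proof -
    have "\<kappa> * ?L * Q j ^ e * measure ?M (A j) = (\<integral>\<omega>. \<kappa> * ?L * Q j ^ e * indicator (A j) \<omega> \<partial>?M)"
      using As[of j] by (simp add: Int_absorb2 sets.sets_into_space)
    also have "\<dots> \<le> (\<integral>\<omega>. (\<Sum>a\<in>\<Lambda>. indicator (A j \<inter> B a j) \<omega>) \<partial>?M)"
    proof (rule integral_mono)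
      show "integrable ?M (\<lambda>\<omega>. \<kappa> * ?L * Q j ^ e * indicator (A j) \<omega>)"
        by (intro integrable_mult_right M.integrable_const_bound[where B = 1]) (use As in auto)
      show "integrable ?M (\<lambda>\<omega>. \<Sum>a\<in>\<Lambda>. indicator (A j \<inter> B a j) \<omega> :: real)"
      proof (rule Bochner_Integration.integrable_sum)
        fix a assume "a \<in> \<Lambda>"
        thus "integrable ?M (\<lambda>\<omega>. indicator (A j \<inter> B a j) \<omega> :: real)"
          using As Bs by (intro M.integrable_const_bound[where B = 1]) auto
      qed
      fix \<omega> assume w: "\<omega> \<in> space ?M"
      show "\<kappa> * ?L * Q j ^ e * indicator (A j) \<omega> \<le> (\<Sum>a\<in>\<Lambda>. indicator (A j \<inter> B a j) \<omega>)"
      proof (cases "\<omega> \<in> A j")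
        case True
        hence "\<kappa> * ?L * Q j ^ e < X j \<omega>" by (simp add: A_def bad_def)
        also have "X j \<omega> = (\<Sum>a\<in>\<Lambda>. indicator (A j \<inter> B a j) \<omega>)"
          unfolding Xi[OF w] by (rule sum.cong) (use True in \<open>auto simp: indicator_def\<close>)
        finally show ?thesis using True by simp
      qed (simp add: sum_nonneg)
    qed
    also have "\<dots> = (\<Sum>a\<in>\<Lambda>. \<integral>\<omega>. indicator (A j \<inter> B a j) \<omega> \<partial>?M)"
    proof (rule Bochner_Integration.integral_sum)
      fix a assume "a \<in> \<Lambda>"
      thus "integrable ?M (\<lambda>\<omega>. indicator (A j \<inter> B a j) \<omega> :: real)"
        using As Bs by (intro M.integrable_const_bound[where B = 1]) auto
    qed
    also have "\<dots> = (\<Sum>a\<in>\<Lambda>. measure ?M (A j \<inter> B a j))"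
      by (rule sum.cong) (use As Bs in \<open>auto simp: Int_absorb2 sets.sets_into_space le_infI1\<close>)
    finally show ?thesis .
  qed
  have tot: "measure ?M (B a J) = Q J ^ e" if a: "a \<in> \<Lambda>" for a
  proof -
    have "measure ?M (space ?M \<inter> B a J) = (Q J / 1) ^ card (h a) * measure ?M (space ?M \<inter> {\<omega> \<in> space ?M. \<forall>g\<in>h a. \<omega> g \<le> 1})"
      unfolding B_def by (rule level_scaling) (use h[OF a] Q(2)[of J] Q(3)[of J] in auto)
    moreover have "{\<omega> \<in> space ?M. \<forall>g\<in>h a. \<omega> g \<le> 1} = space ?M"
    proof -
      have "\<omega> g \<le> 1" if "\<omega> \<in> space ?M" "g \<in> h a" for \<omega> g
        using component_range[of \<omega> ?I g] h[OF a] that unfolding birth_space_def by auto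
      thus ?thesis by blast
    qed
    moreover have "space ?M \<inter> B a J = B a J" by (auto simp: B_def)
    ultimately show ?thesis using h[OF a] by (simp add: M.prob_space)
  qed
  have mA: "measure ?M (\<Union>j\<in>{..J}. A j) = (\<Sum>j\<le>J. measure ?M (A j))"
    by (rule M.finite_measure_finite_Union) (use As dis in auto)
  have "\<kappa> * ?L * Q J ^ e * (\<Sum>j\<le>J. measure ?M (A j)) = (\<Sum>j\<le>J. (Q J / Q j) ^ e * (\<kappa> * ?L * Q j ^ e * measure ?M (A j)))"
    unfolding sum_distrib_left
    by (rule sum.cong) (use Q(2) in \<open>auto simp: power_divide less_imp_neq[symmetric]\<close>)
  also have "\<dots> \<le> (\<Sum>j\<le>J. (Q J / Q j) ^ e * (\<Sum>a\<in>\<Lambda>. measure ?M (A j \<inter> B a j)))"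
    by (intro sum_mono mult_left_mono first) (use Q(2) in \<open>auto simp: less_imp_le\<close>)
  also have "\<dots> = (\<Sum>j\<le>J. \<Sum>a\<in>\<Lambda>. measure ?M (A j \<inter> B a J))"
    unfolding sum_distrib_left by (intro sum.cong refl) (simp add: scal)
  also have "\<dots> = (\<Sum>a\<in>\<Lambda>. \<Sum>j\<le>J. measure ?M (A j \<inter> B a J))" by (rule sum.swap)
  also have "\<dots> = (\<Sum>a\<in>\<Lambda>. measure ?M (\<Union>j\<in>{..J}. A j \<inter> B a J))"
  proof (rule sum.cong[OF refl])
    fix a assume a: "a \<in> \<Lambda>"
    show "(\<Sum>j\<le>J. measure ?M (A j \<inter> B a J)) = measure ?M (\<Union>j\<in>{..J}. A j \<inter> B a J)"
    proof (rule M.finite_measure_finite_Union[symmetric])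
      show "disjoint_family_on (\<lambda>j. A j \<inter> B a J) {..J}"
        using dis unfolding disjoint_family_on_def by blast
    qed (use As Bs[OF a] in auto)
  qed
  also have "\<dots> \<le> (\<Sum>a\<in>\<Lambda>. measure ?M (B a J))"
    by (intro sum_mono M.finite_measure_mono) (use Bs in auto)
  also have "\<dots> = ?L * Q J ^ e" using tot by simp
  finally have main: "\<kappa> * (?L * Q J ^ e) * measure ?M (\<Union>j\<in>{..J}. A j) \<le> ?L * Q J ^ e"
    unfolding mA by (simp add: mult.assoc)
  show "measure ?M {\<omega> \<in> space ?M. \<exists>j\<le>J. bad j \<omega>} \<le> 1 / \<kappa>"
  proof (cases "\<Lambda> = {}")
    case True
    hence "{\<omega> \<in> space ?M. \<exists>j\<le>J. bad j \<omega>} = {}" by (auto simp: bad_def X_def)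
    show ?thesis unfolding \<open>{\<omega> \<in> space ?M. \<exists>j\<le>J. bad j \<omega>} = {}\<close> using \<kappa> by simp
  next
    case False
    hence pos: "?L * Q J ^ e > 0"
      using fin zero_less_power[OF Q(2)[of J], of e] by (intro mult_pos_pos) (auto simp: card_gt_0_iff)
    have "\<kappa> * measure ?M (\<Union>j\<in>{..J}. A j) * (?L * Q J ^ e) \<le> 1 * (?L * Q J ^ e)" using main by (simp add: mult_ac)
    hence "\<kappa> * measure ?M (\<Union>j\<in>{..J}. A j) \<le> 1" using pos by (rule mult_right_le_imp_le)
    thus ?thesis unfolding un using \<kappa> by (simp add: field_simps)
  qed
qed

definition clique_pairs :: "nat \<Rightarrow> nat \<Rightarrow> nat \<Rightarrow> (nat set \<times> nat set) set" where
  "clique_pairs n k i = {(T, T'). T \<subseteq> {1..n} \<and> T' \<subseteq> {1..n} \<and> card T = k \<and> card T' = k \<and> card (T \<inter> T') = i}"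

definition pair_edges :: "nat set \<times> nat set \<Rightarrow> nat set set" where
  "pair_edges = (\<lambda>(T, T'). pairs T \<union> pairs T')"

lemma finite_clique_pairs: "finite (clique_pairs n k i)"
  by (rule finite_subset[of _ "Pow {1..n} \<times> Pow {1..n}"]) (auto simp: clique_pairs_def)

lemma card_pair_edges:
  assumes "a \<in> clique_pairs n k i"
  shows "pair_edges a \<subseteq> pairs {1..n} \<and> card (pair_edges a) = 2 * (k choose 2) - (i choose 2)"
proof -
  obtain T T' where a: "a = (T, T')" "T \<subseteq> {1..n}" "T' \<subseteq> {1..n}" "card T = k" "card T' = k" "card (T \<inter> T') = i"
    using assms by (auto simp: clique_pairs_def)
  have f: "finite T" "finite T'" using finite_subset[OF a(2)] finite_subset[OF a(3)] by simp_all
  have "pairs T \<inter> pairs T' = pairs (T \<inter> T')" by (auto simp: pairs_def)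
  hence "card (pairs T \<union> pairs T') + card (pairs (T \<inter> T')) = card (pairs T) + card (pairs T')"
    using card_Un_Int[of "pairs T" "pairs T'"] f by simp
  hence "card (pairs T \<union> pairs T') = 2 * (k choose 2) - (i choose 2)"
    using a f by (simp add: card_pairs)
  thus ?thesis using a pairs_mono[OF a(2)] pairs_mono[OF a(3)] by (simp add: pair_edges_def)
qed

lemma card_clique_pairs:
  assumes ik: "i \<le> k" and n: "n > 0"
  shows "real (card (clique_pairs n k i)) \<le> real n ^ (2 * k - i)"
proof -
  let ?S = "\<lambda>j. {A. A \<subseteq> {1..n} \<and> card A = j}"
  have cS: "card (?S j) \<le> n ^ j" for j
  proof -
    have "card (?S j) = n choose j" using n_subsets[of "{1..n}" j] by simp
    also have "\<dots> \<le> n ^ j"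
    proof (cases "j \<le> n")
      case True thus ?thesis by (rule binomial_le_pow)
    qed (simp add: binomial_eq_0)
    finally show ?thesis .
  qed
  have fS: "finite (?S j)" for j by (rule finite_subset[of _ "Pow {1..n}"]) auto
  have "card (clique_pairs n k i) \<le> card (?S i \<times> (?S (k - i) \<times> ?S (k - i)))"
  proof (rule card_inj_on_le[where f = "\<lambda>(T, T'). (T \<inter> T', (T - T', T' - T))"])
    show "inj_on (\<lambda>(T, T'). (T \<inter> T', (T - T', T' - T))) (clique_pairs n k i)"
    proof (rule inj_onI)
      fix a b :: "nat set \<times> nat set"
      assume "(\<lambda>(T, T'). (T \<inter> T', (T - T', T' - T))) a = (\<lambda>(T, T'). (T \<inter> T', (T - T', T' - T))) b"
      moreover obtain A B C D where ab: "a = (A, B)" "b = (C, D)" by (cases a, cases b)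
      ultimately have "A \<inter> B = C \<inter> D" "A - B = C - D" "B - A = D - C" by simp_all
      hence "A = C" "B = D" by blast+
      thus "a = b" using ab by simp
    qed
    show "(\<lambda>(T, T'). (T \<inter> T', (T - T', T' - T))) ` clique_pairs n k i \<subseteq> ?S i \<times> (?S (k - i) \<times> ?S (k - i))"
    proof (rule image_subsetI)
      fix a assume "a \<in> clique_pairs n k i"
      then obtain T T' where a: "a = (T, T')" "T \<subseteq> {1..n}" "T' \<subseteq> {1..n}" "card T = k" "card T' = k" "card (T \<inter> T') = i"
        by (auto simp: clique_pairs_def)
      have f: "finite T" "finite T'" using finite_subset[OF a(2)] finite_subset[OF a(3)] by simp_all
      have "card (T - T') = k - i" "card (T' - T) = k - i"
        using card_Diff_subset_Int[of T T'] card_Diff_subset_Int[of T' T] f a by (simp_all add: Int_commute)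
      thus "(\<lambda>(T, T'). (T \<inter> T', (T - T', T' - T))) a \<in> ?S i \<times> (?S (k - i) \<times> ?S (k - i))"
        using a by auto
    qed
    show "finite (?S i \<times> (?S (k - i) \<times> ?S (k - i)))" using fS by blast
  qed
  also have "\<dots> = card (?S i) * (card (?S (k - i)) * card (?S (k - i)))" by (simp only: card_cartesian_product)
  also have "\<dots> \<le> n ^ i * (n ^ (k - i) * n ^ (k - i))" by (intro mult_le_mono cS)
  also have "\<dots> = n ^ (2 * k - i)"
  proof -
    have "2 * k - i = i + ((k - i) + (k - i))" using ik by simp
    thus ?thesis by (simp only: power_add)
  qed
  finally have "real (card (clique_pairs n k i)) \<le> real (n ^ (2 * k - i))" by (simp only: of_nat_le_iff)
  thus ?thesis by simp
qed

lemma pair_count_level: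
  "pair_count k i (level {1..n} q \<omega>) {1..n} = card {a \<in> clique_pairs n k i. \<forall>g\<in>pair_edges a. \<omega> g \<le> q}"
proof -
  have *: "pairs T \<subseteq> level {1..n} q \<omega> \<longleftrightarrow> (\<forall>g\<in>pairs T. \<omega> g \<le> q)" if "T \<subseteq> {1..n}" for T
    using pairs_mono[OF that] unfolding level_def by blast
  have "{(T, T'). T \<in> cliques k (level {1..n} q \<omega>) {1..n} \<and> T' \<in> cliques k (level {1..n} q \<omega>) {1..n} \<and> card (T \<inter> T') = i}
    = {a \<in> clique_pairs n k i. \<forall>g\<in>pair_edges a. \<omega> g \<le> q}" (is "?A = ?B")
  proof (rule set_eqI)
    fix a :: "nat set \<times> nat set"
    obtain T T' where a: "a = (T, T')" by (cases a)
    show "a \<in> ?A \<longleftrightarrow> a \<in> ?B"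
      using *[of T] *[of T'] unfolding a cliques_def clique_pairs_def pair_edges_def mem_Collect_eq prod.case by blast
  qed
  thus ?thesis unfolding pair_count_def by simp
qed

lemma pair_count_mono:
  assumes "finite V'" "S \<subseteq> S'" "V \<subseteq> V'"
  shows "pair_count k i S V \<le> pair_count k i S' V'"
  unfolding pair_count_def
proof (rule card_mono)
  show "finite {(T, T'). T \<in> cliques k S' V' \<and> T' \<in> cliques k S' V' \<and> card (T \<inter> T') = i}"
    by (rule finite_subset[of _ "cliques k S' V' \<times> cliques k S' V'"]) (use assms in auto)
  show "{(T, T'). T \<in> cliques k S V \<and> T' \<in> cliques k S V \<and> card (T \<inter> T') = i}
    \<subseteq> {(T, T'). T \<in> cliques k S' V' \<and> T' \<in> cliques k S' V' \<and> card (T \<inter> T') = i}"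
    using cliques_mono[OF assms(2,3), of k] by blast
qed

text \<open>Only dyadic times are inspected; counts at intermediate times follow by monotonicity. Times below
\<open>(1 / 2) ^ (r * n)\<close> are earlier than every time at which the graph is observed.\<close>
definition regular_event :: "nat \<Rightarrow> nat \<Rightarrow> (nat set \<Rightarrow> real) set" where
  "regular_event r n = {\<omega> \<in> space (birth_space n). \<forall>k\<le>r. \<forall>i\<le>k. \<forall>j\<le>r * n.
     real (pair_count k i (level {1..n} ((1 / 2) ^ j) \<omega>) {1..n})
       \<le> 2 * (real r + 1)\<^sup>2 * (real n ^ (2 * k - i) * ((1 / 2) ^ j) ^ (2 * (k choose 2) - (i choose 2)))}"

text \<open>Each of the at most \<open>(r + 1)\<^sup>2\<close> conditions on \<open>k\<close> and \<open>i\<close> fails with probability at most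
\<open>1 / (2 * (r + 1)\<^sup>2)\<close>, simultaneously for all times. Bounds from above on clique
counts are preserved when edges are removed.\<close>
lemma regular_event:
  assumes n: "n > 0"
  shows "decreasing_event n (regular_event r n)" and "measure (birth_space n) (regular_event r n) \<ge> 1 / 2"
proof -
  let ?M = "birth_space n"
  interpret M: prob_space ?M by (rule prob_space_birth_space)
  define \<kappa> where "\<kappa> = 2 * (real r + 1)\<^sup>2"
  have \<kappa>0: "\<kappa> > 0" by (simp add: \<kappa>_def zero_less_power)
  define Bad where "Bad k i = {\<omega> \<in> space ?M. \<exists>j\<le>r * n. \<kappa> * real (card (clique_pairs n k i)) * ((1 / 2) ^ j) ^ (2 * (k choose 2) - (i choose 2))
       < real (card {a \<in> clique_pairs n k i. \<forall>g\<in>pair_edges a. \<omega> g \<le> (1 / 2) ^ j})}" for k i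
  have Bs: "Bad k i \<in> sets ?M" and Bm: "measure ?M (Bad k i) \<le> 1 / \<kappa>" for k i
    unfolding Bad_def
    by (rule subgraph_count_maximal[OF finite_clique_pairs card_pair_edges _ _ _ \<kappa>0];
        simp add: power_decreasing power_le_one)+
  define V where "V k i = {\<omega> \<in> space ?M. \<exists>j\<le>r * n. \<not> real (pair_count k i (level {1..n} ((1 / 2) ^ j) \<omega>) {1..n})
       \<le> \<kappa> * (real n ^ (2 * k - i) * ((1 / 2) ^ j) ^ (2 * (k choose 2) - (i choose 2)))}" for k i
  have VB: "V k i \<subseteq> Bad k i" if "i \<le> k" for k i
  proof
    fix \<omega> assume "\<omega> \<in> V k i"
    then obtain j where j: "j \<le> r * n" "\<omega> \<in> space ?M" "\<kappa> * (real n ^ (2 * k - i) * ((1 / 2) ^ j) ^ (2 * (k choose 2) - (i choose 2)))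
        < real (pair_count k i (level {1..n} ((1 / 2) ^ j) \<omega>) {1..n})" by (auto simp: V_def not_le)
    have "\<kappa> * real (card (clique_pairs n k i)) * ((1 / 2) ^ j) ^ (2 * (k choose 2) - (i choose 2))
       \<le> \<kappa> * real n ^ (2 * k - i) * ((1 / 2) ^ j) ^ (2 * (k choose 2) - (i choose 2))"
      by (intro mult_right_mono mult_left_mono card_clique_pairs that n) (use \<kappa>0 in auto)
    hence "\<kappa> * real (card (clique_pairs n k i)) * ((1 / 2) ^ j) ^ (2 * (k choose 2) - (i choose 2))
       < real (card {a \<in> clique_pairs n k i. \<forall>g\<in>pair_edges a. \<omega> g \<le> (1 / 2) ^ j})"
      using j(3) unfolding pair_count_level by (simp only: mult.assoc)
    thus "\<omega> \<in> Bad k i" using j by (auto simp: Bad_def)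
  qed
  have Vs: "V k i \<in> sets ?M" for k i
  proof -
    have fin: "finite (clique_pairs n k i)" by (rule finite_clique_pairs)
    have "V k i = (\<Union>j\<in>{..r * n}. \<Union>\<A>\<in>{\<A> \<in> Pow (clique_pairs n k i). \<not> real (card \<A>) \<le> \<kappa> * (real n ^ (2 * k - i) * ((1 / 2) ^ j) ^ (2 * (k choose 2) - (i choose 2)))}.
       {\<omega> \<in> space ?M. \<forall>a\<in>clique_pairs n k i. (\<forall>g\<in>pair_edges a. \<omega> g \<le> (1 / 2) ^ j) \<longleftrightarrow> a \<in> \<A>})" (is "?L = ?R")
    proof (rule set_eqI)
      fix \<omega> :: "nat set \<Rightarrow> real"
      have e: "{a \<in> clique_pairs n k i. \<forall>g\<in>pair_edges a. \<omega> g \<le> q} = \<A> \<longleftrightarrow>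
         (\<forall>a\<in>clique_pairs n k i. (\<forall>g\<in>pair_edges a. \<omega> g \<le> q) \<longleftrightarrow> a \<in> \<A>)" if "\<A> \<subseteq> clique_pairs n k i" for \<A> q
        using that by blast
      show "\<omega> \<in> ?L \<longleftrightarrow> \<omega> \<in> ?R"
      proof
        assume "\<omega> \<in> ?L"
        then obtain j where j: "j \<le> r * n" "\<omega> \<in> space ?M" "\<not> real (card {a \<in> clique_pairs n k i. \<forall>g\<in>pair_edges a. \<omega> g \<le> (1 / 2) ^ j}) \<le> \<kappa> * (real n ^ (2 * k - i) * ((1 / 2) ^ j) ^ (2 * (k choose 2) - (i choose 2)))"
          unfolding V_def pair_count_level by blast
        thus "\<omega> \<in> ?R" by (intro UN_I[of j] UN_I[of "{a \<in> clique_pairs n k i. \<forall>g\<in>pair_edges a. \<omega> g \<le> (1 / 2) ^ j}"]) auto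
      next
        assume "\<omega> \<in> ?R"
        then obtain j \<A> where j: "j \<le> r * n" "\<A> \<subseteq> clique_pairs n k i" "\<not> real (card \<A>) \<le> \<kappa> * (real n ^ (2 * k - i) * ((1 / 2) ^ j) ^ (2 * (k choose 2) - (i choose 2)))"
          "\<omega> \<in> space ?M" "\<forall>a\<in>clique_pairs n k i. (\<forall>g\<in>pair_edges a. \<omega> g \<le> (1 / 2) ^ j) \<longleftrightarrow> a \<in> \<A>" by blast
        have "{a \<in> clique_pairs n k i. \<forall>g\<in>pair_edges a. \<omega> g \<le> (1 / 2) ^ j} = \<A>" using e[OF j(2)] j(5) by blast
        thus "\<omega> \<in> ?L" unfolding V_def pair_count_level using j by blast
      qed
    qed
    also have "\<dots> \<in> sets ?M"
    proof (intro sets.finite_UN sets.sets_Collect_finite_All fin)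
      fix j \<A> a assume a: "a \<in> clique_pairs n k i"
      have s: "{\<omega> \<in> space ?M. \<forall>g\<in>pair_edges a. \<omega> g \<le> (1 / 2) ^ j} \<in> sets ?M"
        by (rule born_before_sets) (use card_pair_edges[OF a] in blast)
      have s': "{\<omega> \<in> space ?M. \<not> (\<forall>g\<in>pair_edges a. \<omega> g \<le> (1 / 2) ^ j)} \<in> sets ?M"
        by (rule sets.sets_Collect_neg[OF s])
      show "{\<omega> \<in> space ?M. (\<forall>g\<in>pair_edges a. \<omega> g \<le> (1 / 2) ^ j) = (a \<in> \<A>)} \<in> sets ?M"
      proof (cases "a \<in> \<A>")
        case True thus ?thesis using s by (simp only: True simp_thms)
      next
        case False thus ?thesis using s' by (simp only: False simp_thms)
      qed
    qed (use fin in auto)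
    finally show ?thesis .
  qed
  let ?U = "regular_event r n"
  have U: "?U = space ?M - (\<Union>k\<in>{..r}. \<Union>i\<in>{..k}. V k i)"
    unfolding regular_event_def V_def \<kappa>_def by blast
  have Us: "?U \<in> sets ?M" unfolding U using Vs by (intro sets.Diff sets.top sets.finite_UN) auto
  show "decreasing_event n ?U"
    unfolding decreasing_event_def
  proof (intro conjI Us ballI impI)
    fix \<omega> \<omega>' assume w: "\<omega> \<in> ?U" "\<omega>' \<in> space ?M" "\<forall>f\<in>pairs {1..n}. \<omega> f \<le> \<omega>' f"
    have "level {1..n} q \<omega>' \<subseteq> level {1..n} q \<omega>" for q using w(3) unfolding level_def by force
    hence "pair_count k i (level {1..n} q \<omega>') {1..n} \<le> pair_count k i (level {1..n} q \<omega>) {1..n}" for k i q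
      by (intro pair_count_mono) auto
    thus "\<omega>' \<in> ?U" using w(1,2) unfolding regular_event_def mem_Collect_eq
      by (meson of_nat_mono order_trans)
  qed
  have "measure ?M (\<Union>k\<in>{..r}. \<Union>i\<in>{..k}. V k i) \<le> (\<Sum>k\<in>{..r}. measure ?M (\<Union>i\<in>{..k}. V k i))"
    by (rule M.finite_measure_subadditive_finite) (use Vs in auto)
  also have "\<dots> \<le> (\<Sum>k\<in>{..r}. (real r + 1) / \<kappa>)"
  proof (rule sum_mono)
    fix k assume k: "k \<in> {..r}"
    have "measure ?M (\<Union>i\<in>{..k}. V k i) \<le> (\<Sum>i\<in>{..k}. measure ?M (V k i))"
      by (rule M.finite_measure_subadditive_finite) (use Vs in auto)
    also have "\<dots> \<le> (\<Sum>i\<in>{..k}. 1 / \<kappa>)"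
    proof (rule sum_mono)
      fix i assume "i \<in> {..k}"
      hence "measure ?M (V k i) \<le> measure ?M (Bad k i)" using VB Bs by (intro M.finite_measure_mono) auto
      thus "measure ?M (V k i) \<le> 1 / \<kappa>" using Bm[of k i] by linarith
    qed
    also have "\<dots> = (real k + 1) * (1 / \<kappa>)" by simp
    also have "\<dots> \<le> (real r + 1) * (1 / \<kappa>)" using k \<kappa>0 by (intro mult_right_mono) auto
    finally show "measure ?M (\<Union>i\<in>{..k}. V k i) \<le> (real r + 1) / \<kappa>" by simp
  qed
  also have "\<dots> = (real r + 1) * ((real r + 1) / (2 * (real r + 1)\<^sup>2))" by (simp add: \<kappa>_def)
  also have "\<dots> = 1 / 2"
  proof -
    have "x * (x / (2 * x\<^sup>2)) = 1 / 2" if "x > 0" for x :: real using that by (simp add: power2_eq_square)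
    from this[of "real r + 1"] show ?thesis by simp
  qed
  finally have "measure ?M (\<Union>k\<in>{..r}. \<Union>i\<in>{..k}. V k i) \<le> 1 / 2" .
  moreover have "measure ?M ?U = 1 - measure ?M (\<Union>k\<in>{..r}. \<Union>i\<in>{..k}. V k i)"
    unfolding U using Vs by (intro M.prob_compl sets.finite_UN) auto
  ultimately show "measure ?M ?U \<ge> 1 / 2" by linarith
qed

text \<open>The last factor is the price for rounding a time up to a dyadic one.\<close>
definition regularity_const :: "nat \<Rightarrow> real" where
  "regularity_const r = 2 * (real r + 1)\<^sup>2 * 2 ^ (2 * (r choose 2))"

lemma dyadic_above:
  fixes q :: real
  assumes "0 < q" "q \<le> 1"
  obtains j :: nat where "q \<le> (1 / 2) ^ j" "(1 / 2) ^ j < 2 * q"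
proof -
  obtain N :: nat where N: "(1 / 2) ^ N < q" using real_arch_pow_inv[OF assms(1), of "1 / 2"] by auto
  define j where "j = (GREATEST j. q \<le> (1 / 2 :: real) ^ j)"
  have bd: "k \<le> N" if "q \<le> (1 / 2) ^ k" for k
  proof (rule ccontr)
    assume "\<not> k \<le> N"
    hence "(1 / 2 :: real) ^ k \<le> (1 / 2) ^ N" by (intro power_decreasing) auto
    thus False using that N by linarith
  qed
  have P0: "q \<le> (1 / 2 :: real) ^ 0" using assms by simp
  have j: "q \<le> (1 / 2) ^ j" unfolding j_def by (rule GreatestI_nat[of "\<lambda>j. q \<le> (1 / 2) ^ j" 0 N, OF P0 bd])
  have "\<not> q \<le> (1 / 2 :: real) ^ Suc j"
  proof
    assume "q \<le> (1 / 2 :: real) ^ Suc j"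
    hence "Suc j \<le> (GREATEST j. q \<le> (1 / 2 :: real) ^ j)"
      by (rule Greatest_le_nat[of "\<lambda>j. q \<le> (1 / 2) ^ j" "Suc j" N, OF _ bd])
    hence "Suc j \<le> j" unfolding j_def[symmetric] .
    thus False by simp
  qed
  hence "(1 / 2) ^ j < 2 * q" by simp
  thus ?thesis using that j by blast
qed

lemma regular_pair_bound:
  assumes \<omega>: "\<omega> \<in> regular_event r n" and W: "W \<subseteq> {1..n}" and q: "(1 / 2) ^ (r * n) \<le> q" "q \<le> 1"
  shows "pair_bound r n (regularity_const r) (level W q \<omega>) W q"
  unfolding pair_bound_def
proof (intro allI impI)
  fix k i assume k: "k \<le> r" "i \<le> k"
  have "0 < (1 / 2 :: real) ^ (r * n)" by simp
  hence q0: "0 < q" using q by linarith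
  obtain j where j: "q \<le> (1 / 2) ^ j" "(1 / 2) ^ j < 2 * q" using dyadic_above[OF q0 q(2)] by blast
  define e where "e = 2 * (k choose 2) - (i choose 2)"
  define j' where "j' = min j (r * n)"
  have jr: "j' \<le> r * n" by (simp add: j'_def)
  have j': "q \<le> (1 / 2) ^ j'" "(1 / 2) ^ j' \<le> 2 * q"
  proof -
    have "q \<le> (1 / 2) ^ j' \<and> (1 / 2) ^ j' \<le> 2 * q"
    proof (cases "j \<le> r * n")
      case True thus ?thesis using j by (simp add: j'_def)
    next
      case False
      hence "(1 / 2 :: real) ^ j \<le> (1 / 2) ^ (r * n)" by (intro power_decreasing) auto
      hence "q \<le> (1 / 2) ^ (r * n)" "(1 / 2) ^ (r * n) \<le> 2 * q" using j(1) q(1) q0 by linarith+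
      moreover have "j' = r * n" using False by (simp add: j'_def)
      ultimately show ?thesis by simp
    qed
    thus "q \<le> (1 / 2) ^ j'" "(1 / 2) ^ j' \<le> 2 * q" by auto
  qed
  have "level W q \<omega> \<subseteq> level {1..n} ((1 / 2) ^ j') \<omega>"
    using pairs_mono[OF W] j'(1) unfolding level_def by auto
  hence "pair_count k i (level W q \<omega>) W \<le> pair_count k i (level {1..n} ((1 / 2) ^ j') \<omega>) {1..n}"
    by (intro pair_count_mono W) auto
  also have "real \<dots> \<le> 2 * (real r + 1)\<^sup>2 * (real n ^ (2 * k - i) * ((1 / 2) ^ j') ^ e)"
    using \<omega> k jr unfolding regular_event_def e_def by blast
  also have "\<dots> \<le> 2 * (real r + 1)\<^sup>2 * (real n ^ (2 * k - i) * (2 * q) ^ e)"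
    using j' by (intro mult_left_mono power_mono) auto
  also have "\<dots> = 2 * (real r + 1)\<^sup>2 * 2 ^ e * (real n ^ (2 * k - i) * q ^ e)" by (simp add: power_mult_distrib)
  also have "\<dots> \<le> regularity_const r * (real n ^ (2 * k - i) * q ^ e)"
  proof -
    have "k choose 2 \<le> r choose 2" using k by (intro binomial_right_mono)
    hence "(2::real) ^ e \<le> 2 ^ (2 * (r choose 2))" unfolding e_def by (intro power_increasing) auto
    thus ?thesis unfolding regularity_const_def using q0 by (intro mult_right_mono mult_left_mono) auto
  qed
  finally show "real (pair_count k i (level W q \<omega>) W) \<le> regularity_const r * (real n ^ (2 * k - i) * q ^ (2 * (k choose 2) - (i choose 2)))"
    unfolding e_def by simp
qed

section \<open>Removing the pairs by decreasing birth time\<close>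

text \<open>The admissible deficit of the logarithm of the number of factors, in units of \<open>n\<close>: the constant
of the complete graph, two units for the deviations of light and of heavy losses, and the difference
between the number of pairs and \<open>n\<^sup>2 * q\<close>.\<close>
definition deficit_const :: "nat \<Rightarrow> real" where
  "deficit_const r = ln (2 * real r) + 3 + real r * ln 32"

lemma sum_inverse_le_ln:
  assumes "1 \<le> m" "m \<le> N"
  shows "(\<Sum>j\<in>{m<..N}. 1 / real j) \<le> ln (real N) - ln (real m)"
  using assms(2)
proof (induction N rule: dec_induct)
  case (step N)
  have "{m<..Suc N} = insert (Suc N) {m<..N}" using step by auto
  hence "(\<Sum>j\<in>{m<..Suc N}. 1 / real j) = 1 / real (Suc N) + (\<Sum>j\<in>{m<..N}. 1 / real j)" by simp
  moreover have "1 / real (Suc N) \<le> ln (real (Suc N)) - ln (real N)"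
  proof -
    have N: "real N > 0" using step assms by simp
    have "ln (real N / real (Suc N)) \<le> real N / real (Suc N) - 1" using N by (intro ln_le_minus_one) simp
    moreover have "real N / real (Suc N) - 1 = - (1 / real (Suc N))" by (simp add: field_simps)
    moreover have "ln (real N / real (Suc N)) = ln (real N) - ln (real (Suc N))" using N by (simp add: ln_div)
    ultimately show ?thesis by linarith
  qed
  ultimately show ?case using step.IH by linarith
qed simp

lemma ln_fact_ge: "real M * (ln (real M) - 1) \<le> ln (fact M)" if "M > 0"
proof -
  have "real M ^ M / fact M \<le> exp (real M)"
  proof -
    have "(\<Sum>k\<in>{M}. real M ^ k /\<^sub>R fact k) \<le> exp (real M)"
      unfolding exp_def by (rule sum_le_suminf[OF summable_exp_generic]) auto
    thus ?thesis by (simp add: scaleR_conv_of_real divide_inverse mult.commute)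
  qed
  hence "ln (real M ^ M / fact M) \<le> ln (exp (real M))" using that by (intro ln_mono) auto
  hence "ln (real M ^ M / fact M) \<le> real M" by simp
  moreover have "ln (real M ^ M / fact M) = real M * ln (real M) - ln (fact M)"
    using that by (simp add: ln_div ln_realpow)
  ultimately show ?thesis by (simp add: algebra_simps)
qed

lemma ln_num_factors_complete_ge:
  assumes W: "finite W" and r: "r \<ge> 2" "r dvd card W" and n: "card W > 0" "card W \<le> n" "n \<le> 2 * card W"
  shows "num_factors r (pairs W) W > 0"
    and "real (card W) / real r * (real (r - 1) * ln (real n)) - (ln (2 * real r) + 1) * real n \<le> ln (real (num_factors r (pairs W) W))"
proof -
  obtain M where M: "card W = r * M" using r(2) by (auto simp: dvd_def)
  have M0: "M > 0" using M n by (cases M) auto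
  have le: "fact M ^ (r - 1) \<le> num_factors r (pairs W) W" by (rule fact_le_num_factors_complete[OF W M]) (use r in simp)
  have "(0::nat) < fact M ^ (r - 1)" by simp
  thus pos: "num_factors r (pairs W) W > 0" using le by linarith
  have Mr: "real M = real (card W) / real r" using M r by simp
  have "real (r - 1) * (real M * (ln (real M) - 1)) \<le> real (r - 1) * ln (fact M)"
    by (intro mult_left_mono ln_fact_ge M0) simp
  also have "\<dots> = ln (fact M ^ (r - 1))" by (simp add: ln_realpow)
  also have "\<dots> \<le> ln (real (num_factors r (pairs W) W))"
  proof (rule ln_mono)
    have "real (fact M ^ (r - 1)) \<le> real (num_factors r (pairs W) W)" using le by (simp only: of_nat_le_iff)
    thus "fact M ^ (r - 1) \<le> real (num_factors r (pairs W) W)" by simp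
  qed (use pos in auto)
  finally have 1: "real (r - 1) * (real M * (ln (real M) - 1)) \<le> ln (real (num_factors r (pairs W) W))" .
  have "ln (real n) - ln (2 * real r) \<le> ln (real M)"
  proof -
    have "real n \<le> 2 * real r * real M" using n(3) M by (metis mult.assoc of_nat_le_iff of_nat_mult of_nat_numeral)
    moreover have "real n > 0" using n by simp
    ultimately have "ln (real n) \<le> ln (2 * real r * real M)" by (intro ln_mono) auto
    thus ?thesis using M0 r by (simp add: ln_mult)
  qed
  hence "real (r - 1) * real M * (ln (real n) - ln (2 * real r) - 1) \<le> real (r - 1) * real M * (ln (real M) - 1)"
    by (intro mult_left_mono) auto
  moreover have "real (r - 1) * real M * (ln (2 * real r) + 1) \<le> real n * (ln (2 * real r) + 1)"
  proof (rule mult_right_mono)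
    have "(r - 1) * M \<le> r * M" by (intro mult_right_mono) auto
    hence "(r - 1) * M \<le> n" using M n by linarith
    thus "real (r - 1) * real M \<le> real n" by (metis of_nat_le_iff of_nat_mult)
    have "ln (2 * real r) \<ge> 0" using r by (intro ln_ge_zero) auto
    thus "0 \<le> ln (2 * real r) + 1" by simp
  qed
  ultimately show "real (card W) / real r * (real (r - 1) * ln (real n)) - (ln (2 * real r) + 1) * real n \<le> ln (real (num_factors r (pairs W) W))"
    using 1 unfolding Mr[symmetric] by (simp add: algebra_simps)
qed

lemma level_mono: "q \<le> q' \<Longrightarrow> level W q \<omega> \<subseteq> level W q' \<omega>"
  unfolding level_def by auto

text \<open>The list contains the pairs of \<open>W\<close> by decreasing birth time. Thus \<open>pool m\<close> is the graph
of the \<open>m\<close> earliest pairs, which is the graph at the birth of \<open>latest m\<close>, its last pair.\<close>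
locale birth_order =
  fixes W :: "nat set" and \<omega> :: "nat set \<Rightarrow> real" and l :: "nat set list"
  assumes finW: "finite W" and l: "l \<in> permutations_of_set (pairs W)"
    and sorted: "sorted_wrt (\<lambda>a b. \<omega> b < \<omega> a) l"
begin

definition "N = length l"
definition "pool m = set (drop (N - m) l)"
definition "latest m = l ! (N - m)"

lemma l_facts: "set l = pairs W" "distinct l" "N = card (pairs W)"
  using l distinct_card[of l] by (auto simp: permutations_of_set_def N_def)

lemma drop_step: "1 \<le> m \<Longrightarrow> m \<le> N \<Longrightarrow> drop (N - m) l = latest m # drop (N - (m - 1)) l"
proof -
  assume m: "1 \<le> m" "m \<le> N"
  hence "N - m < length l" by (simp add: N_def)
  from Cons_nth_drop_Suc[OF this] have "drop (N - m) l = l ! (N - m) # drop (Suc (N - m)) l" by simp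
  moreover have "Suc (N - m) = N - (m - 1)" using m by simp
  ultimately show ?thesis by (simp add: latest_def)
qed

lemma pool_N: "pool N = pairs W" by (simp add: pool_def l_facts)

lemma card_pool: "m \<le> N \<Longrightarrow> card (pool m) = m"
  unfolding pool_def using l_facts(2) by (subst distinct_card) (auto simp: N_def)

lemma pool_step:
  assumes "1 \<le> m" "m \<le> N"
  shows "pool m = insert (latest m) (pool (m - 1))" "latest m \<notin> pool (m - 1)" "pool m - {latest m} = pool (m - 1)" "latest m \<in> pool m"
proof -
  have d: "distinct (drop (N - m) l)" using l_facts by simp
  show 1: "pool m = insert (latest m) (pool (m - 1))" unfolding pool_def drop_step[OF assms] by simp
  show 2: "latest m \<notin> pool (m - 1)" using d unfolding drop_step[OF assms] pool_def by simp
  show "pool m - {latest m} = pool (m - 1)" "latest m \<in> pool m" using 1 2 by auto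
qed

lemma pool_mono: "m \<le> m' \<Longrightarrow> pool m \<subseteq> pool m'"
proof -
  assume "m \<le> m'"
  hence "N - m' \<le> N - m" by simp
  thus ?thesis unfolding pool_def by (rule set_drop_subset_set_drop)
qed

lemma pool_sub: "pool m \<subseteq> pairs W"
  unfolding pool_def using set_drop_subset[of "N - m" l] l_facts by simp

lemma latest_in: "1 \<le> m \<Longrightarrow> m \<le> N \<Longrightarrow> latest m \<in> pairs W"
  using pool_step(4) pool_sub by blast

lemma pool_level:
  assumes "1 \<le> m" "m \<le> N"
  shows "pool m = level W (\<omega> (latest m)) \<omega>"
proof -
  let ?a = "take (N - m) l"
  have split: "l = ?a @ latest m # drop (N - (m - 1)) l" using drop_step[OF assms] append_take_drop_id[of "N - m" l] by simp
  have s: "sorted_wrt (\<lambda>a b. \<omega> b < \<omega> a) (?a @ latest m # drop (N - (m - 1)) l)" using sorted split by simp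
  have hi: "\<omega> (latest m) < \<omega> g" if "g \<in> set ?a" for g using s that by (auto simp: sorted_wrt_append)
  have lo: "\<omega> g < \<omega> (latest m)" if "g \<in> set (drop (N - (m - 1)) l)" for g using s that by (auto simp: sorted_wrt_append)
  have ss: "pool m = insert (latest m) (set (drop (N - (m - 1)) l))" unfolding pool_def drop_step[OF assms] by simp
  have all: "pairs W = set ?a \<union> insert (latest m) (set (drop (N - (m - 1)) l))"
    using arg_cong[OF split, of set] l_facts(1) by simp
  show ?thesis
  proof (rule set_eqI)
    fix g
    show "g \<in> pool m \<longleftrightarrow> g \<in> level W (\<omega> (latest m)) \<omega>"
    proof
      assume "g \<in> pool m"
      thus "g \<in> level W (\<omega> (latest m)) \<omega>" unfolding level_def ss all using lo by force
    next
      assume g: "g \<in> level W (\<omega> (latest m)) \<omega>"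
      hence "g \<notin> set ?a" using hi unfolding level_def by force
      thus "g \<in> pool m" using g unfolding ss level_def all by blast
    qed
  qed
qed

lemma latest_early:
  assumes "1 \<le> m" "m \<le> N" "card (level W p \<omega>) < m"
  shows "p < \<omega> (latest m)"
proof (rule ccontr)
  assume "\<not> ?thesis"
  hence "pool m \<subseteq> level W p \<omega>" unfolding pool_level[OF assms(1,2)] level_def by force
  moreover have "finite (level W p \<omega>)" unfolding level_def using finW by simp
  ultimately have "m \<le> card (level W p \<omega>)" using card_mono card_pool[OF assms(2)] by metis
  thus False using assms(3) by simp
qed

lemma card_level_le: "card (level W p \<omega>) \<le> N"
  unfolding l_facts(3) level_def using finW by (intro card_mono) auto

lemma pool_at_level:
  assumes "1 \<le> card (level W p \<omega>)"
  shows "pool (card (level W p \<omega>)) = level W p \<omega>"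
proof -
  let ?m = "card (level W p \<omega>)"
  have fin: "finite (level W p \<omega>)" unfolding level_def using finW by simp
  have le: "\<omega> (latest ?m) \<le> p"
  proof (rule ccontr)
    assume "\<not> ?thesis"
    hence n: "p < \<omega> (latest ?m)" by simp
    have "level W p \<omega> \<subseteq> pool ?m - {latest ?m}"
    proof
      fix g assume "g \<in> level W p \<omega>"
      hence g: "g \<in> pairs W" "\<omega> g \<le> p" by (simp_all add: level_def)
      define t where "t = latest ?m"
      have "\<omega> g < \<omega> t" using g(2) n unfolding t_def by linarith
      hence "g \<in> level W (\<omega> t) \<omega>" "g \<noteq> t" using g by (auto simp: level_def)
      thus "g \<in> pool ?m - {latest ?m}" using pool_level[OF assms card_level_le] unfolding t_def by blast
    qed
    hence "level W p \<omega> \<subseteq> pool (?m - 1)" using pool_step(3)[OF assms card_level_le] by simp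
    moreover have "finite (pool (?m - 1))" by (simp add: pool_def)
    ultimately have "?m \<le> card (pool (?m - 1))" by (intro card_mono)
    also have "card (pool (?m - 1)) = ?m - 1" by (rule card_pool) (use card_level_le[of p] in simp)
    finally show False using assms by simp
  qed
  have "pool ?m \<subseteq> level W p \<omega>" using pool_level[OF assms card_level_le] level_mono[OF le] by blast
  thus ?thesis by (intro card_subset_eq fin) (use card_pool[OF card_level_le] in auto)
qed

lemma light_sum_eq:
  assumes "m \<le> M" "M \<le> N"
  shows "light_sum r W b m (drop (N - M) l) = (\<Sum>j\<in>{m<..M}. light r W b (pool j) (latest j))"
  using assms
proof (induction M rule: dec_induct)
  case base
  thus ?case by (simp add: light_sum_short N_def)
next
  case (step M)
  have d: "drop (N - Suc M) l = latest (Suc M) # drop (N - M) l" using drop_step[of "Suc M"] step by simp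
  have len: "length (drop (N - M) l) = M" using step by (simp add: N_def)
  have s: "set (latest (Suc M) # drop (N - M) l) = pool (Suc M)" unfolding pool_def d ..
  have "light_sum r W b m (drop (N - Suc M) l) = light r W b (pool (Suc M)) (latest (Suc M)) + light_sum r W b m (drop (N - M) l)"
    unfolding d light_sum.simps s using step len by simp
  moreover have "{m<..Suc M} = insert (Suc M) {m<..M}" using step by auto
  ultimately show ?case using step by simp
qed

lemma ln_num_factors_telescope:
  assumes "m \<le> M" "M \<le> N" "\<And>j. m \<le> j \<Longrightarrow> j \<le> M \<Longrightarrow> num_factors r (pool j) W > 0"
  shows "ln (real (num_factors r (pool m) W)) = ln (real (num_factors r (pool M) W)) - (\<Sum>j\<in>{m<..M}. loss r W (pool j) (latest j))"
  using assms
proof (induction M rule: dec_induct)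
  case base thus ?case by simp
next
  case (step M)
  have "pool (Suc M) - {latest (Suc M)} = pool M" using pool_step(3)[of "Suc M"] step by simp
  hence "loss r W (pool (Suc M)) (latest (Suc M)) = ln (real (num_factors r (pool (Suc M)) W)) - ln (real (num_factors r (pool M) W))"
    unfolding loss_def using step.prems(2)[of M] step.prems(2)[of "Suc M"] step.hyps by (simp add: ln_div)
  moreover have "{m<..Suc M} = insert (Suc M) {m<..M}" using step by auto
  ultimately show ?case using step by simp
qed

end

lemma sum_sqrt_geometric:
  assumes p: "0 < p" and I: "finite I" "\<And>i. i \<in> I \<Longrightarrow> p \<le> (1 / 2) ^ i"
  shows "(\<Sum>i\<in>I. sqrt (p / (1 / 2) ^ i)) \<le> 4"
proof (cases "I = {}")
  case False
  define M where "M = Max I"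
  have M: "M \<in> I" "\<And>i. i \<in> I \<Longrightarrow> i \<le> M" using I False by (auto simp: M_def)
  define s where "s = sqrt (2::real)"
  have s: "s > 0" "4 \<le> 3 * s"
  proof -
    show "s > 0" by (simp add: s_def)
    have "(4/3)\<^sup>2 \<le> (2::real)" by (simp add: power2_eq_square)
    hence "4 / 3 \<le> s" unfolding s_def by (rule real_le_rsqrt)
    thus "4 \<le> 3 * s" by simp
  qed
  have pw: "sqrt (p / (1 / 2) ^ i) = sqrt p * s ^ i" for i
    by (simp add: s_def power_one_over real_sqrt_mult real_sqrt_power)
  have geo: "(\<Sum>i\<le>k. s ^ i) \<le> 4 * s ^ k" for k
  proof (induction k)
    case (Suc k)
    have "4 * s ^ k \<le> 3 * s * s ^ k" using s by (intro mult_right_mono) auto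
    thus ?case using Suc by simp
  qed simp
  have "(\<Sum>i\<in>I. sqrt (p / (1 / 2) ^ i)) \<le> (\<Sum>i\<le>M. sqrt p * s ^ i)"
    unfolding pw using M(2) s p by (intro sum_mono2) auto
  also have "\<dots> = sqrt p * (\<Sum>i\<le>M. s ^ i)" by (rule sum_distrib_left[symmetric])
  also have "\<dots> \<le> sqrt p * (4 * s ^ M)" using geo p by (intro mult_left_mono) auto
  also have "\<dots> = 4 * sqrt (p / (1 / 2) ^ M)" unfolding pw by simp
  also have "\<dots> \<le> 4 * 1"
  proof (intro mult_left_mono)
    have "p / (1 / 2) ^ M \<le> 1" using I(2)[OF M(1)] by (simp add: divide_le_eq)
    thus "sqrt (p / (1 / 2) ^ M) \<le> 1" by simp
  qed simp
  finally show ?thesis by simp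
qed simp

lemma link_scale_eq:
  assumes "r \<ge> 1"
  shows "clique_scale n (r - 1) x * x ^ (r - 1) = real n ^ (r - 1) * x ^ (r choose 2)"
proof -
  have "r choose 2 = ((r - 1) choose 2) + (r - 1)" using choose_Suc_2[of "r - 1"] assms by simp
  thus ?thesis by (simp only: clique_scale_def power_add mult.assoc)
qed

text \<open>The scale of the number of \<open>r\<close>-cliques at a vertex grows at least linearly in time.\<close>
lemma link_scale_growth:
  assumes "0 < p" "p \<le> q" "q \<le> 1" "r \<ge> 2"
  shows "clique_scale n (r - 1) p * p ^ (r - 1) * (q / p) \<le> clique_scale n (r - 1) q * q ^ (r - 1)"
proof -
  have e: "clique_scale n (r - 1) x * x ^ (r - 1) = real n ^ (r - 1) * x ^ (r choose 2)" for x :: real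
    by (rule link_scale_eq) (use assms in simp)
  have "r choose 2 \<ge> 1" using assms(4) by (metis One_nat_def Suc_leI zero_less_binomial)
  hence "(q / p) ^ 1 \<le> (q / p) ^ (r choose 2)" using assms by (intro power_increasing) auto
  hence "real n ^ (r - 1) * p ^ (r choose 2) * (q / p) \<le> real n ^ (r - 1) * p ^ (r choose 2) * (q / p) ^ (r choose 2)"
    using assms by (intro mult_left_mono) auto
  also have "\<dots> = real n ^ (r - 1) * q ^ (r choose 2)" using assms by (simp add: power_divide)
  finally show ?thesis unfolding e .
qed

text \<open>The deterministic part of the argument, at one point \<open>\<omega>\<close> outside all exceptional events: the
clique counts are regular, no snapshot shows a witness, and the light losses never exceed their mean
by more than \<open>n\<close>. The threshold \<open>b0\<close> for light losses is large enough for the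
heavy ones to be rare, and \<open>m0\<close> below is a lower bound for the number of pairs born by
time \<open>p\<close>.\<close>
locale removal = birth_order W \<omega> l for W \<omega> l +
  fixes r n :: nat and p KS e1 b0 :: real and K :: nat
  assumes r3: "r \<ge> 3" and W: "W \<subseteq> {1..n}" "n \<le> 2 * card W" "r dvd card W"
    and p: "0 < p" "p \<le> 1" "(1 / 2) ^ (r * n) \<le> p"
    and Dp: "1 \<le> clique_scale n (r - 1) p * p ^ (r - 1)" "clique_scale n (r - 1) p * p ^ (r - 1) \<le> real n * p"
    and \<omega>: "\<omega> \<in> regular_event r n"
    and nwp: "no_witness r n W (level W p \<omega>) p e1 (1 / (8 * peak_bound r (regularity_const r) KS)) K {}"
    and nwf: "\<And>f. f \<in> pairs W \<Longrightarrow> p \<le> \<omega> f \<Longrightarrow> no_witness r n W (level W (\<omega> f) \<omega>) (\<omega> f) e1 (1 / (8 * peak_bound r (regularity_const r) KS)) K f"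
    and e1: "0 < e1" "e1 \<le> 1" and KS: "KS \<ge> 0"
    and K: "real K * (32 * (peak_bound r (regularity_const r) KS)\<^sup>2 * overlap_bound r (regularity_const r)) \<le> clique_scale n (r - 1) p * p ^ (r - 1)"
    and n_large: "16 * (real r + 3) \<le> real n"
    and slack: "2 * real r * ln (real n) + real r * ln (1 / local_ratio r (regularity_const r) e1) \<le> (KS - deficit_const r) * real n"
    and b0: "0 < b0"
    and b0_large: "4 * ((loss_bound r (regularity_const r) e1)\<^sup>2 * 4 ^ (r choose 2) * (real r * regularity_const r) * sqrt (32 * regularity_const r))
        \<le> b0 * (clique_scale n (r - 1) p * p ^ (r - 1))"
    and light: "\<And>m. nat \<lceil>(real n)\<^sup>2 * p / 32\<rceil> \<le> m \<Longrightarrow> m \<le> card (pairs W) \<Longrightarrow>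
      light_sum r W (\<lambda>j. b0 * sqrt (real (nat \<lceil>(real n)\<^sup>2 * p / 32\<rceil>) / real j)) m l
        < (\<Sum>j\<in>{m<..card (pairs W)}. (real (r - 1) * real (card W) / 2) / real j) + real n"
begin

definition "Dp = clique_scale n (r - 1) p * p ^ (r - 1)"
definition "m0 = nat \<lceil>(real n)\<^sup>2 * p / 32\<rceil>"
definition "b j = b0 * sqrt (real m0 / real j)"
definition "\<Gamma> = real (r - 1) * real (card W) / 2"
abbreviation "C \<equiv> loss_bound r (regularity_const r) e1"

lemma n0: "n > 0" using n_large by (cases n) auto

lemma kap1: "regularity_const r \<ge> 1"
proof -
  have "1 * 1 \<le> (2 * (real r + 1)\<^sup>2) * (2::real) ^ (2 * (r choose 2))"
  proof (rule mult_mono)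
    have "1 \<le> (real r + 1)\<^sup>2" by (rule one_le_power) simp
    thus "1 \<le> 2 * (real r + 1)\<^sup>2" by linarith
  qed (auto simp: one_le_power)
  thus ?thesis by (simp add: regularity_const_def)
qed

lemma m0: "1 \<le> m0" "(real n)\<^sup>2 * p / 32 \<le> real m0"
proof -
  have "(real n)\<^sup>2 * p / 32 > 0" using n0 p by simp
  thus "1 \<le> m0" unfolding m0_def by linarith
  show "(real n)\<^sup>2 * p / 32 \<le> real m0" unfolding m0_def by (rule real_nat_ceiling_ge)
qed

lemma \<omega>_le1: "g \<in> pairs W \<Longrightarrow> \<omega> g \<le> 1"
proof -
  assume "g \<in> pairs W"
  hence "g \<in> pairs {1..n}" using pairs_mono[OF W(1)] by auto
  moreover have "\<omega> \<in> space (unif_prod (pairs {1..n}))" using \<omega> by (simp add: regular_event_def birth_space_def)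
  ultimately show ?thesis using component_range by auto
qed

lemma snap:
  assumes "p \<le> q" "q \<le> 1" "1 \<le> m" "m \<le> Dp * (q / p)"
  shows "snapshot r n W (level W q \<omega>) q (regularity_const r) m"
proof
  have q0: "0 < q" using assms p by linarith
  have sc: "Dp * (q / p) \<le> clique_scale n (r - 1) q * q ^ (r - 1)" unfolding Dp_def by (rule link_scale_growth) (use assms p r3 in auto)
  show "3 \<le> r" "W \<subseteq> {1..n}" "n \<le> 2 * card W" "0 < q" "q \<le> 1" "1 \<le> regularity_const r" "1 \<le> m"
    using r3 W q0 assms kap1 by auto
  show "level W q \<omega> \<subseteq> pairs W" by (auto simp: level_def)
  show "pair_bound r n (regularity_const r) (level W q \<omega>) W q"
    by (rule regular_pair_bound[OF \<omega> W(1)]) (use assms p in auto)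
  show mD: "m \<le> clique_scale n (r - 1) q * q ^ (r - 1)" using sc assms by linarith
  thus "1 \<le> clique_scale n (r - 1) q * q ^ (r - 1)" using assms by linarith
  have "Dp * (q / p) \<le> real n * p * (q / p)" using Dp(2) q0 p unfolding Dp_def by (intro mult_right_mono) auto
  also have "\<dots> = real n * q" using p by simp
  finally show "m \<le> real n * q" using assms by linarith
qed

text \<open>The link scales at \<open>q \<ge> p\<close> are at least the scale \<open>Dp\<close> at \<open>p\<close>.\<close>
lemma snap_p:
  assumes "p \<le> q" "q \<le> 1"
  shows "snapshot r n W (level W q \<omega>) q (regularity_const r) Dp"
proof (rule snap[OF assms])
  show "1 \<le> Dp" using Dp by (simp add: Dp_def)
  have "Dp * 1 \<le> Dp * (q / p)" using \<open>1 \<le> Dp\<close> assms p by (intro mult_left_mono) auto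
  thus "Dp \<le> Dp * (q / p)" by simp
qed

lemma card_level_p: "m0 \<le> card (level W p \<omega>)"
proof -
  interpret snapshot r n W "level W p \<omega>" p "regularity_const r" Dp by (rule snap_p) (use p in auto)
  have "(real n)\<^sup>2 * p / 32 \<le> real (card (level W p \<omega>))" by (rule degree_sum[OF nwp]) (use n_large in simp)
  thus ?thesis unfolding m0_def by linarith
qed

lemma late:
  assumes "card (level W p \<omega>) < j" "j \<le> N"
  shows "1 \<le> j" "latest j \<in> pairs W" "p < \<omega> (latest j)" "\<omega> (latest j) \<le> 1" "pool j = level W (\<omega> (latest j)) \<omega>"
proof -
  show j: "1 \<le> j" using assms by simp
  show "latest j \<in> pairs W" by (rule latest_in[OF j assms(2)])
  thus "\<omega> (latest j) \<le> 1" by (rule \<omega>_le1)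
  show "p < \<omega> (latest j)" by (rule latest_early[OF j assms(2,1)])
  show "pool j = level W (\<omega> (latest j)) \<omega>" by (rule pool_level[OF j assms(2)])
qed

definition "tau j = \<omega> (latest j)"
definition "codegree j = card {Z \<in> cliques r (pool j) W. latest j \<in> pairs Z}"
definition "Dq q = clique_scale n (r - 1) q * q ^ (r - 1)"

lemma Dq_pos: "0 < q \<Longrightarrow> 0 < Dq q" using n0 by (simp add: Dq_def clique_scale_def)

lemma Dq_eq: "Dq q = real n ^ (r - 1) * q ^ (r choose 2)"
  unfolding Dq_def by (rule link_scale_eq) (use r3 in simp)

lemma pool_size_ge:
  assumes "card (level W p \<omega>) < j" "j \<le> N"
  shows "(real n)\<^sup>2 * tau j / 32 \<le> real j"
proof -
  note lt = late[OF assms]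
  interpret snapshot r n W "level W (\<omega> (latest j)) \<omega>" "\<omega> (latest j)" "regularity_const r" Dp by (rule snap_p) (use lt in auto)
  have "(real n)\<^sup>2 * \<omega> (latest j) / 32 \<le> real (card (level W (\<omega> (latest j)) \<omega>))"
    by (rule degree_sum[OF nwf]) (use n_large lt in auto)
  thus ?thesis using card_pool[OF assms(2)] lt(5) by (simp add: tau_def)
qed

lemma pool_size_le:
  assumes "card (level W p \<omega>) < j" "j \<le> N"
  shows "real j \<le> regularity_const r * (real n)\<^sup>2 * tau j"
proof -
  note lt = late[OF assms]
  let ?S = "level W (\<omega> (latest j)) \<omega>"
  interpret snapshot r n W ?S "\<omega> (latest j)" "regularity_const r" Dp by (rule snap_p) (use lt in auto)
  have pbi: "real (pair_count 2 2 ?S W) \<le> regularity_const r * (real n ^ (2 * 2 - 2) * \<omega> (latest j) ^ (2 * (2 choose 2) - (2 choose 2)))"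
    using pb[unfolded pair_bound_def, rule_format, of 2 2] r3 by simp
  have "?S \<subseteq> cliques 2 ?S W"
  proof
    fix f assume f: "f \<in> ?S"
    hence f2: "f \<subseteq> W" "card f = 2" by (auto simp: level_def pairs_def)
    have "pairs f \<subseteq> {f}"
    proof
      fix g assume "g \<in> pairs f"
      hence "g \<subseteq> f" "card g = card f" using f2 by (auto simp: pairs_def)
      moreover have "finite f" by (rule finite_subset[OF f2(1) finW])
      ultimately show "g \<in> {f}" using card_subset_eq by blast
    qed
    thus "f \<in> cliques 2 ?S W" using f f2 by (auto simp: cliques_def)
  qed
  hence "card ?S \<le> card (cliques 2 ?S W)" using finW by (intro card_mono) auto
  hence "real (card ?S) \<le> real (pair_count 2 2 ?S W)" using pair_count_diag[OF finW] by simp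
  also note pbi
  finally show ?thesis using card_pool[OF assms(2)] lt(5) by (simp add: tau_def)
qed

text \<open>The induction hypothesis is a sum over the steps; the exchange argument needs the time of the
snapshot. The harmonic sum turns into \<open>- ln q\<close> up to a constant, and the coefficients agree because
\<open>card W / r * (r choose 2) = \<Gamma>\<close>.\<close>
lemma count_lower:
  assumes j: "card (level W p \<omega>) < j" "j \<le> N"
    and A: "ln (real (num_factors r (pairs W) W)) - (\<Sum>i\<in>{j<..N}. \<Gamma> / real i) - 2 * real n \<le> ln (real (num_factors r (pool j) W))"
  shows "real (card W) / real r * ln (Dq (tau j)) - deficit_const r * real n \<le> ln (real (num_factors r (pool j) W))"
proof -
  note lt = late[OF j]
  define q where "q = tau j"
  have q: "0 < q" "q \<le> 1" using lt p by (auto simp: q_def tau_def)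
  have n1: "real n > 0" using n0 by simp
  have cW: "card W > 0" "card W \<le> n" using W n0 card_mono[OF _ W(1)] by auto
  have j0: "real j > 0" using lt(1) by simp
  have N_le: "real N \<le> (real n)\<^sup>2"
  proof -
    have "N = card W choose 2" using l_facts(3) card_pairs[OF finW] by simp
    also have "\<dots> \<le> n choose 2" using cW by (intro binomial_right_mono)
    also have "\<dots> \<le> n ^ 2" using n_large by (intro binomial_le_pow) simp
    finally have "real N \<le> real (n ^ 2)" by (simp only: of_nat_le_iff)
    thus ?thesis by simp
  qed
  have "(\<Sum>i\<in>{j<..N}. \<Gamma> / real i) = \<Gamma> * (\<Sum>i\<in>{j<..N}. 1 / real i)" by (simp add: sum_distrib_left)
  also have "\<dots> \<le> \<Gamma> * (ln (real N) - ln (real j))"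
    by (intro mult_left_mono sum_inverse_le_ln lt(1) j(2)) (simp add: \<Gamma>_def)
  also have "\<dots> \<le> \<Gamma> * (ln 32 - ln q)"
  proof (intro mult_left_mono)
    have "ln (real N) \<le> ln ((real n)\<^sup>2)" using N_le j0 j(2) by (intro ln_mono) auto
    moreover have "ln ((real n)\<^sup>2 * q / 32) \<le> ln (real j)"
      using pool_size_ge[OF j] q n1 by (intro ln_mono) (auto simp: q_def)
    moreover have "ln ((real n)\<^sup>2 * q / 32) = ln ((real n)\<^sup>2) + ln q - ln 32"
      using q n1 by (simp add: ln_mult ln_div)
    ultimately show "ln (real N) - ln (real j) \<le> ln 32 - ln q" by linarith
  qed (simp add: \<Gamma>_def)
  finally have harm: "(\<Sum>i\<in>{j<..N}. \<Gamma> / real i) \<le> \<Gamma> * (ln 32 - ln q)" .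
  have init: "real (card W) / real r * (real (r - 1) * ln (real n)) - (ln (2 * real r) + 1) * real n \<le> ln (real (num_factors r (pairs W) W))"
    by (rule ln_num_factors_complete_ge(2)[OF finW]) (use r3 W cW in auto)
  have "ln (Dq q) = real (r - 1) * ln (real n) + real (r choose 2) * ln q"
    unfolding Dq_eq using q n1 by (simp add: ln_mult ln_realpow)
  moreover have "real (card W) / real r * (real (r choose 2) * ln q) = \<Gamma> * ln q"
  proof -
    have c: "real (r choose 2) = real r * real (r - 1) / 2" using r3 by (simp add: real_choose_2 of_nat_diff)
    show ?thesis unfolding c \<Gamma>_def using r3 by simp
  qed
  ultimately have e: "real (card W) / real r * ln (Dq q) = real (card W) / real r * (real (r - 1) * ln (real n)) + \<Gamma> * ln q"
    by (simp only: distrib_left)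
  have h32: "\<Gamma> * ln 32 \<le> real r * ln 32 * real n"
  proof -
    have "\<Gamma> \<le> real r * real n"
    proof -
      have "real (r - 1) * real (card W) \<le> real r * real n" using cW by (intro mult_mono) auto
      moreover have "0 \<le> real (r - 1) * real (card W)" by simp
      ultimately show ?thesis unfolding \<Gamma>_def by linarith
    qed
    hence "\<Gamma> * ln 32 \<le> real r * real n * ln 32" by (intro mult_right_mono) auto
    thus ?thesis by (simp add: mult_ac)
  qed
  have "real (card W) / real r * ln (Dq q) - deficit_const r * real n \<le> ln (real (num_factors r (pairs W) W)) - \<Gamma> * (ln 32 - ln q) - 2 * real n"
  proof -
    have "deficit_const r * real n = (ln (2 * real r) + 1) * real n + 2 * real n + real r * ln 32 * real n"
      by (simp add: deficit_const_def algebra_simps)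
    moreover have "\<Gamma> * (ln 32 - ln q) = \<Gamma> * ln 32 - \<Gamma> * ln q" by (rule right_diff_distrib)
    ultimately show ?thesis using init h32 unfolding e by linarith
  qed
  thus ?thesis using harm A unfolding q_def by linarith
qed

lemma C_ge2: "C \<ge> 2"
proof -
  interpret snapshot r n W "level W p \<omega>" p "regularity_const r" Dp by (rule snap_p) (use p in auto)
  show ?thesis by (simp add: loss_bound_def)
qed

lemma loss_step:
  assumes j: "card (level W p \<omega>) < j" "j \<le> N"
    and pos: "num_factors r (pool j) W > 0"
    and A: "ln (real (num_factors r (pairs W) W)) - (\<Sum>i\<in>{j<..N}. \<Gamma> / real i) - 2 * real n \<le> ln (real (num_factors r (pool j) W))"
  shows "num_factors r (pool (j - 1)) W > 0" "loss r W (pool j) (latest j) \<le> C * real (codegree j) / Dq (tau j)"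
proof -
  note lt = late[OF j]
  let ?q = "\<omega> (latest j)" let ?S = "level W ?q \<omega>"
  interpret snapshot r n W ?S ?q "regularity_const r" Dp by (rule snap_p) (use lt in auto)
  have nw: "no_witness r n W ?S ?q e1 (1 / (8 * MM KS)) K (latest j)" by (rule nwf) (use lt in auto)
  have F0: "finite (latest j)" "card (latest j) \<le> 2"
    using lt(2) finite_subset[OF _ finW] by (auto simp: pairs_def)
  have D: "D = Dq ?q" by (simp add: D_def Dq_def)
  have e: "latest j \<in> ?S" using pool_step(4)[OF lt(1) j(2)] lt(5) by simp
  have pos': "num_factors r ?S W > 0" using pos lt(5) by simp
  have lnA: "real (card W) / real r * ln D - deficit_const r * real n \<le> ln (real (num_factors r ?S W))"
    using count_lower[OF j A] lt(5) unfolding D tau_def by simp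
  have K': "real K * (32 * (MM KS)\<^sup>2 * K5) \<le> Dp" using K by (simp add: Dp_def)
  note el = edge_loss[OF nw F0 e1 KS K' n_large slack e pos' lnA]
  have S': "?S - {latest j} = pool (j - 1)" using pool_step(3)[OF lt(1) j(2)] lt(5) by simp
  show "num_factors r (pool (j - 1)) W > 0" using el(1) unfolding S' .
  show "loss r W (pool j) (latest j) \<le> C * real (codegree j) / Dq (tau j)"
    using el(2) unfolding loss_def codegree_def tau_def D lt(5) .
qed

text \<open>Two cliques that both have \<open>latest j\<close> as their last-born edge share this edge, and different
\<open>j\<close> give different pairs of cliques. So the squares of the codegrees add up to at most the
number of pairs of cliques that share an edge at the end of the scale. The factor \<open>Q / p\<close> in the
denominator, which makes the sum over the scales converge, comes from the growth of the link scales.\<close>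
lemma scale_sum:
  assumes Q: "p \<le> Q" "Q \<le> 1" and J: "\<And>j. j \<in> J \<Longrightarrow> card (level W p \<omega>) < j \<and> j \<le> N \<and> tau j \<le> Q"
  shows "(\<Sum>j\<in>J. (real (codegree j))\<^sup>2) \<le> real r * (regularity_const r * real n * (Dq Q)\<^sup>2 / (Dp * (Q / p)))"
proof -
  have Dp1: "1 \<le> Dp" using Dp by (simp add: Dp_def)
  have "Dp * 1 \<le> Dp * (Q / p)" using Dp1 Q p by (intro mult_left_mono) auto
  hence m1: "1 \<le> Dp * (Q / p)" using Dp1 by linarith
  interpret snapshot r n W "level W Q \<omega>" Q "regularity_const r" "Dp * (Q / p)" by (rule snap[OF Q m1]) simp
  have finJ: "finite J" by (rule finite_subset[of _ "{..N}"]) (use J in auto)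
  define E where "E j = {Z \<in> cliques r (pool j) W. latest j \<in> pairs Z}" for j
  have finE: "finite (E j)" for j using finW by (simp add: E_def)
  have dis: "E i \<inter> E j = {}" if "i \<in> J" "j \<in> J" "i < j" for i j
  proof -
    have "latest j \<notin> pool i"
    proof
      assume "latest j \<in> pool i"
      moreover have "pool i \<subseteq> pool (j - 1)" by (rule pool_mono) (use that in simp)
      ultimately show False using pool_step(2)[of j] J[OF that(2)] late(1)[of j] by auto
    qed
    thus ?thesis unfolding E_def cliques_def by blast
  qed
  let ?P = "{(Z, Z'). Z \<in> cliques r (level W Q \<omega>) W \<and> Z' \<in> cliques r (level W Q \<omega>) W \<and> 2 \<le> card (Z \<inter> Z')}"
  have finP: "finite ?P"
    by (rule finite_subset[of _ "cliques r (level W Q \<omega>) W \<times> cliques r (level W Q \<omega>) W"]) (use finW in auto)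
  have sub: "E j \<times> E j \<subseteq> ?P" if "j \<in> J" for j
  proof -
    have lt: "card (level W p \<omega>) < j" "j \<le> N" "tau j \<le> Q" using J[OF that] by auto
    have "pool j \<subseteq> level W Q \<omega>" using late(5)[OF lt(1,2)] level_mono[OF lt(3), of W \<omega>] by (simp add: tau_def)
    hence "cliques r (pool j) W \<subseteq> cliques r (level W Q \<omega>) W" by (intro cliques_mono) auto
    moreover have "2 \<le> card (Z \<inter> Z')" if Z: "Z \<in> E j" "Z' \<in> E j" for Z Z'
    proof -
      have "latest j \<subseteq> Z \<inter> Z'" "card (latest j) = 2" using Z by (auto simp: E_def pairs_def)
      moreover have "finite (Z \<inter> Z')" using Z clique_finite[OF finW] by (auto simp: E_def)
      ultimately show ?thesis using card_mono[of "Z \<inter> Z'" "latest j"] by simp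
    qed
    ultimately show ?thesis by (auto simp: E_def)
  qed
  have "(\<Sum>j\<in>J. card (E j \<times> E j)) = card (\<Union>j\<in>J. E j \<times> E j)"
  proof (rule card_UN_disjoint[symmetric, OF finJ])
    show "\<forall>i\<in>J. finite (E i \<times> E i)" using finE by simp
    show "\<forall>i\<in>J. \<forall>j\<in>J. i \<noteq> j \<longrightarrow> (E i \<times> E i) \<inter> (E j \<times> E j) = {}"
    proof (intro ballI impI)
      fix i j assume "i \<in> J" "j \<in> J" "i \<noteq> j"
      hence "E i \<inter> E j = {}" using dis[of i j] dis[of j i] by (cases "i < j") auto
      thus "(E i \<times> E i) \<inter> (E j \<times> E j) = {}" by blast
    qed
  qed
  also have "\<dots> \<le> card ?P" by (rule card_mono[OF finP]) (use sub in blast)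
  finally have "real (\<Sum>j\<in>J. card (E j \<times> E j)) \<le> real (card ?P)" by (simp only: of_nat_le_iff)
  also have "\<dots> \<le> real r * (regularity_const r * real n * D\<^sup>2 / (Dp * (Q / p)))" by (rule card_edge_sharing)
  finally have "(\<Sum>j\<in>J. real (card (E j \<times> E j))) \<le> real r * (regularity_const r * real n * D\<^sup>2 / (Dp * (Q / p)))" by (simp only: of_nat_sum)
  moreover have "real (card (E j \<times> E j)) = (real (codegree j))\<^sup>2" for j
    by (simp add: card_cartesian_product codegree_def E_def power2_eq_square)
  ultimately show ?thesis by (simp add: D_def Dq_def)
qed

definition "heavy_const = C\<^sup>2 * 4 ^ (r choose 2) * (real r * regularity_const r) * sqrt (32 * regularity_const r)"

text \<open>A heavy loss \<open>x\<close> exceeds the threshold \<open>B\<close>, hence \<open>x \<le> x\<^sup>2 / B\<close>, so the squares of the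
codegrees take the place of the codegrees.\<close>
lemma heavy_scale:
  assumes Q: "p \<le> Q" "Q \<le> 1"
    and J: "\<And>j. j \<in> J \<Longrightarrow> card (level W p \<omega>) < j \<and> j \<le> N \<and> tau j \<le> Q \<and> Q < 2 * tau j"
    and los: "\<And>j. j \<in> J \<Longrightarrow> loss r W (pool j) (latest j) \<le> C * real (codegree j) / Dq (tau j)"
    and hv: "\<And>j. j \<in> J \<Longrightarrow> b j < loss r W (pool j) (latest j)"
  shows "(\<Sum>j\<in>J. loss r W (pool j) (latest j)) \<le> heavy_const * real n / (b0 * Dp) * sqrt (p / Q)"
proof -
  have Q0: "Q > 0" using Q p by linarith
  have Dp1: "1 \<le> Dp" using Dp by (simp add: Dp_def)
  have DQ0: "Dq Q > 0" by (rule Dq_pos[OF Q0])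
  have C0: "C > 0" using C_ge2 by linarith
  define B where "B = b0 * sqrt (p / (32 * regularity_const r * Q))"
  have B0: "B > 0" using b0 p Q0 kap1 by (simp add: B_def)
  define c where "c = C\<^sup>2 * 4 ^ (r choose 2) / (B * (Dq Q)\<^sup>2)"
  have c0: "c \<ge> 0" using B0 DQ0 by (simp add: c_def)
  have pt: "loss r W (pool j) (latest j) \<le> c * (real (codegree j))\<^sup>2" if j: "j \<in> J" for j
  proof -
    have jj: "card (level W p \<omega>) < j" "j \<le> N" "tau j \<le> Q" "Q < 2 * tau j" using J[OF j] by auto
    have t0: "tau j > 0" using late[OF jj(1,2)] p by (simp add: tau_def)
    have j0: "real j > 0" using late(1)[OF jj(1,2)] by simp
    have bB: "B \<le> b j"
    proof -
      have "p / (32 * regularity_const r * Q) \<le> real m0 / real j"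
      proof -
        have "real j \<le> regularity_const r * (real n)\<^sup>2 * Q"
        proof -
          have "regularity_const r * (real n)\<^sup>2 * tau j \<le> regularity_const r * (real n)\<^sup>2 * Q" using kap1 jj(3) by (intro mult_left_mono) auto
          thus ?thesis using pool_size_le[OF jj(1,2)] by linarith
        qed
        hence "((real n)\<^sup>2 * p / 32) / (regularity_const r * (real n)\<^sup>2 * Q) \<le> real m0 / real j"
          using m0 j0 p by (intro frac_le) auto
        moreover have "((real n)\<^sup>2 * p / 32) / (regularity_const r * (real n)\<^sup>2 * Q) = p / (32 * regularity_const r * Q)"
          using n0 Q0 kap1 by (simp add: field_simps)
        ultimately show ?thesis by simp
      qed
      thus ?thesis unfolding B_def b_def using b0 by (intro mult_left_mono) auto
    qed
    have Dt: "Dq Q \<le> 2 ^ (r choose 2) * Dq (tau j)"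
    proof -
      have "Q ^ (r choose 2) \<le> (2 * tau j) ^ (r choose 2)" using jj Q0 by (intro power_mono) auto
      hence "real n ^ (r - 1) * Q ^ (r choose 2) \<le> real n ^ (r - 1) * (2 * tau j) ^ (r choose 2)" by (intro mult_left_mono) auto
      thus ?thesis by (simp add: Dq_eq power_mult_distrib mult_ac)
    qed
    have Dt0: "Dq (tau j) > 0" by (rule Dq_pos[OF t0])
    define x where "x = C * real (codegree j) / Dq (tau j)"
    have lx: "loss r W (pool j) (latest j) \<le> x" using los[OF j] by (simp add: x_def)
    have Bx: "B < x" using bB hv[OF j] lx by linarith
    have "x * B \<le> x * x" using Bx B0 by (intro mult_left_mono) auto
    hence "x \<le> x\<^sup>2 / B" using B0 by (simp add: power2_eq_square le_divide_eq)
    also have "\<dots> \<le> c * (real (codegree j))\<^sup>2"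
    proof -
      have "x \<le> C * real (codegree j) * 2 ^ (r choose 2) / Dq Q"
      proof -
        have "1 / Dq (tau j) \<le> 2 ^ (r choose 2) / Dq Q" using Dt Dt0 DQ0 by (simp add: field_simps)
        hence "C * real (codegree j) * (1 / Dq (tau j)) \<le> C * real (codegree j) * (2 ^ (r choose 2) / Dq Q)"
          using C0 by (intro mult_left_mono) auto
        thus ?thesis by (simp add: x_def)
      qed
      hence "x\<^sup>2 \<le> (C * real (codegree j) * 2 ^ (r choose 2) / Dq Q)\<^sup>2" using Bx B0 by (intro power_mono) auto
      also have "\<dots> = C\<^sup>2 * (real (codegree j))\<^sup>2 * 4 ^ (r choose 2) / (Dq Q)\<^sup>2"
      proof -
        have "((2::real) ^ (r choose 2))\<^sup>2 = 4 ^ (r choose 2)" by (simp add: power2_eq_square power_mult_distrib[symmetric])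
        thus ?thesis by (simp add: power_mult_distrib power_divide)
      qed
      finally have "x\<^sup>2 / B \<le> C\<^sup>2 * (real (codegree j))\<^sup>2 * 4 ^ (r choose 2) / (Dq Q)\<^sup>2 / B" using B0 by (intro divide_right_mono) auto
      also have "\<dots> = c * (real (codegree j))\<^sup>2" by (simp add: c_def mult_ac)
      finally show ?thesis .
    qed
    finally show ?thesis using lx by linarith
  qed
  have "(\<Sum>j\<in>J. loss r W (pool j) (latest j)) \<le> c * (\<Sum>j\<in>J. (real (codegree j))\<^sup>2)"
    unfolding sum_distrib_left by (rule sum_mono) (rule pt)
  also have "\<dots> \<le> c * (real r * (regularity_const r * real n * (Dq Q)\<^sup>2 / (Dp * (Q / p))))"
    by (rule mult_left_mono[OF scale_sum[OF Q] c0]) (use J in blast)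
  also have "\<dots> = C\<^sup>2 * 4 ^ (r choose 2) * (real r * regularity_const r) * real n / Dp * (p / (B * Q))"
    using DQ0 by (simp add: c_def mult_ac)
  also have "p / (B * Q) = sqrt (32 * regularity_const r) / b0 * sqrt (p / Q)"
  proof -
    define s where "s = sqrt (p / Q)"
    have s: "s > 0" "s * s = p / Q" using p Q0 by (auto simp: s_def)
    have "sqrt (p / (32 * regularity_const r * Q)) = s / sqrt (32 * regularity_const r)"
      by (simp add: s_def real_sqrt_divide real_sqrt_mult)
    hence "p / (B * Q) = (p / Q) / (b0 * (s / sqrt (32 * regularity_const r)))" by (simp add: B_def)
    also have "\<dots> = (s * s) / (b0 * (s / sqrt (32 * regularity_const r)))" by (simp only: s)
    also have "\<dots> = sqrt (32 * regularity_const r) / b0 * s" using s(1) by simp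
    finally show ?thesis by (simp add: s_def)
  qed
  finally show ?thesis by (simp add: heavy_const_def mult_ac)
qed

text \<open>The times are grouped into dyadic scales; their contributions decay geometrically.\<close>
lemma heavy_total:
  assumes M: "card (level W p \<omega>) \<le> M"
    and los: "\<And>j. j \<in> {M<..N} \<Longrightarrow> loss r W (pool j) (latest j) \<le> C * real (codegree j) / Dq (tau j)"
  shows "(\<Sum>j | j \<in> {M<..N} \<and> b j < loss r W (pool j) (latest j). loss r W (pool j) (latest j)) \<le> real n"
proof -
  let ?L = "\<lambda>j. loss r W (pool j) (latest j)"
  let ?H = "{j. j \<in> {M<..N} \<and> b j < ?L j}"
  have jj: "card (level W p \<omega>) < j" "j \<le> N" if "j \<in> ?H" for j using that M by auto
  have "\<exists>i. tau j \<le> (1 / 2) ^ i \<and> (1 / 2) ^ i < 2 * tau j" if "j \<in> ?H" for j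
  proof -
    have "0 < tau j" "tau j \<le> 1" using late[OF jj[OF that]] p by (auto simp: tau_def)
    then obtain i where "tau j \<le> (1 / 2) ^ i" "(1 / 2) ^ i < 2 * tau j" by (rule dyadic_above)
    thus ?thesis by blast
  qed
  then obtain sc where sc: "\<And>j. j \<in> ?H \<Longrightarrow> tau j \<le> (1 / 2) ^ sc j \<and> (1 / 2) ^ sc j < 2 * tau j" by metis
  define I where "I = sc ` ?H"
  have finI: "finite I" by (simp add: I_def)
  have Ip: "p \<le> (1 / 2) ^ i" if "i \<in> I" for i
  proof -
    have "i \<in> sc ` ?H" using that unfolding I_def .
    then obtain j where j: "j \<in> ?H" "i = sc j" by blast
    have "p < tau j" using late(3)[OF jj[OF j(1)]] by (simp add: tau_def)
    thus ?thesis using sc[OF j(1)] j(2) by auto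
  qed
  have Dp1: "1 \<le> Dp" using Dp by (simp add: Dp_def)
  have Kh0: "heavy_const \<ge> 0" using kap1 by (simp add: heavy_const_def)
  have "(\<Sum>j\<in>?H. ?L j) = (\<Sum>i\<in>I. \<Sum>j | j \<in> ?H \<and> sc j = i. ?L j)"
    unfolding I_def by (rule sum.image_gen) simp
  also have "\<dots> \<le> (\<Sum>i\<in>I. heavy_const * real n / (b0 * Dp) * sqrt (p / (1 / 2) ^ i))"
  proof (rule sum_mono)
    fix i assume i: "i \<in> I"
    show "(\<Sum>j | j \<in> ?H \<and> sc j = i. ?L j) \<le> heavy_const * real n / (b0 * Dp) * sqrt (p / (1 / 2) ^ i)"
    proof (rule heavy_scale)
      show "p \<le> (1 / 2) ^ i" by (rule Ip[OF i])
      show "(1 / 2 :: real) ^ i \<le> 1" by (rule power_le_one) auto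
      fix j assume j: "j \<in> {j. j \<in> ?H \<and> sc j = i}"
      thus "card (level W p \<omega>) < j \<and> j \<le> N \<and> tau j \<le> (1 / 2) ^ i \<and> (1 / 2) ^ i < 2 * tau j"
        using jj[of j] sc[of j] by blast
      show "?L j \<le> C * real (codegree j) / Dq (tau j)" by (rule los) (use j in blast)
      show "b j < ?L j" using j by blast
    qed
  qed
  also have "\<dots> = heavy_const * real n / (b0 * Dp) * (\<Sum>i\<in>I. sqrt (p / (1 / 2) ^ i))" by (rule sum_distrib_left[symmetric])
  also have "\<dots> \<le> heavy_const * real n / (b0 * Dp) * 4"
    by (intro mult_left_mono sum_sqrt_geometric p(1) finI Ip) (use Kh0 b0 Dp1 in auto)
  also have "\<dots> \<le> real n"
  proof -
    have "4 * heavy_const \<le> b0 * Dp" using b0_large by (simp add: heavy_const_def Dp_def)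
    hence "4 * heavy_const * real n \<le> b0 * Dp * real n" by (intro mult_right_mono) auto
    moreover have "b0 * Dp > 0" using b0 Dp1 by simp
    ultimately show ?thesis by (simp add: divide_le_eq mult_ac)
  qed
  finally show ?thesis .
qed

text \<open>Downward induction on the number of remaining pairs: the bounds on the losses above \<open>M\<close> use only
the factor counts above \<open>M\<close>, and these losses determine the count at \<open>M\<close>.\<close>
lemma counts_survive:
  assumes M: "card (level W p \<omega>) \<le> M" "M \<le> N"
  shows "num_factors r (pool M) W > 0 \<and>
    ln (real (num_factors r (pairs W) W)) - (\<Sum>i\<in>{M<..N}. \<Gamma> / real i) - 2 * real n \<le> ln (real (num_factors r (pool M) W))"
  using M
proof (induction "N - M" arbitrary: M rule: less_induct)
  case less
  let ?L = "\<lambda>j. loss r W (pool j) (latest j)"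
  have cW: "card W > 0" "card W \<le> n" using W n0 card_mono[OF _ W(1)] by auto
  have IH: "num_factors r (pool j) W > 0 \<and>
    ln (real (num_factors r (pairs W) W)) - (\<Sum>i\<in>{j<..N}. \<Gamma> / real i) - 2 * real n \<le> ln (real (num_factors r (pool j) W))" if "j \<in> {M<..N}" for j
    using that less.prems by (intro less.hyps) auto
  have jj: "card (level W p \<omega>) < j" "j \<le> N" if "j \<in> {M<..N}" for j using that less.prems by auto
  have los: "?L j \<le> C * real (codegree j) / Dq (tau j)" "num_factors r (pool (j - 1)) W > 0" if "j \<in> {M<..N}" for j
    using loss_step(2,1)[OF jj[OF that] conjunct1[OF IH[OF that]] conjunct2[OF IH[OF that]]] by blast+
  have pos: "num_factors r (pool j) W > 0" if "M \<le> j" "j \<le> N" for j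
  proof (cases "j = N")
    case True
    thus ?thesis using ln_num_factors_complete_ge(1)[OF finW, of r n] r3 W cW by (simp add: pool_N)
  next
    case False
    thus ?thesis using los(2)[of "Suc j"] that by simp
  qed
  have tele: "ln (real (num_factors r (pool M) W)) = ln (real (num_factors r (pool N) W)) - (\<Sum>j\<in>{M<..N}. ?L j)"
    by (rule ln_num_factors_telescope[OF less.prems(2) order_refl pos])
  have split: "?L j = light r W b (pool j) (latest j) + (if b j < ?L j then ?L j else 0)" if "j \<in> {M<..N}" for j
  proof -
    have "pool j - {latest j} = pool (j - 1)" "card (pool j) = j"
      using pool_step(3)[of j] late(1)[OF jj[OF that]] jj(2)[OF that] card_pool by auto
    thus ?thesis using los(2)[OF that] by (simp add: light_def)
  qed
  have "(\<Sum>j\<in>{M<..N}. ?L j) = (\<Sum>j\<in>{M<..N}. light r W b (pool j) (latest j) + (if b j < ?L j then ?L j else 0))"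
    by (rule sum.cong[OF refl]) (rule split)
  also have "\<dots> = (\<Sum>j\<in>{M<..N}. light r W b (pool j) (latest j)) + (\<Sum>j | j \<in> {M<..N} \<and> b j < ?L j. ?L j)"
    by (simp add: sum.distrib sum.If_cases Int_def)
  also have "(\<Sum>j\<in>{M<..N}. light r W b (pool j) (latest j)) = light_sum r W b M l"
    using light_sum_eq[OF less.prems(2) order_refl, of r b] by simp
  also have "light_sum r W b M l \<le> (\<Sum>i\<in>{M<..N}. \<Gamma> / real i) + real n"
  proof -
    have "light_sum r W b M l < (\<Sum>i\<in>{M<..N}. \<Gamma> / real i) + real n"
      using light[of M] card_level_p less.prems l_facts(3) unfolding b_def m0_def \<Gamma>_def by simp
    thus ?thesis by simp
  qed
  also have "(\<Sum>j | j \<in> {M<..N} \<and> b j < ?L j. ?L j) \<le> real n"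
    by (rule heavy_total[OF less.prems(1) los(1)])
  finally have "(\<Sum>j\<in>{M<..N}. ?L j) \<le> (\<Sum>i\<in>{M<..N}. \<Gamma> / real i) + 2 * real n" by simp
  moreover have "num_factors r (pool M) W > 0" by (rule pos[OF order_refl less.prems(2)])
  ultimately show ?case using tele pool_N by simp
qed

lemma factor_exists: "num_factors r (level W p \<omega>) W > 0"
proof -
  have "1 \<le> card (level W p \<omega>)" using card_level_p m0 by linarith
  thus ?thesis using counts_survive[OF order_refl card_level_le] pool_at_level by simp
qed

end

section \<open>The family of witnesses\<close>

lemma pred_sparse_nbhd [measurable]: "Measurable.pred borel (\<lambda>q. sparse_nbhd r n W S q \<epsilon> k R t v)"
  unfolding sparse_nbhd_def clique_scale_def by measurable

lemma pred_crowded_nbhd [measurable]: "Measurable.pred borel (\<lambda>q. crowded_nbhd r n W S q \<epsilon> \<eta> K R y)"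
  unfolding crowded_nbhd_def clique_scale_def by measurable

lemma pred_pair_bound [measurable]: "Measurable.pred borel (\<lambda>q. pair_bound r n \<kappa> S V q)"
  unfolding pair_bound_def by measurable

text \<open>The components are the pair that defines the snapshot (if any), the root set, the root, the
vertex to be avoided, the size of the cliques and the kind of the witness: 0 and 1 for a sparse
neighbourhood with the density of the hierarchy and with density \<open>1 / 4\<close> (for degrees), 2 for a
crowded one. The root set is given as a list with repetitions, so that the number of witnesses is evident.\<close>
type_synonym witness = "nat set option \<times> nat list \<times> nat \<times> nat \<times> nat \<times> nat"

text \<open>A sparse neighbourhood is improbable only if the pair counts of the graph without \<open>x\<close> are under
control. This is made a part of the witness, since the event that all counts are regular is not local
to \<open>W\<close>.\<close>
definition witness_pred :: "nat \<Rightarrow> nat \<Rightarrow> real \<Rightarrow> nat set \<Rightarrow> real \<Rightarrow> real \<Rightarrow> nat \<Rightarrow> witness \<Rightarrow> real \<Rightarrow> nat set set \<Rightarrow> bool" where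
  "witness_pred r n p W e1 \<eta> K = (\<lambda>(t, xs, x, v, k, kd) q S. p \<le> q \<and>
     (if kd = 2 then crowded_nbhd r n W S q (eps e1 r (r - 1)) \<eta> K (set xs) x
      else sparse_nbhd r n W S q (if kd = 0 then eps e1 r k else 1 / 4) k (set xs) x v \<and>
        pair_bound r n (regularity_const r) {g \<in> S. x \<notin> g} W q))"

definition witness_event :: "nat \<Rightarrow> nat \<Rightarrow> real \<Rightarrow> nat set \<Rightarrow> real \<Rightarrow> real \<Rightarrow> nat \<Rightarrow> witness \<Rightarrow> (nat set \<Rightarrow> real) set" where
  "witness_event r n p W e1 \<eta> K i = {\<omega> \<in> space (birth_space n).
     witness_pred r n p W e1 \<eta> K i (stop_time p (fst i) \<omega>) (level W (stop_time p (fst i) \<omega>) \<omega>)}"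

definition witness_index :: "nat \<Rightarrow> nat set \<Rightarrow> witness set" where
  "witness_index r W = {(t, xs, x, v, k, kd). (\<forall>f. t = Some f \<longrightarrow> f \<in> pairs W) \<and> set xs \<subseteq> W \<and> length xs = r + 1 \<and>
     x \<in> set xs \<and> v \<in> W \<and> 1 \<le> k \<and> k \<le> r - 1 \<and> kd \<le> 2 \<and> (kd = 2 \<longrightarrow> (\<forall>f. t = Some f \<longrightarrow> x \<notin> f))}"

lemma witness_pred_borel: "{q. witness_pred r n p W e1 \<eta> K i q S} \<in> sets borel"
proof -
  obtain t xs x v k kd where i: "i = (t, xs, x, v, k, kd)" by (cases i)
  have "Measurable.pred borel (\<lambda>q. witness_pred r n p W e1 \<eta> K i q S)"
    unfolding witness_pred_def i prod.case by measurable
  thus ?thesis by (simp add: pred_def)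
qed

lemma witness_event_sets:
  assumes "W \<subseteq> {1..n}" "i \<in> witness_index r W"
  shows "witness_event r n p W e1 \<eta> K i \<in> sets (sigma_inside n W)"
  unfolding witness_event_def
  by (rule snapshot_event_sets[OF assms(1)]) (use assms(2) witness_pred_borel in \<open>auto simp: witness_index_def\<close>)

text \<open>The pair contributes at most \<open>n\<^sup>2\<close>, the list \<open>n ^ (r + 1)\<close>, and each of the four remaining
components at most \<open>n\<close>.\<close>
lemma card_witness_index:
  assumes W: "W \<subseteq> {1..n}" and n: "r \<le> n" "3 \<le> n"
  shows "finite (witness_index r W)" "card (witness_index r W) \<le> n ^ (r + 7)"
proof -
  have finW: "finite W" using finite_subset[OF W] by simp
  have cW: "card W \<le> n" using card_mono[OF _ W] by simp
  let ?T = "insert None (Some ` pairs W)"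
  let ?X = "{xs. set xs \<subseteq> W \<and> length xs = r + 1}"
  let ?P = "?T \<times> ?X \<times> W \<times> W \<times> {1..r - 1} \<times> {..2 :: nat}"
  have finX: "finite ?X" by (rule finite_lists_length_eq[OF finW])
  have finP: "finite ?P" using finW finX by auto
  have sub: "witness_index r W \<subseteq> ?P"
  proof
    fix i assume i: "i \<in> witness_index r W"
    obtain t xs x v k kd where ieq: "i = (t, xs, x, v, k, kd)" by (cases i)
    have I: "\<And>f. t = Some f \<Longrightarrow> f \<in> pairs W" "set xs \<subseteq> W" "length xs = r + 1" "x \<in> set xs" "v \<in> W" "1 \<le> k" "k \<le> r - 1" "kd \<le> 2"
      using i unfolding ieq witness_index_def by auto
    have "t \<in> ?T" using I(1) by (cases t) simp_all
    moreover have "x \<in> W" using I(2,4) by (rule subsetD)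
    ultimately show "i \<in> ?P" unfolding ieq using I(2,3,5-8) by simp
  qed
  show "finite (witness_index r W)" by (rule finite_subset[OF sub finP])
  have cT: "card ?T \<le> n ^ 2"
  proof -
    have "card ?T = card (pairs W) + 1"
      using finW by (subst card_insert_disjoint) (auto simp: card_image)
    also have "card (pairs W) = card W choose 2" by (rule card_pairs[OF finW])
    also have "\<dots> \<le> n choose 2" using cW by (rule binomial_right_mono)
    also have "(n choose 2) + 1 \<le> n ^ 2"
    proof -
      have "n choose 2 \<le> n * (n - 1)" by (simp add: choose_two)
      moreover have "n * (n - 1) + 1 \<le> n * n" using n by (cases n) auto
      ultimately show ?thesis unfolding power2_eq_square by linarith
    qed
    finally show ?thesis by simp
  qed
  have cX: "card ?X \<le> n ^ (r + 1)"
    unfolding card_lists_length_eq[OF finW] using cW by (rule power_mono) simp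
  have "card (witness_index r W) \<le> card ?P" by (rule card_mono[OF finP sub])
  also have "\<dots> = card ?T * (card ?X * (card W * (card W * (card {1..r - 1} * card {..2 :: nat}))))"
    by (simp only: card_cartesian_product)
  also have "\<dots> \<le> n ^ 2 * (n ^ (r + 1) * (n * (n * (n * n))))"
    by (intro mult_le_mono cT cX cW) (use n in auto)
  also have "\<dots> = n ^ (r + 7)" by (simp add: power_add power2_eq_square eval_nat_numeral)
  finally show "card (witness_index r W) \<le> n ^ (r + 7)" .
qed

lemma witness_cond_prob:
  assumes r: "r \<ge> 3" and W: "W \<subseteq> {1..n}" and i: "i \<in> witness_index r W" and n: "n > 0"
    and p: "0 < p" "p \<le> 1" and Dp: "1 \<le> D" "D = clique_scale n (r - 1) p * p ^ (r - 1)" "D \<le> real n * p"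
    and e1: "0 < e1" "e1 \<le> 1" and \<eta>: "\<eta> > 0" "e1 / \<eta> \<le> exp (-1)" and K: "c' * D \<le> real K"
    and c: "0 \<le> c" "c \<le> (eps e1 r (r - 1))\<^sup>2 / (8 * real r * regularity_const r)" "c \<le> c'"
  shows "AE \<omega> in birth_space n. real_cond_exp (birth_space n) (sigma_avoiding n (fst (snd (snd i))))
     (indicator (witness_event r n p W e1 \<eta> K i)) \<omega> \<le> exp (- c * D)"
proof -
  obtain t xs x v k kd where ieq: "i = (t, xs, x, v, k, kd)" by (cases i)
  have I: "\<And>f. t = Some f \<Longrightarrow> f \<in> pairs W" "set xs \<subseteq> W" "x \<in> set xs" "v \<in> W" "1 \<le> k" "k \<le> r - 1"
    "\<And>f. kd = 2 \<Longrightarrow> t = Some f \<Longrightarrow> x \<notin> f"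
    using i unfolding ieq witness_index_def by auto
  have xW: "x \<in> W" using I by auto
  have finW: "finite W" using finite_subset[OF W] by simp
  have kap0: "regularity_const r > 0" by (simp add: regularity_const_def zero_less_power)
  have eps0: "eps e1 r j > 0" for j using e1 r by (simp add: eps_def)
  have eps_mono: "eps e1 r (r - 1) \<le> eps e1 r j" if "j \<le> r - 1" for j
    unfolding eps_def using e1 r that by (intro divide_left_mono power_increasing mult_pos_pos zero_less_power) auto
  have "AE \<omega> in birth_space n. real_cond_exp (birth_space n) (sigma_avoiding n x)
     (indicator {\<omega> \<in> space (birth_space n). witness_pred r n p W e1 \<eta> K i (stop_time p t \<omega>) (level W (stop_time p t \<omega>) \<omega>)}) \<omega> \<le> exp (- c * D)"
  proof (rule snapshot_cond_prob[OF W I(1)])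
    fix q :: real and H assume q: "0 \<le> q" "q \<le> 1" and H: "H \<subseteq> pairs W" "\<And>g. g \<in> H \<Longrightarrow> x \<in> g \<Longrightarrow> t = Some g" "\<And>g. t = Some g \<Longrightarrow> g \<in> H"
    let ?V = "{v \<in> W - {x}. t \<noteq> Some {x, v}}"
    have finV: "finite ?V" using finW by simp
    show "bexp q ?V (\<lambda>N. if witness_pred r n p W e1 \<eta> K i q (H \<union> (\<lambda>v. {x, v}) ` N) then 1 else 0) \<le> exp (- c * D)"
    proof (cases "p \<le> q")
      case False
      hence "bexp q ?V (\<lambda>N. if witness_pred r n p W e1 \<eta> K i q (H \<union> (\<lambda>v. {x, v}) ` N) then 1 else 0) = bexp q ?V (\<lambda>N. 0)"
        by (intro bexp_cong) (simp add: witness_pred_def ieq)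
      thus ?thesis using finV by simp
    next
      case pq: True
      have q0: "0 < q" using pq p by linarith
      have mD: "D \<le> clique_scale n (r - 1) q * q ^ (r - 1)"
      proof -
        have "D * 1 \<le> D * (q / p)" using Dp pq p by (intro mult_left_mono) auto
        also have "\<dots> \<le> clique_scale n (r - 1) q * q ^ (r - 1)" unfolding Dp(2) by (rule link_scale_growth) (use pq p q r in auto)
        finally show ?thesis by simp
      qed
      have mn: "D \<le> real n * q" using Dp(3) pq mult_left_mono[OF pq, of "real n"] by simp
      show ?thesis
      proof (cases "kd = 2")
        case True
        have nx: "x \<notin> g" if "g \<in> H" for g using H(2)[OF that] I(7)[OF True] by blast
        have V: "?V = W - {x}" using I(7)[OF True] by auto
        have "bexp q (W - {x}) (\<lambda>N. if witness_pred r n p W e1 \<eta> K i q (H \<union> (\<lambda>v. {x, v}) ` N) then 1 else 0)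
          = bexp q (W - {x}) (\<lambda>N. if crowded_nbhd r n W (H \<union> star x N) q (eps e1 r (r - 1)) \<eta> K (set xs) x then 1 else 0)"
          using True pq by (simp add: witness_pred_def ieq star_def)
        also have "\<dots> \<le> (eps e1 r (r - 1) / \<eta>) ^ K"
          by (rule crowded_nbhd_prob[OF finW xW I(3) q0 q(2) n eps0 \<eta>(1) H(1) nx])
        also have "\<dots> \<le> exp (-1) ^ K"
        proof (rule power_mono)
          have "eps e1 r (r - 1) \<le> e1" using eps_def[of e1 r] e1 r one_le_power[of "8 * real r" "r - 1"] by (simp add: divide_le_eq)
          hence "eps e1 r (r - 1) / \<eta> \<le> e1 / \<eta>" using \<eta> by (intro divide_right_mono) auto
          thus "eps e1 r (r - 1) / \<eta> \<le> exp (-1)" using \<eta>(2) by linarith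
        qed (use eps0[of "r - 1"] \<eta> in auto)
        also have "\<dots> = exp (- real K)" by (simp add: exp_of_nat_mult[symmetric])
        also have "\<dots> \<le> exp (- c * D)"
        proof -
          have "c * D \<le> c' * D" using c Dp by (intro mult_right_mono) auto
          thus ?thesis using K by simp
        qed
        finally show ?thesis unfolding V .
      next
        case False
        define \<epsilon> where "\<epsilon> = (if kd = 0 then eps e1 r k else 1 / 4)"
        have \<epsilon>: "eps e1 r (r - 1) \<le> \<epsilon>"
        proof (cases "kd = 0")
          case True thus ?thesis using eps_mono[OF I(6)] by (simp add: \<epsilon>_def)
        next
          case False
          have "(8 * real r) ^ 1 \<le> (8 * real r) ^ (r - 1)" using r by (intro power_increasing) auto
          hence "4 \<le> (8 * real r) ^ (r - 1)" using r by simp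
          hence "e1 / (8 * real r) ^ (r - 1) \<le> 1 / 4" using e1 by (intro frac_le) auto
          thus ?thesis using False by (simp add: \<epsilon>_def eps_def)
        qed
        have \<epsilon>0: "\<epsilon> > 0" using \<epsilon> eps0[of "r - 1"] by linarith
        have "bexp q ?V (\<lambda>N. if witness_pred r n p W e1 \<eta> K i q (H \<union> (\<lambda>v. {x, v}) ` N) then 1 else 0)
          = bexp q ?V (\<lambda>N. if sparse_nbhd r n W (H \<union> star x N) q \<epsilon> k (set xs) x v \<and> pair_bound r n (regularity_const r) {g \<in> H \<union> star x N. x \<notin> g} W q then 1 else 0)"
          using False pq by (simp add: witness_pred_def ieq star_def \<epsilon>_def)
        also have "\<dots> \<le> exp (- (\<epsilon>\<^sup>2 / (8 * real r * regularity_const r)) * D)"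
          by (rule sparse_nbhd_prob[OF finW xW I(3) I(5,6) q0 q(2) kap0 n \<epsilon>0 _ mn mD H]) (use Dp in auto)
        also have "\<dots> \<le> exp (- c * D)"
        proof -
          have "(eps e1 r (r - 1))\<^sup>2 \<le> \<epsilon>\<^sup>2" using \<epsilon> eps0[of "r - 1"] by (intro power_mono) auto
          hence "(eps e1 r (r - 1))\<^sup>2 / (8 * real r * regularity_const r) \<le> \<epsilon>\<^sup>2 / (8 * real r * regularity_const r)"
            using kap0 by (intro divide_right_mono) auto
          hence "c * D \<le> \<epsilon>\<^sup>2 / (8 * real r * regularity_const r) * D" using c Dp by (intro mult_right_mono) auto
          thus ?thesis by simp
        qed
        finally show ?thesis .
      qed
    qed
  qed (use p xW witness_pred_borel in auto)
  thus ?thesis unfolding witness_event_def ieq by simp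
qed

text \<open>Regular pair counts are inherited by the graph without \<open>x\<close>, so the additional condition in the
definition of a witness is satisfied.\<close>
lemma no_witness_of_events:
  assumes W: "W \<subseteq> {1..n}" and r: "r \<ge> 3" and \<omega>: "\<omega> \<in> space (birth_space n)"
    and t: "\<And>f. t = Some f \<Longrightarrow> f \<in> pairs W"
    and q: "q = stop_time p t \<omega>" "p \<le> q" and pb: "pair_bound r n (regularity_const r) (level W q \<omega>) W q"
    and none: "\<And>i. i \<in> witness_index r W \<Longrightarrow> \<omega> \<notin> witness_event r n p W e1 \<eta> K i"
    and F0: "F0 = (case t of None \<Rightarrow> {} | Some f \<Rightarrow> f)"
  shows "no_witness r n W (level W q \<omega>) q e1 \<eta> K F0"
proof -
  have finW: "finite W" using finite_subset[OF W] by simp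
  let ?S = "level W q \<omega>"
  have pb': "pair_bound r n (regularity_const r) {g \<in> ?S. x \<notin> g} W q" for x
    unfolding pair_bound_def
  proof (intro allI impI)
    fix k i assume ki: "k \<le> r" "i \<le> k"
    have "pair_count k i {g \<in> ?S. x \<notin> g} W \<le> pair_count k i ?S W" by (rule pair_count_mono[OF finW]) auto
    thus "real (pair_count k i {g \<in> ?S. x \<notin> g} W) \<le> regularity_const r * (real n ^ (2 * k - i) * q ^ (2 * (k choose 2) - (i choose 2)))"
      using pb ki unfolding pair_bound_def by (meson of_nat_mono order_trans)
  qed
  have list: "\<exists>xs. set xs = R \<and> length xs = r + 1" if R: "R \<subseteq> W" "card R \<le> r + 1" "R \<noteq> {}" for R
  proof -
    have finR: "finite R" by (rule finite_subset[OF R(1) finW])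
    obtain ys where ys: "set ys = R" "distinct ys" using finite_distinct_list[OF finR] by blast
    have ly: "length ys = card R" using ys distinct_card by metis
    have ne: "ys \<noteq> []" using ys R by auto
    let ?xs = "ys @ replicate (r + 1 - card R) (hd ys)"
    have "set ?xs = R" using ys hd_in_set[OF ne] by (auto simp: set_replicate_conv_if)
    moreover have "length ?xs = r + 1" using ly R by simp
    ultimately show ?thesis by blast
  qed
  have ev: "\<not> witness_pred r n p W e1 \<eta> K (t, xs, x, v, k, kd) q ?S" if "(t, xs, x, v, k, kd) \<in> witness_index r W" for xs x v k kd
    using none[OF that] \<omega> unfolding witness_event_def q(1) by simp
  have low0: "\<not> sparse_nbhd r n W ?S q (eps e1 r k) k R x v"
    if R: "R \<subseteq> W" "card R \<le> r + 1" "x \<in> R" "v \<in> W" "1 \<le> k" "k \<le> r - 1" for R x v k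
  proof -
    obtain xs where xs: "set xs = R" "length xs = r + 1" using list[OF R(1,2)] R(3) by blast
    have "(t, xs, x, v, k, 0) \<in> witness_index r W" using R xs t by (auto simp: witness_index_def)
    from ev[OF this] show ?thesis using pb' q(2) xs by (simp add: witness_pred_def)
  qed
  have low1: "\<not> sparse_nbhd r n W ?S q (1 / 4) 1 {x} x x" if x: "x \<in> W" for x
  proof -
    obtain xs where xs: "set xs = {x}" "length xs = r + 1" using list[of "{x}"] x by auto
    have "(t, xs, x, x, 1, 1) \<in> witness_index r W" using x xs t r by (auto simp: witness_index_def)
    from ev[OF this] show ?thesis using pb' q(2) xs by (simp add: witness_pred_def)
  qed
  have up: "\<not> crowded_nbhd r n W ?S q (eps e1 r (r - 1)) \<eta> K R y" if R: "R \<subseteq> W" "card R = r + 1" "y \<in> R" "y \<notin> F0" for R y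
  proof -
    obtain xs where xs: "set xs = R" "length xs = r + 1" using list[of R] R by force
    have "(t, xs, y, y, 1, 2) \<in> witness_index r W" using R xs t r F0 by (auto simp: witness_index_def)
    from ev[OF this] show ?thesis using q(2) xs by (simp add: witness_pred_def)
  qed
  show ?thesis unfolding no_witness_def using low0 low1 up by blast
qed

lemma strict_order_exists:
  assumes A: "finite A" and inj: "inj_on \<omega> A"
  obtains l where "l \<in> permutations_of_set A" "sorted_wrt (\<lambda>a b. \<omega> b < (\<omega> a :: real)) l"
proof -
  obtain xs where xs: "set xs = A" "distinct xs" using finite_distinct_list[OF A] by blast
  let ?l = "sort_key (\<lambda>g. - \<omega> g) xs"
  have l: "set ?l = A" "distinct ?l" using xs by auto
  have s: "sorted (map (\<lambda>g. - \<omega> g) ?l)" by simp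
  have "\<omega> (?l ! j) < \<omega> (?l ! i)" if ij: "i < j" "j < length ?l" for i j
  proof -
    have "\<omega> (?l ! j) \<le> \<omega> (?l ! i)" using sorted_nth_mono[OF s, of i j] ij by simp
    moreover have "?l ! i \<noteq> ?l ! j" using l(2) ij by (simp add: nth_eq_iff_index_eq)
    hence "\<omega> (?l ! i) \<noteq> \<omega> (?l ! j)" using inj l(1) ij by (metis inj_onD nth_mem order.strict_trans)
    ultimately show ?thesis by simp
  qed
  hence "sorted_wrt (\<lambda>a b. \<omega> b < \<omega> a) ?l" unfolding sorted_wrt_iff_nth_less by blast
  moreover have "?l \<in> permutations_of_set A" using l by (simp add: permutations_of_set_def)
  ultimately show ?thesis using that by blast
qed

lemma has_clique_factor_of_num_factors:
  assumes W: "W \<subseteq> {1..n}" and pos: "num_factors r (level W p \<omega>) W > 0"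
  shows "has_clique_factor r (induced (birth_graph n p \<omega>) W)"
proof -
  have "factors r (level W p \<omega>) W \<noteq> {}" using pos by (auto simp: num_factors_def)
  then obtain P where P: "P \<subseteq> cliques r (level W p \<omega>) W" "pairwise disjnt P" "\<Union>P = W" by (auto simp: factors_def)
  have fs: "fst (induced (birth_graph n p \<omega>) W) = W" using W by (auto simp: induced_def birth_graph_def)
  have "level W p \<omega> \<subseteq> snd (induced (birth_graph n p \<omega>) W)"
    using pairs_mono[OF W] by (auto simp: level_def induced_def birth_graph_def pairs_def)
  hence "\<forall>T\<in>P. clique_copy r (induced (birth_graph n p \<omega>) W) T"
    using P(1) unfolding clique_copy_def fs cliques_def by blast
  thus ?thesis unfolding has_clique_factor_def fs using P by blast
qed

section \<open>The exceptional event and the covering\<close>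

lemma nat_floor_ge_half:
  fixes x :: real assumes "1 \<le> x"
  shows "real (nat \<lfloor>x\<rfloor>) \<le> x" "x / 2 \<le> real (nat \<lfloor>x\<rfloor>)"
proof -
  have f: "1 \<le> \<lfloor>x\<rfloor>" using assms by (simp add: le_floor_iff)
  hence e: "real (nat \<lfloor>x\<rfloor>) = of_int \<lfloor>x\<rfloor>" by simp
  show "real (nat \<lfloor>x\<rfloor>) \<le> x" unfolding e by simp
  have "x < of_int \<lfloor>x\<rfloor> + 1" by linarith
  moreover have "(1::real) \<le> of_int \<lfloor>x\<rfloor>" using f by simp
  ultimately show "x / 2 \<le> real (nat \<lfloor>x\<rfloor>)" unfolding e by linarith
qed

text \<open>The exceptional event consists of the ties and of the orders for which the light losses exceed their
mean by \<open>n\<close> at some step. The union over the at most \<open>n\<^sup>2\<close> steps is absorbed by half of the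
exponent.\<close>
lemma bad_order_event:
  assumes W: "W \<subseteq> {1..n}" and r: "r > 0" and n: "2 \<le> n" and m0: "1 \<le> m0" and b0: "0 < b0" "10 * real r * b0 \<le> 1"
    and big: "2 * ln (real n) \<le> real n / (40 * real r * b0)"
  obtains M where "M \<in> sets (birth_space n)" "measure (birth_space n) M \<le> exp (- (real n / (40 * real r * b0)))"
    "\<And>\<omega>. \<omega> \<in> space (birth_space n) \<Longrightarrow> \<omega> \<notin> M \<Longrightarrow> \<exists>l \<in> permutations_of_set (pairs W). sorted_wrt (\<lambda>a b. \<omega> b < \<omega> a) l \<and>
       (\<forall>m. m0 \<le> m \<longrightarrow> m \<le> card (pairs W) \<longrightarrow>
         light_sum r W (\<lambda>j. b0 * sqrt (real m0 / real j)) m l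
          < (\<Sum>j\<in>{m<..card (pairs W)}. (real (r - 1) * real (card W) / 2) / real j) + real n)"
proof -
  let ?M = "birth_space n" and ?A = "pairs W"
  let ?ls = "light_sum r W (\<lambda>j. b0 * sqrt (real m0 / real j))"
  let ?G = "\<lambda>m. (\<Sum>j\<in>{m<..card ?A}. (real (r - 1) * real (card W) / 2) / real j) + real n"
  interpret M: prob_space ?M by (rule prob_space_birth_space)
  have finW: "finite W" using finite_subset[OF W] by simp
  have cW: "card W \<le> n" using card_mono[OF _ W] by simp
  have finA: "finite ?A" by (rule finite_pairs[OF finW])
  have WI: "?A \<subseteq> pairs {1..n}" by (rule pairs_mono[OF W])
  define ties where "ties = (\<Union>f\<in>?A. \<Union>g\<in>?A - {f}. {\<omega> \<in> space ?M. \<omega> f = \<omega> g})"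
  define Lm where "Lm m = {l \<in> permutations_of_set ?A. ?G m \<le> ?ls m l}" for m
  define L where "L = (\<Union>m\<in>{m0..card ?A}. Lm m)"
  have L: "L \<subseteq> permutations_of_set ?A" by (auto simp: L_def Lm_def)
  define X where "X = (\<Union>l\<in>L. order_event n l)"
  have tie: "{\<omega> \<in> space ?M. \<omega> f = \<omega> g} \<in> null_sets ?M" if "f \<in> ?A" "g \<in> ?A - {f}" for f g
  proof -
    have fg: "f \<in> pairs {1..n}" "g \<in> pairs {1..n}" "f \<noteq> g" using that WI by auto
    show ?thesis by (rule null_setsI[OF tie_null(2)[OF fg] tie_null(1)[OF fg]])
  qed
  have ties: "ties \<in> null_sets ?M" unfolding ties_def
    using finA tie by (intro null_sets_UN' countable_finite) auto
  have Xs: "X \<in> sets ?M" unfolding X_def by (rule measure_orders_le[OF WI L])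
  define E where "E = exp (- (real n / (20 * real r * b0)))"
  have cardL: "real (card L) \<le> (real n)\<^sup>2 * (fact (card ?A) * E)"
  proof -
    have "card L \<le> (\<Sum>m\<in>{m0..card ?A}. card (Lm m))" unfolding L_def by (rule card_UN_le) simp
    hence "real (card L) \<le> (\<Sum>m\<in>{m0..card ?A}. real (card (Lm m)))" by (metis of_nat_mono of_nat_sum)
    also have "\<dots> \<le> (\<Sum>m\<in>{m0..card ?A}. fact (card ?A) * E)"
    proof (rule sum_mono)
      fix m assume m: "m \<in> {m0..card ?A}"
      show "real (card (Lm m)) \<le> fact (card ?A) * E"
        unfolding Lm_def E_def by (rule light_tail[OF finW cW r finA m0 _ b0]) (use m in simp)
    qed
    also have "\<dots> = real (Suc (card ?A) - m0) * (fact (card ?A) * E)" by simp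
    also have "\<dots> \<le> (real n)\<^sup>2 * (fact (card ?A) * E)"
    proof (rule mult_right_mono)
      have "card ?A = card W choose 2" by (rule card_pairs[OF finW])
      also have "\<dots> \<le> n choose 2" using cW by (rule binomial_right_mono)
      also have "\<dots> \<le> n\<^sup>2" using n by (rule binomial_le_pow)
      finally have "Suc (card ?A) - m0 \<le> n\<^sup>2" using m0 by simp
      thus "real (Suc (card ?A) - m0) \<le> (real n)\<^sup>2" by (metis of_nat_mono of_nat_power)
    qed (simp add: E_def)
    finally show ?thesis .
  qed
  have "measure ?M X \<le> real (card L) / fact (card ?A)" unfolding X_def by (rule measure_orders_le[OF WI L])
  also have "\<dots> \<le> (real n)\<^sup>2 * (fact (card ?A) * E) / fact (card ?A)" using cardL by (intro divide_right_mono) auto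
  also have "\<dots> = (real n)\<^sup>2 * E" by simp
  also have "(real n)\<^sup>2 = exp (2 * ln (real n))"
    using n ln_realpow[of "real n" 2] by (metis exp_ln of_nat_0_less_iff of_nat_numeral pos2 order.strict_trans2 zero_less_power)
  also have "exp (2 * ln (real n)) * E = exp (2 * ln (real n) - 2 * (real n / (40 * real r * b0)))"
    unfolding E_def exp_add[symmetric] by simp
  also have "\<dots> \<le> exp (- (real n / (40 * real r * b0)))" unfolding exp_le_cancel_iff using big by argo
  finally have mX: "measure ?M X \<le> exp (- (real n / (40 * real r * b0)))" .
  show ?thesis
  proof (rule that)
    show "ties \<union> X \<in> sets ?M" using ties Xs by auto
    have "measure ?M (ties \<union> X) = measure ?M X" using measure_Un_null_set[OF Xs ties] by (simp add: Un_commute)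
    thus "measure ?M (ties \<union> X) \<le> exp (- (real n / (40 * real r * b0)))" using mX by simp
  next
    fix \<omega> assume w: "\<omega> \<in> space ?M" "\<omega> \<notin> ties \<union> X"
    have "inj_on \<omega> ?A" 
    proof (rule inj_onI, rule ccontr)
      fix f g assume "f \<in> ?A" "g \<in> ?A" "\<omega> f = \<omega> g" "f \<noteq> g"
      hence "\<omega> \<in> ties" using w(1) unfolding ties_def by blast
      thus False using w(2) by blast
    qed
    then obtain l where l: "l \<in> permutations_of_set ?A" "sorted_wrt (\<lambda>a b. \<omega> b < \<omega> a) l"
      by (rule strict_order_exists[OF finA])
    have "\<omega> \<in> order_event n l" using w(1) l(2) by (simp add: order_event_def)
    hence "l \<notin> L" using w(2) unfolding X_def by blast
    hence "?ls m l < ?G m" if "m0 \<le> m" "m \<le> card ?A" for m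
      using that l(1) unfolding L_def Lm_def by fastforce
    thus "\<exists>l \<in> permutations_of_set ?A. sorted_wrt (\<lambda>a b. \<omega> b < \<omega> a) l \<and>
       (\<forall>m. m0 \<le> m \<longrightarrow> m \<le> card ?A \<longrightarrow> ?ls m l < ?G m)" using l by blast
  qed
qed

lemma constants_positive:
  assumes "r \<ge> 3" "\<kappa> > 0" "0 < e1"
  shows "0 < peak_bound r \<kappa> KS" "0 < overlap_bound r \<kappa>" "0 < local_ratio r \<kappa> e1" "0 < eps e1 r k"
  using assms by (simp_all add: peak_bound_def overlap_bound_def local_ratio_def link_share_def eps_def)

text \<open>The statement for a fixed \<open>n\<close>, with the density \<open>D\<close> in place of the normalised expected number of
cliques. The constants are chosen in this order: \<open>KS\<close> exceeds the admissible deficit by one;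
the hierarchy of densities starts so low that a crowded neighbourhood gains a factor \<open>exp (- 1)\<close> for
each of its \<open>K\<close> cliques; \<open>K\<close>, of order \<open>D\<close>, is as large as the greedy choice of tuples
permits; \<open>b0\<close> is the least threshold that makes the heavy losses sum up to at most
\<open>n\<close>, and it is of order \<open>1 / D\<close>.\<close>
lemma factor_failure_cover:
  assumes r: "r \<ge> 3"
  shows "\<exists>c T :: real. 0 < c \<and> 1 \<le> T \<and>
    (\<forall>n p D W. D = real n ^ (r - 1) * p ^ (r choose 2) \<longrightarrow> 0 < p \<longrightarrow> p \<le> 1 \<longrightarrow> (1 / 2) ^ (r * n) \<le> p \<longrightarrow>
      T \<le> D \<longrightarrow> T * ln (real n) \<le> D \<longrightarrow> D \<le> real n * p \<longrightarrow> T \<le> real n \<longrightarrow> T * ln (real n) \<le> real n \<longrightarrow>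
      W \<subseteq> {1..n} \<longrightarrow> n \<le> 2 * card W \<longrightarrow> r dvd card W \<longrightarrow>
      (\<exists>M \<in> sets (birth_space n). measure (birth_space n) M \<le> exp (- (c * real n * D)) \<and>
        (\<exists>(A :: nat set) (E :: nat \<Rightarrow> (nat set \<Rightarrow> real) set) (x :: nat \<Rightarrow> nat).
          finite A \<and> card A \<le> n ^ (r + 7) \<and>
          (\<forall>\<alpha>\<in>A. x \<alpha> \<in> W \<and> E \<alpha> \<in> sets (sigma_inside n W) \<and>
            (AE \<omega> in birth_space n. real_cond_exp (birth_space n) (sigma_avoiding n (x \<alpha>)) (indicator (E \<alpha>)) \<omega> \<le> exp (- c * D))) \<and>
          {\<omega> \<in> space (birth_space n). \<not> has_clique_factor r (induced (birth_graph n p \<omega>) W)} \<inter> regular_event r n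
            \<subseteq> M \<union> (\<Union>\<alpha>\<in>A. E \<alpha>))))"
proof -
  define KS where "KS = deficit_const r + 1"
  define MM where "MM = peak_bound r (regularity_const r) KS"
  define Q where "Q = 32 * MM\<^sup>2 * overlap_bound r (regularity_const r)"
  define \<eta> where "\<eta> = 1 / (8 * MM)"
  define e1 where "e1 = min 1 (exp (-1) * \<eta>)"
  define B where "B = 4 * ((loss_bound r (regularity_const r) e1)\<^sup>2 * 4 ^ (r choose 2) * (real r * regularity_const r) * sqrt (32 * regularity_const r))"
  have kap0: "regularity_const r > 0" by (simp add: regularity_const_def zero_less_power)
  have r0: "real r > 0" using r by simp
  have MM0: "MM > 0" using constants_positive(1)[OF r kap0 zero_less_one] by (simp add: MM_def)
  have Q0: "Q > 0" using constants_positive(2)[OF r kap0 zero_less_one] MM0 by (simp add: Q_def)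
  have \<eta>0: "\<eta> > 0" using MM0 by (simp add: \<eta>_def)
  have e1: "0 < e1" "e1 \<le> 1" "e1 / \<eta> \<le> exp (-1)" using \<eta>0 by (auto simp: e1_def min_def divide_le_eq not_le)
  have C2: "loss_bound r (regularity_const r) e1 \<ge> 2" by (simp add: loss_bound_def)
  have B0: "B > 0" unfolding B_def using C2 r0 kap0 by (intro mult_pos_pos zero_less_power) auto
  have KA0: "deficit_const r \<ge> 0" unfolding deficit_const_def using r by (intro add_nonneg_nonneg mult_nonneg_nonneg ln_ge_zero) auto
  define c where "c = Min {(eps e1 r (r - 1))\<^sup>2 / (8 * real r * regularity_const r), 1 / (2 * Q), 1 / (40 * real r * B)}"
  have c: "c \<le> (eps e1 r (r - 1))\<^sup>2 / (8 * real r * regularity_const r)" "c \<le> 1 / (2 * Q)" "c \<le> 1 / (40 * real r * B)"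
    by (simp_all add: c_def)
  have c0: "c > 0" using constants_positive(4)[OF r kap0 e1(1), of "r - 1"] Q0 B0 r0 kap0
    by (simp add: c_def)
  define v where "v = 2 * real r * \<bar>ln (1 / local_ratio r (regularity_const r) e1)\<bar>"
  define T where "T = 3 + Q + 80 * real r * B + 16 * (real r + 3) + 4 * real r + v"
  have rB: "80 * real r * B > 0" using r0 B0 by simp
  have abs0: "v \<ge> 0" using r0 by (simp add: v_def)
  have T: "3 \<le> T" "Q \<le> T" "80 * real r * B \<le> T" "16 * (real r + 3) \<le> T" "4 * real r \<le> T" "v \<le> T"
    using Q0 rB abs0 r0 by (auto simp: T_def algebra_simps)
  show ?thesis
  proof (rule exI[of _ c], rule exI[of _ T], intro conjI c0 allI impI)
    show "1 \<le> T" using T by simp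
    fix n :: nat and p D :: real and W :: "nat set"
    assume D: "D = real n ^ (r - 1) * p ^ (r choose 2)" and p: "0 < p" "p \<le> 1" "(1 / 2) ^ (r * n) \<le> p"
      and TD: "T \<le> D" "T * ln (real n) \<le> D" and Dn: "D \<le> real n * p" and Tn: "T \<le> real n" "T * ln (real n) \<le> real n"
      and W: "W \<subseteq> {1..n}" "n \<le> 2 * card W" "r dvd card W"
    have n: "3 \<le> n" "r \<le> n" using Tn T r by auto
    have ln0: "ln (real n) \<ge> 0" using n by simp
    have D0: "0 < D" "1 \<le> D" using TD T by auto
    have De: "D = clique_scale n (r - 1) p * p ^ (r - 1)" unfolding D by (rule link_scale_eq[symmetric]) (use r in simp)
    define K where "K = nat \<lfloor>D / Q\<rfloor>"
    have DQ: "1 \<le> D / Q" using TD T Q0 by (simp add: le_divide_eq)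
    have K: "real K * Q \<le> D" "1 / (2 * Q) * D \<le> real K"
      using nat_floor_ge_half[OF DQ] Q0 by (simp_all add: K_def le_divide_eq)
    define b0 where "b0 = B / D"
    have b0: "0 < b0" "10 * real r * b0 \<le> 1"
    proof -
      have "80 * real r * B \<le> D" using TD T by linarith
      hence "10 * real r * B \<le> D" using rB by linarith
      thus "10 * real r * b0 \<le> 1" using D0 by (simp add: b0_def divide_le_eq)
    qed (use B0 D0 in \<open>simp add: b0_def\<close>)
    have b0e: "real n / (40 * real r * b0) = real n * D / (40 * real r * B)" using D0 by (simp add: b0_def)
    have big: "2 * ln (real n) \<le> real n / (40 * real r * b0)"
    proof -
      have "80 * real r * B * ln (real n) \<le> T * ln (real n)" using T ln0 by (intro mult_right_mono)
      also have "\<dots> \<le> 1 * D" using TD by simp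
      also have "\<dots> \<le> real n * D" using n D0 by (intro mult_right_mono) auto
      finally show ?thesis unfolding b0e using r0 B0 by (simp add: le_divide_eq mult_ac)
    qed
    define m0 where "m0 = nat \<lceil>(real n)\<^sup>2 * p / 32\<rceil>"
    have m0: "1 \<le> m0"
    proof -
      have "0 < (real n)\<^sup>2 * p / 32" using n p by simp
      thus ?thesis unfolding m0_def by linarith
    qed
    obtain M where M: "M \<in> sets (birth_space n)" "measure (birth_space n) M \<le> exp (- (real n / (40 * real r * b0)))"
      "\<And>\<omega>. \<omega> \<in> space (birth_space n) \<Longrightarrow> \<omega> \<notin> M \<Longrightarrow> \<exists>l \<in> permutations_of_set (pairs W). sorted_wrt (\<lambda>a b. \<omega> b < \<omega> a) l \<and>
         (\<forall>m. m0 \<le> m \<longrightarrow> m \<le> card (pairs W) \<longrightarrow>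
           light_sum r W (\<lambda>j. b0 * sqrt (real m0 / real j)) m l
            < (\<Sum>j\<in>{m<..card (pairs W)}. (real (r - 1) * real (card W) / 2) / real j) + real n)"
      by (rule bad_order_event[OF W(1) _ _ m0 b0 big]) (use r n in auto)
    let ?I = "witness_index r W"
    obtain h where h: "bij_betw h {0..<card ?I} ?I"
      using ex_bij_betw_nat_finite[OF card_witness_index(1)[OF W(1) n(2,1)]] by blast
    let ?A = "{0..<card ?I}" and ?E = "\<lambda>\<alpha>. witness_event r n p W e1 \<eta> K (h \<alpha>)" and ?x = "\<lambda>\<alpha>. fst (snd (snd (h \<alpha>)))"
    have cA: "card ?A \<le> n ^ (r + 7)" using card_witness_index(2)[OF W(1) n(2,1)] by simp
    have wit: "?x \<alpha> \<in> W \<and> ?E \<alpha> \<in> sets (sigma_inside n W) \<and>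
       (AE \<omega> in birth_space n. real_cond_exp (birth_space n) (sigma_avoiding n (?x \<alpha>)) (indicator (?E \<alpha>)) \<omega> \<le> exp (- c * D))"
      if "\<alpha> \<in> ?A" for \<alpha>
    proof (intro conjI)
      have i: "h \<alpha> \<in> ?I" using h that by (auto simp: bij_betw_def)
      show "?x \<alpha> \<in> W" using i by (auto simp: witness_index_def split: prod.splits)
      show "?E \<alpha> \<in> sets (sigma_inside n W)" by (rule witness_event_sets[OF W(1) i])
      show "AE \<omega> in birth_space n. real_cond_exp (birth_space n) (sigma_avoiding n (?x \<alpha>)) (indicator (?E \<alpha>)) \<omega> \<le> exp (- c * D)"
        by (rule witness_cond_prob[OF r W(1) i _ p(1,2) D0(2) De Dn e1(1,2) \<eta>0 e1(3) K(2) _ c(1,2)]) (use n c0 in auto)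
    qed
    have cover: "\<omega> \<in> M \<union> (\<Union>\<alpha>\<in>?A. ?E \<alpha>)"
      if w: "\<omega> \<in> space (birth_space n)" "\<not> has_clique_factor r (induced (birth_graph n p \<omega>) W)" "\<omega> \<in> regular_event r n" for \<omega>
    proof (rule ccontr)
      assume "\<omega> \<notin> M \<union> (\<Union>\<alpha>\<in>?A. ?E \<alpha>)"
      hence nM: "\<omega> \<notin> M" and nE': "\<omega> \<notin> (\<Union>\<alpha>\<in>?A. ?E \<alpha>)" by simp_all
      have nE: "\<omega> \<notin> ?E \<alpha>" if "\<alpha> \<in> ?A" for \<alpha> using nE' UN_I[OF that, of \<omega> ?E] by argo
      have none: "\<omega> \<notin> witness_event r n p W e1 \<eta> K i" if "i \<in> ?I" for i
      proof -
        have "i \<in> h ` ?A" using that bij_betw_imp_surj_on[OF h] by argo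
        then obtain \<alpha> where "\<alpha> \<in> ?A" "i = h \<alpha>" by (elim imageE)
        thus ?thesis using nE by simp
      qed
      obtain l where l: "l \<in> permutations_of_set (pairs W)" "sorted_wrt (\<lambda>a b. \<omega> b < \<omega> a) l"
        "\<And>m. m0 \<le> m \<Longrightarrow> m \<le> card (pairs W) \<Longrightarrow>
           light_sum r W (\<lambda>j. b0 * sqrt (real m0 / real j)) m l
            < (\<Sum>j\<in>{m<..card (pairs W)}. (real (r - 1) * real (card W) / 2) / real j) + real n"
        using M(3)[OF w(1) nM] by blast
      have finW: "finite W" using finite_subset[OF W(1)] by simp
      have nwp: "no_witness r n W (level W p \<omega>) p e1 \<eta> K {}"
        by (rule no_witness_of_events[where t = None, OF W(1) r w(1) _ _ _ _ none])
          (use regular_pair_bound[OF w(3) W(1) p(3,2)] in \<open>auto simp: stop_time_def\<close>)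
      have nwf: "no_witness r n W (level W (\<omega> f) \<omega>) (\<omega> f) e1 \<eta> K f" if f: "f \<in> pairs W" "p \<le> \<omega> f" for f
      proof -
        have "f \<in> pairs {1..n}" using f pairs_mono[OF W(1)] by blast
        hence "\<omega> f \<in> {0..1}" using component_range[of \<omega> "pairs {1..n}" f] w(1) by (simp add: birth_space_def)
        hence pb: "pair_bound r n (regularity_const r) (level W (\<omega> f) \<omega>) W (\<omega> f)"
          using f p by (intro regular_pair_bound[OF w(3) W(1)]) auto
        show ?thesis
          by (rule no_witness_of_events[where t = "Some f", OF W(1) r w(1) _ _ f(2) pb none])
            (use f in \<open>auto simp: stop_time_def\<close>)
      qed
      interpret removal W \<omega> l r n p KS e1 b0 K
      proof unfold_locales
        show "finite W" by (rule finW)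
        show "16 * (real r + 3) \<le> real n" using T Tn by linarith
        show "2 * real r * ln (real n) + real r * ln (1 / local_ratio r (regularity_const r) e1) \<le> (KS - deficit_const r) * real n"
        proof -
          have "4 * real r * ln (real n) \<le> T * ln (real n)" using T ln0 by (intro mult_right_mono)
          hence "4 * real r * ln (real n) \<le> real n" using Tn by linarith
          moreover have "2 * real r * ln (1 / local_ratio r (regularity_const r) e1) \<le> v"
            unfolding v_def using r0 by (intro mult_left_mono) auto
          hence "2 * real r * ln (1 / local_ratio r (regularity_const r) e1) \<le> real n" using T Tn by linarith
          ultimately show ?thesis by (simp add: KS_def)
        qed
        show "0 \<le> KS" using KA0 by (simp add: KS_def)
        show "real K * (32 * (peak_bound r (regularity_const r) KS)\<^sup>2 * overlap_bound r (regularity_const r)) \<le> clique_scale n (r - 1) p * p ^ (r - 1)"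
          using K(1) unfolding Q_def MM_def De[symmetric] .
        show "4 * ((loss_bound r (regularity_const r) e1)\<^sup>2 * 4 ^ (r choose 2) * (real r * regularity_const r) * sqrt (32 * regularity_const r)) \<le> b0 * (clique_scale n (r - 1) p * p ^ (r - 1))"
          unfolding De[symmetric] B_def[symmetric] using D0 by (simp add: b0_def)
        show "1 \<le> clique_scale n (r - 1) p * p ^ (r - 1)" "clique_scale n (r - 1) p * p ^ (r - 1) \<le> real n * p"
          using D0 Dn unfolding De[symmetric] by auto
        show "no_witness r n W (level W p \<omega>) p e1 (1 / (8 * peak_bound r (regularity_const r) KS)) K {}"
          using nwp unfolding \<eta>_def MM_def .
        show "no_witness r n W (level W (\<omega> f) \<omega>) (\<omega> f) e1 (1 / (8 * peak_bound r (regularity_const r) KS)) K f"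
          if "f \<in> pairs W" "p \<le> \<omega> f" for f using nwf[OF that] unfolding \<eta>_def MM_def .
      qed (use l r W p w e1 b0 m0_def in auto)
      show False using has_clique_factor_of_num_factors[OF W(1) factor_exists] w(2) by blast
    qed
    have mM: "measure (birth_space n) M \<le> exp (- (c * real n * D))"
    proof -
      have "c * (real n * D) \<le> 1 / (40 * real r * B) * (real n * D)" using c(3) D0 by (intro mult_right_mono) auto
      hence "c * real n * D \<le> real n / (40 * real r * b0)" unfolding b0e by simp
      hence "exp (- (real n / (40 * real r * b0))) \<le> exp (- (c * real n * D))" by simp
      with M(2) show ?thesis by (rule order_trans)
    qed
    show "\<exists>M \<in> sets (birth_space n). measure (birth_space n) M \<le> exp (- (c * real n * D)) \<and>
        (\<exists>(A :: nat set) (E :: nat \<Rightarrow> (nat set \<Rightarrow> real) set) (x :: nat \<Rightarrow> nat).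
          finite A \<and> card A \<le> n ^ (r + 7) \<and>
          (\<forall>\<alpha>\<in>A. x \<alpha> \<in> W \<and> E \<alpha> \<in> sets (sigma_inside n W) \<and>
            (AE \<omega> in birth_space n. real_cond_exp (birth_space n) (sigma_avoiding n (x \<alpha>)) (indicator (E \<alpha>)) \<omega> \<le> exp (- c * D))) \<and>
          {\<omega> \<in> space (birth_space n). \<not> has_clique_factor r (induced (birth_graph n p \<omega>) W)} \<inter> regular_event r n
            \<subseteq> M \<union> (\<Union>\<alpha>\<in>A. E \<alpha>))"
    proof (rule bexI[OF _ M(1)], rule conjI[OF mM], rule exI[of _ ?A], rule exI[of _ ?E], rule exI[of _ ?x], intro conjI)
      show "finite ?A" by simp
      show "card ?A \<le> n ^ (r + 7)" by (rule cA)
      show "\<forall>\<alpha>\<in>?A. ?x \<alpha> \<in> W \<and> ?E \<alpha> \<in> sets (sigma_inside n W) \<and>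
            (AE \<omega> in birth_space n. real_cond_exp (birth_space n) (sigma_avoiding n (?x \<alpha>)) (indicator (?E \<alpha>)) \<omega> \<le> exp (- c * D))"
        using wit by (rule ballI)
      show "{\<omega> \<in> space (birth_space n). \<not> has_clique_factor r (induced (birth_graph n p \<omega>) W)} \<inter> regular_event r n
            \<subseteq> M \<union> (\<Union>\<alpha>\<in>?A. ?E \<alpha>)"
      proof
        fix \<omega> assume "\<omega> \<in> {\<omega> \<in> space (birth_space n). \<not> has_clique_factor r (induced (birth_graph n p \<omega>) W)} \<inter> regular_event r n"
        hence "\<omega> \<in> space (birth_space n)" "\<not> has_clique_factor r (induced (birth_graph n p \<omega>) W)" "\<omega> \<in> regular_event r n"
          unfolding Int_iff mem_Collect_eq by argo+
        thus "\<omega> \<in> M \<union> (\<Union>\<alpha>\<in>?A. ?E \<alpha>)" by (rule cover)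
      qed
    qed
  qed
qed

section \<open>Asymptotics\<close>

text \<open>The power \<open>r choose 2\<close> turns \<open>n powr (- 2 / r)\<close> into \<open>n powr (- (r - 1))\<close>.\<close>
lemma density_ge:
  assumes r: "r \<ge> 2" and n: "n \<ge> 3" and T: "T \<ge> 1" and p: "0 \<le> p"
    and le: "T * (real n powr (- 2 / real r) * ln (real n) powr (1 / real (r choose 2))) \<le> p"
  shows "T * ln (real n) \<le> real n ^ (r - 1) * p ^ (r choose 2)"
proof -
  let ?e = "r choose 2"
  have e: "?e > 0" using r by (simp add: zero_less_binomial)
  have l0: "ln (real n) > 0" using n by simp
  have "T * ln (real n) \<le> T ^ ?e * ln (real n)"
  proof -
    have "1 \<le> ?e" using e by linarith
    hence "T ^ 1 \<le> T ^ ?e" using T by (intro power_increasing)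
    thus ?thesis using l0 by simp
  qed
  also have "\<dots> = real n ^ (r - 1) * (T * (real n powr (- 2 / real r) * ln (real n) powr (1 / real ?e))) ^ ?e"
  proof -
    have "(real n powr (- 2 / real r)) ^ ?e = real n powr (- 2 / real r * real ?e)"
      using n by (simp add: powr_realpow[symmetric] powr_powr)
    also have "- 2 / real r * real ?e = - real (r - 1)" using r by (simp add: real_choose_2 of_nat_diff field_simps)
    finally have 1: "real n ^ (r - 1) * (real n powr (- 2 / real r)) ^ ?e = 1"
      using n by (simp add: powr_realpow[symmetric] powr_minus)
    have 2: "(ln (real n) powr (1 / real ?e)) ^ ?e = ln (real n)"
      using l0 e by (simp add: powr_realpow[symmetric] powr_powr)
    have "real n ^ (r - 1) * (T * (real n powr (- 2 / real r) * ln (real n) powr (1 / real ?e))) ^ ?e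
      = T ^ ?e * (real n ^ (r - 1) * (real n powr (- 2 / real r)) ^ ?e) * (ln (real n) powr (1 / real ?e)) ^ ?e"
      by (simp only: power_mult_distrib mult_ac)
    thus ?thesis unfolding 1 2 by simp
  qed
  also have "\<dots> \<le> real n ^ (r - 1) * p ^ ?e"
    using le T by (intro mult_left_mono power_mono) auto
  finally show ?thesis .
qed

text \<open>The upper bound on \<open>p\<close> enters here: it says that \<open>n ^ (r - 2) * p ^ ((r choose 2) - 1) \<le> 1\<close>, so
that the link scale of \<open>r\<close>-cliques is the smallest one.\<close>
lemma density_le:
  assumes r: "r \<ge> 3" and n: "n \<ge> 1" and p: "0 \<le> p" "p \<le> real n powr (- 2 / real (r + 1))"
  shows "real n ^ (r - 1) * p ^ (r choose 2) \<le> real n * p"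
proof -
  let ?e = "r choose 2"
  have r1: "r - 1 = Suc (r - 2)" using r by simp
  have e0: "?e > 0" using r by (simp add: zero_less_binomial)
  hence e1: "?e = Suc (?e - 1)" by simp
  have re: "real (?e - 1) = (real r - 2) * (real r + 1) / 2"
  proof -
    have "real (?e - 1) = real ?e - 1" using e0 by (simp only: e1[symmetric] of_nat_diff Suc_leI One_nat_def of_nat_1)
    thus ?thesis unfolding real_choose_2 by (simp add: field_simps)
  qed
  have "p ^ (?e - 1) \<le> (real n powr (- 2 / real (r + 1))) ^ (?e - 1)" using p by (intro power_mono)
  also have "\<dots> = real n powr (- 2 / real (r + 1) * real (?e - 1))"
    using n by (simp add: powr_realpow[symmetric] powr_powr)
  also have "- 2 / real (r + 1) * real (?e - 1) = - real (r - 2)"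
    unfolding re using r by (simp add: of_nat_diff field_simps)
  finally have "real n ^ (r - 2) * p ^ (?e - 1) \<le> real n ^ (r - 2) * real n powr (- real (r - 2))"
    by (intro mult_left_mono) auto
  also have "\<dots> = 1" using n by (simp add: powr_realpow[symmetric] powr_minus)
  finally have a: "real n ^ (r - 2) * p ^ (?e - 1) \<le> 1" .
  have "real n ^ (r - 1) * p ^ ?e = (real n * p) * (real n ^ (r - 2) * p ^ (?e - 1))"
    by (subst r1, subst e1) simp
  also have "\<dots> \<le> (real n * p) * 1" using a p by (intro mult_left_mono) auto
  finally show ?thesis by simp
qed

text \<open>The graph at time \<open>p\<close> is then in the range of the inspected dyadic times.\<close>
lemma half_power_le:
  assumes p: "0 < p" "p \<le> 1" and D: "1 \<le> real n ^ (r - 1) * p ^ e" and e: "e > 0" and n: "n > 0"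
  shows "(1 / 2) ^ (r * n) \<le> p"
proof -
  have "real n ^ (r - 1) \<le> (2 ^ n) ^ (r - 1)" by (intro power_mono) (use less_exp[of n] in \<open>simp_all add: less_imp_le\<close>)
  also have "\<dots> = 2 ^ (n * (r - 1))" by (simp add: power_mult)
  also have "\<dots> \<le> 2 ^ (r * n)" by (intro power_increasing) auto
  finally have b: "real n ^ (r - 1) \<le> 2 ^ (r * n)" .
  have "p ^ e \<le> p ^ 1" using p e by (intro power_decreasing) auto
  hence "real n ^ (r - 1) * p ^ e \<le> 2 ^ (r * n) * p" using b p by (intro mult_mono) auto
  hence "1 \<le> 2 ^ (r * n) * p" using D by linarith
  thus ?thesis by (simp add: power_divide divide_le_eq mult.commute)
qed

lemma mu_le:
  assumes "r \<le> n" "0 < n" "0 \<le> p" "r > 0"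
  shows "mu r n p / real n \<le> real n ^ (r - 1) * p ^ (r choose 2)"
proof -
  have "real (n choose r) \<le> real (n ^ r)" using binomial_le_pow[OF assms(1)] by (rule of_nat_mono)
  hence "mu r n p \<le> real n ^ r * p ^ (r choose 2)" unfolding mu_def using assms by (intro mult_right_mono) auto
  also have "real n ^ r = real n ^ (r - 1) * real n" using assms by (metis power_minus_mult)
  finally show ?thesis using assms by (simp add: divide_le_eq mult_ac)
qed

theorem theorem4p2:
  fixes r :: nat
  assumes "r \<ge> 3"
  shows "\<exists>c\<^sub>r c C :: real. c\<^sub>r > 0 \<and> c > 0 \<and> C > 0 \<and>
    (\<forall>(b :: nat \<Rightarrow> real) (p :: nat \<Rightarrow> real).
       (\<forall>n. b n \<ge> 0) \<longrightarrow> b \<in> o(\<lambda>n. real n) \<longrightarrow>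
       (\<forall>n. 0 \<le> p n \<and> p n \<le> 1) \<longrightarrow>
       (\<lambda>n. real n powr (- 2 / real r) * ln (real n) powr (1 / real (r choose 2))) \<in> o(p) \<longrightarrow>
       p \<in> o(\<lambda>n. real n powr (- 2 / real (r + 1))) \<longrightarrow>
       (\<forall>\<^sub>F n in sequentially.
          \<exists>U. decreasing_event n U \<and> measure (birth_space n) U \<ge> c\<^sub>r \<and>
            (\<forall>W. W \<subseteq> {1..n} \<longrightarrow> real (card ({1..n} - W)) \<le> b n \<longrightarrow> r dvd card W \<longrightarrow>
               (\<exists>M \<in> sets (birth_space n).
                  measure (birth_space n) M \<le> exp (- c * real (card W) * mu r n (p n) / real n) \<and>
                  (\<exists>(A :: nat set) (E :: nat \<Rightarrow> (nat set \<Rightarrow> real) set) (x :: nat \<Rightarrow> nat).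
                     finite A \<and> real (card A) \<le> real n powr C \<and>
                     (\<forall>\<alpha>\<in>A. single_root_witness r n (p n) c W (E \<alpha>) (x \<alpha>)) \<and>
                     {\<omega> \<in> space (birth_space n).
                        \<not> has_clique_factor r (induced (birth_graph n (p n) \<omega>) W)} \<inter> U
                       \<subseteq> M \<union> (\<Union>\<alpha>\<in>A. E \<alpha>))))))"
proof -
  have r: "r \<ge> 3" by (rule assms)
  obtain c T where c0: "0 < c" and T: "1 \<le> T" and cover: "\<And>n p D W. D = real n ^ (r - 1) * p ^ (r choose 2) \<Longrightarrow> 0 < p \<Longrightarrow> p \<le> 1 \<Longrightarrow> (1 / 2) ^ (r * n) \<le> p \<Longrightarrow>
      T \<le> D \<Longrightarrow> T * ln (real n) \<le> D \<Longrightarrow> D \<le> real n * p \<Longrightarrow> T \<le> real n \<Longrightarrow> T * ln (real n) \<le> real n \<Longrightarrow>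
      W \<subseteq> {1..n} \<Longrightarrow> n \<le> 2 * card W \<Longrightarrow> r dvd card W \<Longrightarrow>
      (\<exists>M \<in> sets (birth_space n). measure (birth_space n) M \<le> exp (- (c * real n * D)) \<and>
        (\<exists>(A :: nat set) (E :: nat \<Rightarrow> (nat set \<Rightarrow> real) set) (x :: nat \<Rightarrow> nat).
          finite A \<and> card A \<le> n ^ (r + 7) \<and>
          (\<forall>\<alpha>\<in>A. x \<alpha> \<in> W \<and> E \<alpha> \<in> sets (sigma_inside n W) \<and>
            (AE \<omega> in birth_space n. real_cond_exp (birth_space n) (sigma_avoiding n (x \<alpha>)) (indicator (E \<alpha>)) \<omega> \<le> exp (- c * D))) \<and>
          {\<omega> \<in> space (birth_space n). \<not> has_clique_factor r (induced (birth_graph n p \<omega>) W)} \<inter> regular_event r n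
            \<subseteq> M \<union> (\<Union>\<alpha>\<in>A. E \<alpha>)))"
    using factor_failure_cover[OF r] by (elim exE conjE) (rule that, assumption, assumption, simp only: atomize_imp atomize_all, iprover)
  show ?thesis
  proof (rule exI[of _ "1 / 2"], rule exI[of _ c], rule exI[of _ "real (r + 7)"], intro conjI allI impI)
    fix b p :: "nat \<Rightarrow> real"
    assume b0: "\<forall>n. b n \<ge> 0" and b: "b \<in> o(\<lambda>n. real n)" and p01: "\<forall>n. 0 \<le> p n \<and> p n \<le> 1"
      and lower: "(\<lambda>n. real n powr (- 2 / real r) * ln (real n) powr (1 / real (r choose 2))) \<in> o(p)"
      and upper: "p \<in> o(\<lambda>n. real n powr (- 2 / real (r + 1)))"
    have T0: "0 < T" using T by simp
    have ev1: "\<forall>\<^sub>F n in sequentially. norm (b n) \<le> 1 / 2 * norm (real n)"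
      by (rule landau_o.smallD[OF b]) simp
    have ev2: "\<forall>\<^sub>F n in sequentially. norm (real n powr (- 2 / real r) * ln (real n) powr (1 / real (r choose 2))) \<le> 1 / T * norm (p n)"
      by (rule landau_o.smallD[OF lower]) (use T0 in simp)
    have ev3: "\<forall>\<^sub>F n in sequentially. norm (p n) \<le> 1 * norm (real n powr (- 2 / real (r + 1)))"
      by (rule landau_o.smallD[OF upper]) simp
    have ev4: "\<forall>\<^sub>F n in sequentially. T * ln (real n) \<le> real n" using T0 by real_asymp
    have ev5: "\<forall>\<^sub>F n in sequentially. T \<le> real n" by real_asymp
    have ev6: "\<forall>\<^sub>F n in sequentially. real r + 3 \<le> real n" by real_asymp
    show "\<forall>\<^sub>F n in sequentially.
          \<exists>U. decreasing_event n U \<and> measure (birth_space n) U \<ge> 1 / 2 \<and>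
            (\<forall>W. W \<subseteq> {1..n} \<longrightarrow> real (card ({1..n} - W)) \<le> b n \<longrightarrow> r dvd card W \<longrightarrow>
               (\<exists>M \<in> sets (birth_space n).
                  measure (birth_space n) M \<le> exp (- c * real (card W) * mu r n (p n) / real n) \<and>
                  (\<exists>(A :: nat set) (E :: nat \<Rightarrow> (nat set \<Rightarrow> real) set) (x :: nat \<Rightarrow> nat).
                     finite A \<and> real (card A) \<le> real n powr real (r + 7) \<and>
                     (\<forall>\<alpha>\<in>A. single_root_witness r n (p n) c W (E \<alpha>) (x \<alpha>)) \<and>
                     {\<omega> \<in> space (birth_space n).
                        \<not> has_clique_factor r (induced (birth_graph n (p n) \<omega>) W)} \<inter> U
                       \<subseteq> M \<union> (\<Union>\<alpha>\<in>A. E \<alpha>))))"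
      using ev1 ev2 ev3 ev4 ev5 ev6
    proof eventually_elim
      case (elim n)
      have n: "3 \<le> n" "r \<le> n" "0 < n" using elim(6) by auto
      let ?p = "p n"
      define D where "D = real n ^ (r - 1) * ?p ^ (r choose 2)"
      have f0: "0 < real n powr (- 2 / real r) * ln (real n) powr (1 / real (r choose 2))" using n by simp
      have le: "T * (real n powr (- 2 / real r) * ln (real n) powr (1 / real (r choose 2))) \<le> ?p"
        using elim(2) f0 p01 T0 by (simp add: le_divide_eq mult.commute)
      have p: "0 < ?p" "?p \<le> 1" using le f0 T0 p01 by (auto intro: less_le_trans[OF mult_pos_pos])
      have TD: "T * ln (real n) \<le> D" unfolding D_def by (rule density_ge[OF _ _ T _ le]) (use r n p in auto)
      have "1 \<le> ln (real n)" using n exp_le by (subst ln_ge_iff) auto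
      hence "T * 1 \<le> T * ln (real n)" using T0 by (intro mult_left_mono) auto
      hence TD': "T \<le> D" using TD by linarith
      have Dn: "D \<le> real n * ?p" unfolding D_def by (rule density_le[OF r]) (use n p elim(3) in auto)
      have half: "(1 / 2) ^ (r * n) \<le> ?p"
        by (rule half_power_le[OF p, of n r "r choose 2"]) (use TD' T n r in \<open>auto simp: D_def zero_less_binomial\<close>)
      have muD: "mu r n ?p / real n \<le> D" unfolding D_def by (rule mu_le) (use n p r in auto)
      show ?case
      proof (rule exI[of _ "regular_event r n"], intro conjI allI impI)
        show "decreasing_event n (regular_event r n)" "1 / 2 \<le> measure (birth_space n) (regular_event r n)"
          by (rule regular_event[OF n(3)])+
        fix W assume W: "W \<subseteq> {1..n}" "real (card ({1..n} - W)) \<le> b n" "r dvd card W"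
        have finW: "finite W" using finite_subset[OF W(1)] by simp
        have cW: "card W \<le> n" using card_mono[OF _ W(1)] by simp
        have "card ({1..n} - W) = n - card W" using card_Diff_subset[OF finW W(1)] by simp
        hence W2: "n \<le> 2 * card W" using W(2) elim(1) b0 cW by (simp add: of_nat_diff)
        obtain M A E x where M: "M \<in> sets (birth_space n)" "measure (birth_space n) M \<le> exp (- (c * real n * D))"
          and A: "finite (A :: nat set)" "card A \<le> n ^ (r + 7)"
          and wit: "\<forall>\<alpha>\<in>A. x \<alpha> \<in> W \<and> E \<alpha> \<in> sets (sigma_inside n W) \<and>
            (AE \<omega> in birth_space n. real_cond_exp (birth_space n) (sigma_avoiding n (x \<alpha>)) (indicator (E \<alpha>)) \<omega> \<le> exp (- c * D))"
          and sub: "{\<omega> \<in> space (birth_space n). \<not> has_clique_factor r (induced (birth_graph n ?p \<omega>) W)} \<inter> regular_event r n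
            \<subseteq> M \<union> (\<Union>\<alpha>\<in>A. E \<alpha>)"
          using cover[OF D_def p half TD' TD Dn elim(5,4) W(1) W2 W(3)] by (elim bexE exE conjE) (rule that)
        have mM: "measure (birth_space n) M \<le> exp (- c * real (card W) * mu r n ?p / real n)"
        proof -
          have mu0: "0 \<le> mu r n ?p / real n" using p by (simp add: mu_def)
          have "c * real (card W) * (mu r n ?p / real n) \<le> c * real n * D"
            using cW c0 muD mu0 by (intro mult_mono) auto
          hence "exp (- (c * real n * D)) \<le> exp (- c * real (card W) * mu r n ?p / real n)" by simp
          with M(2) show ?thesis by (rule order_trans)
        qed
        have cA: "real (card A) \<le> real n powr real (r + 7)"
        proof -
          have "real (card A) \<le> real (n ^ (r + 7))" using A(2) by (rule of_nat_mono)
          also have "\<dots> = real n powr real (r + 7)" using n by (simp only: powr_realpow of_nat_power of_nat_0_less_iff)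
          finally show ?thesis .
        qed
        have srw: "single_root_witness r n ?p c W (E \<alpha>) (x \<alpha>)" if "\<alpha> \<in> A" for \<alpha>
          unfolding single_root_witness_def
        proof (intro conjI)
          have w: "x \<alpha> \<in> W" "E \<alpha> \<in> sets (sigma_inside n W)"
            "AE \<omega> in birth_space n. real_cond_exp (birth_space n) (sigma_avoiding n (x \<alpha>)) (indicator (E \<alpha>)) \<omega> \<le> exp (- c * D)"
            using bspec[OF wit that] by blast+
          show "0 < c" "x \<alpha> \<in> W" "E \<alpha> \<in> sets (sigma_inside n W)" by (rule c0 w)+
          have "c * (mu r n ?p / real n) \<le> c * D" using muD c0 by (intro mult_left_mono) auto
          hence le: "exp (- c * D) \<le> exp (- c * mu r n ?p / real n)" by simp
          show "AE \<omega> in birth_space n. real_cond_exp (birth_space n) (sigma_avoiding n (x \<alpha>)) (indicator (E \<alpha>)) \<omega> \<le> exp (- c * mu r n ?p / real n)"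
            using w(3) by (rule AE_mp) (intro AE_I2 impI, erule order_trans, rule le)
        qed
        show "\<exists>M \<in> sets (birth_space n).
                  measure (birth_space n) M \<le> exp (- c * real (card W) * mu r n ?p / real n) \<and>
                  (\<exists>(A :: nat set) (E :: nat \<Rightarrow> (nat set \<Rightarrow> real) set) (x :: nat \<Rightarrow> nat).
                     finite A \<and> real (card A) \<le> real n powr real (r + 7) \<and>
                     (\<forall>\<alpha>\<in>A. single_root_witness r n ?p c W (E \<alpha>) (x \<alpha>)) \<and>
                     {\<omega> \<in> space (birth_space n).
                        \<not> has_clique_factor r (induced (birth_graph n ?p \<omega>) W)} \<inter> regular_event r n
                       \<subseteq> M \<union> (\<Union>\<alpha>\<in>A. E \<alpha>))"
          by (rule bexI[OF _ M(1)], rule conjI[OF mM], rule exI[of _ A], rule exI[of _ E], rule exI[of _ x])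
            (intro conjI A(1) cA sub ballI srw)
      qed
    qed
  qed (use c0 in auto)
qed

end
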